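(* Let $m$ be a positive integer, let $\rho$ be a weight function with associated function $\zeta(r)=r/\rho(r)$, and let $b:[0,\infty)\to\mathbb{R}$ satisfy conditions (A1), (A2), (A3) recalled in the context, with principal part $\mu$ and oscillating part $\sigma=b-\mu$. Suppose there exist a positive, strictly increasing, continuous function $\Theta$ on $[0,\infty)$ (with values in the range of $\zeta$) and a positive, monotone, continuous function $\Xi$ on $[0,\infty)$ such that $$\int_t^\infty\left|\int_s^\infty\sigma(\tau)\,d\tau\right|ds\le\frac{1}{\Theta(t)}\quad(t\ge 0),$$ $$\left|\frac{d^k}{dt^k}b(t)\right|\le \Xi(t)^{k+1}\quad(t\ge0,\ k=0,\ldots,m),$$ $$\sup_{t\ge0}\left\{\frac{\Xi(t)}{\zeta^{-1}(\Theta(t))}\right\}<\infty$$ and $$\sup_{t\ge0}\left\{\frac{\Theta(t)}{\left(\zeta^{-1}(\Theta(t))\right)^{m+1}}\int_0^t\Xi(s)^{m+1}\,ds\right\}<\infty ,$$ where $\zeta^{-1}$ is the inverse function of $\zeta$. Then there exist constants $\kappa_0>0$ and $C>0$ (independent of $t$ and of the initial data) such that for every $(u_0,u_1)\in\mathcal{H}(\rho,\infty)$ the solution $u$ of the Cauchy problem $$\left(\partial_t^2-\Delta+b(t)\partial_t\right)u(t,x)=0\ \text{ in }(0,\infty)\times\mathbb{R}^n,\qquad u(0,x)=u_0(x),\quad \partial_tu(0,x)=u_1(x)$$ satisfies $$E(t;u)\le C\,\|(u_0,u_1)\|_{\mathcal{H}(\rho,\kappa_0)}^2\exp\left(-\int_0^t\mu(s)\,ds\right)\quad\text{for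 all }t\ge0 .$$
   Context: $\|\cdot\|$ is the $L^2(\mathbb{R}^n)$ norm, and the total energy is $E(t;u)=\frac12\left(\|\nabla u(t,\cdot)\|^2+\|\partial_tu(t,\cdot)\|^2\right)$. The solution is the usual energy solution $u\in C([0,\infty);H^1)\cap C^1([0,\infty);L^2)$. Weight function: a positive, strictly increasing, continuous function $\rho$ on $[0,\infty)$ with $\lim_{r\to\infty}\rho(r)=\infty$ and such that $\zeta(r):=r/\rho(r)$ is strictly increasing. Spaces of data: with $\hat f(\xi)=(2\pi)^{-n/2}\int_{\mathbb{R}^n}e^{-ix\cdot\xi}f(x)\,dx$ and $\kappa>0$, $$\|(u_0,u_1)\|_{\mathcal{H}(\rho,\kappa)}:=\left(\int_{\mathbb{R}^n}e^{2\kappa\rho(|\xi|)}\left((1+|\xi|^2)|\hat u_0(\xi)|^2+|\hat u_1(\xi)|^2\right)d\xi\right)^{1/2},$$ $\mathcal{H}(\rho,\kappa):=\{(u_0,u_1)\in H^1\times L^2:\|(u_0,u_1)\|_{\mathcal{H}(\rho,\kappa)}<\infty\}$ and $\mathcal{H}(\rho,\infty):=\bigcap_{\kappa>0}\mathcal{H}(\rho,\kappa)$. Conditions on $b$: (A1) There exist $T\ge0$ and a function $\mu$ on $[0,\infty)$ with $\sup_{t\ge T}\{(1+t)\mu(t)\}=:\mu_0<1$, $\mu(t)>0$ and $\mu'(t)<0$ for all $t\ge T$, such that the (improper) integral $\int_0^\infty(b(t)-\mu(t))\,dt$ converges. The function $\mu$ is called the principal part of $b$. (A2) The oscillating part $\sigma(t):=b(t)-\mu(t)$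 satisfies $\int_0^\infty\left|\int_s^\infty\sigma(\tau)\,d\tau\right|ds<\infty$. (A3) $b\in C^m([0,\infty))$. *)

theory Defs
  imports "HOL-Analysis.Analysis"
begin

section \<open>Square integrable functions\<close>

text \<open>Elements of \<open>L\<^sup>2\<close> are represented by Borel functions (every almost-everywhere class has
  such a representative); equality in \<open>L\<^sup>2\<close> is equality almost everywhere.\<close>

definition in_L2 :: "(real^'n \<Rightarrow> 'b::euclidean_space) \<Rightarrow> bool" where
  "in_L2 f \<longleftrightarrow> f \<in> borel_measurable lborel \<and> integrable lborel (\<lambda>x. (norm (f x))\<^sup>2)"

definition L2_norm :: "(real^'n \<Rightarrow> 'b::euclidean_space) \<Rightarrow> real" where
  "L2_norm f = sqrt (\<integral>x. (norm (f x))\<^sup>2 \<partial>lborel)"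

definition L2_inner :: "(real^'n \<Rightarrow> complex) \<Rightarrow> (real^'n \<Rightarrow> complex) \<Rightarrow> complex" where
  "L2_inner f g = (\<integral>x. f x * cnj (g x) \<partial>lborel)"

text \<open>The extended integral is used so that a difference outside \<open>L\<^sup>2\<close> has infinite norm rather
  than the default value 0 of the Bochner integral.\<close>

definition L2_tendsto ::
    "('i \<Rightarrow> real^'n \<Rightarrow> 'b::euclidean_space) \<Rightarrow> (real^'n \<Rightarrow> 'b) \<Rightarrow> 'i filter \<Rightarrow> bool" where
  "L2_tendsto F g X \<longleftrightarrow>
     ((\<lambda>i. \<integral>\<^sup>+x. ennreal ((norm (F i x - g x))\<^sup>2) \<partial>lborel) \<longlongrightarrow> 0) X"

section \<open>The Sobolev space \<open>H\<^sup>1\<close>\<close>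

text \<open>Since the domain is finite-dimensional, continuity of all iterated directional derivatives
  up to order \<open>k\<close> is the same as being of class \<open>C\<^sup>k\<close>.\<close>

fun C_k :: "nat \<Rightarrow> (real^'n \<Rightarrow> real) \<Rightarrow> bool" where
  "C_k 0 f = continuous_on UNIV f"
| "C_k (Suc k) f =
     ((\<forall>x. f differentiable (at x)) \<and> (\<forall>v. C_k k (\<lambda>x. frechet_derivative f (at x) v)))"

definition test_function :: "(real^'n \<Rightarrow> real) \<Rightarrow> bool" where
  "test_function \<phi> \<longleftrightarrow> (\<forall>k. C_k k \<phi>) \<and> compact (closure {x. \<phi> x \<noteq> 0})"

text \<open>Real-valued test functions suffice, by linearity.\<close>

definition weak_gradient :: "(real^'n \<Rightarrow> complex) \<Rightarrow> (real^'n \<Rightarrow> complex^'n) \<Rightarrow> bool" where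
  "weak_gradient f g \<longleftrightarrow>
     (\<forall>\<phi> j. test_function \<phi> \<longrightarrow>
        (\<integral>x. frechet_derivative \<phi> (at x) (axis j 1) *\<^sub>R f x \<partial>lborel) =
        - (\<integral>x. \<phi> x *\<^sub>R (g x $ j) \<partial>lborel))"

definition in_H1 :: "(real^'n \<Rightarrow> complex) \<Rightarrow> bool" where
  "in_H1 f \<longleftrightarrow> in_L2 f \<and> (\<exists>g. in_L2 g \<and> weak_gradient f g)"

text \<open>A choice of representative: the weak gradient is unique up to null sets.\<close>

definition grad :: "(real^'n \<Rightarrow> complex) \<Rightarrow> real^'n \<Rightarrow> complex^'n" where
  "grad f = (SOME g. in_L2 g \<and> weak_gradient f g)"

section \<open>The Fourier transform and the spaces of data\<close>

definition fourier_integral :: "(real^'n \<Rightarrow> complex) \<Rightarrow> real^'n \<Rightarrow> complex" where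
  "fourier_integral f \<xi> =
     of_real ((2 * pi) powr (- (real CARD('n) / 2))) *
     (\<integral>x. exp (- \<i> * of_real (x \<bullet> \<xi>)) * f x \<partial>lborel)"

text \<open>For \<open>f\<close> in \<open>L\<^sup>2\<close> the defining integral need not converge absolutely; as usual the transform is
  the \<open>L\<^sup>2\<close> limit of the transforms of the truncations of \<open>f\<close> to balls, and it is determined up to
  null sets.\<close>

definition fourier :: "(real^'n \<Rightarrow> complex) \<Rightarrow> real^'n \<Rightarrow> complex" where
  "fourier f = (SOME g. in_L2 g \<and>
     L2_tendsto (\<lambda>R::real. fourier_integral (\<lambda>x. indicator (cball 0 R) x *\<^sub>R f x)) g at_top)"

definition data_norm_sq ::
    "(real \<Rightarrow> real) \<Rightarrow> real \<Rightarrow> (real^'n \<Rightarrow> complex) \<times> (real^'n \<Rightarrow> complex) \<Rightarrow> ennreal" where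
  "data_norm_sq \<rho> \<kappa> = (\<lambda>(u0, u1). \<integral>\<^sup>+\<xi>. ennreal (exp (2 * \<kappa> * \<rho> (norm \<xi>)) *
     ((1 + (norm \<xi>)\<^sup>2) * (norm (fourier u0 \<xi>))\<^sup>2 + (norm (fourier u1 \<xi>))\<^sup>2)) \<partial>lborel)"

definition data_norm ::
    "(real \<Rightarrow> real) \<Rightarrow> real \<Rightarrow> (real^'n \<Rightarrow> complex) \<times> (real^'n \<Rightarrow> complex) \<Rightarrow> real" where
  "data_norm \<rho> \<kappa> w = sqrt (enn2real (data_norm_sq \<rho> \<kappa> w))"

definition data_space ::
    "(real \<Rightarrow> real) \<Rightarrow> real \<Rightarrow> ((real^'n \<Rightarrow> complex) \<times> (real^'n \<Rightarrow> complex)) set" where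
  "data_space \<rho> \<kappa> = {(u0, u1). in_H1 u0 \<and> in_L2 u1 \<and> data_norm_sq \<rho> \<kappa> (u0, u1) < \<infinity>}"

definition data_space_inf ::
    "(real \<Rightarrow> real) \<Rightarrow> ((real^'n \<Rightarrow> complex) \<times> (real^'n \<Rightarrow> complex)) set" where
  "data_space_inf \<rho> = (\<Inter>\<kappa>\<in>{0<..}. data_space \<rho> \<kappa>)"

section \<open>Energy solutions\<close>

text \<open>Functions of time are only relevant on \<open>[0,\<infinity>)\<close>; limits and derivatives at time 0 are
  one-sided, whence the filter \<open>at t within {0..}\<close>.\<close>

definition has_L2_time_derivative ::
    "(real \<Rightarrow> real^'n \<Rightarrow> complex) \<Rightarrow> (real^'n \<Rightarrow> complex) \<Rightarrow> real \<Rightarrow> bool" where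
  "has_L2_time_derivative u v t \<longleftrightarrow> in_L2 v \<and>
     L2_tendsto (\<lambda>s x. (1 / (s - t)) *\<^sub>R (u s x - u t x)) v (at t within {0..})"

definition time_deriv :: "(real \<Rightarrow> real^'n \<Rightarrow> complex) \<Rightarrow> real \<Rightarrow> real^'n \<Rightarrow> complex" where
  "time_deriv u t = (SOME v. has_L2_time_derivative u v t)"

definition energy :: "(real \<Rightarrow> real^'n \<Rightarrow> complex) \<Rightarrow> real \<Rightarrow> real" where
  "energy u t = ((L2_norm (grad (u t)))\<^sup>2 + (L2_norm (time_deriv u t))\<^sup>2) / 2"

text \<open>\<open>u\<close> belongs to \<open>C([0,\<infinity>);H\<^sup>1) \<inter> C\<^sup>1([0,\<infinity>);L\<^sup>2)\<close>, attains the data, and satisfies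
  \<open>u\<^sub>t\<^sub>t - \<Delta>u + b(t)u\<^sub>t = 0\<close> in the usual variational sense, i.e. tested against every element
  of \<open>H\<^sup>1\<close>.\<close>

definition energy_solution ::
    "(real \<Rightarrow> real) \<Rightarrow> (real^'n \<Rightarrow> complex) \<Rightarrow> (real^'n \<Rightarrow> complex) \<Rightarrow>
     (real \<Rightarrow> real^'n \<Rightarrow> complex) \<Rightarrow> bool" where
  "energy_solution b u0 u1 u \<longleftrightarrow>
     (\<forall>t\<ge>0. in_H1 (u t) \<and>
        L2_tendsto u (u t) (at t within {0..}) \<and>
        L2_tendsto (\<lambda>s. grad (u s)) (grad (u t)) (at t within {0..})) \<and>
     (\<forall>t\<ge>0. (\<exists>v. has_L2_time_derivative u v t) \<and>
        L2_tendsto (time_deriv u) (time_deriv u t) (at t within {0..})) \<and>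
     (\<forall>v t. in_H1 v \<longrightarrow> t > 0 \<longrightarrow>
        ((\<lambda>s. L2_inner (time_deriv u s) v) has_vector_derivative
           (- (\<Sum>j\<in>UNIV. L2_inner (\<lambda>x. grad (u t) x $ j) (\<lambda>x. grad v x $ j))
            - of_real (b t) * L2_inner (time_deriv u t) v)) (at t)) \<and>
     (AE x in lborel. u 0 x = u0 x) \<and>
     (AE x in lborel. time_deriv u 0 x = u1 x)"

section \<open>Weight functions and the conditions on the coefficient\<close>

definition weight_function :: "(real \<Rightarrow> real) \<Rightarrow> bool" where
  "weight_function \<rho> \<longleftrightarrow>
     (\<forall>r\<ge>0. \<rho> r > 0) \<and> strict_mono_on {0..} \<rho> \<and> continuous_on {0..} \<rho> \<and>
     filterlim \<rho> at_top at_top \<and> strict_mono_on {0..} (\<lambda>r. r / \<rho> r)"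

text \<open>The improper integral of \<open>\<sigma>\<close> over \<open>[s,\<infinity>)\<close>, possibly only conditionally convergent.\<close>

definition improper_tail :: "(real \<Rightarrow> real) \<Rightarrow> real \<Rightarrow> real" where
  "improper_tail \<sigma> s = Lim at_top (\<lambda>t. integral {s..t} \<sigma>)"

definition condition_A1 :: "(real \<Rightarrow> real) \<Rightarrow> (real \<Rightarrow> real) \<Rightarrow> bool" where
  "condition_A1 b \<mu> \<longleftrightarrow>
     (\<exists>T\<ge>0. bdd_above ((\<lambda>t. (1 + t) * \<mu> t) ` {T..}) \<and> (SUP t\<in>{T..}. (1 + t) * \<mu> t) < 1 \<and>
        (\<forall>t\<ge>T. \<mu> t > 0 \<and> (\<exists>D<0. (\<mu> has_real_derivative D) (at t within {0..})))) \<and>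
     (\<forall>t\<ge>0. (\<lambda>s. b s - \<mu> s) integrable_on {0..t}) \<and>
     (\<exists>L. ((\<lambda>t. integral {0..t} (\<lambda>s. b s - \<mu> s)) \<longlongrightarrow> L) at_top)"

definition condition_A2 :: "(real \<Rightarrow> real) \<Rightarrow> bool" where
  "condition_A2 \<sigma> \<longleftrightarrow> (\<lambda>s. \<bar>improper_tail \<sigma> s\<bar>) integrable_on {0..}"

text \<open>Iterated derivatives on \<open>[0,\<infinity>)\<close>, one-sided at 0.\<close>

primrec halfline_deriv :: "nat \<Rightarrow> (real \<Rightarrow> real) \<Rightarrow> real \<Rightarrow> real" where
  "halfline_deriv 0 f = f"
| "halfline_deriv (Suc k) f =
     (\<lambda>t. vector_derivative (halfline_deriv k f) (at t within {0..}))"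

definition condition_A3 :: "nat \<Rightarrow> (real \<Rightarrow> real) \<Rightarrow> bool" where
  "condition_A3 m b \<longleftrightarrow>
     (\<forall>k<m. \<forall>t\<ge>0. halfline_deriv k b differentiable (at t within {0..})) \<and>
     (\<forall>k\<le>m. continuous_on {0..} (halfline_deriv k b))"

end

theory Submission
  imports Defs "HOL-Probability.Probability"
begin

text \<open>On the Fourier side every frequency \<open>\<xi>\<close> is a damped oscillator \<open>v'' + b v' + r\<^sup>2 v = 0\<close> with
  \<open>r = |\<xi>|\<close>, and it suffices to bound its energy by \<open>C exp (2 \<kappa>\<^sub>0 \<rho>(r) - \<integral>\<mu>)\<close> times its initial
  energy. While \<open>\<Theta>(t) \<le> \<zeta>(r/N)\<close>, so that \<open>\<Xi>(t)\<close> is small compared with \<open>r\<close>, a WKB solution with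
  \<open>m\<close> correction terms of the Riccati equation leaves a remainder of size
  \<open>r\<^bsup>-m\<^esup> \<integral> \<Xi>\<^bsup>m+1\<^esup> = O(\<rho>(r))\<close>. Once \<open>\<Theta>(t) \<ge> \<zeta>(r/N)\<close>, the oscillating part of \<open>b\<close> is removed by the
  factor \<open>e\<^sup>S\<close> with \<open>S' = \<sigma>\<close>; this costs \<open>r \<integral> |S| \<le> r/\<Theta>(t) = O(\<rho>(r))\<close>. Times \<open>t\<close> with
  \<open>r t\<close> bounded are treated by Duhamel's formula. An energy solution is linked to the oscillators by
  pairing its transform with fundamental solutions of the adjoint equation.\<close>

section \<open>Energy estimates for a damped oscillator\<close>

text \<open>Put \<open>H t = \<zeta>inv (\<Theta> t)\<close>, so that
  \<open>\<Theta> = H / \<rho> H\<close>. At a large frequency neither method covers all times: WKB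
  fails once \<open>\<Xi>\<close>, which is controlled by \<open>H\<close>, is comparable with
  \<open>r\<close>, while removing the oscillation from the start costs a multiple of
  \<open>r\<close>, in general far more than \<open>\<rho> r\<close>. At the moment where
  \<open>H = r / N\<close> both costs are of size \<open>\<rho> r\<close>: the hypothesis on the
  integral of \<open>\<Xi>^(m+1)\<close> bounds it by a multiple of \<open>H^m * \<rho> H\<close>,
  and \<open>r / \<zeta> (r / N) = N * \<rho> (r / N)\<close>. While \<open>r * t\<close> is bounded
  a mode need not decay. There the estimate rests on \<open>\<mu>0 < 1\<close>, by which
  \<open>r\<^sup>2\<close> itself is bounded by a multiple of the decay factor; the initial value
  then enters without the factor \<open>r\<^sup>2\<close>, and the data norm contains
  \<open>u0\<close> besides its gradient. Transforms are determined only up to null sets depending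
  on \<open>t\<close>, so an energy solution has no trajectory at a fixed frequency to which an ODE
  estimate applies. Conserved pairings replace it and give, for each \<open>t\<close>, a
  representation by fundamental solutions at almost every frequency.\<close>

definition mode :: "(real \<Rightarrow> real) \<Rightarrow> real \<Rightarrow> (real \<Rightarrow> real) \<Rightarrow> (real \<Rightarrow> real) \<Rightarrow> bool" where
  "mode b r v w \<longleftrightarrow> (\<forall>t\<ge>0. (v has_real_derivative w t) (at t within {0..}) \<and>
     (w has_real_derivative (- r\<^sup>2 * v t - b t * w t)) (at t within {0..}))"

lemma mode_cont:
  assumes "mode b r v w"
  shows "continuous_on {0..} v" "continuous_on {0..} w"
proof -
  show "continuous_on {0..} v" "continuous_on {0..} w"
    using assms unfolding mode_def continuous_on_eq_continuous_within
    by (auto intro!: DERIV_continuous)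
qed

lemma mode_deriv:
  assumes "mode b r v w" "t > 0"
  shows "(v has_real_derivative w t) (at t)"
    "(w has_real_derivative (- r\<^sup>2 * v t - b t * w t)) (at t)"
proof -
  have "at t within {0..} = at t" by (rule at_within_interior) (use assms(2) in auto)
  then show "(v has_real_derivative w t) (at t)"
    "(w has_real_derivative (- r\<^sup>2 * v t - b t * w t)) (at t)"
    using assms unfolding mode_def by (metis less_imp_le)+
qed

text \<open>\<open>F\<close> times the exponential of minus the primitive of \<open>k\<close> is
  nonincreasing by the mean value theorem. The derivative of \<open>F\<close> is asked for only
  pointwise: later it contains the derivative of \<open>\<mu>\<close>, of which nothing but the sign
  is known.\<close>

lemma gronwall:
  fixes F F' k :: "real \<Rightarrow> real"
  assumes "a \<le> c" and contF: "continuous_on {a..c} F" and contk: "continuous_on {a..c} k"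
    and der: "\<And>x. a < x \<Longrightarrow> x < c \<Longrightarrow> (F has_real_derivative F' x) (at x)"
    and le: "\<And>x. a < x \<Longrightarrow> x < c \<Longrightarrow> F' x \<le> k x * F x"
  shows "F c \<le> F a * exp (integral {a..c} k)"
proof -
  define K where "K x = integral {a..x} k" for x
  have K: "(K has_real_derivative k x) (at x within {a..c})" if "x \<in> {a..c}" for x
    using integral_has_real_derivative[OF contk that] by (simp add: K_def[abs_def])
  have contK: "continuous_on {a..c} K"
    unfolding continuous_on_eq_continuous_within using K DERIV_continuous by blast
  have "F a * exp (- K a) \<ge> F c * exp (- K c)"
  proof (rule DERIV_nonpos_imp_decreasing_open[OF \<open>a \<le> c\<close>])
    fix x assume x: "a < x" "x < c"
    have "at x within {a..c} = at x" by (rule at_within_interior) (use x in auto)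
    then have Kx: "(K has_real_derivative k x) (at x)" using K[of x] x by simp
    have "((\<lambda>x. F x * exp (- K x)) has_real_derivative (F' x - k x * F x) * exp (- K x)) (at x)"
      by (auto intro!: derivative_eq_intros der[OF x] Kx simp: algebra_simps)
    moreover have "(F' x - k x * F x) * exp (- K x) \<le> 0"
      using le[OF x] by (simp add: mult_nonpos_nonneg)
    ultimately show "\<exists>y. ((\<lambda>x. F x * exp (- K x)) has_real_derivative y) (at x) \<and> y \<le> 0" by blast
  qed (intro continuous_intros contF contK)
  then have "F a \<ge> F c * exp (- K c)" by (simp add: K_def)
  then have "F a * exp (K c) \<ge> F c * exp (- K c) * exp (K c)" by (rule mult_right_mono) simp
  then show ?thesis by (simp add: K_def mult.assoc flip: exp_add)
qed

definition mode_energy :: "real \<Rightarrow> (real \<Rightarrow> real) \<Rightarrow> (real \<Rightarrow> real) \<Rightarrow> real \<Rightarrow> real" where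
  "mode_energy r v w t = r\<^sup>2 * (v t)\<^sup>2 + (w t)\<^sup>2"

lemma mode_energy_nonneg: "mode_energy r v w t \<ge> 0"
  by (simp add: mode_energy_def)

text \<open>The terms with \<open>r\<^sup>2\<close> cancel in the derivative of the energy, which
  leaves \<open>- 2 * b * w\<^sup>2\<close>; hence the growth factor is independent of the
  frequency. The bound serves bounded time intervals.\<close>

lemma mode_energy_crude:
  assumes md: "mode b r v w" and b: "continuous_on {0..} b" and st: "0 \<le> s" "s \<le> t"
  shows "mode_energy r v w t \<le> mode_energy r v w s * exp (integral {s..t} (\<lambda>x. 2 * \<bar>b x\<bar>))"
proof (rule gronwall[where F' = "\<lambda>x. - 2 * b x * (w x)\<^sup>2"])
  show "continuous_on {s..t} (\<lambda>a. mode_energy r v w a)"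
    unfolding mode_energy_def
    by (intro continuous_intros continuous_on_subset[OF mode_cont(1)[OF md]]
        continuous_on_subset[OF mode_cont(2)[OF md]]) (use st in auto)
  show "continuous_on {s..t} (\<lambda>x. 2 * \<bar>b x\<bar>)"
    by (intro continuous_intros continuous_on_subset[OF b]) (use st in auto)
next
  fix x assume x: "s < x" "x < t"
  then have x0: "x > 0" using st by simp
  show "(mode_energy r v w has_real_derivative - 2 * b x * (w x)\<^sup>2) (at x)"
    unfolding mode_energy_def[abs_def]
    by (auto intro!: derivative_eq_intros mode_deriv[OF md x0] simp: algebra_simps power2_eq_square)
  have "- 2 * b x * (w x)\<^sup>2 \<le> 2 * \<bar>b x\<bar> * (w x)\<^sup>2"
    by (intro mult_right_mono) auto
  also have "\<dots> \<le> 2 * \<bar>b x\<bar> * mode_energy r v w x"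
    unfolding mode_energy_def by (intro mult_left_mono) auto
  finally show "- 2 * b x * (w x)\<^sup>2 \<le> 2 * \<bar>b x\<bar> * mode_energy r v w x" .
qed (use st in auto)

lemma exp_abs_diff_le:
  fixes x y :: real
  assumes "\<bar>x\<bar> \<le> c" "\<bar>y\<bar> \<le> c"
  shows "\<bar>exp x - exp y\<bar> \<le> exp c * \<bar>x - y\<bar>"
proof -
  have *: "exp y - exp x \<le> exp c * (y - x)" if "x \<le> y" "\<bar>x\<bar> \<le> c" "\<bar>y\<bar> \<le> c" for x y :: real
  proof -
    have "exp y * (1 + (x - y)) \<le> exp y * exp (x - y)"
      by (intro mult_left_mono exp_ge_add_one_self) auto
    then have "exp y - exp x \<le> exp y * (y - x)" by (simp add: algebra_simps flip: exp_add)
    also have "\<dots> \<le> exp c * (y - x)" using that by (intro mult_right_mono) auto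
    finally show ?thesis .
  qed
  show ?thesis
  proof (cases "x \<le> y")
    case True
    then show ?thesis using *[OF True assms] by (simp add: abs_if)
  next
    case False
    then show ?thesis using *[OF _ assms(2,1)] by (simp add: abs_if)
  qed
qed

text \<open>The modified energy \<open>F = V\<^sub>1\<^sup>2 + V\<^sub>2\<^sup>2 + (\<mu>/r) V\<^sub>1 V\<^sub>2\<close> with \<open>V\<^sub>1 = r v\<close> and \<open>V\<^sub>2 = e\<^sup>S w\<close>: the factor
  \<open>e\<^sup>S\<close> absorbs the oscillating part of the damping, and the mixed term distributes the
  dissipation equally over both components. The term with \<open>\<mu>'\<close> is absorbed by the factor
  \<open>exp (\<mu>/r)\<close>, since \<open>\<mu>'\<close> is not assumed to be continuous.\<close>

lemma mode_energy_dissipative: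
  fixes S \<mu> D :: "real \<Rightarrow> real"
  assumes md: "mode b r v w" and r: "r > 0" and st: "0 \<le> s" "s \<le> t"
    and mu: "\<And>x. s \<le> x \<Longrightarrow> 0 < \<mu> x" "\<And>x. s \<le> x \<Longrightarrow> \<mu> x \<le> r / 2"
    and contmu: "continuous_on {s..t} \<mu>"
    and D: "\<And>x. s < x \<Longrightarrow> (\<mu> has_real_derivative D x) (at x)" "\<And>x. s < x \<Longrightarrow> D x \<le> 0"
    and S: "\<And>x. s < x \<Longrightarrow> (S has_real_derivative (b x - \<mu> x)) (at x)"
      "\<And>x. s \<le> x \<Longrightarrow> \<bar>S x\<bar> \<le> S0"
    and contS: "continuous_on {s..t} S"
  shows "mode_energy r v w t \<le> 8 * exp (4 * S0) *
     exp (- integral {s..t} \<mu> + 5 * exp S0 * r * integral {s..t} (\<lambda>x. \<bar>S x\<bar>)) * mode_energy r v w s"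
proof -
  define V1 where "V1 x = r * v x" for x
  define V2 where "V2 x = exp (S x) * w x" for x
  define N where "N x = (V1 x)\<^sup>2 + (V2 x)\<^sup>2" for x
  define F where "F x = N x + \<mu> x / r * (V1 x * V2 x)" for x
  define F1 where "F1 x = F x * exp (\<mu> x / r)" for x
  \<comment> \<open>The derivative of \<open>F\<close>, grouped as \<open>- \<mu> * F\<close>, the
    term with \<open>D\<close>, and terms that each contain a factor vanishing together with
    \<open>S\<close>.\<close>
  define dF where "dF x = - \<mu> x * F x + 2 * r * (exp (- S x) - exp (S x)) * (V1 x * V2 x)
     + D x / r * (V1 x * V2 x) + \<mu> x * (exp (- S x) - 1) * (V2 x)\<^sup>2 - \<mu> x * (exp (S x) - 1) * (V1 x)\<^sup>2" for x
  \<comment> \<open>In units of \<open>exp S0 * r * \<bar>S x\<bar> * N x\<close> the mixed term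
    contributes 2 and the two terms with \<open>\<mu> \<le> r / 2\<close> contribute 1/2 together;
    \<open>N \<le> 2 * F\<close> doubles this to 5.\<close>
  define k where "k x = - \<mu> x + 5 * exp S0 * r * \<bar>S x\<bar>" for x
  have prod: "\<bar>V1 x * V2 x\<bar> \<le> N x / 2" for x
    using sum_squares_bound[of "\<bar>V1 x\<bar>" "\<bar>V2 x\<bar>"] by (simp add: N_def abs_mult)
  have N0: "N x \<ge> 0" for x by (simp add: N_def)
  have S00: "S0 \<ge> 0" using S(2)[of s] by simp
  have mix: "\<bar>\<mu> x / r * (V1 x * V2 x)\<bar> \<le> N x / 4" if "s \<le> x" for x
  proof -
    have "\<bar>\<mu> x / r * (V1 x * V2 x)\<bar> = \<mu> x / r * \<bar>V1 x * V2 x\<bar>"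
      using mu(1)[OF that] r by (simp add: abs_mult)
    also have "\<dots> \<le> (1/2) * (N x / 2)"
      using mu[OF that] r prod[of x] N0[of x] by (intro mult_mono) (auto simp: field_simps)
    finally show ?thesis by simp
  qed
  have FN: "F x \<ge> 3/4 * N x" "F x \<le> 5/4 * N x" if "s \<le> x" for x
    using mix[OF that, unfolded abs_le_iff] unfolding F_def by linarith+
  have F0: "F x \<ge> 0" if "s \<le> x" for x using FN(1)[OF that] N0[of x] by simp
  have "F1 t \<le> F1 s * exp (integral {s..t} k)"
  proof (rule gronwall[where F' = "\<lambda>x. (dF x + F x * (D x / r)) * exp (\<mu> x / r)"])
    have cv: "continuous_on {s..t} v" "continuous_on {s..t} w"
      using mode_cont[OF md] st by (auto elim: continuous_on_subset)
    show "continuous_on {s..t} F1" unfolding F1_def F_def N_def V1_def V2_def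
      by (intro continuous_intros contmu contS cv) (use r in auto)
    show "continuous_on {s..t} k" unfolding k_def by (intro continuous_intros contmu contS)
  next
    fix x assume x: "s < x" "x < t"
    then have x0: "x > 0" using st by simp
    note S2 = S(2)[of x]
    have sx: "s \<le> x" using x by simp
    have dV1: "(V1 has_real_derivative r * exp (- S x) * V2 x) (at x)"
      unfolding V1_def[abs_def] V2_def
      by (auto intro!: derivative_eq_intros mode_deriv[OF md x0] simp: exp_minus field_simps)
    have dV2: "(V2 has_real_derivative - r * exp (S x) * V1 x - \<mu> x * V2 x) (at x)"
      unfolding V2_def[abs_def] V1_def
      by (auto intro!: derivative_eq_intros mode_deriv[OF md x0] S(1)[OF x(1)]
          simp: algebra_simps power2_eq_square)
    have ees: "exp (- S x) * exp (S x) = 1" by (simp flip: exp_add)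
    have dF: "(F has_real_derivative dF x) (at x)"
      unfolding F_def[abs_def] N_def
      apply (rule derivative_eq_intros dV1 dV2 D(1)[OF x(1)] refl | (use r in simp; fail))+
      using r unfolding dF_def F_def N_def by (simp add: field_simps power2_eq_square)
    show "(F1 has_real_derivative (dF x + F x * (D x / r)) * exp (\<mu> x / r)) (at x)"
      unfolding F1_def[abs_def]
      apply (rule derivative_eq_intros dF D(1)[OF x(1)] refl | (use r in simp; fail))+
      using r by (simp add: field_simps)
    have e1: "\<bar>exp (- S x) - exp (S x)\<bar> \<le> 2 * exp S0 * \<bar>S x\<bar>"
      using exp_abs_diff_le[of "- S x" S0 "S x"] S2 sx by simp
    have e2: "\<bar>exp (- S x) - 1\<bar> \<le> exp S0 * \<bar>S x\<bar>" "\<bar>exp (S x) - 1\<bar> \<le> exp S0 * \<bar>S x\<bar>"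
      using exp_abs_diff_le[of "- S x" S0 0] exp_abs_diff_le[of "S x" S0 0] S2 sx S00 by auto
    have a1: "2 * r * (exp (- S x) - exp (S x)) * (V1 x * V2 x) \<le> 2 * exp S0 * r * \<bar>S x\<bar> * N x"
    proof -
      have "2 * r * (exp (- S x) - exp (S x)) * (V1 x * V2 x)
        \<le> \<bar>2 * r * (exp (- S x) - exp (S x)) * (V1 x * V2 x)\<bar>" by (rule abs_ge_self)
      also have "\<dots> = 2 * r * \<bar>exp (- S x) - exp (S x)\<bar> * \<bar>V1 x * V2 x\<bar>" using r by (simp add: abs_mult)
      also have "\<dots> \<le> 2 * r * (2 * exp S0 * \<bar>S x\<bar>) * (N x / 2)"
        using r by (intro mult_mono prod mult_nonneg_nonneg e1) auto
      finally show ?thesis by (simp add: mult_ac)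
    qed
    \<comment> \<open>The factor \<open>exp (\<mu> / r)\<close> adds \<open>F * D / r\<close> to the
      derivative. Its sign is known since \<open>D \<le> 0\<close> and \<open>F\<close> dominates
      \<open>V1 * V2\<close>, so it swallows the indefinite term with \<open>D\<close>.\<close>
    have a2: "D x / r * (V1 x * V2 x) + F x * (D x / r) \<le> 0"
    proof -
      have "F x + V1 x * V2 x \<ge> 0" using FN(1)[OF sx] prod[of x] N0[of x] by (auto simp: abs_le_iff)
      then have "D x / r * (F x + V1 x * V2 x) \<le> 0"
        using D(2)[OF x(1)] r by (intro mult_nonpos_nonneg divide_nonpos_pos)
      then show ?thesis by (simp add: algebra_simps)
    qed
    have a3: "\<mu> x * (exp (- S x) - 1) * (V2 x)\<^sup>2 \<le> r / 2 * (exp S0 * \<bar>S x\<bar>) * (V2 x)\<^sup>2"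
      using mu[OF sx] r e2 S00
      by (intro mult_right_mono order_trans[OF mult_left_mono[of "exp (- S x) - 1" "\<bar>exp (- S x) - 1\<bar>"]] mult_mono) auto
    have a4: "- \<mu> x * (exp (S x) - 1) * (V1 x)\<^sup>2 \<le> r / 2 * (exp S0 * \<bar>S x\<bar>) * (V1 x)\<^sup>2"
    proof -
      have "- \<mu> x * (exp (S x) - 1) \<le> \<mu> x * \<bar>exp (S x) - 1\<bar>"
        using mult_left_mono[of "- (exp (S x) - 1)" "\<bar>exp (S x) - 1\<bar>" "\<mu> x"] mu(1)[OF sx] by (simp add: algebra_simps)
      also have "\<dots> \<le> r / 2 * (exp S0 * \<bar>S x\<bar>)" using mu[OF sx] r e2 by (intro mult_mono) auto
      finally show ?thesis by (intro mult_right_mono) auto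
    qed
    have "dF x + F x * (D x / r) \<le> - \<mu> x * F x + 2 * exp S0 * r * \<bar>S x\<bar> * N x + r / 2 * (exp S0 * \<bar>S x\<bar>) * N x"
      using a1 a2 a3 a4 unfolding dF_def by (simp add: N_def algebra_simps)
    also have "\<dots> = - \<mu> x * F x + (5/2 * exp S0 * r * \<bar>S x\<bar>) * N x" by (simp add: algebra_simps)
    also have "\<dots> \<le> - \<mu> x * F x + (5/2 * exp S0 * r * \<bar>S x\<bar>) * (2 * F x)"
      using FN(1)[OF sx] N0[of x] r by (intro add_left_mono mult_left_mono) auto
    also have "\<dots> = k x * F x" by (simp add: k_def algebra_simps)
    finally have "(dF x + F x * (D x / r)) * exp (\<mu> x / r) \<le> k x * F x * exp (\<mu> x / r)"
      by (rule mult_right_mono) simp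
    then show "(dF x + F x * (D x / r)) * exp (\<mu> x / r) \<le> k x * F1 x" by (simp add: F1_def mult.assoc)
  qed (use st in auto)
  moreover have "integral {s..t} k = - integral {s..t} \<mu> + 5 * exp S0 * r * integral {s..t} (\<lambda>x. \<bar>S x\<bar>)"
  proof -
    have "integral {s..t} k = integral {s..t} (\<lambda>x. - \<mu> x) + integral {s..t} (\<lambda>x. 5 * exp S0 * r * \<bar>S x\<bar>)"
      unfolding k_def by (rule integral_add; intro integrable_continuous_real continuous_intros contmu contS)
    then show ?thesis by simp
  qed
  moreover have E2: "1 \<le> exp (\<mu> x / r)" "exp (\<mu> x / r) \<le> 2" if "s \<le> x" for x
  proof -
    show "1 \<le> exp (\<mu> x / r)" using mu(1)[OF that] r by simp
    have "\<mu> x / r \<le> 1/2" using mu(2)[OF that] r by (simp add: field_simps)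
    then have "exp (\<mu> x / r) \<le> exp (1/2)" by simp
    also have "\<dots> \<le> 2" using exp_bound[of "1/2::real"] by (simp add: power2_eq_square)
    finally show "exp (\<mu> x / r) \<le> 2" .
  qed
  moreover have NE: "mode_energy r v w x \<le> exp (2 * S0) * N x" "N x \<le> exp (2 * S0) * mode_energy r v w x"
    if "s \<le> x" for x
  proof -
    have e: "(exp (S x))\<^sup>2 = exp (2 * S x)" by (simp add: exp_double)
    have "1 \<le> exp (2 * S0)" using S00 by simp
    then have 1: "(V1 x)\<^sup>2 \<le> exp (2 * S0) * (V1 x)\<^sup>2" by (simp add: mult_le_cancel_right1)
    have "exp (2 * S x) \<le> exp (2 * S0)" using S(2)[OF that] by simp
    then have 2: "(V2 x)\<^sup>2 \<le> exp (2 * S0) * (w x)\<^sup>2"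
      unfolding V2_def power_mult_distrib e by (rule mult_right_mono) simp
    have "1 \<le> exp (2 * S0) * exp (2 * S x)" using S(2)[OF that] by (simp flip: exp_add)
    then have "1 * (w x)\<^sup>2 \<le> (exp (2 * S0) * exp (2 * S x)) * (w x)\<^sup>2" by (rule mult_right_mono) simp
    then have 3: "(w x)\<^sup>2 \<le> exp (2 * S0) * (V2 x)\<^sup>2" unfolding V2_def power_mult_distrib e by (simp add: mult_ac)
    have m: "mode_energy r v w x = (V1 x)\<^sup>2 + (w x)\<^sup>2" by (simp add: mode_energy_def V1_def power_mult_distrib)
    show "mode_energy r v w x \<le> exp (2 * S0) * N x" "N x \<le> exp (2 * S0) * mode_energy r v w x"
      unfolding m N_def using 1 2 3 by (auto simp: distrib_left)
  qed
  ultimately have main: "F1 t \<le> F1 s * exp (- integral {s..t} \<mu> + 5 * exp S0 * r * integral {s..t} (\<lambda>x. \<bar>S x\<bar>))"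
    (is "_ \<le> _ * ?E") by simp
  \<comment> \<open>The constant of the statement: \<open>N \<le> 2 * F \<le> 2 * F1\<close> at the
    end and \<open>F1 \<le> 4 * N\<close> at the start give 8, and each passage between
    \<open>N\<close> and the energy costs \<open>exp (2 * S0)\<close>.\<close>
  have "N t \<le> 2 * F t" using FN(1)[OF st(2)] N0[of t] by simp
  also have "\<dots> \<le> 2 * F1 t" using E2(1)[OF st(2)] F0[OF st(2)] by (simp add: F1_def mult_le_cancel_left1)
  also have "\<dots> \<le> 2 * (F1 s * ?E)" using main by simp
  also have "F1 s \<le> (2 * N s) * 2" unfolding F1_def
    using E2(2)[of s] FN(2)[of s] F0[of s] N0[of s] by (intro mult_mono) auto
  finally have Nt: "N t \<le> 8 * N s * ?E" by (simp add: mult_right_mono mult.assoc)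
  have "mode_energy r v w t \<le> exp (2 * S0) * N t" by (rule NE(1)[OF st(2)])
  also have "\<dots> \<le> exp (2 * S0) * (8 * N s * ?E)" using Nt by simp
  also have "\<dots> \<le> exp (2 * S0) * (8 * (exp (2 * S0) * mode_energy r v w s) * ?E)"
    using NE(2)[of s] by simp
  also have "\<dots> = 8 * exp (4 * S0) * ?E * mode_energy r v w s"
  proof -
    have "exp (4 * S0) = exp (2 * S0) * exp (2 * S0)" by (simp flip: exp_add)
    then show ?thesis by simp
  qed
  finally show ?thesis .
qed

text \<open>Both \<open>g - f\<close> and \<open>g + f\<close> are nondecreasing. In the Duhamel
  estimates an explicit antiderivative \<open>g\<close> of the bound thus takes the place of an
  integral.\<close>

lemma abs_diff_le_by_deriv:
  fixes f g :: "real \<Rightarrow> real"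
  assumes "a \<le> c" "continuous_on {a..c} f" "continuous_on {a..c} g"
    and "\<And>x. a < x \<Longrightarrow> x < c \<Longrightarrow> (f has_real_derivative f' x) (at x)"
    and "\<And>x. a < x \<Longrightarrow> x < c \<Longrightarrow> (g has_real_derivative g' x) (at x)"
    and "\<And>x. a < x \<Longrightarrow> x < c \<Longrightarrow> \<bar>f' x\<bar> \<le> g' x"
  shows "\<bar>f c - f a\<bar> \<le> g c - g a"
proof -
  have "(\<lambda>x. g x - f x) a \<le> (\<lambda>x. g x - f x) c"
  proof (rule DERIV_nonneg_imp_increasing_open[OF assms(1)])
    fix x assume x: "a < x" "x < c"
    show "\<exists>y. ((\<lambda>x. g x - f x) has_real_derivative y) (at x) \<and> 0 \<le> y"
      using assms(4-6)[OF x] by (intro exI[of _ "g' x - f' x"]) (auto intro!: derivative_eq_intros)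
  qed (intro continuous_intros assms)
  moreover have "(\<lambda>x. g x + f x) a \<le> (\<lambda>x. g x + f x) c"
  proof (rule DERIV_nonneg_imp_increasing_open[OF assms(1)])
    fix x assume x: "a < x" "x < c"
    show "\<exists>y. ((\<lambda>x. g x + f x) has_real_derivative y) (at x) \<and> 0 \<le> y"
      using assms(4-6)[OF x] by (intro exI[of _ "g' x + f' x"]) (auto intro!: derivative_eq_intros)
  qed (intro continuous_intros assms)
  ultimately show ?thesis by (simp add: abs_le_iff)
qed

lemma integral_deriv_halfline:
  fixes f :: "real \<Rightarrow> real"
  assumes "continuous_on {0..} f" "x \<ge> 0"
  shows "((\<lambda>t. integral {0..t} f) has_real_derivative f x) (at x within {0..})"
proof -
  have "((\<lambda>t. integral {0..t} f) has_real_derivative f x) (at x within {0..x+1})"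
    using assms by (intro integral_has_real_derivative continuous_on_subset[OF assms(1)]) auto
  moreover have "at x within {0..x+1} = at x within {0..}"
    by (rule at_within_nhd[of _ "{..<x+1}"]) auto
  ultimately show ?thesis by simp
qed

lemma continuous_on_integral_halfline:
  fixes f :: "real \<Rightarrow> real"
  assumes "continuous_on {0..} f"
  shows "continuous_on {0..} (\<lambda>t. integral {0..t} f)"
  unfolding continuous_on_eq_continuous_within using integral_deriv_halfline[OF assms] DERIV_continuous
  by (metis atLeast_iff)

text \<open>Gronwall's inequality in the form of a supremum weighted by \<open>e\<^bsup>-\<nu>s\<^esup>\<close> with \<open>\<nu> = 2Kr\<close>.\<close>

lemma mode_low:
  fixes b :: "real \<Rightarrow> real"
  defines "E \<equiv> \<lambda>t. exp (- integral {0..t} b)"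
  assumes md: "mode b r v w" and b: "continuous_on {0..} b" and r: "r > 0"
    and K: "K \<ge> 1"
    and L1: "\<And>s t. 0 \<le> s \<Longrightarrow> s \<le> t \<Longrightarrow> E t \<le> K * E s"
    and L2: "\<And>s t. 0 \<le> s \<Longrightarrow> s \<le> t \<Longrightarrow> (1 + s) * E s \<le> K * ((1 + t) * E t)"
    and L3: "\<And>t. 0 \<le> t \<Longrightarrow> integral {0..t} E \<le> K * ((1 + t) * E t)"
    and t: "t \<ge> 0" "r * t \<le> L" "r \<le> P - L"
  shows "mode_energy r v w t \<le> (12 * exp (4 * K * L) * P\<^sup>2 * K^5 + 2 * K) * E t * ((v 0)\<^sup>2 + (w 0)\<^sup>2)"
proof -
  define \<nu> where "\<nu> = 2 * K * r"
  have lam: "\<nu> > 0" using K r by (simp add: \<nu>_def)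
  have E0: "E s > 0" for s by (simp add: E_def)
  have Eone: "E 0 = 1" by (simp add: E_def)
  have derE: "(E has_real_derivative - b s * E s) (at s within {0..})" if "s \<ge> 0" for s
    unfolding E_def by (auto intro!: derivative_eq_intros integral_deriv_halfline[OF b that])
  have contE: "continuous_on {0..} E"
    unfolding E_def by (intro continuous_intros continuous_on_integral_halfline b)
  note contv = mode_cont(1)[OF md] and contw = mode_cont(2)[OF md]
  have interior: "at s within {0..} = at s" if "s > 0" for s :: real
    by (rule at_within_interior) (use that in auto)
  have "\<exists>s0\<in>{0..t}. \<forall>s\<in>{0..t}. \<bar>v s\<bar> * exp (- \<nu> * s) \<le> \<bar>v s0\<bar> * exp (- \<nu> * s0)"
    by (rule continuous_attains_sup) (use t in \<open>auto intro!: continuous_intros continuous_on_subset[OF contv]\<close>)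
  then obtain s0 where s0: "s0 \<in> {0..t}"
    and s0max: "\<And>s. s \<in> {0..t} \<Longrightarrow> \<bar>v s\<bar> * exp (- \<nu> * s) \<le> \<bar>v s0\<bar> * exp (- \<nu> * s0)" by blast
  define M where "M = \<bar>v s0\<bar> * exp (- \<nu> * s0)"
  have M0: "M \<ge> 0" by (simp add: M_def)
  have vM: "\<bar>v s\<bar> \<le> M * exp (\<nu> * s)" if "s \<in> {0..t}" for s
  proof -
    have "\<bar>v s\<bar> = (\<bar>v s\<bar> * exp (- \<nu> * s)) * exp (\<nu> * s)" by (simp add: mult.assoc flip: exp_add)
    also have "\<dots> \<le> M * exp (\<nu> * s)" unfolding M_def by (intro mult_right_mono s0max[OF that]) auto
    finally show ?thesis .
  qed
  \<comment> \<open>Dividing by \<open>E\<close> removes the damping: \<open>w / E\<close> has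
    derivative \<open>- r\<^sup>2 * v / E\<close>. Hypothesis \<open>L1\<close> replaces
    \<open>1 / E x\<close> by the constant \<open>K / E s\<close>, and only the exponential weight
    remains to be integrated.\<close>
  have wb: "\<bar>w s\<bar> \<le> E s * \<bar>w 0\<bar> + r\<^sup>2 * K * M * exp (\<nu> * s) / \<nu>" if s: "s \<in> {0..t}" for s
  proof -
    have "\<bar>w s / E s - w 0 / E 0\<bar> \<le> r\<^sup>2 * M * K / E s * exp (\<nu> * s) / \<nu> - r\<^sup>2 * M * K / E s * exp (\<nu> * 0) / \<nu>"
    proof (rule abs_diff_le_by_deriv[where f = "\<lambda>x. w x / E x"
        and g = "\<lambda>x. r\<^sup>2 * M * K / E s * exp (\<nu> * x) / \<nu>" and f' = "\<lambda>x. - r\<^sup>2 * v x / E x"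
        and g' = "\<lambda>x. r\<^sup>2 * M * K / E s * exp (\<nu> * x)"])
      show "0 \<le> s" using s by simp
      show "continuous_on {0..s} (\<lambda>x. w x / E x)"
        using E0 by (intro continuous_intros continuous_on_subset[OF contw] continuous_on_subset[OF contE])
          (auto simp: less_imp_neq[symmetric])
      show "continuous_on {0..s} (\<lambda>x. r\<^sup>2 * M * K / E s * exp (\<nu> * x) / \<nu>)"
        using lam E0[of s] by (intro continuous_intros) auto
    next
      fix x assume x: "0 < x" "x < s"
      have dE: "(E has_real_derivative - b x * E x) (at x)" using derE[of x] interior[of x] x by simp
      show "((\<lambda>x. w x / E x) has_real_derivative - r\<^sup>2 * v x / E x) (at x)"
        using E0[of x] by (auto intro!: derivative_eq_intros dE mode_deriv[OF md x(1)] simp: field_simps)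
      show "((\<lambda>x. r\<^sup>2 * M * K / E s * exp (\<nu> * x) / \<nu>) has_real_derivative
          r\<^sup>2 * M * K / E s * exp (\<nu> * x)) (at x)"
        using lam E0[of s] by (auto intro!: derivative_eq_intros)
      have "1 / E x \<le> K / E s" using L1[of x s] x E0[of x] E0[of s] by (simp add: field_simps)
      then have "r\<^sup>2 * \<bar>v x\<bar> * (1 / E x) \<le> r\<^sup>2 * (M * exp (\<nu> * x)) * (K / E s)"
        using vM[of x] x s E0[of x] by (intro mult_mono mult_nonneg_nonneg) (auto intro: M0)
      then show "\<bar>- r\<^sup>2 * v x / E x\<bar> \<le> r\<^sup>2 * M * K / E s * exp (\<nu> * x)"
        using E0[of x] by (simp add: abs_mult mult_ac)
    qed
    also have "\<dots> \<le> r\<^sup>2 * M * K / E s * exp (\<nu> * s) / \<nu>"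
      using lam E0[of s] M0 K by simp
    finally have "\<bar>w s / E s\<bar> \<le> \<bar>w 0\<bar> + r\<^sup>2 * M * K / E s * exp (\<nu> * s) / \<nu>"
      using abs_triangle_ineq2[of "w s / E s" "w 0"] by (simp add: Eone)
    then have "\<bar>w s / E s\<bar> * E s \<le> (\<bar>w 0\<bar> + r\<^sup>2 * M * K / E s * exp (\<nu> * s) / \<nu>) * E s"
      using E0[of s] by (intro mult_right_mono) auto
    moreover have "\<bar>w s / E s\<bar> * E s = \<bar>w s\<bar>" using E0[of s] by (simp add: abs_divide)
    moreover have "(\<bar>w 0\<bar> + r\<^sup>2 * M * K / E s * exp (\<nu> * s) / \<nu>) * E s
       = E s * \<bar>w 0\<bar> + r\<^sup>2 * K * M * exp (\<nu> * s) / \<nu>" using E0[of s] by (simp add: field_simps)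
    ultimately show ?thesis by simp
  qed
  define A where "A = \<bar>v 0\<bar> + K\<^sup>2 * ((1 + t) * E t) * \<bar>w 0\<bar>"
  have vb: "\<bar>v s\<bar> \<le> A + M * exp (\<nu> * s) / 2" if s: "s \<in> {0..t}" for s
  proof -
    define g where "g x = \<bar>w 0\<bar> * integral {0..x} E + r\<^sup>2 * K * M * exp (\<nu> * x) / \<nu> / \<nu>" for x
    have "\<bar>v s - v 0\<bar> \<le> g s - g 0"
    proof (rule abs_diff_le_by_deriv[where f' = w and g' = "\<lambda>x. E x * \<bar>w 0\<bar> + r\<^sup>2 * K * M * exp (\<nu> * x) / \<nu>"])
      show "0 \<le> s" using s by simp
      show "continuous_on {0..s} v" by (rule continuous_on_subset[OF contv]) auto
      show "continuous_on {0..s} g" unfolding g_def using lam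
        by (intro continuous_intros continuous_on_subset[OF continuous_on_integral_halfline[OF contE]]) auto
    next
      fix x assume x: "0 < x" "x < s"
      show "(v has_real_derivative w x) (at x)" by (rule mode_deriv[OF md x(1)])
      have dE: "((\<lambda>t. integral {0..t} E) has_real_derivative E x) (at x)"
        using integral_deriv_halfline[OF contE, of x] interior[of x] x by simp
      show "(g has_real_derivative E x * \<bar>w 0\<bar> + r\<^sup>2 * K * M * exp (\<nu> * x) / \<nu>) (at x)"
        unfolding g_def[abs_def] using lam by (auto intro!: derivative_eq_intros dE simp: mult_ac)
      show "\<bar>w x\<bar> \<le> E x * \<bar>w 0\<bar> + r\<^sup>2 * K * M * exp (\<nu> * x) / \<nu>" using wb[of x] x s by simp
    qed
    moreover have "g 0 \<ge> 0" unfolding g_def using lam M0 K by simp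
    \<comment> \<open>This fixes \<open>\<nu>\<close>: integrating the weight twice divides by
      \<open>\<nu>\<close> twice, and
      \<open>r\<^sup>2 * K / (2 * K * r)\<^sup>2 = 1 / (4 * K)\<close> is at most 1/2.\<close>
    moreover have "r\<^sup>2 * K * M * exp (\<nu> * s) / \<nu> / \<nu> \<le> M * exp (\<nu> * s) / 2"
    proof -
      have "r\<^sup>2 * K / \<nu> / \<nu> = 1 / (4 * K)" using r K by (simp add: \<nu>_def field_simps power2_eq_square)
      also have "\<dots> \<le> 1/2" using K by (simp add: field_simps)
      finally have "r\<^sup>2 * K / \<nu> / \<nu> * (M * exp (\<nu> * s)) \<le> 1/2 * (M * exp (\<nu> * s))"
        using M0 by (intro mult_right_mono) auto
      then show ?thesis by (simp add: mult_ac)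
    qed
    moreover have "\<bar>w 0\<bar> * integral {0..s} E \<le> K\<^sup>2 * ((1 + t) * E t) * \<bar>w 0\<bar>"
    proof (subst mult.commute, rule mult_right_mono)
      have "integral {0..s} E \<le> K * ((1 + s) * E s)" using L3 s by simp
      also have "\<dots> \<le> K * (K * ((1 + t) * E t))" using L2[of s t] s K by (intro mult_left_mono) auto
      finally show "integral {0..s} E \<le> K\<^sup>2 * ((1 + t) * E t)" by (simp add: power2_eq_square mult.assoc)
    qed simp
    moreover have "\<bar>v s\<bar> \<le> \<bar>v 0\<bar> + \<bar>v s - v 0\<bar>" by simp
    moreover have "g s = \<bar>w 0\<bar> * integral {0..s} E + r\<^sup>2 * K * M * exp (\<nu> * s) / \<nu> / \<nu>" by (simp add: g_def)
    ultimately show ?thesis unfolding A_def by linarith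
  qed
  \<comment> \<open>At the point where the weighted supremum is attained, the estimate absorbs half
    of its own left side.\<close>
  have "M * exp (\<nu> * s0) \<le> A + M * exp (\<nu> * s0) / 2"
    using vb[OF s0] by (simp add: M_def mult.assoc flip: exp_add)
  then have "M * exp (\<nu> * s0) \<le> 2 * A" by simp
  moreover have "M * 1 \<le> M * exp (\<nu> * s0)" using s0 lam M0 by (intro mult_left_mono) auto
  ultimately have MA: "M \<le> 2 * A" by simp
  have A0: "A \<ge> 0" using MA M0 by simp
  define e where "e = exp (2 * K * L)"
  have e: "e \<ge> 0" "e\<^sup>2 = exp (4 * K * L)" by (simp_all add: e_def exp_double[symmetric])
  have et: "exp (\<nu> * t) \<le> e"
  proof -
    have "\<nu> * t = 2 * K * (r * t)" by (simp add: \<nu>_def)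
    also have "\<dots> \<le> 2 * K * L" using t K by (intro mult_left_mono) auto
    finally show ?thesis by (simp add: e_def)
  qed
  have tt: "t \<in> {0..t}" using t by simp
  have v1: "\<bar>r * v t\<bar> \<le> 2 * e * (r * A)"
  proof -
    have "\<bar>v t\<bar> \<le> (2 * A) * e" using vM[OF tt] MA A0 et by (intro order_trans[OF vM[OF tt]] mult_mono) auto
    then have "r * \<bar>v t\<bar> \<le> r * ((2 * A) * e)" using r by (intro mult_left_mono) auto
    then show ?thesis using r by (simp add: abs_mult mult_ac)
  qed
  have w1: "\<bar>w t\<bar> \<le> E t * \<bar>w 0\<bar> + e * (r * A)"
  proof -
    have "r\<^sup>2 * K * M * exp (\<nu> * t) / \<nu> = r / 2 * (M * exp (\<nu> * t))"
      using r K by (simp add: \<nu>_def field_simps power2_eq_square)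
    also have "\<dots> \<le> r / 2 * ((2 * A) * e)" using MA M0 A0 et r by (intro mult_left_mono mult_mono) auto
    finally show ?thesis using wb[OF tt] by (simp add: mult_ac)
  qed
  define D where "D = (v 0)\<^sup>2 + (w 0)\<^sup>2"
  have P: "r * (1 + t) \<le> P" using t by (simp add: algebra_simps)
  have P0: "P \<ge> 0" using P r t by (meson mult_nonneg_nonneg add_nonneg_nonneg zero_le_one less_imp_le order_trans)
  have Et: "E t \<le> K" using L1[of 0 t] t Eone by simp
  have E2: "(E t)\<^sup>2 \<le> K * E t" using Et E0[of t] by (simp add: power2_eq_square mult_right_mono)
  \<comment> \<open>Here \<open>r * (1 + t) \<le> P\<close>, and \<open>L2\<close> from time 0 gives
    \<open>1 \<le> K * ((1 + t) * E t)\<close>. So \<open>r\<^sup>2\<close> is itself of the size of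
    the decay factor, which is how an initial value that persists while \<open>r * t\<close> is
    bounded can obey the decaying bound. The fifth power of \<open>K\<close> matches the constant
    needed for \<open>w 0\<close>.\<close>
  have r2: "r\<^sup>2 \<le> P\<^sup>2 * K^5 * E t"
  proof -
    have "r\<^sup>2 * (1 + t) \<le> r\<^sup>2 * (1+t)\<^sup>2" using t by (intro mult_left_mono) (auto simp: power2_eq_square algebra_simps)
    also have "\<dots> = (r * (1 + t))\<^sup>2" by (simp add: power_mult_distrib)
    also have "\<dots> \<le> P\<^sup>2" using P r t by (intro power_mono) auto
    finally have PE: "r\<^sup>2 * (1 + t) * E t \<le> P\<^sup>2 * E t" using E0[of t] by (intro mult_right_mono) auto
    have "1 \<le> K * ((1 + t) * E t)" using L2[of 0 t] t Eone by simp
    then have "r\<^sup>2 * 1 \<le> r\<^sup>2 * (K * ((1 + t) * E t))" by (intro mult_left_mono) auto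
    then have "r\<^sup>2 \<le> K * (r\<^sup>2 * (1 + t) * E t)" by (simp add: mult_ac)
    also have "\<dots> \<le> K * (P\<^sup>2 * E t)" using PE K by (intro mult_left_mono) auto
    also have "\<dots> \<le> K^5 * (P\<^sup>2 * E t)"
      using K E0[of t] self_le_power[of K 5] by (intro mult_right_mono) auto
    finally show ?thesis by (simp add: mult_ac)
  qed
  have rA: "(r * A)\<^sup>2 \<le> 2 * P\<^sup>2 * K^5 * E t * D"
  proof -
    have "(r * A)\<^sup>2 = (r * \<bar>v 0\<bar> + K\<^sup>2 * (r * (1 + t)) * E t * \<bar>w 0\<bar>)\<^sup>2"
      by (simp add: A_def algebra_simps)
    also have "\<dots> \<le> 2 * (r * \<bar>v 0\<bar>)\<^sup>2 + 2 * (K\<^sup>2 * (r * (1 + t)) * E t * \<bar>w 0\<bar>)\<^sup>2"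
      using sum_squares_bound[of "r * \<bar>v 0\<bar>" "K\<^sup>2 * (r * (1 + t)) * E t * \<bar>w 0\<bar>"]
      by (simp add: power2_sum)
    also have "\<dots> = 2 * (r\<^sup>2 * (v 0)\<^sup>2) + 2 * (K^4 * (r * (1 + t))\<^sup>2 * (E t)\<^sup>2 * (w 0)\<^sup>2)"
      by (simp add: power_mult_distrib flip: power_mult)
    also have "\<dots> \<le> 2 * ((P\<^sup>2 * K^5 * E t) * (v 0)\<^sup>2) + 2 * (K^4 * P\<^sup>2 * (K * E t) * (w 0)\<^sup>2)"
      using r2 E2 P r t K by (intro add_mono mult_left_mono mult_right_mono mult_mono power_mono mult_nonneg_nonneg) auto
    also have "\<dots> = 2 * P\<^sup>2 * K^5 * E t * D" by (simp add: D_def algebra_simps eval_nat_numeral)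
    finally show ?thesis .
  qed
  have "mode_energy r v w t = \<bar>r * v t\<bar>\<^sup>2 + \<bar>w t\<bar>\<^sup>2" by (simp add: mode_energy_def power_mult_distrib)
  also have "\<dots> \<le> (2 * e * (r * A))\<^sup>2 + (E t * \<bar>w 0\<bar> + e * (r * A))\<^sup>2"
    by (intro add_mono power_mono v1 w1) auto
  also have "\<dots> \<le> (2 * e * (r * A))\<^sup>2 + (2 * (E t * \<bar>w 0\<bar>)\<^sup>2 + 2 * (e * (r * A))\<^sup>2)"
    using sum_squares_bound[of "E t * \<bar>w 0\<bar>" "e * (r * A)"] by (simp add: power2_sum)
  also have "\<dots> = 6 * (e\<^sup>2 * (r * A)\<^sup>2) + 2 * ((E t)\<^sup>2 * (w 0)\<^sup>2)" by (simp add: power_mult_distrib)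
  also have "\<dots> \<le> 6 * (e\<^sup>2 * (2 * P\<^sup>2 * K^5 * E t * D)) + 2 * ((K * E t) * D)"
    using rA E2 K E0[of t] by (intro add_mono mult_left_mono mult_mono) (auto simp: D_def)
  also have "\<dots> = (12 * exp (4 * K * L) * P\<^sup>2 * K^5 + 2 * K) * E t * D"
    by (simp add: e algebra_simps)
  finally show ?thesis by (simp add: D_def)
qed

section \<open>WKB approximation at high frequencies\<close>

text \<open>\<open>symb \<Xi> j w f\<close>: the function \<open>f\<close> is \<open>j\<close> times differentiable on the half-line and its
  \<open>i\<close>-th derivative is \<open>O(\<Xi>\<^bsup>w+i\<^esup>)\<close> for \<open>i \<le> j\<close>.\<close>

fun symb :: "(real \<Rightarrow> real) \<Rightarrow> nat \<Rightarrow> nat \<Rightarrow> (real \<Rightarrow> complex) \<Rightarrow> bool" where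
  "symb \<Xi> 0 w f \<longleftrightarrow> (\<exists>C. \<forall>t\<ge>0. norm (f t) \<le> C * \<Xi> t ^ w)"
| "symb \<Xi> (Suc j) w f \<longleftrightarrow> (\<exists>C. \<forall>t\<ge>0. norm (f t) \<le> C * \<Xi> t ^ w) \<and>
     (\<exists>f'. (\<forall>t\<ge>0. (f has_vector_derivative f' t) (at t within {0..})) \<and> symb \<Xi> j (Suc w) f')"

lemma symb_bound: "symb \<Xi> j w f \<Longrightarrow> \<exists>C. \<forall>t\<ge>0. norm (f t) \<le> C * \<Xi> t ^ w"
  by (cases j) auto

lemma symb_Suc_imp: "symb \<Xi> (Suc j) w f \<Longrightarrow> symb \<Xi> j w f"
proof (induction j arbitrary: w f)
  case (Suc j w f)
  obtain f' where f': "\<forall>t\<ge>0. (f has_vector_derivative f' t) (at t within {0..})" "symb \<Xi> (Suc j) (Suc w) f'"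
    using Suc.prems unfolding symb.simps(2)[of _ "Suc j"] by blast
  show ?case unfolding symb.simps(2)
    by (intro conjI symb_bound[OF Suc.prems] exI[of _ f'] f'(1) Suc.IH f'(2))
qed simp

lemma symb_antimono: "symb \<Xi> j w f \<Longrightarrow> i \<le> j \<Longrightarrow> symb \<Xi> i w f"
proof (induction j)
  case (Suc j)
  then show ?case using symb_Suc_imp by (metis le_SucE)
qed simp

lemma symb_cong:
  assumes "symb \<Xi> j w f" "\<And>t. t \<ge> 0 \<Longrightarrow> f t = g t"
  shows "symb \<Xi> j w g"
proof (cases j)
  case 0
  then show ?thesis using assms by auto
next
  case (Suc i)
  obtain f' where f': "\<forall>t\<ge>0. (f has_vector_derivative f' t) (at t within {0..})" "symb \<Xi> i (Suc w) f'"
    using assms(1) unfolding Suc symb.simps(2) by blast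
  have "(g has_vector_derivative f' t) (at t within {0..})" if "t \<ge> 0" for t
    by (rule has_vector_derivative_transform[of _ _ _ f]) (use that assms(2) f'(1) in auto)
  moreover have "\<exists>C. \<forall>t\<ge>0. norm (g t) \<le> C * \<Xi> t ^ w" using symb_bound[OF assms(1)] assms(2) by auto
  ultimately show ?thesis unfolding Suc symb.simps(2) using f'(2) by blast
qed

lemma symb_add:
  assumes "symb \<Xi> j w f" "symb \<Xi> j w g"
  shows "symb \<Xi> j w (\<lambda>t. f t + g t)"
  using assms
proof (induction j arbitrary: w f g)
  case (0 w f g)
  then obtain C D where "\<And>t. t\<ge>0 \<Longrightarrow> norm (f t) \<le> C * \<Xi> t ^ w" "\<And>t. t\<ge>0 \<Longrightarrow> norm (g t) \<le> D * \<Xi> t ^ w" by auto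
  then have "\<forall>t\<ge>0. norm (f t + g t) \<le> (C + D) * \<Xi> t ^ w"
    by (auto simp: distrib_right intro!: norm_triangle_le add_mono)
  then show ?case by auto
next
  case (Suc j w f g)
  have "symb \<Xi> j w (\<lambda>t. f t + g t)" by (rule Suc.IH; rule symb_Suc_imp; rule Suc.prems)
  then have b: "\<exists>C. \<forall>t\<ge>0. norm (f t + g t) \<le> C * \<Xi> t ^ w" by (rule symb_bound)
  obtain f' g' where *: "\<forall>t\<ge>0. (f has_vector_derivative f' t) (at t within {0..})" "symb \<Xi> j (Suc w) f'"
    "\<forall>t\<ge>0. (g has_vector_derivative g' t) (at t within {0..})" "symb \<Xi> j (Suc w) g'"
    using Suc.prems by auto
  have "\<forall>t\<ge>0. ((\<lambda>t. f t + g t) has_vector_derivative (f' t + g' t)) (at t within {0..})"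
    using * has_vector_derivative_add by blast
  moreover have "symb \<Xi> j (Suc w) (\<lambda>t. f' t + g' t)" using * by (intro Suc.IH)
  ultimately show ?case unfolding symb.simps by (intro conjI b exI[of _ "\<lambda>t. f' t + g' t"])
qed

lemma symb_mult:
  assumes "symb \<Xi> j w f" "symb \<Xi> j z g"
  shows "symb \<Xi> j (w + z) (\<lambda>t. f t * g t)"
  using assms
proof (induction j arbitrary: w z f g)
  case (0 w z f g)
  then obtain C D where *: "\<And>t. t\<ge>0 \<Longrightarrow> norm (f t) \<le> C * \<Xi> t ^ w" "\<And>t. t\<ge>0 \<Longrightarrow> norm (g t) \<le> D * \<Xi> t ^ z" by auto
  have "norm (f t * g t) \<le> (C * D) * \<Xi> t ^ (w + z)" if "t \<ge> 0" for t
  proof -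
    have "norm (f t * g t) \<le> (C * \<Xi> t ^ w) * (D * \<Xi> t ^ z)"
      unfolding norm_mult using *[OF that] by (intro mult_mono) (auto intro: order_trans[OF norm_ge_zero])
    then show ?thesis by (simp add: power_add mult_ac)
  qed
  then show ?case by auto
next
  case (Suc j w z f g)
  have "symb \<Xi> j (w + z) (\<lambda>t. f t * g t)" by (rule Suc.IH; rule symb_Suc_imp; rule Suc.prems)
  then have b: "\<exists>C. \<forall>t\<ge>0. norm (f t * g t) \<le> C * \<Xi> t ^ (w + z)" by (rule symb_bound)
  obtain f' g' where *: "\<forall>t\<ge>0. (f has_vector_derivative f' t) (at t within {0..})" "symb \<Xi> j (Suc w) f'"
    "\<forall>t\<ge>0. (g has_vector_derivative g' t) (at t within {0..})" "symb \<Xi> j (Suc z) g'"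
    using Suc.prems by auto
  have "symb \<Xi> j (Suc (w + z)) (\<lambda>t. f t * g' t)" "symb \<Xi> j (Suc (w + z)) (\<lambda>t. f' t * g t)"
    using Suc.IH[of w f "Suc z" g'] Suc.IH[of "Suc w" f' z g] * Suc.prems[THEN symb_Suc_imp] by auto
  then have "symb \<Xi> j (Suc (w + z)) (\<lambda>t. f t * g' t + f' t * g t)" by (rule symb_add)
  moreover have "\<forall>t\<ge>0. ((\<lambda>t. f t * g t) has_vector_derivative (f t * g' t + f' t * g t)) (at t within {0..})"
    using * has_vector_derivative_mult by blast
  ultimately show ?case unfolding symb.simps add_Suc
    by (intro conjI b exI[of _ "\<lambda>t. f t * g' t + f' t * g t"])
qed

lemma symb_zero: "symb \<Xi> j w (\<lambda>_. 0)"
proof (induction j arbitrary: w)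
  case (Suc j)
  show ?case unfolding symb.simps by (intro conjI exI[of _ 0] exI[of _ "\<lambda>_. 0"] Suc) auto
qed (auto intro!: exI[of _ 0])

lemma symb_const: "symb \<Xi> j 0 (\<lambda>_. c)"
proof (cases j)
  case (Suc i)
  show ?thesis unfolding symb.simps Suc
    by (intro conjI exI[of _ "norm c"] exI[of _ "\<lambda>_. 0"] symb_zero) auto
qed (auto intro!: exI[of _ "norm c"])

lemma symb_cmult: "symb \<Xi> j w f \<Longrightarrow> symb \<Xi> j w (\<lambda>t. c * f t)"
  using symb_mult[OF symb_const] by simp

lemma symb_sum:
  assumes "finite I" "\<And>i. i \<in> I \<Longrightarrow> symb \<Xi> j w (f i)"
  shows "symb \<Xi> j w (\<lambda>t. \<Sum>i\<in>I. f i t)"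
  using assms by (induction I rule: finite_induct) (auto intro: symb_zero symb_add)

lemma at_within_halfline_neq_bot: "t \<ge> 0 \<Longrightarrow> at t within {0::real..} \<noteq> bot"
proof -
  assume t: "t \<ge> 0"
  have "at_right t \<le> at t within {0..}" by (rule at_le) (use t in auto)
  then show ?thesis using trivial_limit_at_right_real[of t] bot_unique by metis
qed

lemma symb_vector_derivative:
  assumes "symb \<Xi> (Suc j) w f"
  shows "symb \<Xi> j (Suc w) (\<lambda>t. vector_derivative f (at t within {0..}))"
    and "t \<ge> 0 \<Longrightarrow> (f has_vector_derivative vector_derivative f (at t within {0..})) (at t within {0..})"
proof -
  obtain f' where f': "\<forall>t\<ge>0. (f has_vector_derivative f' t) (at t within {0..})" "symb \<Xi> j (Suc w) f'"
    using assms by auto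
  have eq: "vector_derivative f (at t within {0..}) = f' t" if "t \<ge> 0" for t
    using f'(1) that by (intro vector_derivative_within at_within_halfline_neq_bot) auto
  show "symb \<Xi> j (Suc w) (\<lambda>t. vector_derivative f (at t within {0..}))"
    by (rule symb_cong[OF f'(2)]) (simp add: eq)
  show "t \<ge> 0 \<Longrightarrow> (f has_vector_derivative vector_derivative f (at t within {0..})) (at t within {0..})"
    using f'(1) by (simp add: eq)
qed

text \<open>The formal solution \<open>r \<Sum>\<^sub>k r\<^bsup>-k\<^esup> p\<^sub>k\<close> of the Riccati equation
  \<open>\<lambda>' + \<lambda>\<^sup>2 + b \<lambda> + r\<^sup>2 = 0\<close> for the logarithmic derivative of a mode.\<close>

function wkb :: "(real \<Rightarrow> real) \<Rightarrow> nat \<Rightarrow> real \<Rightarrow> complex" where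
  "wkb b 0 = (\<lambda>t. \<i>)"
| "wkb b (Suc k) = (\<lambda>t. \<i> / 2 * (vector_derivative (wkb b k) (at t within {0..})
     + (\<Sum>i\<in>{1..k}. wkb b i t * wkb b (Suc k - i) t) + of_real (b t) * wkb b k t))"
  by pat_completeness auto
termination by (relation "Wellfounded.measure (\<lambda>(b, k). k)") auto

declare wkb.simps [simp del]

text \<open>Every term in the recursion for \<open>wkb b (Suc l)\<close> has weight
  \<open>Suc l\<close>: a derivative and a factor \<open>b\<close> each add one, and the weights in
  the products sum to \<open>Suc l\<close>. Each step uses up one derivative, so \<open>m\<close>
  derivatives of \<open>b\<close> suffice for \<open>wkb b m\<close> with one derivative to spare
  for the remainder.\<close>

lemma symb_wkb:
  assumes b: "symb \<Xi> m 1 (\<lambda>t. of_real (b t))" and "1 \<le> k" "k \<le> Suc m"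
  shows "symb \<Xi> (Suc m - k) k (wkb b k)"
  using assms(2,3)
proof (induction k rule: less_induct)
  case (less k)
  then obtain l where l: "k = Suc l" by (cases k) auto
  show ?case
  proof (cases "l = 0")
    \<comment> \<open>The constant \<open>wkb b 0\<close> has weight 0 and lies outside the
      induction; \<open>wkb b 1 = - b / 2\<close> is computed directly.\<close>
    case True
    have 1: "symb \<Xi> m 1 (\<lambda>t. \<i> / 2 * (of_real (b t) * \<i>))"
      using symb_cmult[OF symb_cmult[OF b, of \<i>], of "\<i>/2"] by (simp add: mult_ac)
    have 2: "vector_derivative (wkb b 0) (at t within {0..}) = 0" if "t \<ge> 0" for t
      unfolding wkb.simps using that by (intro vector_derivative_within at_within_halfline_neq_bot) auto
    have "symb \<Xi> m 1 (wkb b (Suc 0))"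
      by (rule symb_cong[OF 1]) (simp add: wkb.simps(2) 2, simp add: wkb.simps(1))
    then show ?thesis unfolding l True by simp
  next
    case False
    have p: "symb \<Xi> (m - l) i (wkb b i)" if "1 \<le> i" "i \<le> l" for i
      by (rule symb_antimono[OF less.IH[of i]]) (use that less.prems l in auto)
    have "symb \<Xi> (Suc (m - l)) l (wkb b l)" using less.IH[of l] l False less.prems by (simp add: Suc_diff_le)
    then have d: "symb \<Xi> (m - l) (Suc l) (\<lambda>t. vector_derivative (wkb b l) (at t within {0..}))"
      by (rule symb_vector_derivative(1))
    have s: "symb \<Xi> (m - l) (Suc l) (\<lambda>t. \<Sum>i\<in>{1..l}. wkb b i t * wkb b (Suc l - i) t)"
    proof (rule symb_sum)
      fix i assume i: "i \<in> {1..l}"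
      have "symb \<Xi> (m - l) (i + (Suc l - i)) (\<lambda>t. wkb b i t * wkb b (Suc l - i) t)"
        by (rule symb_mult; rule p) (use i in auto)
      then show "symb \<Xi> (m - l) (Suc l) (\<lambda>t. wkb b i t * wkb b (Suc l - i) t)" using i by simp
    qed simp
    have "symb \<Xi> (m - l) (1 + l) (\<lambda>t. of_real (b t) * wkb b l t)"
      by (rule symb_mult[OF symb_antimono[OF b] p]) (use False in auto)
    then have e: "symb \<Xi> (m - l) (Suc l) (\<lambda>t. of_real (b t) * wkb b l t)" by simp
    show ?thesis unfolding l wkb.simps using symb_cmult[OF symb_add[OF symb_add[OF d s] e], of "\<i>/2"]
      by (simp only: diff_Suc_Suc)
  qed
qed

text \<open>\<open>symb\<close> refers from a function to its derivative, so the induction starts at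
  the derivative of order \<open>m\<close> and descends to \<open>b\<close>.\<close>

lemma symb_coefficient:
  assumes diff: "\<forall>k<m. \<forall>t\<ge>0. halfline_deriv k b differentiable (at t within {0..})"
    and bound: "\<forall>t\<ge>0. \<forall>k\<le>m. \<bar>halfline_deriv k b t\<bar> \<le> \<Xi> t ^ (k + 1)"
  shows "symb \<Xi> m 1 (\<lambda>t. of_real (b t))"
proof -
  have bd: "\<exists>C. \<forall>t\<ge>0. norm (of_real (halfline_deriv k b t) :: complex) \<le> C * \<Xi> t ^ Suc k" if "k \<le> m" for k
    using bound that by (intro exI[of _ 1]) auto
  have "symb \<Xi> i (Suc (m - i)) (\<lambda>t. of_real (halfline_deriv (m - i) b t))" if "i \<le> m" for i
    using that
  proof (induction i)
    case 0
    then show ?case unfolding symb.simps(1) by (intro bd) simp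
  next
    case (Suc i)
    define k where "k = m - Suc i"
    have k: "k < m" "m - i = Suc k" using Suc.prems by (auto simp: k_def)
    have "((\<lambda>t. of_real (halfline_deriv k b t)) has_vector_derivative
        (of_real (halfline_deriv (Suc k) b t) :: complex)) (at t within {0..})" if "t \<ge> 0" for t
    proof -
      have "halfline_deriv k b differentiable (at t within {0..})" using diff k(1) that by blast
      then have "(halfline_deriv k b has_vector_derivative halfline_deriv (Suc k) b t) (at t within {0..})"
        by (simp add: vector_derivative_works)
      then show ?thesis by (rule bounded_linear.has_vector_derivative[OF bounded_linear_of_real])
    qed
    then show ?case unfolding symb.simps(2) k_def[symmetric]
      using Suc.IH Suc.prems k bd[of k] by (intro conjI exI[of _ "\<lambda>t. of_real (halfline_deriv (Suc k) b t)"]) auto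
  qed
  from this[of m] show ?thesis by simp
qed

text \<open>Here \<open>h\<close> stands for \<open>1/r\<close>.\<close>

lemma wkb_remainder:
  fixes h :: complex and t :: real and m :: nat and b :: "real \<Rightarrow> real"
  defines "d \<equiv> \<lambda>k. vector_derivative (wkb b k) (at t within {0..})"
    and "L \<equiv> (\<Sum>k\<le>m. h^k * wkb b k t)"
  shows "L\<^sup>2 + 1 + h * ((\<Sum>k\<le>m. h^k * d k) + of_real (b t) * L) =
     h^(m+1) * (d m + of_real (b t) * wkb b m t)
     + (\<Sum>(i,j)\<in>{(i,j). i \<le> m \<and> j \<le> m \<and> i + j > m}. h^(i+j) * (wkb b i t * wkb b j t))"
proof -
  define p where "p k = wkb b k t" for k
  define X where "X k = d k + of_real (b t) * p k" for k
  define g where "g i j = h^(i+j) * (p i * p j)" for i j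
  define T where "T = (\<Sum>(i,j)\<in>{(i,j). i \<le> m \<and> j \<le> m \<and> i + j > m}. g i j)"
  have fin: "finite {(i,j). i \<le> m \<and> j \<le> m \<and> P i j}" for P
    by (rule finite_subset[of _ "{..m} \<times> {..m}"]) auto
  define G where "G k = (\<Sum>i\<le>k. p i * p (k - i))" for k
  have G0: "G 0 = -1" by (simp add: G_def p_def wkb.simps(1))
  \<comment> \<open>The recursion in closed form: in the convolution of order \<open>Suc k\<close>
    the two end terms give \<open>2 * \<i> * p (Suc k)\<close>, which was chosen to make the total
    equal to \<open>- X k\<close>. Hence the orders 1 to \<open>m\<close> of
    \<open>L\<^sup>2\<close> cancel against the linear terms, and only the linear term of order
    \<open>m + 1\<close> and the products of higher order survive.\<close>
  have conv: "G (Suc k) = - X k" for k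
  proof -
    have "(\<Sum>i\<le>Suc k. p i * p (Suc k - i)) = 2 * \<i> * p (Suc k) + (\<Sum>i\<in>{1..k}. p i * p (Suc k - i))"
    proof -
      have "{..Suc k} = insert 0 (insert (Suc k) {1..k})" by auto
      then show ?thesis by (simp add: p_def wkb.simps(1))
    qed
    moreover have "2 * \<i> * p (Suc k) = - (d k + (\<Sum>i\<in>{1..k}. p i * p (Suc k - i)) + of_real (b t) * p k)"
      unfolding p_def by (subst wkb.simps(2)) (simp add: d_def)
    ultimately show ?thesis by (simp add: X_def G_def)
  qed
  have "L\<^sup>2 = (\<Sum>i\<le>m. \<Sum>j\<le>m. g i j)"
    unfolding L_def power2_eq_square sum_product by (intro sum.cong) (auto simp: g_def p_def power_add mult_ac)
  also have "\<dots> = (\<Sum>(i,j)\<in>{..m}\<times>{..m}. g i j)" by (simp add: sum.cartesian_product)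
  also have "{..m}\<times>{..m} = {(i,j). i + j \<le> m} \<union> {(i,j). i \<le> m \<and> j \<le> m \<and> i + j > m}" by auto
  also have "(\<Sum>(i,j)\<in>\<dots>. g i j) = (\<Sum>(i,j)\<in>{(i,j). i + j \<le> m}. g i j) + T"
    unfolding T_def
    by (rule sum.union_disjoint) (auto intro!: fin finite_subset[of "{(i,j). i + j \<le> m}" "{..m}\<times>{..m}"])
  also have "(\<Sum>(i,j)\<in>{(i,j). i + j \<le> m}. g i j) = (\<Sum>k\<le>m. \<Sum>i\<le>k. g i (k - i))"
    by (rule sum.triangle_reindex_eq)
  also have "\<dots> = (\<Sum>k<Suc m. h^k * G k)"
    unfolding sum_distrib_left G_def lessThan_Suc_atMost by (intro sum.cong) (auto simp: g_def)
  also have "\<dots> = -1 - (\<Sum>k<m. h^Suc k * X k)"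
    unfolding sum.lessThan_Suc_shift conv G0 by (simp add: sum_negf)
  finally have L2: "L\<^sup>2 = -1 - (\<Sum>k<m. h^Suc k * X k) + T" .
  have "h * ((\<Sum>k\<le>m. h^k * d k) + of_real (b t) * L) = (\<Sum>k\<le>m. h^Suc k * X k)"
    unfolding L_def by (simp add: sum_distrib_left distrib_left X_def p_def mult_ac flip: sum.distrib)
  also have "\<dots> = (\<Sum>k<m. h^Suc k * X k) + h^Suc m * X m"
    unfolding lessThan_Suc_atMost[symmetric] by simp
  finally have "L\<^sup>2 + 1 + h * ((\<Sum>k\<le>m. h^k * d k) + of_real (b t) * L) = h^(m+1) * X m + T"
    unfolding L2 by simp
  then show ?thesis by (simp only: X_def p_def T_def g_def)
qed

text \<open>The approximate solution is \<open>r\<close> times the partial sum of the formal series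
  in \<open>1 / r\<close>. It is differentiable at all times; where
  \<open>\<Xi> \<le> \<epsilon> * r\<close>, its terms are dominated by powers of
  \<open>\<Xi> / r\<close> and the bounds hold.\<close>

lemma riccati_approx:
  assumes b: "symb \<Xi> m 1 (\<lambda>t. of_real (b t))" and m: "m > 0" and Xi: "\<And>t. t \<ge> 0 \<Longrightarrow> \<Xi> t > 0"
  shows "\<exists>\<epsilon>>0. \<exists>K\<ge>0. \<forall>r>0. \<exists>lam lam'. \<forall>t\<ge>0. (lam has_vector_derivative lam' t) (at t within {0..}) \<and>
    (\<Xi> t \<le> \<epsilon> * r \<longrightarrow> cmod (lam t - \<i> * of_real r) \<le> r / 2 \<and>
       cmod (lam' t + (lam t)\<^sup>2 + of_real (b t) * lam t + of_real (r\<^sup>2)) \<le> K * r\<^sup>2 * (\<Xi> t / r)^(m+1))"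
proof -
  define d where "d k t = vector_derivative (wkb b k) (at t within {0..})" for k t
  have sm: "symb \<Xi> (Suc m - k) k (wkb b k)" if "k \<le> m" for k
    using symb_wkb[OF b, of k] symb_const[of \<Xi> "Suc m" \<i>] that by (cases k) (auto simp: wkb.simps(1) simp del: symb.simps)
  have der: "(wkb b k has_vector_derivative d k t) (at t within {0..})" if "k \<le> m" "t \<ge> 0" for k t
    unfolding d_def using sm[OF that(1)] that by (intro symb_vector_derivative(2)) (auto simp: Suc_diff_le simp del: symb.simps)
  have "\<forall>k\<in>{..m}. \<exists>C. \<forall>t\<ge>0. cmod (wkb b k t) \<le> C * \<Xi> t ^ k"
    using sm symb_bound by blast
  then obtain Cf where Cf: "\<And>k t. k \<le> m \<Longrightarrow> t \<ge> 0 \<Longrightarrow> cmod (wkb b k t) \<le> Cf k * \<Xi> t ^ k"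
    unfolding bchoice_iff by auto
  have "symb \<Xi> 0 (Suc m) (d m)" unfolding d_def using sm[of m] by (intro symb_vector_derivative(1)) (simp del: symb.simps)
  then obtain C1 where C1: "\<And>t. t \<ge> 0 \<Longrightarrow> cmod (d m t) \<le> C1 * \<Xi> t ^ Suc m" by auto
  obtain C2 where C2: "\<And>t. t \<ge> 0 \<Longrightarrow> cmod (of_real (b t)) \<le> C2 * \<Xi> t ^ 1"
    using symb_bound[OF b] by blast
  define C where "C = 1 + \<bar>C1\<bar> + \<bar>C2\<bar> + (\<Sum>k\<le>m. \<bar>Cf k\<bar>)"
  have sumnn: "(\<Sum>k\<le>m. \<bar>Cf k\<bar>) \<ge> 0" by (intro sum_nonneg) auto
  have C: "C \<ge> 1" "C1 \<le> C" "C2 \<le> C" unfolding C_def using sumnn by linarith+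
  have CfC: "Cf k \<le> C" if "k \<le> m" for k
  proof -
    have "\<bar>Cf k\<bar> \<le> (\<Sum>k\<le>m. \<bar>Cf k\<bar>)" using that by (intro member_le_sum) auto
    then show ?thesis unfolding C_def by linarith
  qed
  \<comment> \<open>In units of \<open>r\<close> each of the \<open>m\<close> corrections is at most
    \<open>C * \<epsilon>\<close>, so together they are at most 1/2. This keeps the imaginary part
    of the approximate solution between \<open>r / 2\<close> and \<open>3 / 2 * r\<close>.\<close>
  define \<epsilon> where "\<epsilon> = 1 / (2 * real m * C)"
  have eps: "\<epsilon> > 0" "\<epsilon> \<le> 1" "real m * C * \<epsilon> = 1/2"
  proof -
    have "real m * C \<ge> 1" using m C(1) mult_mono[of 1 "real m" 1 C] by simp
    then show "\<epsilon> > 0" "\<epsilon> \<le> 1" "real m * C * \<epsilon> = 1/2" using m C(1) by (auto simp: \<epsilon>_def field_simps)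
  qed
  \<comment> \<open>The first summand bounds the two terms with \<open>h^(m+1)\<close>. The second
    counts at most \<open>(m + 1)\<^sup>2\<close> products of order above \<open>m\<close>, each at
    most \<open>C\<^sup>2 * (\<Xi> / r)^(m+1)\<close> because
    \<open>\<Xi> / r \<le> 1\<close>.\<close>
  define K where "K = 2 * C\<^sup>2 + (real m + 1)\<^sup>2 * C\<^sup>2"
  have "\<exists>lam lam'. \<forall>t\<ge>0. (lam has_vector_derivative lam' t) (at t within {0..}) \<and>
    (\<Xi> t \<le> \<epsilon> * r \<longrightarrow> cmod (lam t - \<i> * of_real r) \<le> r / 2 \<and>
       cmod (lam' t + (lam t)\<^sup>2 + of_real (b t) * lam t + of_real (r\<^sup>2)) \<le> K * r\<^sup>2 * (\<Xi> t / r)^(m+1))"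
    if r: "r > 0" for r
  proof -
    define h :: complex where "h = 1 / of_real r"
    define L where "L t = (\<Sum>k\<le>m. h^k * wkb b k t)" for t
    define L' where "L' t = (\<Sum>k\<le>m. h^k * d k t)" for t
    have rh: "of_real r * h = 1" using r by (simp add: h_def)
    show ?thesis
    proof (rule exI[of _ "\<lambda>t. of_real r * L t"], rule exI[of _ "\<lambda>t. of_real r * L' t"], intro allI impI conjI)
      fix t :: real assume t: "t \<ge> 0"
      show "((\<lambda>t. of_real r * L t) has_vector_derivative of_real r * L' t) (at t within {0..})"
        unfolding L_def L'_def
        by (intro has_vector_derivative_mult_right has_vector_derivative_sum der t) auto
      assume small: "\<Xi> t \<le> \<epsilon> * r"
      define x where "x = \<Xi> t / r"
      have x: "x > 0" "x \<le> \<epsilon>" using small r Xi[OF t] by (simp_all add: x_def field_simps)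
      then have x1: "x \<le> 1" using eps(2) by linarith
      have nh: "cmod h = 1 / r" using r by (simp add: h_def norm_divide)
      have hk: "cmod (h^k * wkb b k t) \<le> C * x^k" if "k \<le> m" for k
      proof -
        have "cmod (wkb b k t) \<le> C * \<Xi> t ^ k"
          using Cf[OF that t] CfC[OF that] Xi[OF t] by (meson mult_right_mono order_trans zero_le_power less_imp_le)
        then have "cmod (h^k) * cmod (wkb b k t) \<le> (1 / r)^k * (C * \<Xi> t ^ k)"
          using r by (intro mult_mono) (auto simp: norm_power nh)
        then show ?thesis by (simp add: norm_mult x_def power_divide)
      qed
      have xk: "x ^ k \<le> x ^ l" if "l \<le> k" for k l using x x1 that by (intro power_decreasing) auto
      show "cmod (of_real r * L t - \<i> * of_real r) \<le> r / 2"
      proof -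
        have "L t - \<i> = (\<Sum>k<m. h^Suc k * wkb b (Suc k) t)"
          unfolding L_def lessThan_Suc_atMost[symmetric] sum.lessThan_Suc_shift by (simp add: wkb.simps(1))
        also have "cmod \<dots> \<le> (\<Sum>k<m. C * x)"
        proof (rule sum_norm_le)
          fix k assume "k \<in> {..<m}"
          then have "cmod (h^Suc k * wkb b (Suc k) t) \<le> C * x^Suc k" by (intro hk) auto
          also have "\<dots> \<le> C * x" using xk[of 1 "Suc k"] C(1) by (intro mult_left_mono) auto
          finally show "cmod (h^Suc k * wkb b (Suc k) t) \<le> C * x" .
        qed
        also have "\<dots> = real m * C * x" by simp
        also have "\<dots> \<le> real m * C * \<epsilon>" using x C(1) by (intro mult_left_mono) auto
        finally have "cmod (L t - \<i>) \<le> 1/2" using eps(3) by simp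
        then have "r * cmod (L t - \<i>) \<le> r * (1/2)" using r by (intro mult_left_mono) auto
        moreover have "of_real r * L t - \<i> * of_real r = of_real r * (L t - \<i>)" by (simp add: algebra_simps)
        ultimately show ?thesis using r by (simp add: norm_mult)
      qed
      have "of_real r * L' t + (of_real r * L t)\<^sup>2 + of_real (b t) * (of_real r * L t) + of_real (r\<^sup>2)
         = (of_real r)\<^sup>2 * ((L t)\<^sup>2 + 1 + h * (L' t + of_real (b t) * L t))"
      proof -
        have "(of_real r)\<^sup>2 * (h * (L' t + of_real (b t) * L t)) = of_real r * (of_real r * h) * (L' t + of_real (b t) * L t)"
          by (simp add: power2_eq_square mult_ac)
        then show ?thesis unfolding rh by (simp add: algebra_simps power_mult_distrib)
      qed
      also have "(L t)\<^sup>2 + 1 + h * (L' t + of_real (b t) * L t) =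
          h^(m+1) * (d m t + of_real (b t) * wkb b m t)
     + (\<Sum>(i,j)\<in>{(i,j). i \<le> m \<and> j \<le> m \<and> i + j > m}. h^(i+j) * (wkb b i t * wkb b j t))" (is "_ = ?A + ?B")
        unfolding L_def L'_def d_def by (rule wkb_remainder)
      finally have eq: "of_real r * L' t + (of_real r * L t)\<^sup>2 + of_real (b t) * (of_real r * L t) + of_real (r\<^sup>2)
        = (of_real r)\<^sup>2 * (?A + ?B)" .
      have A: "cmod ?A \<le> 2 * C\<^sup>2 * x^(m+1)"
      proof -
        have "cmod (d m t) \<le> C\<^sup>2 * \<Xi> t ^ Suc m"
        proof -
          have "C * 1 \<le> C * C" using C(1) by (intro mult_left_mono) auto
          then have "C1 \<le> C\<^sup>2" using C(2) unfolding power2_eq_square by linarith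
          then show ?thesis using C1[OF t] Xi[OF t] by (meson mult_right_mono order_trans zero_le_power less_imp_le)
        qed
        moreover have "cmod (of_real (b t) * wkb b m t) \<le> (C * \<Xi> t) * (C * \<Xi> t ^ m)"
          unfolding norm_mult
        proof (rule mult_mono)
          show "cmod (of_real (b t)) \<le> C * \<Xi> t"
            using C2[OF t] C(3) Xi[OF t] by (metis mult_right_mono order_trans power_one_right less_imp_le)
          show "cmod (wkb b m t) \<le> C * \<Xi> t ^ m"
            using Cf[OF order_refl t] CfC[OF order_refl] Xi[OF t] by (meson mult_right_mono order_trans zero_le_power less_imp_le)
        qed (use C Xi[OF t] in auto)
        ultimately have "cmod (d m t + of_real (b t) * wkb b m t) \<le> 2 * C\<^sup>2 * \<Xi> t ^ Suc m"
          by (intro norm_triangle_le) (simp add: power2_eq_square mult_ac)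
        then have "cmod (h^(m+1)) * cmod (d m t + of_real (b t) * wkb b m t) \<le> (1/r)^(m+1) * (2 * C\<^sup>2 * \<Xi> t ^ Suc m)"
          using r by (intro mult_mono) (auto simp: norm_power nh norm_mult)
        then show ?thesis by (simp add: norm_mult x_def power_divide mult_ac)
      qed
      have B: "cmod ?B \<le> (real m + 1)\<^sup>2 * C\<^sup>2 * x^(m+1)"
      proof -
        have "cmod ?B \<le> (\<Sum>(i,j)\<in>{(i,j). i \<le> m \<and> j \<le> m \<and> i + j > m}. C\<^sup>2 * x^(m+1))"
        proof (rule sum_norm_le, clarify)
          fix i j assume ij: "i \<le> m" "j \<le> m" "m < i + j"
          have "h^(i+j) * (wkb b i t * wkb b j t) = (h^i * wkb b i t) * (h^j * wkb b j t)"
            by (simp add: power_add mult_ac)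
          then have "cmod (h^(i+j) * (wkb b i t * wkb b j t)) \<le> (C * x^i) * (C * x^j)"
            using hk[OF ij(1)] hk[OF ij(2)] C x by (simp only: norm_mult[of "h^i * wkb b i t"]) (intro mult_mono, auto)
          also have "\<dots> = C\<^sup>2 * x^(i+j)" by (simp add: power_add power2_eq_square)
          also have "\<dots> \<le> C\<^sup>2 * x^(m+1)" using ij by (intro mult_left_mono xk) auto
          finally show "cmod (h^(i+j) * (wkb b i t * wkb b j t)) \<le> C\<^sup>2 * x^(m+1)" .
        qed
        also have "\<dots> = real (card {(i,j). i \<le> m \<and> j \<le> m \<and> i + j > m}) * (C\<^sup>2 * x^(m+1))"
          by (simp add: case_prod_unfold)
        also have "\<dots> \<le> (real m + 1)\<^sup>2 * (C\<^sup>2 * x^(m+1))"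
        proof (rule mult_right_mono)
          have "card {(i,j). i \<le> m \<and> j \<le> m \<and> i + j > m} \<le> card ({..m} \<times> {..m})"
            by (rule card_mono) auto
          also have "\<dots> = (m + 1)\<^sup>2" by (simp add: power2_eq_square)
          finally have "real (card {(i,j). i \<le> m \<and> j \<le> m \<and> i + j > m}) \<le> real ((m + 1)\<^sup>2)"
            by (rule of_nat_mono)
          moreover have "real ((m + 1)\<^sup>2) = (real m + 1)\<^sup>2" by simp
          ultimately show "real (card {(i,j). i \<le> m \<and> j \<le> m \<and> i + j > m}) \<le> (real m + 1)\<^sup>2"
            by (simp only:)
        qed (use x in auto)
        finally show ?thesis by (simp only: mult.assoc)
      qed
      have "cmod ((of_real r)\<^sup>2 * (?A + ?B)) = r\<^sup>2 * cmod (?A + ?B)"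
        unfolding norm_mult by (simp only: norm_power norm_of_real power2_abs)
      also have "\<dots> \<le> r\<^sup>2 * (2 * C\<^sup>2 * x^(m+1) + (real m + 1)\<^sup>2 * C\<^sup>2 * x^(m+1))"
        by (intro mult_left_mono norm_triangle_le add_mono A B zero_le_power2)
      also have "\<dots> = K * r\<^sup>2 * x^(m+1)" by (simp add: K_def algebra_simps)
      finally show "cmod (of_real r * L' t + (of_real r * L t)\<^sup>2 + of_real (b t) * (of_real r * L t) + of_real (r\<^sup>2))
        \<le> K * r\<^sup>2 * (\<Xi> t / r)^(m+1)" unfolding eq x_def .
    qed
  qed
  moreover have "K \<ge> 0" by (simp add: K_def)
  ultimately show ?thesis using eps(1) by blast
qed

lemma power2_add_le: "(x + y)\<^sup>2 \<le> 2 * x\<^sup>2 + 2 * (y::real)\<^sup>2"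
  using sum_squares_bound[of x y] unfolding power2_sum by linarith

text \<open>With \<open>\<lambda> = a + i c\<close> and \<open>y = w - \<lambda> v\<close>, the imaginary part of the Riccati equation makes
  \<open>|y|\<^sup>2 / c\<close> decay exactly like \<open>exp (- \<integral> b)\<close>, up to the remainder \<open>R\<close>: this is how the
  contributions of the higher order terms to \<open>Re \<lambda>\<close> cancel.\<close>

lemma mode_hyperbolic:
  assumes symb: "symb \<Xi> m 1 (\<lambda>t. of_real (b t))" and m: "m > 0" and Xi: "\<And>t. t \<ge> 0 \<Longrightarrow> \<Xi> t > 0"
    and contXi: "continuous_on {0..} \<Xi>" and b: "continuous_on {0..} b"
  shows "\<exists>\<epsilon>>0. \<exists>K\<ge>0. \<forall>r>0. \<forall>v w. \<forall>t\<ge>0. mode b r v w \<longrightarrow> (\<forall>s\<in>{0..t}. \<Xi> s \<le> \<epsilon> * r) \<longrightarrow>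
    mode_energy r v w t \<le>
      72 * exp (- integral {0..t} b + K / r^m * integral {0..t} (\<lambda>s. \<Xi> s^(m+1))) * mode_energy r v w 0"
proof -
  obtain \<epsilon> K where eps: "\<epsilon> > 0" and K: "K \<ge> 0" and ric: "\<And>r. r > 0 \<Longrightarrow> \<exists>lam lam'. \<forall>t\<ge>0. (lam has_vector_derivative lam' t) (at t within {0..}) \<and>
    (\<Xi> t \<le> \<epsilon> * r \<longrightarrow> cmod (lam t - \<i> * of_real r) \<le> r / 2 \<and>
       cmod (lam' t + (lam t)\<^sup>2 + of_real (b t) * lam t + of_real (r\<^sup>2)) \<le> K * r\<^sup>2 * (\<Xi> t / r)^(m+1))"
    using riccati_approx[OF symb m Xi] by blast
  have "mode_energy r v w t \<le>
      72 * exp (- integral {0..t} b + 10 * K / r^m * integral {0..t} (\<lambda>s. \<Xi> s^(m+1))) * mode_energy r v w 0"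
    if r: "r > 0" and t: "t \<ge> 0" and md: "mode b r v w" and small: "\<forall>s\<in>{0..t}. \<Xi> s \<le> \<epsilon> * r" for r v w t
  proof -
    obtain lam lam' where "\<forall>t\<ge>0. (lam has_vector_derivative lam' t) (at t within {0..}) \<and>
    (\<Xi> t \<le> \<epsilon> * r \<longrightarrow> cmod (lam t - \<i> * of_real r) \<le> r / 2 \<and>
       cmod (lam' t + (lam t)\<^sup>2 + of_real (b t) * lam t + of_real (r\<^sup>2)) \<le> K * r\<^sup>2 * (\<Xi> t / r)^(m+1))"
      using ric[OF r] by blast
    then have lam: "\<And>s. s \<ge> 0 \<Longrightarrow> (lam has_vector_derivative lam' s) (at s within {0..})"
      and lamb: "\<And>s. s \<in> {0..t} \<Longrightarrow> cmod (lam s - \<i> * of_real r) \<le> r / 2"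
      and Rb: "\<And>s. s \<in> {0..t} \<Longrightarrow> cmod (lam' s + (lam s)\<^sup>2 + of_real (b s) * lam s + of_real (r\<^sup>2)) \<le> K * r\<^sup>2 * (\<Xi> s / r)^(m+1)"
      using small by auto
    define a c a' c' where "a s = Re (lam s)" and "c s = Im (lam s)"
      and "a' s = Re (lam' s)" and "c' s = Im (lam' s)" for s
    define R where "R s = lam' s + (lam s)\<^sup>2 + of_real (b s) * lam s + of_real (r\<^sup>2)" for s
    have ReR: "a' s = Re (R s) - ((a s)\<^sup>2 - (c s)\<^sup>2) - b s * a s - r\<^sup>2"
      and ImR: "c' s = Im (R s) - 2 * a s * c s - b s * c s" for s
      by (simp_all add: R_def a_def c_def a'_def c'_def power2_eq_square)
    have ac: "\<bar>a s\<bar> \<le> r / 2" "r / 2 \<le> c s" "c s \<le> 3 / 2 * r" if "s \<in> {0..t}" for s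
    proof -
      have "\<bar>Re (lam s - \<i> * of_real r)\<bar> \<le> r / 2" "\<bar>Im (lam s - \<i> * of_real r)\<bar> \<le> r / 2"
        using lamb[OF that] abs_Re_le_cmod abs_Im_le_cmod order_trans by blast+
      then have 1: "\<bar>a s\<bar> \<le> r / 2" and 2: "\<bar>c s - r\<bar> \<le> r / 2" by (simp_all add: a_def c_def)
      show "\<bar>a s\<bar> \<le> r / 2" "r / 2 \<le> c s" "c s \<le> 3 / 2 * r"
        using 1 2[unfolded abs_le_iff] by auto
    qed
    have contlam: "continuous_on {0..} lam"
      unfolding continuous_on_eq_continuous_within by (intro ballI has_vector_derivative_continuous[OF lam]) simp
    have contac: "continuous_on {0..t} a" "continuous_on {0..t} c" unfolding a_def c_def
      by (intro continuous_intros continuous_on_subset[OF contlam]; simp)+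
    \<comment> \<open>\<open>N\<close> is the squared modulus of \<open>y = w - lam * v\<close>,
      which satisfies \<open>y' = - (lam + b) * y - R * v\<close>. Without \<open>R\<close>,
      \<open>N\<close> decays at rate \<open>2 * a + 2 * b\<close> and \<open>c\<close> at rate
      \<open>2 * a + b\<close>; the quotient keeps exactly the rate \<open>b\<close>.\<close>
    define N where "N s = (w s - a s * v s)\<^sup>2 + (c s * v s)\<^sup>2" for s
    define Y where "Y s = N s / c s" for s
    define k where "k s = - b s + 10 * K / r^m * \<Xi> s^(m+1)" for s
    define Y' where "Y' s = - b s * Y s + (2 * c s * Im (R s) * (v s)\<^sup>2 - 2 * Re (R s) * v s * (w s - a s * v s)) / c s
       - Y s * Im (R s) / c s" for s
    have "Y t \<le> Y 0 * exp (integral {0..t} k)"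
    proof (rule gronwall[where F' = Y'])
      have cv: "continuous_on {0..t} v" "continuous_on {0..t} w"
        using mode_cont[OF md] by (auto elim: continuous_on_subset)
      show "continuous_on {0..t} Y" unfolding Y_def N_def
        by (intro continuous_intros contac cv) (use ac r in fastforce)
      show "continuous_on {0..t} k" unfolding k_def using r
        by (intro continuous_intros continuous_on_subset[OF b] continuous_on_subset[OF contXi]) auto
    next
      fix s assume s: "0 < s" "s < t"
      then have s': "s \<in> {0..t}" "s \<ge> 0" by auto
      have int: "at s within {0..} = at s" by (rule at_within_interior) (use s in auto)
      have cpos: "c s > 0" using ac(2)[OF s'(1)] r by linarith
      have dlam: "(lam has_vector_derivative lam' s) (at s)" using lam[OF s'(2)] by (simp add: int)
      have da: "(a has_real_derivative a' s) (at s)" and dc: "(c has_real_derivative c' s) (at s)"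
        unfolding a_def[abs_def] c_def[abs_def] a'_def c'_def has_real_derivative_iff_has_vector_derivative
        using bounded_linear.has_vector_derivative[OF bounded_linear_Re dlam]
          bounded_linear.has_vector_derivative[OF bounded_linear_Im dlam] by auto
      define q where "q = w s - a s * v s"
      define N' where "N' = - 2 * (a s + b s) * N s + 2 * c s * Im (R s) * (v s)\<^sup>2 - 2 * Re (R s) * v s * q"
      have dN: "(N has_real_derivative N') (at s)"
      proof -
        have "(N has_real_derivative (2 * (w s - a s * v s) * ((- r\<^sup>2 * v s - b s * w s) - (a' s * v s + a s * w s))
           + 2 * (c s * v s) * (c' s * v s + c s * w s))) (at s)"
          unfolding N_def[abs_def]
          apply (rule derivative_eq_intros da dc mode_deriv[OF md s(1)] refl)+
          by (simp add: algebra_simps)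
        moreover have "2 * (w s - a s * v s) * ((- r\<^sup>2 * v s - b s * w s) - (a' s * v s + a s * w s))
           + 2 * (c s * v s) * (c' s * v s + c s * w s) = N'"
          unfolding N'_def N_def q_def ReR ImR by algebra
        ultimately show ?thesis by simp
      qed
      have "(Y has_real_derivative (N' * c s - N s * c' s) / (c s * c s)) (at s)"
        unfolding Y_def[abs_def] by (intro DERIV_divide dN dc) (use cpos in simp)
      moreover have "(N' * c s - N s * c' s) / (c s * c s) = Y' s"
        using cpos unfolding N'_def Y'_def Y_def ImR q_def
        by (simp add: divide_simps) (simp add: algebra_simps)
      ultimately show "(Y has_real_derivative Y' s) (at s)" by simp
      have N0: "N s \<ge> 0" by (simp add: N_def)
      have Y0: "Y s \<ge> 0" using N0 cpos by (simp add: Y_def)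
      define B where "B = cmod (R s)"
      have ReB: "\<bar>Re (R s)\<bar> \<le> B" and ImB: "\<bar>Im (R s)\<bar> \<le> B" and B0: "B \<ge> 0"
        by (simp_all add: B_def abs_Re_le_cmod abs_Im_le_cmod)
      have t1: "2 * c s * Im (R s) * (v s)\<^sup>2 / c s \<le> 2 * B / c s * Y s"
      proof -
        have "2 * c s * Im (R s) * (v s)\<^sup>2 / c s = 2 * Im (R s) * (v s)\<^sup>2" using cpos by simp
        also have "\<dots> \<le> 2 * B * (v s)\<^sup>2" using ImB by (intro mult_right_mono) auto
        also have "\<dots> = 2 * B / c s * ((c s * v s)\<^sup>2 / c s)" using cpos by (simp add: power2_eq_square)
        also have "\<dots> \<le> 2 * B / c s * Y s" unfolding Y_def N_def using cpos B0
          by (intro mult_left_mono divide_right_mono) auto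
        finally show ?thesis .
      qed
      have t2: "- 2 * Re (R s) * v s * q / c s \<le> B / c s * Y s"
      proof -
        have "2 * (\<bar>c s * v s\<bar> * \<bar>q\<bar>) \<le> N s"
          using sum_squares_bound[of "\<bar>c s * v s\<bar>" "\<bar>q\<bar>"] by (simp add: N_def q_def add.commute)
        then have cvq: "2 * (\<bar>v s\<bar> * \<bar>q\<bar>) \<le> Y s" using cpos by (simp add: Y_def abs_mult field_simps)
        have "- 2 * Re (R s) * v s * q \<le> \<bar>Re (R s)\<bar> * (2 * (\<bar>v s\<bar> * \<bar>q\<bar>))"
          using abs_ge_self[of "- 2 * Re (R s) * v s * q"] by (simp add: abs_mult mult_ac)
        also have "\<dots> \<le> B * Y s" using ReB cvq B0 by (intro mult_mono) auto
        finally have "- 2 * Re (R s) * v s * q / c s \<le> B * Y s / c s" using cpos by (intro divide_right_mono) auto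
        then show ?thesis by simp
      qed
      have t3: "- (Y s * Im (R s) / c s) \<le> B / c s * Y s"
      proof -
        have "- Im (R s) \<le> B" using ImB by (simp add: abs_le_iff)
        then have "- Im (R s) * (Y s / c s) \<le> B * (Y s / c s)" using Y0 cpos by (intro mult_right_mono) auto
        then show ?thesis by (simp add: mult_ac)
      qed
      have "Y' s \<le> - b s * Y s + 4 * B / c s * Y s"
      proof -
        have "Y' s = - b s * Y s + 2 * c s * Im (R s) * (v s)\<^sup>2 / c s + - 2 * Re (R s) * v s * q / c s + - (Y s * Im (R s) / c s)"
          by (simp add: Y'_def q_def diff_divide_distrib)
        moreover have "4 * B / c s * Y s = 2 * B / c s * Y s + B / c s * Y s + B / c s * Y s"
          using cpos by (simp add: field_simps)
        ultimately show ?thesis using t1 t2 t3 by linarith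
      qed
      also have "\<dots> \<le> - b s * Y s + 10 * K / r^m * \<Xi> s^(m+1) * Y s"
      proof -
        have RB: "B \<le> K * r\<^sup>2 * (\<Xi> s / r)^(m+1)" using Rb[OF s'(1)] by (simp only: B_def R_def)
        \<comment> \<open>The lower bound \<open>c \<ge> r / 2\<close> removes one power of
          \<open>r\<close>, and the remainder bound supplies
          \<open>\<Xi>^(m+1) / r^m\<close>.\<close>
        have "4 * B / c s \<le> 4 * (K * r\<^sup>2 * (\<Xi> s / r)^(m+1)) / (r / 2)"
        proof (rule frac_le)
          show "0 \<le> 4 * (K * r\<^sup>2 * (\<Xi> s / r)^(m+1))" "4 * B \<le> 4 * (K * r\<^sup>2 * (\<Xi> s / r)^(m+1))"
            using RB B0 by linarith+
        qed (use ac(2)[OF s'(1)] r in auto)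
        also have "\<dots> = 8 * K / r^m * \<Xi> s^(m+1)"
          using r by (simp add: power_divide field_simps power2_eq_square)
        also have "\<dots> \<le> 10 * K / r^m * \<Xi> s^(m+1)"
          using K r Xi[OF s'(2)] by (intro mult_right_mono divide_right_mono) auto
        finally have "4 * B / c s * Y s \<le> 10 * K / r^m * \<Xi> s^(m+1) * Y s" by (rule mult_right_mono[OF _ Y0])
        then show ?thesis by simp
      qed
      finally show "Y' s \<le> k s * Y s" by (simp add: k_def algebra_simps)
    qed (rule t)
    moreover have "integral {0..t} k = - integral {0..t} b + 10 * K / r^m * integral {0..t} (\<lambda>s. \<Xi> s^(m+1))"
    proof -
      have "integral {0..t} k = integral {0..t} (\<lambda>s. - b s) + integral {0..t} (\<lambda>s. 10 * K / r^m * \<Xi> s^(m+1))"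
        unfolding k_def by (rule integral_add; intro integrable_continuous_real continuous_intros
          continuous_on_subset[OF b] continuous_on_subset[OF contXi]) auto
      then show ?thesis by simp
    qed
    ultimately have main: "Y t \<le> Y 0 * exp (- integral {0..t} b + 10 * K / r^m * integral {0..t} (\<lambda>s. \<Xi> s^(m+1)))"
      (is "_ \<le> _ * ?E") by simp
    have v2: "r\<^sup>2 * (v s)\<^sup>2 \<le> 4 * N s" and w2: "(w s)\<^sup>2 \<le> 4 * N s" if s: "s \<in> {0..t}" for s
    proof -
      have "(r / 2)\<^sup>2 * (v s)\<^sup>2 \<le> (c s)\<^sup>2 * (v s)\<^sup>2"
        using ac(2)[OF s] r by (intro mult_right_mono power_mono) auto
      also have "\<dots> \<le> N s" by (simp add: N_def power_mult_distrib)
      finally show v2: "r\<^sup>2 * (v s)\<^sup>2 \<le> 4 * N s" by (simp add: power_divide)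
      have "(a s)\<^sup>2 \<le> (r / 2)\<^sup>2" using ac(1)[OF s] by (metis abs_le_square_iff abs_of_nonneg r half_gt_zero less_imp_le)
      then have "(a s)\<^sup>2 * (v s)\<^sup>2 \<le> (r / 2)\<^sup>2 * (v s)\<^sup>2" by (intro mult_right_mono) auto
      then have av: "(a s * v s)\<^sup>2 \<le> N s" using v2 by (simp add: power_mult_distrib power_divide)
      have "(w s)\<^sup>2 = ((w s - a s * v s) + a s * v s)\<^sup>2" by simp
      also have "\<dots> \<le> 2 * (w s - a s * v s)\<^sup>2 + 2 * (a s * v s)\<^sup>2"
        by (rule power2_add_le)
      also have "\<dots> \<le> 4 * N s"
      proof -
        have "(w s - a s * v s)\<^sup>2 \<le> N s" by (simp add: N_def)
        then show ?thesis using av by linarith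
      qed
      finally show "(w s)\<^sup>2 \<le> 4 * N s" .
    qed
    have tt: "t \<in> {0..t}" "0 \<in> {0..t}" using t by auto
    have N0: "N s \<ge> 0" for s by (simp add: N_def)
    \<comment> \<open>The factor 72 is 8 * 3/2 * 6: the energy is at most \<open>8 * N\<close> at
      time \<open>t\<close>, \<open>c t \<le> 3 / 2 * r\<close>, and \<open>N 0 / c 0\<close> is at
      most \<open>6 / r\<close> times the initial energy.\<close>
    have "mode_energy r v w t \<le> 8 * N t" using v2[OF tt(1)] w2[OF tt(1)] by (simp add: mode_energy_def)
    also have "N t = c t * Y t" using ac(2)[OF tt(1)] r by (simp add: Y_def)
    also have "8 * (c t * Y t) \<le> 8 * ((3 / 2 * r) * (Y 0 * ?E))"
      using ac[OF tt(1)] r main N0[of t] by (intro mult_left_mono mult_mono) (auto simp: Y_def)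
    also have "\<dots> = 12 * r * ?E * Y 0" by simp
    also have "Y 0 \<le> 6 / r * mode_energy r v w 0"
    proof -
      have "N 0 \<le> 3 * mode_energy r v w 0"
      proof -
        have a2: "(a 0)\<^sup>2 \<le> (r / 2)\<^sup>2" using ac(1)[OF tt(2)] by (metis abs_le_square_iff abs_of_nonneg r half_gt_zero less_imp_le)
        have c2: "(c 0)\<^sup>2 \<le> (3 / 2 * r)\<^sup>2" using ac[OF tt(2)] r by (intro power_mono) auto
        have "(w 0 - a 0 * v 0)\<^sup>2 \<le> 2 * (w 0)\<^sup>2 + 2 * (a 0 * v 0)\<^sup>2"
          using power2_add_le[of "w 0" "- (a 0 * v 0)"] by simp
        then have "N 0 \<le> 2 * (w 0)\<^sup>2 + 2 * ((a 0)\<^sup>2 * (v 0)\<^sup>2) + (c 0)\<^sup>2 * (v 0)\<^sup>2"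
          by (simp add: N_def power_mult_distrib)
        also have "\<dots> \<le> 2 * (w 0)\<^sup>2 + 2 * ((r / 2)\<^sup>2 * (v 0)\<^sup>2) + (3 / 2 * r)\<^sup>2 * (v 0)\<^sup>2"
          by (intro add_mono mult_left_mono mult_right_mono a2 c2) auto
        also have "\<dots> = 2 * (w 0)\<^sup>2 + (11 / 4) * (r\<^sup>2 * (v 0)\<^sup>2)" by (simp add: power_mult_distrib power_divide)
        also have "\<dots> \<le> 3 * mode_energy r v w 0" unfolding mode_energy_def by (simp add: distrib_left)
        finally show ?thesis .
      qed
      then have "N 0 / c 0 \<le> 3 * mode_energy r v w 0 / (r / 2)"
        using ac(2)[OF tt(2)] r mode_energy_nonneg by (intro frac_le) auto
      then show ?thesis by (simp add: Y_def)
    qed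
    finally show ?thesis using r by (simp add: mult_left_mono mult_ac)
  qed
  then show ?thesis using eps K by (intro exI[of _ \<epsilon>] conjI exI[of _ "10 * K"]) auto
qed

section \<open>The energy bound for all frequencies\<close>

lemma continuous_on_Icc_bounded:
  fixes f :: "real \<Rightarrow> real"
  assumes "continuous_on {a..b} f"
  obtains B where "\<And>t. t \<in> {a..b} \<Longrightarrow> \<bar>f t\<bar> \<le> B"
proof -
  have "bounded (f ` {a..b})"
    by (intro compact_imp_bounded compact_continuous_image assms) auto
  then obtain B where "\<forall>x\<in>{a..b}. \<bar>f x\<bar> \<le> B" unfolding bounded_iff by auto
  then show ?thesis by (intro that[of B]) blast
qed

lemma continuous_on_atLeastI:
  fixes f :: "real \<Rightarrow> 'a::topological_space"
  assumes "\<And>t. t \<ge> a \<Longrightarrow> continuous_on {a..t} f"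
  shows "continuous_on {a..} f"
proof -
  have "continuous (at t within {a..}) f" if "t \<ge> a" for t
  proof -
    have "continuous (at t within {a..t+1}) f"
      using assms[of "t+1"] that unfolding continuous_on_eq_continuous_within by auto
    moreover have "at t within {a..t+1} = at t within {a..}"
      by (rule at_within_nhd[of _ "{..<t+1}"]) auto
    ultimately show ?thesis by simp
  qed
  then show ?thesis unfolding continuous_on_eq_continuous_within by auto
qed

lemma continuous_limit_bounded:
  fixes f :: "real \<Rightarrow> real"
  assumes c: "continuous_on {0..} f" and l: "(f \<longlongrightarrow> l) at_top"
  shows "\<exists>B. \<forall>t\<ge>0. \<bar>f t\<bar> \<le> B"
proof -
  have "eventually (\<lambda>t. dist (f t) l < 1) at_top" using l by (simp add: tendstoD)
  then obtain N where N: "\<And>t. t \<ge> N \<Longrightarrow> dist (f t) l < 1" unfolding eventually_at_top_linorder by blast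
  obtain B where B: "\<And>t. t \<in> {0..max 0 N} \<Longrightarrow> \<bar>f t\<bar> \<le> B"
    by (rule continuous_on_Icc_bounded[OF continuous_on_subset[OF c, of "{0..max 0 N}"]]) auto
  have "\<bar>f t\<bar> \<le> max B (\<bar>l\<bar> + 1)" if "t \<ge> 0" for t
  proof (cases "t \<le> max 0 N")
    case True
    then show ?thesis using B[of t] that by auto
  next
    case False
    then have "dist (f t) l < 1" by (intro N) auto
    then show ?thesis by (auto simp: dist_real_def)
  qed
  then show ?thesis by blast
qed

text \<open>\<open>S\<close> is the negative of the tail integral of the oscillating part, so that \<open>S' = \<sigma>\<close>.\<close>

lemma damping_decomposition:
  assumes A1: "condition_A1 b \<mu>" and A2: "condition_A2 \<sigma>" and sigma: "\<sigma> = (\<lambda>t. b t - \<mu> t)"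
    and b: "continuous_on {0..} b"
  obtains T \<mu>0 D S S0 c where "T \<ge> 0" "0 < \<mu>0" "\<mu>0 < 1" "\<And>t. t \<ge> T \<Longrightarrow> (1 + t) * \<mu> t \<le> \<mu>0"
    "\<And>t. t \<ge> T \<Longrightarrow> \<mu> t > 0" "continuous_on {T..} \<mu>"
    "\<And>t. t > T \<Longrightarrow> (\<mu> has_real_derivative D t) (at t)" "\<And>t. t > T \<Longrightarrow> D t < 0"
    "continuous_on {0..} S" "\<And>t. t \<ge> 0 \<Longrightarrow> \<bar>S t\<bar> \<le> S0"
    "\<And>t. t > T \<Longrightarrow> (S has_real_derivative (b t - \<mu> t)) (at t)"
    "\<And>t. t \<ge> 0 \<Longrightarrow> improper_tail \<sigma> t = - S t"
    "\<And>t. t \<ge> 0 \<Longrightarrow> integral {0..t} \<mu> = integral {0..t} b - S t - c"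
    "\<And>s t. T \<le> s \<Longrightarrow> s \<le> t \<Longrightarrow> integral {0..t} \<mu> = integral {0..s} \<mu> + integral {s..t} \<mu>"
    "\<And>s t. 0 \<le> s \<Longrightarrow> s \<le> t \<Longrightarrow> integral {s..t} (\<lambda>x. \<bar>S x\<bar>) \<le> integral {s..} (\<lambda>x. \<bar>improper_tail \<sigma> x\<bar>)"
proof -
  obtain T where T: "T \<ge> 0" and bdd: "bdd_above ((\<lambda>t. (1 + t) * \<mu> t) ` {T..})"
    and sup: "(SUP t\<in>{T..}. (1 + t) * \<mu> t) < 1"
    and muT: "\<forall>t\<ge>T. \<mu> t > 0 \<and> (\<exists>D<0. (\<mu> has_real_derivative D) (at t within {0..}))"
    using A1 unfolding condition_A1_def by blast
  have sint: "\<sigma> integrable_on {0..t}" if "t \<ge> 0" for t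
    using A1 that unfolding condition_A1_def sigma by blast
  obtain L where L: "((\<lambda>t. integral {0..t} \<sigma>) \<longlongrightarrow> L) at_top"
    using A1 unfolding condition_A1_def sigma by blast
  define S where "S t = integral {0..t} \<sigma> - L" for t
  have contS: "continuous_on {0..} S"
    unfolding S_def by (intro continuous_on_atLeastI continuous_intros indefinite_integral_continuous_1 sint)
  have "(S \<longlongrightarrow> L - L) at_top" unfolding S_def by (intro tendsto_intros L)
  then obtain S0 where S0: "\<And>t. t \<ge> 0 \<Longrightarrow> \<bar>S t\<bar> \<le> S0" using continuous_limit_bounded[OF contS] by blast
  define \<mu>0 where "\<mu>0 = (SUP t\<in>{T..}. (1 + t) * \<mu> t)"
  have mu0: "(1 + t) * \<mu> t \<le> \<mu>0" if "t \<ge> T" for t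
    unfolding \<mu>0_def using that by (intro cSUP_upper bdd) auto
  have "0 < (1 + T) * \<mu> T" using muT T by (intro mult_pos_pos) auto
  then have mu0p: "\<mu>0 > 0" using mu0[of T] by simp
  have "\<forall>t\<in>{T..}. \<exists>D. D < 0 \<and> (\<mu> has_real_derivative D) (at t within {0..})" using muT by auto
  then obtain D where D: "\<forall>t\<in>{T..}. D t < 0 \<and> (\<mu> has_real_derivative D t) (at t within {0..})"
    unfolding bchoice_iff by blast
  have int: "at t within {0..} = at t" if "t > T" for t
    by (rule at_within_interior) (use that T in auto)
  have Dmu: "(\<mu> has_real_derivative D t) (at t)" if "t > T" for t
    using D int[OF that] that by (metis atLeast_iff less_imp_le)
  have contmu: "continuous_on {T..} \<mu>"
  proof -
    have "continuous (at t within {T..}) \<mu>" if "t \<ge> T" for t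
    proof -
      have "(\<mu> has_real_derivative D t) (at t within {T..})"
        using D that T by (auto intro: DERIV_subset[of \<mu> "D t" t "{0..}"])
      then show ?thesis by (rule DERIV_continuous)
    qed
    then show ?thesis by (simp add: continuous_on_eq_continuous_within)
  qed
  have bint: "b integrable_on {s..t}" if "s \<ge> 0" for s t
    by (intro integrable_continuous_real continuous_on_subset[OF b]) (use that in auto)
  have muint: "\<mu> integrable_on {0..t}" and mueq: "integral {0..t} \<mu> = integral {0..t} b - integral {0..t} \<sigma>"
    if "t \<ge> 0" for t
  proof -
    have e: "\<mu> = (\<lambda>x. b x - \<sigma> x)" by (simp add: sigma)
    show "\<mu> integrable_on {0..t}" by (subst e) (intro integrable_diff bint sint that order_refl)
    show "integral {0..t} \<mu> = integral {0..t} b - integral {0..t} \<sigma>"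
      by (subst e) (intro integral_diff bint sint that order_refl)
  qed
  \<comment> \<open>Before \<open>T\<close> only integrability of \<open>\<sigma>\<close> is known.
    Beyond \<open>T\<close> the differentiability of \<open>\<mu>\<close> makes
    \<open>\<sigma>\<close> continuous at the point, which is enough to differentiate its integral
    there.\<close>
  have dS: "(S has_real_derivative (b t - \<mu> t)) (at t)" if "t > T" for t
  proof -
    have t0: "t > 0" using that T by simp
    have "continuous (at t within {0..t+1}) \<sigma>" unfolding sigma
    proof (intro continuous_intros)
      show "continuous (at t within {0..t+1}) b"
        using continuous_on_subset[OF b, of "{0..t+1}"] t0 by (auto simp: continuous_on_eq_continuous_within)
      show "continuous (at t within {0..t+1}) \<mu>"
        by (rule continuous_at_imp_continuous_within[OF DERIV_isCont[OF Dmu[OF that]]])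
    qed
    then have "((\<lambda>u. integral {0..u} \<sigma>) has_vector_derivative \<sigma> t) (at t within {0..t+1})"
      using t0 by (intro integral_has_vector_derivative_continuous_at[of _ _ _ _ "{}", simplified] sint) auto
    moreover have "at t within {0..t+1} = at t" by (rule at_within_interior) (use t0 in auto)
    ultimately have "((\<lambda>u. integral {0..u} \<sigma>) has_real_derivative \<sigma> t) (at t)"
      by (simp add: has_real_derivative_iff_has_vector_derivative)
    then show ?thesis unfolding S_def[abs_def] sigma by (auto intro!: derivative_eq_intros)
  qed
  have tail: "improper_tail \<sigma> t = - S t" if t: "t \<ge> 0" for t
  proof -
    have "((\<lambda>u. integral {0..u} \<sigma> - integral {0..t} \<sigma>) \<longlongrightarrow> L - integral {0..t} \<sigma>) at_top"
      by (intro tendsto_intros L)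
    moreover have "eventually (\<lambda>u. integral {0..u} \<sigma> - integral {0..t} \<sigma> = integral {t..u} \<sigma>) at_top"
      using eventually_ge_at_top[of t]
    proof eventually_elim
      case (elim u)
      have "integral {0..t} \<sigma> + integral {t..u} \<sigma> = integral {0..u} \<sigma>"
        by (rule Henstock_Kurzweil_Integration.integral_combine) (use t elim sint in auto)
      then show ?case by simp
    qed
    ultimately have "((\<lambda>u. integral {t..u} \<sigma>) \<longlongrightarrow> L - integral {0..t} \<sigma>) at_top"
      by (rule Lim_transform_eventually)
    then show ?thesis unfolding improper_tail_def S_def by (simp add: tendsto_Lim)
  qed
  have comb: "integral {0..t} \<mu> = integral {0..s} \<mu> + integral {s..t} \<mu>" if "T \<le> s" "s \<le> t" for s t
    using Henstock_Kurzweil_Integration.integral_combine[of 0 s t \<mu>] muint[of t] that T by simp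
  have tailint: "integral {s..t} (\<lambda>x. \<bar>S x\<bar>) \<le> integral {s..} (\<lambda>x. \<bar>improper_tail \<sigma> x\<bar>)" if "0 \<le> s" "s \<le> t" for s t
  proof -
    have "(\<lambda>x. \<bar>improper_tail \<sigma> x\<bar>) absolutely_integrable_on {0..}"
      using A2 unfolding condition_A2_def by (intro nonnegative_absolutely_integrable_1) auto
    then have "(\<lambda>x. \<bar>improper_tail \<sigma> x\<bar>) absolutely_integrable_on {s..}"
      by (rule set_integrable_subset) (use that in auto)
    then have i: "(\<lambda>x. \<bar>improper_tail \<sigma> x\<bar>) integrable_on {s..}" by (rule set_lebesgue_integral_eq_integral(1))
    have "integral {s..t} (\<lambda>x. \<bar>S x\<bar>) = integral {s..t} (\<lambda>x. \<bar>improper_tail \<sigma> x\<bar>)"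
      using that tail by (intro integral_cong) auto
    also have "\<dots> \<le> integral {s..} (\<lambda>x. \<bar>improper_tail \<sigma> x\<bar>)"
    proof (rule integral_subset_le[OF _ _ i])
      have "(\<lambda>x. \<bar>S x\<bar>) integrable_on {s..t}"
        by (intro integrable_continuous_real continuous_intros continuous_on_subset[OF contS]) (use that in auto)
      then show "(\<lambda>x. \<bar>improper_tail \<sigma> x\<bar>) integrable_on {s..t}"
        by (rule integrable_eq) (use that tail in auto)
    qed auto
    finally show ?thesis .
  qed
  have mu01: "\<mu>0 < 1" using sup by (simp add: \<mu>0_def)
  have mupos: "\<mu> t > 0" if "t \<ge> T" for t using muT that by blast
  have Dneg: "D t < 0" if "t > T" for t using D that by auto
  \<comment> \<open>The constant \<open>c\<close> of the statement is the limit \<open>L\<close>.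
    Since \<open>S\<close> is bounded, the integrals of \<open>b\<close> and of \<open>\<mu>\<close>
    differ by a bounded amount.\<close>
  have mueq': "integral {0..t} \<mu> = integral {0..t} b - S t - L" if "t \<ge> 0" for t
    using mueq[OF that] by (simp add: S_def)
  show ?thesis
    by (rule that[OF T mu0p mu01 mu0 mupos contmu Dmu Dneg contS S0 dS tail mueq' comb tailint])
qed

text \<open>Since \<open>(1 + t) * \<mu> t \<le> \<mu>0 < 1\<close> beyond \<open>T\<close>, the
  derivative of \<open>(1 + t) * exp (- \<integral>\<mu>)\<close> is at least
  \<open>1 - \<mu>0\<close> times the exponential. This yields both the monotonicity and the
  integral bound; the oscillating part and the interval before \<open>T\<close> change only
  constants. The three properties are the hypotheses of \<open>mode_low\<close>.\<close>

lemma damping_growth: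
  fixes b \<mu> S :: "real \<Rightarrow> real"
  assumes T: "T \<ge> 0" and mu0: "0 < \<mu>0" "\<mu>0 < 1" "\<And>t. t \<ge> T \<Longrightarrow> (1 + t) * \<mu> t \<le> \<mu>0"
    and mu: "\<And>t. t \<ge> T \<Longrightarrow> \<mu> t > 0" "continuous_on {T..} \<mu>"
    and S: "\<And>t. t \<ge> 0 \<Longrightarrow> \<bar>S t\<bar> \<le> S0"
    and mueq: "\<And>t. t \<ge> 0 \<Longrightarrow> integral {0..t} \<mu> = integral {0..t} b - S t - c"
    and comb: "\<And>s t. T \<le> s \<Longrightarrow> s \<le> t \<Longrightarrow> integral {0..t} \<mu> = integral {0..s} \<mu> + integral {s..t} \<mu>"
    and b: "continuous_on {0..} b"
  defines "E \<equiv> \<lambda>t. exp (- integral {0..t} b)"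
  obtains K where "K \<ge> 1" "\<And>s t. 0 \<le> s \<Longrightarrow> s \<le> t \<Longrightarrow> E t \<le> K * E s"
    "\<And>s t. 0 \<le> s \<Longrightarrow> s \<le> t \<Longrightarrow> (1 + s) * E s \<le> K * ((1 + t) * E t)"
    "\<And>t. 0 \<le> t \<Longrightarrow> integral {0..t} E \<le> K * ((1 + t) * E t)"
proof -
  define G where "G t = exp (- integral {T..t} \<mu>)" for t
  \<comment> \<open>For \<open>t < T\<close> the interval \<open>{T..t}\<close> is empty and its
    integral is 0, so \<open>G\<close> is constant before \<open>T\<close>, where nothing is known
    about the sign of \<open>\<mu>\<close>.\<close>
  have G1: "G t = 1" if "t \<le> T" for t
    using that by (cases "t = T") (auto simp: G_def)
  have dG: "(G has_real_derivative - \<mu> t * G t) (at t)" if "t > T" for t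
  proof -
    have "((\<lambda>t. integral {T..t} \<mu>) has_real_derivative \<mu> t) (at t within {T..t+1})"
      using that by (intro integral_has_real_derivative continuous_on_subset[OF mu(2)]) auto
    moreover have "at t within {T..t+1} = at t" by (rule at_within_interior) (use that in auto)
    ultimately have "((\<lambda>t. integral {T..t} \<mu>) has_real_derivative \<mu> t) (at t)" by simp
    then show ?thesis unfolding G_def[abs_def] by (auto intro!: derivative_eq_intros)
  qed
  have contG': "continuous_on {T..} G"
    unfolding G_def
    by (intro continuous_on_atLeastI continuous_intros indefinite_integral_continuous_1 integrable_continuous_real
        continuous_on_subset[OF mu(2)]) auto
  have contG: "continuous_on {0..} G"
  proof -
    have "continuous_on ({0..T} \<union> {T..}) G"
    proof (rule continuous_on_closed_Un)
      show "continuous_on {0..T} G" using continuous_on_const[of "{0..T}" 1]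
        by (rule continuous_on_eq) (simp add: G1)
    qed (use contG' in auto)
    moreover have "{0..T} \<union> {T..} = {0..}" using T by auto
    ultimately show ?thesis by simp
  qed
  have G0: "G t > 0" for t by (simp add: G_def)
  have Ganti: "G t \<le> G s" if "s \<le> t" for s t
  proof (cases "t \<le> T")
    case True
    then show ?thesis using that G1 by simp
  next
    case False
    have "G t \<le> G (max s T)"
    proof (rule DERIV_nonpos_imp_decreasing_open[of "max s T" t])
      fix x assume x: "max s T < x" "x < t"
      then show "\<exists>y. (G has_real_derivative y) (at x) \<and> y \<le> 0"
        using dG[of x] mu(1)[of x] G0[of x] by (intro exI[of _ "- \<mu> x * G x"]) auto
    qed (use False that contG' in \<open>auto intro: continuous_on_subset\<close>)
    then show ?thesis using G1 by (cases "s \<le> T") (auto simp: max_def)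
  qed
  \<comment> \<open>Monotonicity of \<open>W k\<close> is used twice: \<open>k = 0\<close> gives
    that of \<open>(1 + t) * G t\<close>, and \<open>k = 1 - \<mu>0\<close>, the largest admissible
    value, bounds the integral of \<open>G\<close>.\<close>
  define W where "W k t = (1 + t) * G t - k * integral {0..t} G" for k t
  have W: "W k s \<le> W k t" if k: "0 \<le> k" "k \<le> 1 - \<mu>0" and st: "0 \<le> s" "s \<le> t" for k s t
  proof -
    have contW: "continuous_on {s..t} (W k)" if "0 \<le> s" for s t unfolding W_def
      by (intro continuous_intros continuous_on_subset[OF contG] continuous_on_subset[OF continuous_on_integral_halfline[OF contG]])
        (use that in auto)
    have dI: "((\<lambda>t. integral {0..t} G) has_real_derivative G x) (at x)" if "x > 0" for x
    proof -
      have "at x within {0..} = at x" by (rule at_within_interior) (use that in auto)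
      then show ?thesis using integral_deriv_halfline[OF contG, of x] that by simp
    qed
    have lo: "W k s \<le> W k t" if st: "0 \<le> s" "s \<le> t" "t \<le> T" for s t
    proof (rule DERIV_nonneg_imp_increasing_open[OF st(2) _ contW[OF st(1)]])
      fix x assume x: "s < x" "x < t"
      have "(G has_real_derivative 0) (at x)"
      proof (rule has_field_derivative_transform_within_open[where f = "\<lambda>_. 1" and S = "{..<T}"])
        show "((\<lambda>_. 1) has_real_derivative 0) (at x)" by simp
      qed (use x st G1 in auto)
      moreover have "x > 0" using x st by simp
      ultimately have "(W k has_real_derivative (G x - k * G x)) (at x)" unfolding W_def[abs_def]
        by (auto intro!: derivative_eq_intros dI[of x])
      moreover have "G x - k * G x \<ge> 0" using k mu0 G0[of x] mult_right_mono[of k 1 "G x"] by simp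
      ultimately show "\<exists>y. (W k has_real_derivative y) (at x) \<and> 0 \<le> y" by blast
    qed
    have hi: "W k s \<le> W k t" if st: "T \<le> s" "s \<le> t" for s t
    proof (rule DERIV_nonneg_imp_increasing_open[OF st(2)])
      fix x assume x: "s < x" "x < t"
      have "x > T" "x > 0" using x st T by auto
      then have "(W k has_real_derivative (G x + (1 + x) * (- \<mu> x * G x) - k * G x)) (at x)"
        unfolding W_def[abs_def] by (auto intro!: derivative_eq_intros dI[of x] dG[of x])
      moreover have "G x + (1 + x) * (- \<mu> x * G x) - k * G x \<ge> 0"
      proof -
        have "(1 - (1 + x) * \<mu> x - k) * G x \<ge> 0" using k mu0(3)[of x] x st G0[of x] by (intro mult_nonneg_nonneg) auto
        then show ?thesis by (simp add: algebra_simps)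
      qed
      ultimately show "\<exists>y. (W k has_real_derivative y) (at x) \<and> 0 \<le> y" by blast
    qed (use st T in \<open>auto intro!: contW\<close>)
    consider "t \<le> T" | "T \<le> s" | "s \<le> T" "T \<le> t" by linarith
    then show ?thesis
    proof cases
      case 3
      then show ?thesis using lo[of s T] hi[of T t] st by simp
    qed (use lo hi st in auto)
  qed
  have X: "(1 + s) * G s \<le> (1 + t) * G t" if "0 \<le> s" "s \<le> t" for s t
    using W[of 0 s t] that mu0 by (simp add: W_def)
  have I: "integral {0..t} G \<le> (1 + t) * G t / (1 - \<mu>0)" if "0 \<le> t" for t
  proof -
    have "W (1 - \<mu>0) 0 \<ge> 0" using G0[of 0] by (simp add: W_def)
    then have "(1 - \<mu>0) * integral {0..t} G \<le> (1 + t) * G t"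
      using W[of "1 - \<mu>0" 0 t] that mu0 by (simp add: W_def)
    then show ?thesis using mu0 by (simp add: field_simps)
  qed
  have contE: "continuous_on {0..} E" unfolding E_def
    by (intro continuous_intros continuous_on_integral_halfline b)
  obtain k0 where k0: "\<And>t. t \<in> {0..T} \<Longrightarrow> \<bar>integral {0..t} b\<bar> \<le> k0"
    by (rule continuous_on_Icc_bounded[OF continuous_on_subset[OF continuous_on_integral_halfline[OF b], of "{0..T}"]]) auto
  define \<kappa> where "\<kappa> = exp (\<bar>k0\<bar> + 2 * S0)"
  have S00: "S0 \<ge> 0" using S[of 0] by simp
  have cmp: "E t \<le> \<kappa> * G t \<and> G t \<le> \<kappa> * E t" if t: "t \<ge> 0" for t
  proof -
    have "\<bar>integral {0..t} b - integral {T..t} \<mu>\<bar> \<le> \<bar>k0\<bar> + 2 * S0"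
    proof (cases "t \<le> T")
      case True
      then have "integral {T..t} \<mu> = 0" by (cases "t = T") auto
      then show ?thesis using k0[of t] True t S00 by auto
    next
      case False
      have "integral {T..t} \<mu> = integral {0..t} \<mu> - integral {0..T} \<mu>" using comb[of T t] False by simp
      then have "integral {0..t} b - integral {T..t} \<mu> = integral {0..T} b + (S t - S T)"
        using mueq[of t] mueq[of T] t T by simp
      then show ?thesis using k0[of T] S[of t] S[of T] T t by (simp add: abs_le_iff)
    qed
    then show ?thesis unfolding E_def G_def \<kappa>_def by (auto simp flip: exp_add)
  qed
  have kap: "\<kappa> \<ge> 1" using S00 by (simp add: \<kappa>_def)
  have E0: "E t > 0" for t by (simp add: E_def)
  \<comment> \<open>Passing from \<open>E\<close> to \<open>G\<close> and back costs
    \<open>\<kappa>\<close> twice; the denominator comes from the integral bound.\<close>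
  define K where "K = \<kappa>\<^sup>2 / (1 - \<mu>0)"
  have K\<kappa>: "\<kappa>\<^sup>2 \<le> K" using mu0 kap unfolding K_def by (simp add: field_simps mult_le_cancel_right1)
  show ?thesis
  proof (rule that)
    have "1 \<le> \<kappa>\<^sup>2" using kap by (simp add: one_le_power)
    then show "K \<ge> 1" using K\<kappa> by simp
  next
    fix s t :: real assume st: "0 \<le> s" "s \<le> t"
    have "E t \<le> \<kappa> * G t" using cmp[of t] st by simp
    also have "\<dots> \<le> \<kappa> * (\<kappa> * E s)" using Ganti[OF st(2)] cmp[of s] st kap by (intro mult_left_mono) auto
    also have "\<dots> = \<kappa>\<^sup>2 * E s" by (simp add: power2_eq_square)
    also have "\<dots> \<le> K * E s" using K\<kappa> E0[of s] by (intro mult_right_mono) auto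
    finally show "E t \<le> K * E s" .
    have "(1 + s) * E s \<le> (1 + s) * (\<kappa> * G s)" using cmp[of s] st by (intro mult_left_mono) auto
    also have "\<dots> = \<kappa> * ((1 + s) * G s)" by simp
    also have "\<dots> \<le> \<kappa> * ((1 + t) * G t)" using X[OF st] kap by (intro mult_left_mono) auto
    also have "\<dots> \<le> \<kappa> * ((1 + t) * (\<kappa> * E t))" using cmp[of t] st kap by (intro mult_left_mono) auto
    also have "\<dots> = \<kappa>\<^sup>2 * ((1 + t) * E t)" by (simp add: power2_eq_square)
    also have "\<dots> \<le> K * ((1 + t) * E t)" using K\<kappa> E0[of t] st by (intro mult_right_mono) auto
    finally show "(1 + s) * E s \<le> K * ((1 + t) * E t)" .
  next
    fix t :: real assume t: "0 \<le> t"
    have "integral {0..t} E \<le> integral {0..t} (\<lambda>x. \<kappa> * G x)"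
      by (intro integral_le integrable_continuous_real continuous_intros continuous_on_subset[OF contE] continuous_on_subset[OF contG])
        (use cmp in auto)
    also have "\<dots> = \<kappa> * integral {0..t} G" by simp
    also have "\<dots> \<le> \<kappa> * ((1 + t) * (\<kappa> * E t) / (1 - \<mu>0))"
    proof (rule mult_left_mono)
      have "(1 + t) * G t / (1 - \<mu>0) \<le> (1 + t) * (\<kappa> * E t) / (1 - \<mu>0)"
        using cmp[OF t] t mu0 by (intro divide_right_mono mult_left_mono) auto
      then show "integral {0..t} G \<le> (1 + t) * (\<kappa> * E t) / (1 - \<mu>0)" using I[OF t] by linarith
    qed (use kap in auto)
    also have "\<dots> = K * ((1 + t) * E t)" by (simp add: K_def power2_eq_square)
    finally show "integral {0..t} E \<le> K * ((1 + t) * E t)" .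
  qed
qed

section \<open>Combination of the estimates over all zones of time and frequency\<close>

lemma weight_function_zeta_strict:
  assumes "weight_function \<rho>" "0 \<le> x" "x < y"
  shows "x / \<rho> x < y / \<rho> y" "\<rho> x < \<rho> y" "\<rho> x > 0"
  using assms unfolding weight_function_def strict_mono_on_def by auto

text \<open>For \<open>r \<le> r0\<close> the Duhamel estimate runs up to time
  \<open>2 / r + T\<close> and the dissipative estimate takes over. For \<open>r > r0\<close> the
  dissipative estimate starts at the time where \<open>H\<close> reaches \<open>r / N\<close>, or at
  the fixed time \<open>T2\<close> if that is later. Only the high frequencies produce the weight in
  \<open>\<rho>\<close>.\<close>

theorem mode_bound:
  fixes m :: nat and \<rho> \<zeta> b \<mu> \<sigma> \<Theta> \<Xi> \<zeta>inv :: "real \<Rightarrow> real"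
  assumes m: "m > 0"
    and weight: "weight_function \<rho>"
    and zeta: "\<zeta> = (\<lambda>r. r / \<rho> r)"
    and zeta_inv: "\<zeta>inv = the_inv_into {0..} \<zeta>"
    and sigma: "\<sigma> = (\<lambda>t. b t - \<mu> t)"
    and A1: "condition_A1 b \<mu>"
    and A2: "condition_A2 \<sigma>"
    and A3: "condition_A3 m b"
    and Theta: "\<forall>t\<ge>0. \<Theta> t > 0" "strict_mono_on {0..} \<Theta>" "continuous_on {0..} \<Theta>"
      "\<Theta> ` {0..} \<subseteq> \<zeta> ` {0..}"
    and Xi: "\<forall>t\<ge>0. \<Xi> t > 0" "continuous_on {0..} \<Xi>"
    and tail: "\<forall>t\<ge>0. integral {t..} (\<lambda>s. \<bar>improper_tail \<sigma> s\<bar>) \<le> 1 / \<Theta> t"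
    and deriv_bound: "\<forall>t\<ge>0. \<forall>k\<le>m. \<bar>halfline_deriv k b t\<bar> \<le> \<Xi> t ^ (k + 1)"
    and sup1: "bdd_above ((\<lambda>t. \<Xi> t / \<zeta>inv (\<Theta> t)) ` {0..})"
    and sup2: "bdd_above ((\<lambda>t. \<Theta> t / \<zeta>inv (\<Theta> t) ^ (m + 1) *
                  integral {0..t} (\<lambda>s. \<Xi> s ^ (m + 1))) ` {0..})"
  shows "\<exists>\<kappa>0>0. \<exists>C>0. \<forall>r>0. \<forall>v w. mode b r v w \<longrightarrow> (\<forall>t\<ge>0. mode_energy r v w t \<le>
     C * exp (2 * \<kappa>0 * \<rho> r) * exp (- integral {0..t} \<mu>) * ((1 + r\<^sup>2) * (v 0)\<^sup>2 + (w 0)\<^sup>2))"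
proof -
  have contb: "continuous_on {0..} b"
    using A3 unfolding condition_A3_def by (metis halfline_deriv.simps(1) zero_le)
  obtain T \<mu>0 D S S0 c where T: "T \<ge> 0" and mu0: "0 < \<mu>0" "\<mu>0 < 1" "\<And>t. t \<ge> T \<Longrightarrow> (1 + t) * \<mu> t \<le> \<mu>0"
    and mupos: "\<And>t. t \<ge> T \<Longrightarrow> \<mu> t > 0" and contmu: "continuous_on {T..} \<mu>"
    and Dmu: "\<And>t. t > T \<Longrightarrow> (\<mu> has_real_derivative D t) (at t)" "\<And>t. t > T \<Longrightarrow> D t < 0"
    and contS: "continuous_on {0..} S" and S0: "\<And>t. t \<ge> 0 \<Longrightarrow> \<bar>S t\<bar> \<le> S0"
    and dS: "\<And>t. t > T \<Longrightarrow> (S has_real_derivative (b t - \<mu> t)) (at t)"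
    and tailS: "\<And>t. t \<ge> 0 \<Longrightarrow> improper_tail \<sigma> t = - S t"
    and mueq: "\<And>t. t \<ge> 0 \<Longrightarrow> integral {0..t} \<mu> = integral {0..t} b - S t - c"
    and comb: "\<And>s t. T \<le> s \<Longrightarrow> s \<le> t \<Longrightarrow> integral {0..t} \<mu> = integral {0..s} \<mu> + integral {s..t} \<mu>"
    and tailint: "\<And>s t. 0 \<le> s \<Longrightarrow> s \<le> t \<Longrightarrow> integral {s..t} (\<lambda>x. \<bar>S x\<bar>) \<le> integral {s..} (\<lambda>x. \<bar>improper_tail \<sigma> x\<bar>)"
    by (rule damping_decomposition[OF A1 A2 sigma contb]) blast
  define E where "E t = exp (- integral {0..t} b)" for t
  define M where "M t = exp (- integral {0..t} \<mu>)" for t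
  have M0: "M t > 0" and E0: "E t > 0" for t by (simp_all add: M_def E_def)
  obtain K where K: "K \<ge> 1" "\<And>s t. 0 \<le> s \<Longrightarrow> s \<le> t \<Longrightarrow> E t \<le> K * E s"
    "\<And>s t. 0 \<le> s \<Longrightarrow> s \<le> t \<Longrightarrow> (1 + s) * E s \<le> K * ((1 + t) * E t)"
    "\<And>t. 0 \<le> t \<Longrightarrow> integral {0..t} E \<le> K * ((1 + t) * E t)"
    using damping_growth[OF T mu0 mupos contmu S0 mueq comb contb, of thesis] unfolding E_def by blast
  define e0 where "e0 = exp (S0 + \<bar>c\<bar>)"
  have EM: "E t \<le> e0 * M t" if "t \<ge> 0" for t
  proof -
    have "0 \<le> S0 + \<bar>c\<bar> + S t + c" using S0[OF that] by (auto simp: abs_if split: if_splits)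
    then show ?thesis unfolding E_def M_def e0_def mueq[OF that] by (simp flip: exp_add)
  qed
  have e01: "e0 \<ge> 1" unfolding e0_def using S0[of 0] by simp
  have Mcomb: "exp (- integral {s..t} \<mu>) * M s = M t" if "T \<le> s" "s \<le> t" for s t
    using comb[OF that] by (simp add: M_def flip: exp_add)

  have zmono: "\<zeta> x < \<zeta> y" "\<rho> x < \<rho> y" "\<rho> x > 0" if "0 \<le> x" "x < y" for x y
    using weight_function_zeta_strict[OF weight that] by (simp_all add: zeta)
  have rho: "\<rho> x > 0" if "x \<ge> 0" for x using zmono(3)[OF that, of "x + 1"] by simp
  have rho_le: "\<rho> x \<le> \<rho> y" if "0 \<le> x" "x \<le> y" for x y
    using zmono(2)[of x y] that by (cases "x = y") auto
  have zinj: "inj_on \<zeta> {0..}"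
    by (rule inj_onI) (metis atLeast_iff linorder_neqE_linordered_idom order_less_irrefl zmono(1))
  define H where "H t = \<zeta>inv (\<Theta> t)" for t
  have H: "H t \<ge> 0" "\<zeta> (H t) = \<Theta> t" if "t \<ge> 0" for t
  proof -
    have mem: "\<Theta> t \<in> \<zeta> ` {0..}" using Theta(4) that by auto
    show "\<zeta> (H t) = \<Theta> t" unfolding H_def zeta_inv by (rule f_the_inv_into_f[OF zinj mem])
    show "H t \<ge> 0" using the_inv_into_into[OF zinj mem, of "{0..}"] unfolding H_def zeta_inv by simp
  qed
  have z0: "\<zeta> 0 = 0" by (simp add: zeta)
  have Hpos: "H t > 0" if "t \<ge> 0" for t
    using H[OF that] Theta(1) that z0 by (metis less_eq_real_def less_irrefl)
  have zle: "\<zeta> x \<le> \<zeta> y \<longleftrightarrow> x \<le> y" if "0 \<le> x" "0 \<le> y" for x y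
    using zmono(1)[of x y] zmono(1)[of y x] that by (metis le_less linorder_not_less)
  have Theta_mono: "\<Theta> s \<le> \<Theta> t" if "0 \<le> s" "s \<le> t" for s t
    using Theta(2) that unfolding strict_mono_on_def by (metis atLeast_iff le_less order_trans)
  have Hmono: "H s \<le> H t" if "0 \<le> s" "s \<le> t" for s t
    using Theta_mono[OF that] H that zle by (metis order_trans)
  obtain C1' where C1': "\<And>t. t \<ge> 0 \<Longrightarrow> \<Xi> t / H t \<le> C1'" using sup1 unfolding bdd_above_def H_def by auto
  define C1 where "C1 = \<bar>C1'\<bar> + 1"
  have C1: "\<Xi> t \<le> C1 * H t" "C1 > 0" if "t \<ge> 0" for t
  proof -
    have "\<Xi> t \<le> C1' * H t" using C1'[OF that] Hpos[OF that] by (simp add: field_simps)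
    also have "\<dots> \<le> C1 * H t" unfolding C1_def using Hpos[OF that] by (intro mult_right_mono) auto
    finally show "\<Xi> t \<le> C1 * H t" "C1 > 0" by (simp_all add: C1_def)
  qed
  obtain C2' where C2': "\<And>t. t \<ge> 0 \<Longrightarrow> \<Theta> t / H t ^ (m + 1) * integral {0..t} (\<lambda>s. \<Xi> s ^ (m + 1)) \<le> C2'"
    using sup2 unfolding bdd_above_def H_def by auto
  define C2 where "C2 = \<bar>C2'\<bar>"
  \<comment> \<open>Since \<open>\<Theta> = H / \<rho> H\<close>, the factor in front of the
    integral in \<open>sup2\<close> is the reciprocal of \<open>H^m * \<rho> H\<close>.\<close>
  have C2: "integral {0..t} (\<lambda>s. \<Xi> s ^ (m + 1)) \<le> C2 * (H t ^ m * \<rho> (H t))" if "t \<ge> 0" for t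
  proof -
    have Th: "\<Theta> t = H t / \<rho> (H t)" using H(2)[OF that] by (simp add: zeta)
    define P where "P = H t ^ m * \<rho> (H t)"
    define J where "J = integral {0..t} (\<lambda>s. \<Xi> s ^ (m + 1))"
    have 1: "\<Theta> t / H t ^ (m + 1) * J \<le> C2" using C2'[OF that] unfolding C2_def J_def by simp
    have 2: "\<Theta> t / H t ^ (m + 1) = 1 / P"
      unfolding Th P_def using Hpos[OF that] by (simp add: field_simps)
    have "P > 0" unfolding P_def using Hpos[OF that] rho[of "H t"] by simp
    moreover have "J / P \<le> C2" using 1 unfolding 2 by simp
    ultimately have "J \<le> C2 * P" by (simp add: pos_divide_le_eq)
    then show ?thesis by (simp only: P_def J_def)
  qed

  have symb: "symb \<Xi> m 1 (\<lambda>t. of_real (b t))"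
    using A3 deriv_bound unfolding condition_A3_def by (intro symb_coefficient) auto
  have "\<exists>\<epsilon>>0. \<exists>K\<ge>0. \<forall>r>0. \<forall>v w. \<forall>t\<ge>0. mode b r v w \<longrightarrow> (\<forall>s\<in>{0..t}. \<Xi> s \<le> \<epsilon> * r) \<longrightarrow>
    mode_energy r v w t \<le>
      72 * exp (- integral {0..t} b + K / r^m * integral {0..t} (\<lambda>s. \<Xi> s^(m+1))) * mode_energy r v w 0"
    by (rule mode_hyperbolic[OF symb m _ Xi(2) contb]) (simp add: Xi(1))
  then obtain \<epsilon> K1 where eps: "\<epsilon> > 0" and K1: "K1 \<ge> 0"
    and hyp: "\<forall>r>0. \<forall>v w. \<forall>t\<ge>0. mode b r v w \<longrightarrow> (\<forall>s\<in>{0..t}. \<Xi> s \<le> \<epsilon> * r) \<longrightarrow>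
    mode_energy r v w t \<le>
      72 * exp (- integral {0..t} b + K1 / r^m * integral {0..t} (\<lambda>s. \<Xi> s^(m+1))) * mode_energy r v w 0"
    by (elim exE conjE) (rule that)
  \<comment> \<open>Chosen so that \<open>H \<le> r / N\<close> forces
    \<open>\<Xi> \<le> C1 * H \<le> \<epsilon> * r\<close>, the smallness needed for WKB;
    \<open>N \<ge> 1\<close> gives \<open>r / N \<le> r\<close>.\<close>
  define N where "N = max 1 (C1 / \<epsilon>)"
  have N: "N \<ge> 1" "C1 \<le> \<epsilon> * N"
    using eps by (auto simp: N_def max_def field_simps)

  have diss: "mode_energy r v w t \<le> 8 * exp (4 * S0) * exp (5 * exp S0 * (r / \<Theta> s)) *
      exp (- integral {s..t} \<mu>) * mode_energy r v w s"
    if md: "mode b r v w" and r: "r > 0" and st: "s \<le> t" "T \<le> s" "2 / r \<le> s" for r v w s t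
  proof -
    have s0: "0 \<le> s" using st T by simp
    have "mode_energy r v w t \<le> 8 * exp (4 * S0) *
       exp (- integral {s..t} \<mu> + 5 * exp S0 * r * integral {s..t} (\<lambda>x. \<bar>S x\<bar>)) * mode_energy r v w s"
    proof (rule mode_energy_dissipative[where D = D and \<mu> = \<mu> and S = S, OF md r s0 st(1)])
      fix x assume x: "s \<le> x"
      show "0 < \<mu> x" using mupos x st by simp
      \<comment> \<open>The starting time \<open>2 / r\<close> is what turns
        \<open>(1 + x) * \<mu> x \<le> 1\<close> into the smallness
        \<open>\<mu> x \<le> r / 2\<close> required by the modified energy.\<close>
      have "2 \<le> r * x" using x st(3) r by (simp add: field_simps) (meson mult_left_mono order_trans less_imp_le)
      then have "1 \<le> r / 2 * (1 + x)" using r by (simp add: algebra_simps)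
      moreover have "(1 + x) * \<mu> x \<le> 1" using mu0 x st by (meson less_imp_le order_trans)
      ultimately have "(1 + x) * \<mu> x \<le> (1 + x) * (r / 2)" by (simp add: mult.commute)
      then show "\<mu> x \<le> r / 2" using x s0 by simp
    next
      show "continuous_on {s..t} \<mu>" by (rule continuous_on_subset[OF contmu]) (use st in auto)
      show "continuous_on {s..t} S" by (rule continuous_on_subset[OF contS]) (use s0 in auto)
    next
      fix x assume x: "s < x"
      show "(\<mu> has_real_derivative D x) (at x)" "D x \<le> 0" "(S has_real_derivative b x - \<mu> x) (at x)"
        using Dmu[of x] dS[of x] x st by auto
    qed (use S0 s0 in auto)
    also have "\<dots> \<le> 8 * exp (4 * S0) * exp (- integral {s..t} \<mu> + 5 * exp S0 * (r / \<Theta> s)) * mode_energy r v w s"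
    proof -
      have "integral {s..t} (\<lambda>x. \<bar>S x\<bar>) \<le> 1 / \<Theta> s" using tailint[OF s0 st(1)] tail s0 by (meson order_trans)
      then have "5 * exp S0 * r * integral {s..t} (\<lambda>x. \<bar>S x\<bar>) \<le> 5 * exp S0 * r * (1 / \<Theta> s)"
        using r by (intro mult_left_mono) auto
      then have "exp (- integral {s..t} \<mu> + 5 * exp S0 * r * integral {s..t} (\<lambda>x. \<bar>S x\<bar>))
          \<le> exp (- integral {s..t} \<mu> + 5 * exp S0 * (r / \<Theta> s))" by simp
      then show ?thesis by (intro mult_right_mono[OF mult_left_mono] mode_energy_nonneg) auto
    qed
    also have "\<dots> = 8 * exp (4 * S0) * exp (5 * exp S0 * (r / \<Theta> s)) * exp (- integral {s..t} \<mu>) * mode_energy r v w s"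
      unfolding exp_add by (simp only: mult_ac)
    finally show ?thesis .
  qed
  define cd where "cd = 8 * exp (4 * S0)"
  have cd1: "cd \<ge> 1"
  proof -
    have "S0 \<ge> 0" using S0[of 0] by simp
    then have "1 \<le> exp (4 * S0)" by simp
    then show ?thesis unfolding cd_def by linarith
  qed
  have diss': "mode_energy r v w t \<le> cd * exp (5 * exp S0 * (r / \<Theta> s)) * A * M t * B"
    if "mode b r v w" "r > 0" "s \<le> t" "T \<le> s" "2 / r \<le> s" and Q: "mode_energy r v w s \<le> A * M s * B"
    for r v w s t A B
  proof -
    have "mode_energy r v w t \<le> cd * exp (5 * exp S0 * (r / \<Theta> s)) * exp (- integral {s..t} \<mu>) * mode_energy r v w s"
      unfolding cd_def by (rule diss) (use that in auto)
    also have "\<dots> \<le> cd * exp (5 * exp S0 * (r / \<Theta> s)) * exp (- integral {s..t} \<mu>) * (A * M s * B)"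
      using cd1 by (intro mult_left_mono Q) auto
    also have "\<dots> = cd * exp (5 * exp S0 * (r / \<Theta> s)) * A * (exp (- integral {s..t} \<mu>) * M s) * B" by (simp add: mult_ac)
    also have "exp (- integral {s..t} \<mu>) * M s = M t" by (rule Mcomb) (use that in auto)
    finally show ?thesis .
  qed

  \<comment> \<open>For \<open>r < r0\<close> one has \<open>r / N < H 0 \<le> H t\<close>, so no
    time satisfies \<open>H t \<le> r / N\<close>: the WKB zone is empty.\<close>
  define r0 where "r0 = N * H 0"
  have r0: "r0 > 0" using N Hpos[of 0] by (simp add: r0_def)
  \<comment> \<open>A bound of \<open>r * x\<close> for \<open>x \<le> 2 / r + T\<close> that is
    uniform in \<open>r \<le> r0\<close>.\<close>
  define Lc where "Lc = 2 + r0 * T"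
  have Lc: "Lc \<ge> 0" using r0 T by (simp add: Lc_def)
  define ca where "ca = (12 * exp (4 * K * Lc) * (r0 + Lc)\<^sup>2 * K^5 + 2 * K) * e0"
  have ca: "ca > 0" unfolding ca_def using K(1) e01 by (intro mult_pos_pos add_nonneg_pos) auto
  define Ca where "Ca = cd * exp (5 * exp S0 * (r0 / \<Theta> 0)) * ca"
  have low: "mode_energy r v w t \<le> Ca * M t * ((v 0)\<^sup>2 + (w 0)\<^sup>2)"
    if md: "mode b r v w" and r: "r > 0" "r \<le> r0" and t: "t \<ge> 0" for r v w t
  proof -
    define B where "B = (v 0)\<^sup>2 + (w 0)\<^sup>2"
    have B0: "B \<ge> 0" by (simp add: B_def)
    define s where "s = 2 / r + T"
    have s: "s \<ge> T" "s \<ge> 2 / r" "s \<ge> 0" using T r by (auto simp: s_def)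
    have lowzone: "mode_energy r v w x \<le> ca * M x * B" if x: "0 \<le> x" "x \<le> s" for x
    proof -
      have "r * x \<le> r * s" using x r by (intro mult_left_mono) auto
      also have "\<dots> = 2 + r * T" using r by (simp add: s_def distrib_left)
      also have "\<dots> \<le> Lc" using r T by (simp add: Lc_def mult_right_mono)
      finally have rx: "r * x \<le> Lc" .
      have "mode_energy r v w x \<le> (12 * exp (4 * K * Lc) * (r0 + Lc)\<^sup>2 * K^5 + 2 * K) * E x * B"
        unfolding B_def E_def
        by (rule mode_low[OF md contb r(1) K[unfolded E_def] x(1) rx]) (use r Lc in auto)
      also have "\<dots> \<le> (12 * exp (4 * K * Lc) * (r0 + Lc)\<^sup>2 * K^5 + 2 * K) * (e0 * M x) * B"
        using EM[OF x(1)] B0 K(1) by (intro mult_right_mono mult_left_mono) auto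
      finally show ?thesis by (simp add: ca_def mult_ac)
    qed
    have "Ca \<ge> ca"
    proof -
      have "1 * 1 \<le> cd * exp (5 * exp S0 * (r0 / \<Theta> 0))"
        using cd1 r0 Theta(1) by (intro mult_mono) auto
      then show ?thesis unfolding Ca_def using ca mult_right_mono[of 1 "cd * exp (5 * exp S0 * (r0 / \<Theta> 0))" ca] by simp
    qed
    show ?thesis
    proof (cases "t \<le> s")
      case True
      have "mode_energy r v w t \<le> ca * M t * B" using lowzone t True by simp
      also have "\<dots> \<le> Ca * M t * B" using \<open>Ca \<ge> ca\<close> M0[of t] B0 by (intro mult_right_mono) auto
      finally show ?thesis by (simp add: B_def)
    next
      case False
      have "mode_energy r v w t \<le> cd * exp (5 * exp S0 * (r / \<Theta> s)) * ca * M t * B"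
        by (rule diss'[OF md r(1) _ s(1,2) lowzone]) (use False s in auto)
      also have "\<dots> \<le> cd * exp (5 * exp S0 * (r0 / \<Theta> 0)) * ca * M t * B"
      proof -
        have "r / \<Theta> s \<le> r0 / \<Theta> 0" using r Theta(1) Theta_mono[of 0 s] s by (intro frac_le) auto
        then have "exp (5 * exp S0 * (r / \<Theta> s)) \<le> exp (5 * exp S0 * (r0 / \<Theta> 0))"
          unfolding exp_le_cancel_iff by (intro mult_left_mono) auto
        then show ?thesis using cd1 ca M0[of t] B0 by (intro mult_right_mono mult_left_mono) auto
      qed
      finally show ?thesis by (simp add: Ca_def B_def)
    qed
  qed

  \<comment> \<open>From \<open>T2\<close> on the dissipative estimate applies to every
    \<open>r > r0\<close> at once; the bounded interval before it is left to the crude energy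
    bound.\<close>
  define T2 where "T2 = T + 2 / r0"
  have T2: "T2 \<ge> T" "T2 \<ge> 0" "T2 \<ge> 2 / r0" using T r0 by (auto simp: T2_def)
  define I2 where "I2 = integral {0..T2} (\<lambda>x. 2 * \<bar>b x\<bar>)"
  have contab: "continuous_on {s..t} (\<lambda>x. 2 * \<bar>b x\<bar>)" if "0 \<le> s" for s t
    by (intro continuous_intros continuous_on_subset[OF contb]) (use that in auto)
  have I2: "integral {0..t} (\<lambda>x. 2 * \<bar>b x\<bar>) \<le> I2" if "0 \<le> t" "t \<le> T2" for t
    unfolding I2_def by (intro integral_subset_le integrable_continuous_real contab) (use that in auto)
  have I20: "I2 \<ge> 0" using I2[of 0] T2 by simp
  \<comment> \<open>The factor 72 comes from WKB. In \<open>exp (2 * I2)\<close>, one factor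
    \<open>exp I2\<close> is the crude growth up to \<open>T2\<close>, the other compensates the
    decay factor, which is at least \<open>exp (- I2)\<close> there.\<close>
  define cb where "cb = max 72 (exp (2 * I2)) * e0"
  have cb: "cb > 0" using e01 by (simp add: cb_def)
  \<comment> \<open>\<open>\<kappa>1\<close> is the loss of the WKB zone and
    \<open>\<kappa>2\<close> that of the dissipative zone, both as multiples of
    \<open>\<rho> r\<close>.\<close>
  define \<kappa>1 where "\<kappa>1 = K1 * C2"
  define \<kappa>2 where "\<kappa>2 = 5 * exp S0 * N"
  have kap: "\<kappa>1 \<ge> 0" "\<kappa>2 > 0" using K1 N by (auto simp: \<kappa>1_def C2_def \<kappa>2_def)
  define Cb where "Cb = cd * cb"
  have high: "mode_energy r v w t \<le> Cb * exp ((\<kappa>1 + \<kappa>2) * \<rho> r) * M t * mode_energy r v w 0"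
    if md: "mode b r v w" and r: "r > r0" and t: "t \<ge> 0" for r v w t
  proof -
    define B where "B = mode_energy r v w 0"
    have B0: "B \<ge> 0" unfolding B_def by (rule mode_energy_nonneg)
    have rpos: "r > 0" using r r0 by simp
    have rhor: "\<rho> r > 0" using rho rpos by simp
    have rN: "0 \<le> r / N" "r / N \<le> r" using rpos N by (auto simp: field_simps mult_le_cancel_left1)
    have early: "mode_energy r v w x \<le> cb * exp (\<kappa>1 * \<rho> r) * M x * B" if x: "0 \<le> x" "x \<le> T2" for x
    proof -
      have "mode_energy r v w x \<le> B * exp (integral {0..x} (\<lambda>x. 2 * \<bar>b x\<bar>))"
        unfolding B_def by (rule mode_energy_crude[OF md contb order_refl x(1)])
      also have "\<dots> \<le> B * exp I2" using I2[OF x] B0 by (intro mult_left_mono) auto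
      also have "\<dots> \<le> B * (exp (2 * I2) * E x)"
      proof -
        have "integral {0..x} b \<le> integral {0..x} (\<lambda>x. 2 * \<bar>b x\<bar>)"
          by (intro integral_le integrable_continuous_real contab continuous_on_subset[OF contb]) auto
        then have "I2 \<le> 2 * I2 + (- integral {0..x} b)" using I2[OF x] by simp
        then have "exp I2 \<le> exp (2 * I2 + (- integral {0..x} b))" by simp
        then show ?thesis using B0 unfolding exp_add E_def by (intro mult_left_mono) auto
      qed
      also have "\<dots> \<le> B * (max 72 (exp (2 * I2)) * (e0 * M x))"
        using EM[OF x(1)] E0[of x] B0 by (intro mult_left_mono mult_mono) auto
      also have "\<dots> = cb * M x * B" by (simp add: cb_def mult_ac)
      also have "\<dots> \<le> cb * M x * B * exp (\<kappa>1 * \<rho> r)"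
      proof -
        have "1 \<le> exp (\<kappa>1 * \<rho> r)" using kap rhor by simp
        then show ?thesis using cb M0[of x] B0 mult_left_mono[of 1 "exp (\<kappa>1 * \<rho> r)" "cb * M x * B"] by simp
      qed
      finally show ?thesis by (simp add: mult_ac)
    qed
    have hypzone: "mode_energy r v w x \<le> cb * exp (\<kappa>1 * \<rho> r) * M x * B" if x: "0 \<le> x" "H x \<le> r / N" for x
    proof -
      have "\<Xi> s \<le> \<epsilon> * r" if "s \<in> {0..x}" for s
      proof -
        have "\<Xi> s \<le> C1 * H s" using C1(1)[of s] that by simp
        also have "\<dots> \<le> C1 * (r / N)" using Hmono[of s x] that x C1(2)[of 0] by (intro mult_left_mono) auto
        also have "\<dots> \<le> (\<epsilon> * N) * (r / N)" using N rN by (intro mult_right_mono) auto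
        also have "\<dots> = \<epsilon> * r" using N by simp
        finally show ?thesis .
      qed
      then have "mode_energy r v w x \<le>
        72 * exp (- integral {0..x} b + K1 / r^m * integral {0..x} (\<lambda>s. \<Xi> s^(m+1))) * B"
        unfolding B_def using hyp rpos x(1) md by simp
      also have "\<dots> \<le> 72 * exp (- integral {0..x} b + \<kappa>1 * \<rho> r) * B"
      proof -
        have "integral {0..x} (\<lambda>s. \<Xi> s^(m+1)) \<le> C2 * (H x ^ m * \<rho> (H x))" by (rule C2[OF x(1)])
        also have "\<dots> \<le> C2 * (r ^ m * \<rho> r)"
          using Hpos[OF x(1)] x rN rpos rho_le[of "H x" r] rho[of "H x"]
          by (intro mult_left_mono mult_mono power_mono) (auto simp: C2_def)
        finally have "K1 / r^m * integral {0..x} (\<lambda>s. \<Xi> s^(m+1)) \<le> K1 / r^m * (C2 * (r ^ m * \<rho> r))"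
          using K1 rpos by (intro mult_left_mono) auto
        also have "\<dots> = \<kappa>1 * \<rho> r" using rpos by (simp add: \<kappa>1_def)
        finally show ?thesis using B0 by (intro mult_right_mono mult_left_mono) auto
      qed
      also have "\<dots> = 72 * exp (\<kappa>1 * \<rho> r) * E x * B" unfolding exp_add E_def by (simp only: mult_ac)
      also have "\<dots> \<le> max 72 (exp (2 * I2)) * exp (\<kappa>1 * \<rho> r) * (e0 * M x) * B"
        using EM[OF x(1)] E0[of x] B0 by (intro mult_mono) auto
      finally show ?thesis by (simp add: cb_def mult_ac)
    qed
    have triv: "cb * exp (\<kappa>1 * \<rho> r) * M t * B \<le> Cb * exp ((\<kappa>1 + \<kappa>2) * \<rho> r) * M t * B"
    proof -
      have "cb \<le> Cb" unfolding Cb_def using cd1 cb by simp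
      moreover have "exp (\<kappa>1 * \<rho> r) \<le> exp ((\<kappa>1 + \<kappa>2) * \<rho> r)" using kap rhor by simp
      ultimately show ?thesis using cb M0[of t] B0 by (intro mult_right_mono mult_mono) auto
    qed
    have "mode_energy r v w t \<le> Cb * exp ((\<kappa>1 + \<kappa>2) * \<rho> r) * M t * B"
    proof (cases "t \<le> T2 \<or> H t \<le> r / N")
      case True
      then have "mode_energy r v w t \<le> cb * exp (\<kappa>1 * \<rho> r) * M t * B" using early hypzone t by blast
      then show ?thesis using triv by simp
    next
      case False
      then have tT: "T2 \<le> t" and Ht: "r / N < H t" by auto
      \<comment> \<open>A switching time is wanted at which an early bound is available and
        \<open>H\<close> has already reached \<open>r / N\<close>. If \<open>H T2\<close> is large
        enough, \<open>T2\<close> serves.\<close>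
      have "\<exists>s. T2 \<le> s \<and> s \<le> t \<and> r / N \<le> H s \<and> mode_energy r v w s \<le> cb * exp (\<kappa>1 * \<rho> r) * M s * B"
      proof (cases "r / N \<le> H T2")
        case True
        then show ?thesis using early[of T2] T2 tT by blast
      next
        case False
        then have "\<Theta> T2 \<le> \<zeta> (r / N)" using H[of T2] T2 zle[of "H T2" "r / N"] rN by simp
        moreover have "\<zeta> (r / N) \<le> \<Theta> t" using H[OF t] Ht zle[of "r / N" "H t"] rN by simp
        \<comment> \<open>The intermediate value theorem is applied to \<open>\<Theta>\<close>,
          whose continuity is given, rather than to \<open>H\<close>; injectivity of
          \<open>\<zeta>\<close> then yields \<open>H s = r / N\<close>.\<close>
        ultimately obtain s where s: "T2 \<le> s" "s \<le> t" "\<Theta> s = \<zeta> (r / N)"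
          using IVT'[of \<Theta> T2 "\<zeta> (r / N)" t] tT continuous_on_subset[OF Theta(3), of "{T2..t}"] T2 by auto
        have "H s = r / N" using H[of s] s T2 zle[of "H s" "r / N"] zle[of "r / N" "H s"] rN by simp
        then show ?thesis using hypzone[of s] s T2 by auto
      qed
      then obtain s where s: "T2 \<le> s" "s \<le> t" "r / N \<le> H s"
        and Qs: "mode_energy r v w s \<le> cb * exp (\<kappa>1 * \<rho> r) * M s * B" by blast
      have "2 / r \<le> 2 / r0" using r r0 by (intro divide_left_mono) auto
      then have s2: "T \<le> s" "2 / r \<le> s" using s T2 by auto
      have "mode_energy r v w t \<le> cd * exp (5 * exp S0 * (r / \<Theta> s)) * (cb * exp (\<kappa>1 * \<rho> r)) * M t * B"
        by (rule diss'[OF md rpos s(2) s2 Qs])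
      also have "\<dots> \<le> cd * exp (\<kappa>2 * \<rho> r) * (cb * exp (\<kappa>1 * \<rho> r)) * M t * B"
      proof -
        have rNp: "0 < r / N" using rpos N by simp
        have "\<zeta> (r / N) \<le> \<Theta> s" using H[of s] s zle[of "r / N" "H s"] rN T2 by simp
        moreover have zp: "\<zeta> (r / N) > 0" using zmono(1)[of 0 "r / N"] rNp z0 by simp
        ultimately have "r / \<Theta> s \<le> r / \<zeta> (r / N)" using rpos by (intro divide_left_mono mult_pos_pos) auto
        also have "\<dots> = N * \<rho> (r / N)" using rpos N by (simp add: zeta)
        also have "\<dots> \<le> N * \<rho> r" using N rho_le[of "r / N" r] rN by (intro mult_left_mono) auto
        finally have "5 * exp S0 * (r / \<Theta> s) \<le> 5 * exp S0 * (N * \<rho> r)" by (intro mult_left_mono) auto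
        then have "exp (5 * exp S0 * (r / \<Theta> s)) \<le> exp (\<kappa>2 * \<rho> r)"
          unfolding exp_le_cancel_iff \<kappa>2_def by (simp only: mult.assoc)
        then show ?thesis using cd1 cb M0[of t] B0 by (intro mult_right_mono mult_left_mono) auto
      qed
      also have "\<dots> = Cb * exp ((\<kappa>1 + \<kappa>2) * \<rho> r) * M t * B"
        unfolding Cb_def distrib_right exp_add by (simp only: mult_ac)
      finally show ?thesis .
    qed
    then show ?thesis by (simp add: B_def)
  qed

  define C where "C = Ca + Cb"
  have Ca0: "Ca > 0" unfolding Ca_def using cd1 ca by simp
  have Cb0: "Cb > 0" unfolding Cb_def using cd1 cb by simp
  \<comment> \<open>The data norm carries \<open>exp (2 * \<kappa> * \<rho>)\<close>, so
    \<open>\<kappa>0\<close> is half of the total loss.\<close>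
  have "mode_energy r v w t \<le> C * exp (2 * ((\<kappa>1 + \<kappa>2) / 2) * \<rho> r) * exp (- integral {0..t} \<mu>) * ((1 + r\<^sup>2) * (v 0)\<^sup>2 + (w 0)\<^sup>2)"
    if r: "r > 0" and md: "mode b r v w" and t: "t \<ge> 0" for r v w t
  proof -
    define B where "B = (1 + r\<^sup>2) * (v 0)\<^sup>2 + (w 0)\<^sup>2"
    have B: "(v 0)\<^sup>2 + (w 0)\<^sup>2 \<le> B" "mode_energy r v w 0 \<le> B" "B \<ge> 0"
      by (auto simp: B_def mode_energy_def algebra_simps)
    have rr: "\<rho> r > 0" using rho r by simp
    have "mode_energy r v w t \<le> C * exp ((\<kappa>1 + \<kappa>2) * \<rho> r) * M t * B"
    proof (cases "r \<le> r0")
      case True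
      have "mode_energy r v w t \<le> Ca * M t * ((v 0)\<^sup>2 + (w 0)\<^sup>2)" by (rule low[OF md r True t])
      also have "\<dots> \<le> C * M t * B" unfolding C_def
        using Ca0 Cb0 M0[of t] B by (intro mult_mono) auto
      also have "\<dots> \<le> C * M t * B * exp ((\<kappa>1 + \<kappa>2) * \<rho> r)"
      proof -
        have "1 \<le> exp ((\<kappa>1 + \<kappa>2) * \<rho> r)" using kap rr by simp
        moreover have "C * M t * B \<ge> 0" unfolding C_def using Ca0 Cb0 M0[of t] B by (intro mult_nonneg_nonneg) auto
        ultimately show ?thesis using mult_left_mono[of 1 "exp ((\<kappa>1 + \<kappa>2) * \<rho> r)" "C * M t * B"] by simp
      qed
      finally show ?thesis by (simp add: mult_ac)
    next
      case False
      then have "mode_energy r v w t \<le> Cb * exp ((\<kappa>1 + \<kappa>2) * \<rho> r) * M t * mode_energy r v w 0"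
        by (intro high md t) simp
      also have "\<dots> \<le> C * exp ((\<kappa>1 + \<kappa>2) * \<rho> r) * M t * B" unfolding C_def
        using Ca0 Cb0 M0[of t] B by (intro mult_mono mode_energy_nonneg) auto
      finally show ?thesis .
    qed
    moreover have "2 * ((\<kappa>1 + \<kappa>2) / 2) * \<rho> r = (\<kappa>1 + \<kappa>2) * \<rho> r" by simp
    ultimately show ?thesis unfolding M_def B_def by (simp only:)
  qed
  moreover have "C > 0" "(\<kappa>1 + \<kappa>2) / 2 > 0" using Ca0 Cb0 kap by (auto simp: C_def)
  ultimately show ?thesis by blast
qed

section \<open>Square integrable functions\<close>

text \<open>With values in \<open>ennreal\<close>, the inequalities below hold without
  integrability, and \<open>L2_tendsto\<close> is convergence of this quantity to 0.\<close>

definition L2sq :: "(real^'n \<Rightarrow> 'b::euclidean_space) \<Rightarrow> ennreal" where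
  "L2sq f = (\<integral>\<^sup>+x. ennreal ((norm (f x))\<^sup>2) \<partial>lborel)"

lemma L2_tendsto_L2sq: "L2_tendsto F g X \<longleftrightarrow> ((\<lambda>i. L2sq (\<lambda>x. F i x - g x)) \<longlongrightarrow> 0) X"
  by (simp add: L2_tendsto_def L2sq_def)

lemma in_L2_L2sq: "in_L2 f \<longleftrightarrow> f \<in> borel_measurable lborel \<and> L2sq f < \<infinity>"
  unfolding in_L2_def L2sq_def integrable_iff_bounded by auto

lemma in_L2_measurable [measurable_dest]: "in_L2 f \<Longrightarrow> f \<in> borel_measurable borel"
  by (simp add: in_L2_def)

lemma in_L2_integrable: "in_L2 f \<Longrightarrow> integrable lborel (\<lambda>x. (norm (f x))\<^sup>2)"
  by (simp add: in_L2_def)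

lemma L2_norm_sq: "(L2_norm f)\<^sup>2 = (\<integral>x. (norm (f x))\<^sup>2 \<partial>lborel)"
  by (simp add: L2_norm_def)

lemma L2_norm_nonneg: "L2_norm f \<ge> 0"
  by (simp add: L2_norm_def)

lemma L2sq_eq: "in_L2 f \<Longrightarrow> L2sq f = ennreal ((L2_norm f)\<^sup>2)"
  unfolding L2sq_def L2_norm_sq by (intro nn_integral_eq_integral in_L2_integrable) auto

lemma L2_norm_eq: "(L2_norm f)\<^sup>2 = enn2real (L2sq f)" if "f \<in> borel_measurable borel"
  unfolding L2_norm_sq L2sq_def by (rule integral_eq_nn_integral) (use that in auto)

lemma L2sq_cong_AE: "AE x in lborel. f x = g x \<Longrightarrow> L2sq f = L2sq g"
  unfolding L2sq_def by (intro nn_integral_cong_AE) auto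

lemma L2sq_mono: "(\<And>x. norm (f x) \<le> norm (g x)) \<Longrightarrow> L2sq f \<le> L2sq g"
  unfolding L2sq_def by (intro nn_integral_mono ennreal_leI power_mono) auto

lemma L2sq_minus_commute: "L2sq (\<lambda>x. f x - g x) = L2sq (\<lambda>x. g x - f x)"
  by (simp add: L2sq_def norm_minus_commute)

lemma norm_add_sq_le: "(norm (x + y))\<^sup>2 \<le> 2 * (norm x)\<^sup>2 + 2 * (norm y)\<^sup>2"
  for x y :: "'b::real_normed_vector"
proof -
  have "(norm (x + y))\<^sup>2 \<le> (norm x + norm y)\<^sup>2" by (intro power_mono norm_triangle_ineq) auto
  also have "\<dots> \<le> 2 * (norm x)\<^sup>2 + 2 * (norm y)\<^sup>2"
    using sum_squares_bound[of "norm x" "norm y"] by (simp add: power2_sum)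
  finally show ?thesis .
qed

text \<open>The factor 2 in place of Minkowski's inequality is harmless for the uses made of it:
  finiteness, crude bounds and limits equal to 0.\<close>

lemma L2sq_add_le:
  assumes [measurable]: "f \<in> borel_measurable borel" "g \<in> borel_measurable borel"
  shows "L2sq (\<lambda>x. f x + g x) \<le> 2 * L2sq f + 2 * L2sq g"
proof -
  have "L2sq (\<lambda>x. f x + g x) \<le> (\<integral>\<^sup>+x. 2 * ennreal ((norm (f x))\<^sup>2) + 2 * ennreal ((norm (g x))\<^sup>2) \<partial>lborel)"
    unfolding L2sq_def
  proof (rule nn_integral_mono)
    fix x
    have "ennreal ((norm (f x + g x))\<^sup>2) \<le> ennreal (2 * (norm (f x))\<^sup>2 + 2 * (norm (g x))\<^sup>2)"
      by (intro ennreal_leI norm_add_sq_le)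
    then show "ennreal ((norm (f x + g x))\<^sup>2) \<le> 2 * ennreal ((norm (f x))\<^sup>2) + 2 * ennreal ((norm (g x))\<^sup>2)"
      by (simp add: ennreal_plus ennreal_mult)
  qed
  also have "\<dots> = 2 * L2sq f + 2 * L2sq g"
    unfolding L2sq_def by (simp add: nn_integral_add nn_integral_cmult)
  finally show ?thesis .
qed

lemma L2sq_diff_le:
  assumes [measurable]: "f \<in> borel_measurable borel" "g \<in> borel_measurable borel" "h \<in> borel_measurable borel"
  shows "L2sq (\<lambda>x. f x - h x) \<le> 2 * L2sq (\<lambda>x. f x - g x) + 2 * L2sq (\<lambda>x. g x - h x)"
  using L2sq_add_le[of "\<lambda>x. f x - g x" "\<lambda>x. g x - h x"] by simp

lemma in_L2_add: "in_L2 f \<Longrightarrow> in_L2 g \<Longrightarrow> in_L2 (\<lambda>x. f x + g x)"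
  using L2sq_add_le[of f g] unfolding in_L2_L2sq
  by (auto simp: ennreal_mult_less_top less_top[symmetric] ennreal_add_eq_top ennreal_mult_eq_top_iff top_unique)

lemma in_L2_dominated:
  assumes "in_L2 g" "f \<in> borel_measurable borel" "\<And>x. norm (f x) \<le> norm (g x)"
  shows "in_L2 f"
  using assms L2sq_mono[of f g] unfolding in_L2_L2sq by (auto intro: le_less_trans)

lemma in_L2_cmult:
  fixes f :: "real^'n \<Rightarrow> complex"
  assumes "in_L2 f"
  shows "in_L2 (\<lambda>x. c * f x)"
  using assms unfolding in_L2_def by (auto simp: power_mult_distrib norm_mult)

lemma in_L2_minus: "in_L2 f \<Longrightarrow> in_L2 (\<lambda>x. - f x)"
  unfolding in_L2_def by auto

lemma in_L2_diff: "in_L2 f \<Longrightarrow> in_L2 g \<Longrightarrow> in_L2 (\<lambda>x. f x - g x)"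
  using in_L2_add[OF _ in_L2_minus, of f g] by simp

lemma in_L2_cnj: "in_L2 f \<Longrightarrow> in_L2 (\<lambda>x. cnj (f x))"
  unfolding in_L2_def by (auto simp: borel_measurable_continuous_on[OF continuous_on_cnj[OF continuous_on_id]])

lemma in_L2_mult_bounded:
  fixes f g :: "real^'n \<Rightarrow> complex"
  assumes f: "in_L2 f" and [measurable]: "g \<in> borel_measurable borel" and b: "\<And>x. norm (g x) \<le> B"
  shows "in_L2 (\<lambda>x. g x * f x)"
proof (rule in_L2_dominated[OF in_L2_cmult[OF f, of "of_real B"]])
  note [measurable] = in_L2_measurable[OF f]
  show "(\<lambda>x. g x * f x) \<in> borel_measurable borel" by measurable
  have "B \<ge> 0" using b[of 0] norm_ge_zero order_trans by blast
  then show "norm (g x * f x) \<le> norm (of_real B * f x)" for x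
    using b[of x] by (simp add: norm_mult mult_right_mono)
qed

lemma integrable_mult_L2:
  fixes f g :: "real^'n \<Rightarrow> complex"
  assumes "in_L2 f" "in_L2 g"
  shows "integrable lborel (\<lambda>x. f x * g x)"
proof (rule Bochner_Integration.integrable_bound)
  note [measurable] = in_L2_measurable[OF assms(1)] in_L2_measurable[OF assms(2)]
  show "integrable lborel (\<lambda>x. (norm (f x))\<^sup>2 + (norm (g x))\<^sup>2)"
    using assms by (intro Bochner_Integration.integrable_add in_L2_integrable)
  show "(\<lambda>x. f x * g x) \<in> borel_measurable lborel" by measurable
  have "norm (f x * g x) \<le> (norm (f x))\<^sup>2 + (norm (g x))\<^sup>2" for x
  proof -
    have "0 \<le> norm (f x) * norm (g x)" by simp
    then show ?thesis using sum_squares_bound[of "norm (f x)" "norm (g x)"] unfolding norm_mult by linarith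
  qed
  then show "AE x in lborel. norm (f x * g x) \<le> norm ((norm (f x))\<^sup>2 + (norm (g x))\<^sup>2)"
    by (auto intro: order_trans)
qed

lemma integrable_inner_L2:
  "in_L2 f \<Longrightarrow> in_L2 g \<Longrightarrow> integrable lborel (\<lambda>x. f x * cnj (g x))"
  by (rule integrable_mult_L2[OF _ in_L2_cnj])

lemma L2_Cauchy_Schwarz:
  fixes f g :: "real^'n \<Rightarrow> complex"
  assumes f: "in_L2 f" and g: "in_L2 g"
  shows "norm (\<integral>x. f x * g x \<partial>lborel) \<le> L2_norm f * L2_norm g"
proof -
  define A where "A = (\<integral>x. (norm (f x))\<^sup>2 \<partial>lborel)"
  define B where "B = (\<integral>x. (norm (g x))\<^sup>2 \<partial>lborel)"
  define C where "C = (\<integral>x. norm (f x) * norm (g x) \<partial>lborel)"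
  have iC: "integrable lborel (\<lambda>x. norm (f x) * norm (g x))"
    using integrable_norm[OF integrable_mult_L2[OF f g]] by (simp add: norm_mult)
  have C0: "C \<ge> 0" unfolding C_def by (intro Bochner_Integration.integral_nonneg) auto
  have A0: "A \<ge> 0" and B0: "B \<ge> 0" unfolding A_def B_def by (intro Bochner_Integration.integral_nonneg; simp)+
  \<comment> \<open>The discriminant argument, applied to the moduli of \<open>f\<close> and
    \<open>g\<close>.\<close>
  have key: "0 \<le> s\<^sup>2 * A - 2 * s * C + B" for s
  proof -
    have "0 \<le> (\<integral>x. (s * norm (f x) - norm (g x))\<^sup>2 \<partial>lborel)" by (intro Bochner_Integration.integral_nonneg) auto
    also have "\<dots> = (\<integral>x. s\<^sup>2 * (norm (f x))\<^sup>2 - 2 * s * (norm (f x) * norm (g x)) + (norm (g x))\<^sup>2 \<partial>lborel)"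
      by (intro Bochner_Integration.integral_cong) (auto simp: power2_diff power_mult_distrib)
    also have "\<dots> = s\<^sup>2 * A - 2 * s * C + B"
      unfolding A_def B_def C_def using in_L2_integrable[OF f] in_L2_integrable[OF g] iC by simp
    finally show ?thesis .
  qed
  have "C\<^sup>2 \<le> A * B"
  proof (cases "A = 0")
    case True
    have "C = 0"
    proof (rule ccontr)
      assume "C \<noteq> 0"
      \<comment> \<open>When \<open>A = 0\<close> the polynomial is linear in \<open>s\<close>; this
        choice of \<open>s\<close> makes it equal to -1.\<close>
      then show False using key[of "(B + 1) / (2 * C)"] True by simp
    qed
    then show ?thesis using True by simp
  next
    case False
    then have "A > 0" using A0 by simp
    then show ?thesis using key[of "C / A"] by (simp add: field_simps power2_eq_square)
  qed
  then have "C \<le> sqrt (A * B)" by (rule real_le_rsqrt)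
  then have "C \<le> L2_norm f * L2_norm g" by (simp add: L2_norm_def A_def B_def real_sqrt_mult)
  moreover have "norm (\<integral>x. f x * g x \<partial>lborel) \<le> C"
    using integral_norm_bound[of lborel "\<lambda>x. f x * g x"] by (simp add: C_def norm_mult)
  ultimately show ?thesis by simp
qed

lemma L2_norm_cnj: "L2_norm (\<lambda>x. cnj (f x)) = L2_norm f"
  by (simp add: L2_norm_def)

lemma L2_inner_bound: "in_L2 f \<Longrightarrow> in_L2 g \<Longrightarrow> norm (L2_inner f g) \<le> L2_norm f * L2_norm g"
  unfolding L2_inner_def using L2_Cauchy_Schwarz[OF _ in_L2_cnj, of f g] by (simp add: L2_norm_cnj)

lemma L2_inner_self: "in_L2 f \<Longrightarrow> L2_inner f f = of_real ((L2_norm f)\<^sup>2)"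
proof -
  assume f: "in_L2 f"
  have "L2_inner f f = (\<integral>x. of_real ((norm (f x))\<^sup>2) \<partial>lborel)"
    unfolding L2_inner_def complex_norm_square[symmetric] by (rule refl)
  then show ?thesis unfolding L2_norm_sq by (simp only: integral_complex_of_real)
qed

lemma L2_inner_diff_left:
  "in_L2 f \<Longrightarrow> in_L2 g \<Longrightarrow> in_L2 h \<Longrightarrow> L2_inner (\<lambda>x. f x - g x) h = L2_inner f h - L2_inner g h"
  unfolding L2_inner_def left_diff_distrib
  by (intro Bochner_Integration.integral_diff integrable_inner_L2)

lemma L2_inner_diff_right:
  "in_L2 f \<Longrightarrow> in_L2 g \<Longrightarrow> in_L2 h \<Longrightarrow> L2_inner h (\<lambda>x. f x - g x) = L2_inner h f - L2_inner h g"
  unfolding L2_inner_def complex_cnj_diff right_diff_distrib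
  by (intro Bochner_Integration.integral_diff integrable_inner_L2)

lemma L2_tendsto_norm:
  assumes "L2_tendsto F f X" "eventually (\<lambda>i. in_L2 (F i)) X" "in_L2 f"
  shows "((\<lambda>i. L2_norm (\<lambda>x. F i x - f x)) \<longlongrightarrow> 0) X"
proof -
  have 1: "((\<lambda>i. enn2real (L2sq (\<lambda>x. F i x - f x))) \<longlongrightarrow> enn2real 0) X"
    using assms(1) unfolding L2_tendsto_L2sq by (intro tendsto_enn2real) auto
  have 2: "eventually (\<lambda>i. enn2real (L2sq (\<lambda>x. F i x - f x)) = (L2_norm (\<lambda>x. F i x - f x))\<^sup>2) X"
    using assms(2) by eventually_elim (use assms(3) in \<open>simp add: L2_norm_eq in_L2_measurable in_L2_diff\<close>)
  have "((\<lambda>i. (L2_norm (\<lambda>x. F i x - f x))\<^sup>2) \<longlongrightarrow> 0) X"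
    using Lim_transform_eventually[OF 1 2] by simp
  then have "((\<lambda>i. sqrt ((L2_norm (\<lambda>x. F i x - f x))\<^sup>2)) \<longlongrightarrow> sqrt 0) X" by (intro tendsto_intros)
  then show ?thesis by (simp add: L2_norm_nonneg)
qed

lemma L2_tendsto_inner:
  assumes F: "L2_tendsto F f X" "eventually (\<lambda>i. in_L2 (F i)) X" "in_L2 f"
    and G: "L2_tendsto G g X" "eventually (\<lambda>i. in_L2 (G i)) X" "in_L2 g"
  shows "((\<lambda>i. L2_inner (F i) (G i)) \<longlongrightarrow> L2_inner f g) X"
proof -
  note nF = L2_tendsto_norm[OF F] and nG = L2_tendsto_norm[OF G]
  have "((\<lambda>i. L2_inner (F i) (G i) - L2_inner f g) \<longlongrightarrow> 0) X"
  proof (rule Lim_null_comparison)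
    show "((\<lambda>i. L2_norm (\<lambda>x. F i x - f x) * L2_norm (\<lambda>x. G i x - g x)
       + L2_norm (\<lambda>x. F i x - f x) * L2_norm g + L2_norm f * L2_norm (\<lambda>x. G i x - g x)) \<longlongrightarrow> 0) X"
      by (rule tendsto_eq_intros nF nG refl | simp)+
    show "eventually (\<lambda>i. norm (L2_inner (F i) (G i) - L2_inner f g) \<le> L2_norm (\<lambda>x. F i x - f x) * L2_norm (\<lambda>x. G i x - g x)
       + L2_norm (\<lambda>x. F i x - f x) * L2_norm g + L2_norm f * L2_norm (\<lambda>x. G i x - g x)) X"
      using F(2) G(2)
    proof eventually_elim
      case (elim i)
      have dF: "in_L2 (\<lambda>x. F i x - f x)" and dG: "in_L2 (\<lambda>x. G i x - g x)"
        using elim F(3) G(3) by (auto intro: in_L2_diff)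
      have eq: "L2_inner (F i) (G i) - L2_inner f g = L2_inner (\<lambda>x. F i x - f x) (\<lambda>x. G i x - g x)
          + L2_inner (\<lambda>x. F i x - f x) g + L2_inner f (\<lambda>x. G i x - g x)"
        using elim F(3) G(3) dG dF by (simp add: L2_inner_diff_left L2_inner_diff_right)
      have tri: "norm (x + y + z) \<le> a + b + c" if "norm x \<le> a" "norm y \<le> b" "norm z \<le> c" for x y z :: complex and a b c
        using that norm_triangle_ineq[of "x + y" z] norm_triangle_ineq[of x y] by linarith
      show ?case unfolding eq
        by (rule tri[OF L2_inner_bound[OF dF dG] L2_inner_bound[OF dF G(3)] L2_inner_bound[OF F(3) dG]])
    qed
  qed
  then show ?thesis by (simp add: LIM_zero_iff)
qed

lemma L2_tendsto_const: "L2_tendsto (\<lambda>_. f) f X"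
  by (simp add: L2_tendsto_def)

lemma L2_tendsto_unique:
  fixes F :: "'i \<Rightarrow> real^'n \<Rightarrow> 'b::euclidean_space"
  assumes "L2_tendsto F f X" "L2_tendsto F g X" "X \<noteq> bot"
    and m: "eventually (\<lambda>i. F i \<in> borel_measurable borel) X"
    and [measurable]: "f \<in> borel_measurable borel" "g \<in> borel_measurable borel"
  shows "AE x in lborel. f x = g x"
proof -
  have "((\<lambda>i. 2 * L2sq (\<lambda>x. F i x - f x) + 2 * L2sq (\<lambda>x. F i x - g x)) \<longlongrightarrow> 2 * 0 + 2 * 0) X"
    using assms(1,2) unfolding L2_tendsto_L2sq
    by (intro tendsto_add ennreal_tendsto_cmult) auto
  moreover have "eventually (\<lambda>i. L2sq (\<lambda>x. f x - g x) \<le> 2 * L2sq (\<lambda>x. F i x - f x) + 2 * L2sq (\<lambda>x. F i x - g x)) X"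
    using m
  proof eventually_elim
    case (elim i)
    then show ?case using L2sq_diff_le[of f "F i" g] by (simp add: L2sq_minus_commute[of f])
  qed
  ultimately have "L2sq (\<lambda>x. f x - g x) \<le> 2 * 0 + 2 * 0"
    using assms(3) by (intro tendsto_lowerbound)
  then have "(\<integral>\<^sup>+x. ennreal ((norm (f x - g x))\<^sup>2) \<partial>lborel) = 0" by (simp add: L2sq_def)
  then have "AE x in lborel. ennreal ((norm (f x - g x))\<^sup>2) = 0"
    by (subst (asm) nn_integral_0_iff_AE) auto
  then show ?thesis by eventually_elim (simp add: ennreal_eq_0_iff)
qed

lemma L2_tendsto_dominated:
  fixes F :: "nat \<Rightarrow> real^'n \<Rightarrow> 'b::euclidean_space"
  assumes [measurable]: "\<And>n. F n \<in> borel_measurable borel" "f \<in> borel_measurable borel"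
    and h: "in_L2 h" and dom: "\<And>n x. norm (F n x) \<le> norm (h x)"
    and lim: "AE x in lborel. (\<lambda>n. F n x) \<longlonglongrightarrow> f x"
  shows "L2_tendsto F f sequentially"
proof -
  note [measurable] = in_L2_measurable[OF h]
  have "(\<lambda>n. \<integral>\<^sup>+x. ennreal ((norm (F n x - f x))\<^sup>2) \<partial>lborel) \<longlonglongrightarrow> (\<integral>\<^sup>+x. 0 \<partial>(lborel :: (real^'n) measure))"
  proof (rule nn_integral_dominated_convergence[where w = "\<lambda>x. ennreal (4 * (norm (h x))\<^sup>2)"])
    show "AE x in lborel. (\<lambda>n. ennreal ((norm (F n x - f x))\<^sup>2)) \<longlonglongrightarrow> 0"
      using lim
    proof eventually_elim
      case (elim x)
      have "(\<lambda>n. (norm (F n x - f x))\<^sup>2) \<longlonglongrightarrow> (norm (f x - f x))\<^sup>2" by (intro tendsto_intros elim)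
      then show ?case using tendsto_ennrealI by fastforce
    qed
    show "AE x in lborel. ennreal ((norm (F n x - f x))\<^sup>2) \<le> ennreal (4 * (norm (h x))\<^sup>2)" for n
      using lim
    proof eventually_elim
      case (elim x)
      have "norm (f x) \<le> norm (h x)"
        by (rule tendsto_upperbound[OF tendsto_norm[OF elim]]) (auto simp: dom)
      then have "norm (F n x - f x) \<le> 2 * norm (h x)" using dom[of n x] norm_triangle_ineq4[of "F n x" "f x"] by linarith
      then have "(norm (F n x - f x))\<^sup>2 \<le> (2 * norm (h x))\<^sup>2" by (intro power_mono) auto
      then show ?case by (intro ennreal_leI) (simp add: power_mult_distrib)
    qed
    show "(\<integral>\<^sup>+x. ennreal (4 * (norm (h x))\<^sup>2) \<partial>lborel) < \<infinity>"
      using h unfolding in_L2_L2sq L2sq_def by (simp add: ennreal_mult nn_integral_cmult ennreal_mult_less_top)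
  qed auto
  then show ?thesis by (simp add: L2_tendsto_def)
qed

section \<open>Affine changes of variables\<close>

lemma lborel_integral_affine:
  fixes f :: "'a::euclidean_space \<Rightarrow> 'b::{banach,second_countable_topology}"
  assumes [measurable]: "f \<in> borel_measurable borel" and c: "c \<noteq> 0"
  shows "(\<integral>x. f x \<partial>lborel) = \<bar>c\<bar>^DIM('a) *\<^sub>R (\<integral>x. f (t + c *\<^sub>R x) \<partial>lborel)"
  by (subst lborel_affine[OF c, of t]) (simp add: integral_density integral_distr)

lemma lborel_nn_integral_affine:
  fixes f :: "'a::euclidean_space \<Rightarrow> ennreal"
  assumes [measurable]: "f \<in> borel_measurable borel" and c: "c \<noteq> 0"
  shows "(\<integral>\<^sup>+x. f x \<partial>lborel) = ennreal (\<bar>c\<bar>^DIM('a)) * (\<integral>\<^sup>+x. f (t + c *\<^sub>R x) \<partial>lborel)"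
  by (subst lborel_affine[OF c, of t]) (simp add: nn_integral_density nn_integral_distr nn_integral_cmult)

lemma lborel_integrable_affine:
  fixes f :: "'a::euclidean_space \<Rightarrow> 'b::{banach,second_countable_topology}"
  assumes "integrable lborel f" and c: "c \<noteq> 0"
  shows "integrable lborel (\<lambda>x. f (t + c *\<^sub>R x))"
proof -
  have [measurable]: "f \<in> borel_measurable borel" using assms(1) by auto
  have "(\<integral>\<^sup>+x. ennreal (norm (f x)) \<partial>lborel) < \<infinity>" using assms(1) unfolding integrable_iff_bounded by simp
  then have "(\<integral>\<^sup>+x. ennreal (norm (f (t + c *\<^sub>R x))) \<partial>lborel) < \<infinity>"
    using c by (subst (asm) lborel_nn_integral_affine[OF _ c, of _ t])
      (auto simp: ennreal_mult_less_top ennreal_mult_eq_top_iff less_top[symmetric])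
  then show ?thesis unfolding integrable_iff_bounded by simp
qed

lemma lborel_integral_translate:
  fixes f :: "'a::euclidean_space \<Rightarrow> 'b::{banach,second_countable_topology}"
  assumes "f \<in> borel_measurable borel"
  shows "(\<integral>x. f (x + z) \<partial>lborel) = (\<integral>x. f x \<partial>lborel)"
  using lborel_integral_affine[OF assms, of 1 z] by (simp add: add.commute)

lemma lborel_integral_reflect:
  fixes f :: "'a::euclidean_space \<Rightarrow> 'b::{banach,second_countable_topology}"
  assumes "f \<in> borel_measurable borel"
  shows "(\<integral>x. f (- x) \<partial>lborel) = (\<integral>x. f x \<partial>lborel)"
  using lborel_integral_affine[OF assms, of "-1" 0] by simp

lemma L2sq_translate:
  fixes f :: "real^'n \<Rightarrow> 'b::euclidean_space"
  assumes [measurable]: "f \<in> borel_measurable borel"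
  shows "L2sq (\<lambda>x. f (x + z)) = L2sq f"
  using lborel_nn_integral_affine[of "\<lambda>x. ennreal ((norm (f x))\<^sup>2)" 1 z] by (simp add: L2sq_def add.commute)

lemma L2sq_reflect:
  fixes f :: "real^'n \<Rightarrow> 'b::euclidean_space"
  assumes [measurable]: "f \<in> borel_measurable borel"
  shows "L2sq (\<lambda>x. f (- x)) = L2sq f"
  using lborel_nn_integral_affine[of "\<lambda>x. ennreal ((norm (f x))\<^sup>2)" "-1" 0] by (simp add: L2sq_def)

lemma in_L2_translate:
  fixes f :: "real^'n \<Rightarrow> 'b::euclidean_space"
  shows "in_L2 f \<Longrightarrow> in_L2 (\<lambda>x. f (x + z))"
  unfolding in_L2_L2sq by (auto simp: L2sq_translate)

lemma in_L2_reflect: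
  fixes f :: "real^'n \<Rightarrow> 'b::euclidean_space"
  shows "in_L2 f \<Longrightarrow> in_L2 (\<lambda>x. f (- x))"
  unfolding in_L2_L2sq by (auto simp: L2sq_reflect)

text \<open>The increments are so small that the sum of \<open>4^k\<close> times their squared
  moduli still has an integral of at most \<open>\<Sum>k. (1/2)^k\<close>. It is therefore finite
  almost everywhere, and there the increments are bounded by a geometric sequence of ratio
  1/2.\<close>

lemma L2_subseq_limit:
  fixes F :: "nat \<Rightarrow> real^'n \<Rightarrow> complex"
  assumes m: "\<And>k. F k \<in> borel_measurable borel"
    and small: "\<And>k. L2sq (\<lambda>x. F (Suc k) x - F k x) \<le> ennreal ((1/8)^k)"
  shows "AE x in lborel. convergent (\<lambda>k. F k x)"
proof -
  note [measurable] = m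
  define d where "d k x = F (Suc k) x - F k x" for k x
  have [measurable]: "d k \<in> borel_measurable borel" for k unfolding d_def by measurable
  define S where "S x = (\<Sum>k. ennreal (4^k * (norm (d k x))\<^sup>2))" for x
  have "(\<integral>\<^sup>+x. S x \<partial>lborel) = (\<Sum>k. \<integral>\<^sup>+x. ennreal (4^k * (norm (d k x))\<^sup>2) \<partial>lborel)"
    unfolding S_def by (rule nn_integral_suminf) measurable
  also have "\<dots> \<le> (\<Sum>k. ennreal ((1/2)^k))"
  proof (rule suminf_le)
    fix k
    have "(\<integral>\<^sup>+x. ennreal (4^k * (norm (d k x))\<^sup>2) \<partial>lborel) = ennreal (4^k) * L2sq (d k)"
      unfolding L2sq_def by (simp add: ennreal_mult nn_integral_cmult)
    also have "\<dots> \<le> ennreal (4^k) * ennreal ((1/8)^k)"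
      unfolding d_def by (intro mult_left_mono small) auto
    also have "\<dots> = ennreal ((1/2)^k)"
      by (simp add: ennreal_mult[symmetric] power_mult_distrib[symmetric])
    finally show "(\<integral>\<^sup>+x. ennreal (4^k * (norm (d k x))\<^sup>2) \<partial>lborel) \<le> ennreal ((1/2)^k)" .
  qed auto
  also have "\<dots> = ennreal (\<Sum>k. (1/2)^k)" by (rule suminf_ennreal2) (auto intro: summable_geometric)
  also have "\<dots> < \<infinity>" by simp
  finally have "AE x in lborel. S x \<noteq> \<infinity>" unfolding S_def
    by (intro nn_integral_noteq_infinite) auto
  then show ?thesis
  proof eventually_elim
    case (elim x)
    define C where "C = enn2real (S x)"
    have dk: "norm (d k x) \<le> sqrt C * (1/2)^k" for k
    proof -
      define f where "f k = ennreal (4^k * (norm (d k x))\<^sup>2)" for k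
      have "sum f {k} \<le> suminf f" by (rule sum_le_suminf) auto
      then have "ennreal (4^k * (norm (d k x))\<^sup>2) \<le> S x" by (simp add: S_def f_def[abs_def])
      also have "S x = ennreal C" using elim by (simp add: C_def less_top)
      finally have "4^k * (norm (d k x))\<^sup>2 \<le> C" by (subst (asm) ennreal_le_iff) (auto simp: C_def)
      then have "sqrt (4^k * (norm (d k x))\<^sup>2) \<le> sqrt C" by simp
      moreover have "sqrt (4^k) = (2::real)^k"
        using real_sqrt_power[of 4 k] by simp
      ultimately show ?thesis by (simp add: real_sqrt_mult power_one_over field_simps)
    qed
    have "summable (\<lambda>k. d k x)"
      by (rule summable_comparison_test[OF _ summable_mult[OF summable_geometric[of "1/2::real"], of "sqrt C"]])
        (use dk in auto)
    then have "convergent (\<lambda>k. \<Sum>j<k. d j x)" by (simp add: summable_iff_convergent)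
    moreover have "(\<Sum>j<k. d j x) = F k x - F 0 x" for k
      using sum_lessThan_telescope[of "\<lambda>j. F j x" k] by (simp add: d_def)
    ultimately have "convergent (\<lambda>k. F k x - F 0 x)" by simp
    then show ?case using convergent_add[OF _ convergent_const[of "F 0 x"], of "\<lambda>k. F k x - F 0 x"] by simp
  qed
qed

text \<open>Riesz-Fischer: a rapidly converging subsequence has a pointwise limit almost everywhere,
  and Fatou's lemma along it carries the Cauchy estimate over to that limit.\<close>

lemma L2_complete:
  fixes F :: "nat \<Rightarrow> real^'n \<Rightarrow> complex"
  assumes inL2: "\<And>n. in_L2 (F n)"
    and Cauchy: "\<And>e. e > 0 \<Longrightarrow> \<exists>N. \<forall>m\<ge>N. \<forall>n\<ge>N. L2sq (\<lambda>x. F m x - F n x) \<le> ennreal e"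
  shows "\<exists>g. in_L2 g \<and> L2_tendsto F g sequentially"
proof -
  note [measurable] = in_L2_measurable[OF inL2]
  have "\<forall>k. \<exists>N. \<forall>m\<ge>N. \<forall>n\<ge>N. L2sq (\<lambda>x. F m x - F n x) \<le> ennreal ((1/8)^k)" using Cauchy by simp
  then obtain N where N: "\<And>k m n. N k \<le> m \<Longrightarrow> N k \<le> n \<Longrightarrow> L2sq (\<lambda>x. F m x - F n x) \<le> ennreal ((1/8)^k)"
    by metis
  \<comment> \<open>A sum of thresholds lies above each of them, which gives nested thresholds
    without choosing a strictly increasing subsequence.\<close>
  define r where "r k = (\<Sum>j\<le>k. N j)" for k
  have r: "N j \<le> r k" if "j \<le> k" for j k unfolding r_def using that by (intro member_le_sum) auto
  have conv: "AE x in lborel. convergent (\<lambda>k. F (r k) x)"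
    by (rule L2_subseq_limit) (auto intro!: N r)
  \<comment> \<open>\<open>lim\<close> gives a Borel function on the whole space; its arbitrary
    values where the sequence diverges concern a null set only.\<close>
  define g where "g x = lim (\<lambda>k. F (r k) x)" for x
  have [measurable]: "g \<in> borel_measurable borel" unfolding g_def by (rule borel_measurable_lim_metric) simp
  have bound: "L2sq (\<lambda>x. F m x - g x) \<le> ennreal ((1/8)^j)" if "m \<ge> N j" for m j
  proof -
    have "L2sq (\<lambda>x. F m x - g x) = (\<integral>\<^sup>+x. liminf (\<lambda>k. ennreal ((norm (F m x - F (r k) x))\<^sup>2)) \<partial>lborel)"
      unfolding L2sq_def
    proof (rule nn_integral_cong_AE)
      show "AE x in lborel. ennreal ((norm (F m x - g x))\<^sup>2) = liminf (\<lambda>k. ennreal ((norm (F m x - F (r k) x))\<^sup>2))"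
        using conv
      proof eventually_elim
        case (elim x)
        then have "(\<lambda>k. F (r k) x) \<longlonglongrightarrow> g x" unfolding g_def by (simp add: convergent_LIMSEQ_iff)
        then have "(\<lambda>k. ennreal ((norm (F m x - F (r k) x))\<^sup>2)) \<longlonglongrightarrow> ennreal ((norm (F m x - g x))\<^sup>2)"
          by (intro tendsto_intros)
        then show ?case by (intro lim_imp_Liminf[symmetric]) auto
      qed
    qed
    also have "\<dots> \<le> liminf (\<lambda>k. \<integral>\<^sup>+x. ennreal ((norm (F m x - F (r k) x))\<^sup>2) \<partial>lborel)"
      by (rule nn_integral_liminf) measurable
    also have "\<dots> \<le> liminf (\<lambda>k. ennreal ((1/8)^j))"
      using N[OF that r] unfolding L2sq_def
      by (intro Liminf_mono eventually_sequentiallyI[of j]) auto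
    finally show ?thesis by (simp add: Liminf_const)
  qed
  have "L2_tendsto F g sequentially"
    unfolding L2_tendsto_L2sq
  proof (rule order_tendstoI)
    fix a :: ennreal assume "0 < a"
    moreover have "(\<lambda>j. ennreal ((1/8)^j)) \<longlonglongrightarrow> ennreal 0" by (intro tendsto_ennrealI LIMSEQ_realpow_zero) auto
    ultimately have "eventually (\<lambda>j. ennreal ((1/8)^j) < a) sequentially" by (intro order_tendstoD) auto
    then obtain j where "ennreal ((1/8)^j) < a" by (auto simp: eventually_sequentially)
    then show "eventually (\<lambda>m. L2sq (\<lambda>x. F m x - g x) < a) sequentially"
      using bound by (intro eventually_sequentiallyI[of "N j"]) (meson le_less_trans)
  qed auto
  moreover have "in_L2 g"
  proof -
    have "L2sq (\<lambda>x. F (N 0) x - g x) < \<infinity>" using bound[of 0 "N 0"] by (auto intro: le_less_trans)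
    then have "in_L2 (\<lambda>x. F (N 0) x - g x)" unfolding in_L2_L2sq by simp
    from in_L2_diff[OF inL2[of "N 0"] this] show ?thesis by simp
  qed
  ultimately show ?thesis by blast
qed

text \<open>The limit is taken along the integers; the Cauchy condition in the real parameter
  extends the convergence to all values.\<close>

lemma L2_complete_at_top:
  fixes F :: "real \<Rightarrow> real^'n \<Rightarrow> complex"
  assumes inL2: "\<And>R. in_L2 (F R)"
    and Cauchy: "\<And>e. e > 0 \<Longrightarrow> \<exists>N. \<forall>R\<ge>N. \<forall>S\<ge>N. L2sq (\<lambda>x. F R x - F S x) \<le> ennreal e"
  shows "\<exists>g. in_L2 g \<and> L2_tendsto F g at_top"
proof -
  note [measurable] = in_L2_measurable[OF inL2]
  have "\<exists>g. in_L2 g \<and> L2_tendsto (\<lambda>n. F (real n)) g sequentially"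
  proof (rule L2_complete[OF inL2])
    fix e :: real assume "e > 0"
    then obtain N where "\<forall>R\<ge>N. \<forall>S\<ge>N. L2sq (\<lambda>x. F R x - F S x) \<le> ennreal e" using Cauchy by blast
    then show "\<exists>N. \<forall>m\<ge>N. \<forall>n\<ge>N. L2sq (\<lambda>x. F (real m) x - F (real n) x) \<le> ennreal e"
      by (intro exI[of _ "nat \<lceil>N\<rceil>"]) (simp add: nat_le_iff ceiling_le_iff)
  qed
  then obtain g where g: "in_L2 g" and lim: "L2_tendsto (\<lambda>n. F (real n)) g sequentially" by blast
  note [measurable] = in_L2_measurable[OF g]
  have "L2_tendsto F g at_top" unfolding L2_tendsto_L2sq
  proof (rule order_tendstoI)
    fix a :: ennreal assume "0 < a"
    then obtain e where e: "e > 0" "ennreal e < a"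
      by (metis dense ennreal_cases ennreal_less_zero_iff less_top_ennreal top.not_eq_extremum less_trans)
    obtain N where N: "\<And>R S. R \<ge> N \<Longrightarrow> S \<ge> N \<Longrightarrow> L2sq (\<lambda>x. F R x - F S x) \<le> ennreal (e / 2)" using Cauchy[of "e/2"] e by auto
    have "L2sq (\<lambda>x. F R x - g x) \<le> ennreal e" if R: "R \<ge> N" for R
    proof -
      have "((\<lambda>n. ennreal e + 2 * L2sq (\<lambda>x. F (real n) x - g x)) \<longlonglongrightarrow> ennreal e + 2 * 0)"
        using lim unfolding L2_tendsto_L2sq by (intro tendsto_add tendsto_const ennreal_tendsto_cmult) auto
      moreover have "eventually (\<lambda>n. L2sq (\<lambda>x. F R x - g x) \<le> ennreal e + 2 * L2sq (\<lambda>x. F (real n) x - g x)) sequentially"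
      proof (rule eventually_sequentiallyI)
        fix n assume "nat \<lceil>N\<rceil> \<le> n"
        then have n: "real n \<ge> N" by (simp add: nat_le_iff ceiling_le_iff)
        have "L2sq (\<lambda>x. F R x - g x) \<le> 2 * L2sq (\<lambda>x. F R x - F (real n) x) + 2 * L2sq (\<lambda>x. F (real n) x - g x)"
          by (rule L2sq_diff_le) measurable
        also have "2 * L2sq (\<lambda>x. F R x - F (real n) x) \<le> 2 * ennreal (e / 2)"
          by (intro mult_left_mono N R n) auto
        also have "2 * ennreal (e / 2) = ennreal e" using ennreal_mult[of 2 "e/2"] e by simp
        finally show "L2sq (\<lambda>x. F R x - g x) \<le> ennreal e + 2 * L2sq (\<lambda>x. F (real n) x - g x)"
          by (simp add: add_right_mono)
      qed
      ultimately have "L2sq (\<lambda>x. F R x - g x) \<le> ennreal e + 2 * 0" by (intro tendsto_lowerbound) auto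
      then show ?thesis by simp
    qed
    then show "eventually (\<lambda>R. L2sq (\<lambda>x. F R x - g x) < a) at_top"
      using e by (auto simp: eventually_at_top_linorder intro!: exI[of _ N] intro: le_less_trans)
  qed auto
  then show ?thesis using g by blast
qed

text \<open>The truncation that occurs in the definition of \<open>fourier\<close>, named so that
  its measurability and integrability can be stated.\<close>

definition trunc :: "real \<Rightarrow> (real^'n \<Rightarrow> complex) \<Rightarrow> real^'n \<Rightarrow> complex" where
  "trunc R f x = indicator (cball 0 R) x *\<^sub>R f x"

lemma trunc_measurable [measurable]: "f \<in> borel_measurable borel \<Longrightarrow> trunc R f \<in> borel_measurable borel"
  unfolding trunc_def by (intro borel_measurable_scaleR borel_measurable_indicator borel_closed) auto

lemma norm_trunc_le: "norm (trunc R f x) \<le> norm (f x)"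
  by (simp add: trunc_def indicator_def)

lemma in_L2_trunc: "in_L2 f \<Longrightarrow> in_L2 (trunc R f)"
  by (rule in_L2_dominated[OF _ _ norm_trunc_le]) auto

lemma in_L2_indicator: "in_L2 (\<lambda>x. indicator (cball 0 R) x *\<^sub>R (1::complex) :: complex)"
proof -
  have "integrable lborel (indicator (cball 0 R :: (real^'n) set) :: _ \<Rightarrow> real)"
    using emeasure_lborel_cball_finite[of "0 :: real^'n" R] by (intro integrable_real_indicator) auto
  moreover have eq: "(norm (indicator (cball 0 R) x *\<^sub>R (1::complex)))\<^sup>2 = indicator (cball 0 R) x" for x :: "real^'n"
    by (simp add: indicator_def)
  moreover have "(\<lambda>x. indicator (cball 0 R) x *\<^sub>R (1::complex)) \<in> borel_measurable lborel"
    by (intro borel_measurable_scaleR borel_measurable_indicator) auto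
  ultimately show ?thesis unfolding in_L2_def eq by blast
qed

lemma integrable_trunc: "in_L2 f \<Longrightarrow> integrable lborel (trunc R f)"
  using integrable_mult_L2[OF in_L2_indicator[of R], of f] by (simp add: trunc_def[abs_def])

lemma trunc_tendsto:
  fixes f :: "real^'n \<Rightarrow> complex"
  assumes f: "in_L2 f"
  shows "L2_tendsto (\<lambda>R. trunc R f) f at_top"
  unfolding L2_tendsto_L2sq
proof (rule tendsto_at_topI_sequentially)
  fix X :: "nat \<Rightarrow> real" assume X: "filterlim X at_top sequentially"
  have "L2_tendsto (\<lambda>n. trunc (X n) f) f sequentially"
  proof (rule L2_tendsto_dominated[where h = f])
    show "in_L2 f" by (rule f)
    show "norm (trunc (X n) f x) \<le> norm (f x)" for n and x :: "real^'n" by (rule norm_trunc_le)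
    show "AE x in lborel. (\<lambda>n. trunc (X n) f x) \<longlonglongrightarrow> f x"
    proof (rule AE_I2)
      fix x :: "real^'n"
      have "eventually (\<lambda>n. norm x \<le> X n) sequentially" using X by (simp add: filterlim_at_top)
      then have "eventually (\<lambda>n. f x = trunc (X n) f x) sequentially"
        by eventually_elim (simp add: trunc_def)
      then show "(\<lambda>n. trunc (X n) f x) \<longlonglongrightarrow> f x" by (rule Lim_transform_eventually[OF tendsto_const])
    qed
  qed (use in_L2_measurable[OF f] in measurable)
  then show "(\<lambda>n. L2sq (\<lambda>x. trunc (X n) f x - f x)) \<longlonglongrightarrow> 0" by (simp add: L2_tendsto_L2sq)
qed

lemma L2_tendsto_Cauchy:
  fixes F :: "real \<Rightarrow> real^'n \<Rightarrow> complex"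
  assumes F: "L2_tendsto F f at_top" "\<And>R. in_L2 (F R)" "in_L2 f" and e: "e > 0"
  shows "\<exists>N. \<forall>R\<ge>N. \<forall>S\<ge>N. L2sq (\<lambda>x. F R x - F S x) \<le> ennreal e"
proof -
  have "eventually (\<lambda>R. L2sq (\<lambda>x. F R x - f x) < ennreal (e / 4)) at_top"
    using F(1) e unfolding L2_tendsto_L2sq by (intro order_tendstoD) auto
  then obtain N where N: "\<And>R. R \<ge> N \<Longrightarrow> L2sq (\<lambda>x. F R x - f x) < ennreal (e / 4)"
    by (auto simp: eventually_at_top_linorder)
  have "L2sq (\<lambda>x. F R x - F S x) \<le> ennreal e" if "R \<ge> N" "S \<ge> N" for R S
  proof -
    have "L2sq (\<lambda>x. F R x - F S x) \<le> 2 * L2sq (\<lambda>x. F R x - f x) + 2 * L2sq (\<lambda>x. f x - F S x)"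
      by (intro L2sq_diff_le in_L2_measurable F)
    also have "\<dots> \<le> 2 * ennreal (e / 4) + 2 * ennreal (e / 4)"
      using N[OF that(1)] N[OF that(2)] L2sq_minus_commute[of f "F S"]
      by (intro add_mono mult_left_mono) auto
    also have "2 * ennreal (e / 4) = ennreal (e / 2)" using ennreal_mult[of 2 "e/4"] e by simp
    also have "ennreal (e / 2) + ennreal (e / 2) = ennreal e" using ennreal_plus[of "e/2" "e/2"] e by simp
    finally show ?thesis .
  qed
  then show ?thesis by blast
qed

section \<open>The Fourier transform and Plancherel's theorem\<close>

lemma integral_gaussian_exp_real:
  fixes s :: real
  shows "(\<integral>x. exp (- \<i> * of_real (x * s)) * of_real (exp (- (x\<^sup>2) / 2)) \<partial>lborel) = of_real (sqrt (2 * pi) * exp (- (s\<^sup>2) / 2))"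
    and "integrable lborel (\<lambda>x. exp (- \<i> * of_real (x * s)) * complex_of_real (exp (- (x\<^sup>2) / 2)))"
proof -
  have "integrable lborel (\<lambda>x. exp (- x\<^sup>2 / 2) :: real)"
  proof -
    have "integrable lborel (\<lambda>x. sqrt (2 * pi) * std_normal_density x)"
      using integrable_normal_density[of 1 0] by (intro integrable_mult_right) simp
    then show ?thesis by (simp add: std_normal_density_def)
  qed
  then show i: "integrable lborel (\<lambda>x. exp (- \<i> * of_real (x * s)) * complex_of_real (exp (- (x\<^sup>2) / 2)))"
    by (rule Bochner_Integration.integrable_bound) (auto simp: norm_mult)
  \<comment> \<open>The integral is read off from the characteristic function of the standard normal
    law, evaluated at \<open>- s\<close>.\<close>
  have "of_real (exp (- ((- s)\<^sup>2) / 2)) = char std_normal_distribution (- s)"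
    by (simp add: char_std_normal_distribution)
  also have "\<dots> = (\<integral>x. std_normal_density x *\<^sub>R iexp (- s * x) \<partial>lborel)"
    unfolding char_def by (subst integral_density) auto
  also have "\<dots> = (\<integral>x. of_real (1 / sqrt (2 * pi)) * (exp (- \<i> * of_real (x * s)) * of_real (exp (- (x\<^sup>2) / 2))) \<partial>lborel)"
    by (intro Bochner_Integration.integral_cong) (auto simp: std_normal_density_def scaleR_conv_of_real mult_ac)
  also have "\<dots> = of_real (1 / sqrt (2 * pi)) * (\<integral>x. exp (- \<i> * of_real (x * s)) * of_real (exp (- (x\<^sup>2) / 2)) \<partial>lborel)"
    by simp
  finally have e: "of_real (exp (- ((- s)\<^sup>2) / 2)) = of_real (1 / sqrt (2 * pi)) * (\<integral>x. exp (- \<i> * of_real (x * s)) * complex_of_real (exp (- (x\<^sup>2) / 2)) \<partial>lborel)" .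
  have "of_real (sqrt (2 * pi) * exp (- (s\<^sup>2) / 2)) = of_real (sqrt (2 * pi)) * (of_real (exp (- ((- s)\<^sup>2) / 2)) :: complex)" by simp
  also have "\<dots> = (of_real (sqrt (2 * pi)) * of_real (1 / sqrt (2 * pi))) * (\<integral>x. exp (- \<i> * of_real (x * s)) * complex_of_real (exp (- (x\<^sup>2) / 2)) \<partial>lborel)"
    unfolding e by (simp only: mult.assoc)
  also have "of_real (sqrt (2 * pi)) * of_real (1 / sqrt (2 * pi)) = (1::complex)"
    by (simp flip: of_real_mult)
  finally show "(\<integral>x. exp (- \<i> * of_real (x * s)) * of_real (exp (- (x\<^sup>2) / 2)) \<partial>lborel) = of_real (sqrt (2 * pi) * exp (- (s\<^sup>2) / 2))"
    by simp
qed

text \<open>\<open>lborel\<close> is the image of the product of one-dimensional measures under the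
  coordinate map, so a product of functions of single coordinates integrates factor by
  factor.\<close>

lemma lborel_integral_prod_Basis:
  fixes f :: "'a::euclidean_space \<Rightarrow> real \<Rightarrow> complex"
  assumes "\<And>b. b \<in> Basis \<Longrightarrow> integrable lborel (f b)"
  shows "integrable lborel (\<lambda>x::'a. \<Prod>b\<in>Basis. f b (x \<bullet> b))"
    and "(\<integral>x. (\<Prod>b\<in>Basis. f b ((x::'a) \<bullet> b)) \<partial>lborel) = (\<Prod>b\<in>Basis. \<integral>x. f b x \<partial>lborel)"
proof -
  interpret P: product_sigma_finite "\<lambda>_::'a. lborel :: real measure"
    by standard
  have [measurable]: "(\<lambda>x. f b (x \<bullet> b)) \<in> borel_measurable borel" if "b \<in> Basis" for b
  proof -
    have [measurable]: "f b \<in> borel_measurable borel" using assms[OF that] by auto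
    show ?thesis by measurable
  qed
  have [measurable]: "(\<lambda>x::'a. \<Prod>b\<in>Basis. f b (x \<bullet> b)) \<in> borel_measurable borel"
    by (rule borel_measurable_prod) simp
  have T: "(\<lambda>f. \<Sum>b\<in>Basis. f b *\<^sub>R b) \<in> measurable (Pi\<^sub>M Basis (\<lambda>_::'a. lborel)) borel" by measurable
  have eq: "(\<Prod>b\<in>Basis. f b ((\<Sum>b'\<in>Basis. y b' *\<^sub>R b') \<bullet> b)) = (\<Prod>b\<in>Basis. f b (y b))" for y
    by (intro prod.cong) (auto simp: inner_sum_left_Basis)
  show "integrable lborel (\<lambda>x::'a. \<Prod>b\<in>Basis. f b (x \<bullet> b))"
    by (subst lborel_eq, subst integrable_distr_eq[OF T]) (auto simp: eq intro!: P.product_integrable_prod assms)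
  show "(\<integral>x. (\<Prod>b\<in>Basis. f b ((x::'a) \<bullet> b)) \<partial>lborel) = (\<Prod>b\<in>Basis. \<integral>x. f b x \<partial>lborel)"
    by (subst lborel_eq, subst integral_distr[OF T]) (auto simp: eq intro!: P.product_integral_prod assms)
qed

lemma integral_gaussian_exp:
  fixes z :: "real^'n"
  shows "(\<integral>x. exp (- \<i> * of_real (x \<bullet> z)) * of_real (exp (- (norm x)\<^sup>2 / 2)) \<partial>lborel)
     = of_real ((2 * pi) powr (real CARD('n) / 2) * exp (- (norm z)\<^sup>2 / 2))"
    and "integrable lborel (\<lambda>x. exp (- \<i> * of_real (x \<bullet> z)) * complex_of_real (exp (- (norm x)\<^sup>2 / 2)))"
proof -
  have eq: "(\<Prod>b\<in>Basis. exp (- \<i> * of_real ((x \<bullet> b) * (z \<bullet> b))) * of_real (exp (- ((x \<bullet> b)\<^sup>2) / 2)))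
     = exp (- \<i> * of_real (x \<bullet> z)) * complex_of_real (exp (- (norm x)\<^sup>2 / 2))" for x :: "real^'n"
  proof -
    have "(\<Prod>b\<in>Basis. exp (- \<i> * of_real ((x \<bullet> b) * (z \<bullet> b)))) = exp (- \<i> * of_real (x \<bullet> z))"
      by (subst euclidean_inner[of x z]) (simp add: sum_distrib_left exp_sum)
    moreover have "(\<Prod>b\<in>Basis. exp (- ((x \<bullet> b)\<^sup>2) / 2)) = exp (- (norm x)\<^sup>2 / 2)"
    proof -
      have "(norm x)\<^sup>2 = (\<Sum>b\<in>Basis. (x \<bullet> b)\<^sup>2)"
        unfolding power2_norm_eq_inner euclidean_inner[of x x] by (simp add: power2_eq_square)
      then show ?thesis by (simp add: sum_divide_distrib sum_negf[symmetric] exp_sum)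
    qed
    ultimately show ?thesis by (simp only: prod.distrib of_real_prod[symmetric])
  qed
  note P = lborel_integral_prod_Basis[of "\<lambda>b x. exp (- \<i> * of_real (x * (z \<bullet> b))) * of_real (exp (- (x\<^sup>2) / 2))"]
  show "integrable lborel (\<lambda>x. exp (- \<i> * of_real (x \<bullet> z)) * complex_of_real (exp (- (norm x)\<^sup>2 / 2)))"
    using P(1)[OF integral_gaussian_exp_real(2)] unfolding eq .
  have "(\<integral>x. exp (- \<i> * of_real (x \<bullet> z)) * of_real (exp (- (norm x)\<^sup>2 / 2)) \<partial>lborel)
    = (\<Prod>b\<in>(Basis::(real^'n) set). of_real (sqrt (2 * pi) * exp (- ((z \<bullet> b)\<^sup>2) / 2)))"
    using P(2)[OF integral_gaussian_exp_real(2)] unfolding eq integral_gaussian_exp_real(1) .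
  also have "\<dots> = of_real ((sqrt (2 * pi)) ^ CARD('n) * exp (- (norm z)\<^sup>2 / 2))"
  proof -
    have "(norm z)\<^sup>2 = (\<Sum>b\<in>Basis. (z \<bullet> b)\<^sup>2)"
      unfolding power2_norm_eq_inner euclidean_inner[of z z] by (simp add: power2_eq_square)
    then have "(\<Prod>b\<in>(Basis::(real^'n) set). exp (- ((z \<bullet> b)\<^sup>2) / 2)) = exp (- (norm z)\<^sup>2 / 2)"
      by (simp add: sum_divide_distrib sum_negf[symmetric] exp_sum)
    moreover have "(\<Prod>b\<in>(Basis::(real^'n) set). sqrt (2 * pi)) = sqrt (2 * pi) ^ CARD('n)" by simp
    ultimately show ?thesis by (simp only: prod.distrib of_real_prod[symmetric])
  qed
  also have "sqrt (2 * pi) ^ CARD('n) = (2 * pi) powr (real CARD('n) / 2)"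
    by (simp add: powr_half_sqrt[symmetric] powr_realpow[symmetric] powr_powr)
  finally show "(\<integral>x. exp (- \<i> * of_real (x \<bullet> z)) * of_real (exp (- (norm x)\<^sup>2 / 2)) \<partial>lborel)
     = of_real ((2 * pi) powr (real CARD('n) / 2) * exp (- (norm z)\<^sup>2 / 2))" .
qed

lemma integrable_gaussian:
  assumes "e > 0"
  shows "integrable lborel (\<lambda>x::real^'n. exp (- (e * norm x)\<^sup>2 / 2))"
proof -
  have "integrable lborel (\<lambda>x::real^'n. exp (- (norm x)\<^sup>2 / 2))"
    using integrable_norm[OF integral_gaussian_exp(2)[of "0::real^'n"]] by (simp add: norm_mult)
  from lborel_integrable_affine[OF this, of e 0] show ?thesis using assms by simp
qed

lemma integral_gaussian_exp_scaled:
  fixes z :: "real^'n"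
  assumes e: "e > 0"
  shows "(\<integral>x. exp (- \<i> * of_real (x \<bullet> z)) * of_real (exp (- (e * norm x)\<^sup>2 / 2)) \<partial>lborel)
     = of_real ((2 * pi) powr (real CARD('n) / 2) * exp (- (norm z / e)\<^sup>2 / 2) / e ^ CARD('n))"
proof -
  let ?f = "\<lambda>y::real^'n. exp (- \<i> * of_real (y \<bullet> (z /\<^sub>R e))) * complex_of_real (exp (- (norm y)\<^sup>2 / 2))"
  have "(\<integral>x. ?f x \<partial>lborel) = \<bar>e\<bar>^DIM(real^'n) *\<^sub>R (\<integral>x. ?f (0 + e *\<^sub>R x) \<partial>lborel)"
    by (rule lborel_integral_affine) (use e in \<open>auto\<close>)
  also have "(\<lambda>x. ?f (0 + e *\<^sub>R x)) = (\<lambda>x. exp (- \<i> * of_real (x \<bullet> z)) * of_real (exp (- (e * norm x)\<^sup>2 / 2)))"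
  proof (rule ext)
    fix x
    have "(0 + e *\<^sub>R x) \<bullet> (z /\<^sub>R e) = x \<bullet> z" "norm (0 + e *\<^sub>R x) = e * norm x" using e by simp_all
    then show "?f (0 + e *\<^sub>R x) = exp (- \<i> * of_real (x \<bullet> z)) * of_real (exp (- (e * norm x)\<^sup>2 / 2))" by (simp only:)
  qed
  finally have "of_real ((2 * pi) powr (real CARD('n) / 2) * exp (- (norm (z /\<^sub>R e))\<^sup>2 / 2)) =
     of_real (e ^ CARD('n)) * (\<integral>x. exp (- \<i> * of_real (x \<bullet> z)) * complex_of_real (exp (- (e * norm x)\<^sup>2 / 2)) \<partial>lborel)"
    unfolding integral_gaussian_exp(1) using e by (simp add: scaleR_conv_of_real)
  moreover have "norm (z /\<^sub>R e) = norm z / e" using e by (simp add: divide_inverse mult.commute)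
  ultimately show ?thesis using e by (simp add: field_simps)
qed

section \<open>The Fourier integral of integrable functions\<close>

lemma integrable_modulated:
  fixes f :: "real^'n \<Rightarrow> complex"
  assumes "integrable lborel f"
  shows "integrable lborel (\<lambda>x. exp (- \<i> * of_real (x \<bullet> \<xi>)) * f x)"
proof -
  note [measurable] = borel_measurable_integrable[OF assms]
  show ?thesis using assms by (rule Bochner_Integration.integrable_bound) (auto simp: norm_mult)
qed

lemma fourier_integral_diff:
  fixes f g :: "real^'n \<Rightarrow> complex"
  assumes "integrable lborel f" "integrable lborel g"
  shows "fourier_integral (\<lambda>x. f x - g x) \<xi> = fourier_integral f \<xi> - fourier_integral g \<xi>"
  unfolding fourier_integral_def
  using integrable_modulated[OF assms(1), of \<xi>] integrable_modulated[OF assms(2), of \<xi>]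
  by (simp add: right_diff_distrib)

lemma fourier_integral_bound:
  fixes f :: "real^'n \<Rightarrow> complex"
  shows "norm (fourier_integral f \<xi>) \<le> (2 * pi) powr (- (real CARD('n) / 2)) * (\<integral>x. norm (f x) \<partial>lborel)"
proof -
  have "norm (\<integral>x. exp (- \<i> * of_real (x \<bullet> \<xi>)) * f x \<partial>lborel) \<le> (\<integral>x. norm (exp (- \<i> * of_real (x \<bullet> \<xi>)) * f x) \<partial>lborel)"
    by (rule integral_norm_bound)
  also have "\<dots> = (\<integral>x. norm (f x) \<partial>lborel)" by (simp add: norm_mult)
  finally show ?thesis unfolding fourier_integral_def by (simp add: norm_mult mult_left_mono)
qed

lemma fourier_integral_measurable [measurable]:
  fixes f :: "real^'n \<Rightarrow> complex"
  assumes [measurable]: "f \<in> borel_measurable borel"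
  shows "fourier_integral f \<in> borel_measurable borel"
proof -
  have "(\<lambda>\<xi>. \<integral>x. exp (- \<i> * of_real (x \<bullet> \<xi>)) * f x \<partial>lborel) \<in> borel_measurable lborel"
    by (rule lborel.borel_measurable_lebesgue_integral) (simp add: case_prod_unfold)
  then show ?thesis unfolding fourier_integral_def[abs_def] by measurable
qed

lemma integrable_pair_kernel:
  fixes f g :: "real^'n \<Rightarrow> complex"
  assumes f: "integrable lborel f" and g: "integrable lborel g"
    and k [measurable]: "(\<lambda>(x, y). k x y) \<in> borel_measurable (lborel \<Otimes>\<^sub>M lborel)"
    and k1: "\<And>x y. norm (k x y :: complex) \<le> 1"
  shows "integrable (lborel \<Otimes>\<^sub>M lborel) (\<lambda>(x, y). k x y * (f x * g y))"
proof -
  note [measurable] = borel_measurable_integrable[OF f] borel_measurable_integrable[OF g]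
  have "integrable (lborel \<Otimes>\<^sub>M lborel) (\<lambda>(x, y). f x * g y)"
  proof (rule lborel_pair.Fubini_integrable)
    show "(\<lambda>(x, y). f x * g y) \<in> borel_measurable (lborel \<Otimes>\<^sub>M lborel)" by measurable
    show "integrable lborel (\<lambda>x. \<integral>y. norm (case (x, y) of (x, y) \<Rightarrow> f x * g y) \<partial>lborel)"
      using f by (simp add: norm_mult integrable_norm)
    show "AE x in lborel. integrable lborel (\<lambda>y. case (x, y) of (x, y) \<Rightarrow> f x * g y)"
      using g by simp
  qed
  then show ?thesis
  proof (rule Bochner_Integration.integrable_bound)
    show "(\<lambda>(x, y). k x y * (f x * g y)) \<in> borel_measurable (lborel \<Otimes>\<^sub>M lborel)"
    proof -
      have "(\<lambda>p. (case p of (x, y) \<Rightarrow> k x y) * (f (fst p) * g (snd p))) \<in> borel_measurable (lborel \<Otimes>\<^sub>M lborel)"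
        by measurable
      then show ?thesis by (simp add: case_prod_unfold)
    qed
    show "AE p in lborel \<Otimes>\<^sub>M lborel. norm (case p of (x, y) \<Rightarrow> k x y * (f x * g y)) \<le> norm (case p of (x, y) \<Rightarrow> f x * g y)"
      using k1 by (auto simp: norm_mult mult_left_le_one_le)
  qed
qed

text \<open>Fubini for a kernel symmetric in the two variables. Plancherel's identity, inversion and
  the weak gradients of inverse transforms all rest on it.\<close>

lemma fourier_integral_multiplication:
  fixes f g :: "real^'n \<Rightarrow> complex"
  assumes f: "integrable lborel f" and g: "integrable lborel g"
  shows "(\<integral>\<xi>. fourier_integral f \<xi> * g \<xi> \<partial>lborel) = (\<integral>x. f x * fourier_integral g x \<partial>lborel)"
proof -
  define c :: complex where "c = of_real ((2 * pi) powr (- (real CARD('n) / 2)))"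
  define k :: "real^'n \<Rightarrow> real^'n \<Rightarrow> complex" where "k x y = exp (- \<i> * of_real (x \<bullet> y))" for x y
  have km: "(\<lambda>(x, y). k x y) \<in> borel_measurable (lborel \<Otimes>\<^sub>M lborel)"
    unfolding k_def case_prod_unfold by measurable
  have "integrable (lborel \<Otimes>\<^sub>M lborel) (\<lambda>(x, y). k x y * (f x * g y))"
    by (rule integrable_pair_kernel[OF f g km]) (simp add: k_def)
  from lborel_pair.Fubini_integral[OF this]
  have "(\<integral>y. (\<integral>x. k x y * (f x * g y) \<partial>lborel) \<partial>lborel) = (\<integral>x. (\<integral>y. k x y * (f x * g y) \<partial>lborel) \<partial>lborel)" .
  moreover have "(\<integral>x. k x y * (f x * g y) \<partial>lborel) = (\<integral>x. k x y * f x \<partial>lborel) * g y" for y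
    by (simp add: mult.assoc[symmetric])
  moreover have "(\<integral>y. k x y * (f x * g y) \<partial>lborel) = f x * (\<integral>y. k x y * g y \<partial>lborel)" for x
    by (simp add: mult.left_commute)
  ultimately have "(\<integral>y. (\<integral>x. k x y * f x \<partial>lborel) * g y \<partial>lborel) = (\<integral>x. f x * (\<integral>y. k x y * g y \<partial>lborel) \<partial>lborel)" by simp
  then have "c * (\<integral>y. (\<integral>x. k x y * f x \<partial>lborel) * g y \<partial>lborel) = c * (\<integral>x. f x * (\<integral>y. k x y * g y \<partial>lborel) \<partial>lborel)" by simp
  then have "(\<integral>y. c * ((\<integral>x. k x y * f x \<partial>lborel) * g y) \<partial>lborel) = (\<integral>x. c * (f x * (\<integral>y. k x y * g y \<partial>lborel)) \<partial>lborel)"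
    by (simp only: integral_mult_right_zero)
  then show ?thesis unfolding fourier_integral_def c_def[symmetric]
    by (simp add: k_def inner_commute mult_ac)
qed

text \<open>Openness gives convergence of the translated indicator at the points of
  \<open>U\<close>, and this suffices: \<open>U\<close> and its translates have the same measure, so
  the symmetric difference is controlled by the measure of the intersection alone.\<close>

lemma translation_indicator_open:
  fixes U :: "'a::euclidean_space set"
  assumes U: "open U" "emeasure lborel U < \<infinity>" and z: "z \<longlonglongrightarrow> 0"
  shows "(\<lambda>n. \<integral>x. \<bar>indicator U (x + z n) - indicator U x\<bar> \<partial>lborel) \<longlonglongrightarrow> (0::real)"
proof -
  have [measurable]: "U \<in> sets borel" using U by simp
  have iU: "integrable lborel (indicator U :: 'a \<Rightarrow> real)" using U by (intro integrable_real_indicator) auto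
  have iUz: "integrable lborel (\<lambda>x. indicator U (x + z n) :: real)" for n
    using lborel_integrable_affine[OF iU, of 1 "z n"] by (simp add: add.commute)
  have lim: "(\<lambda>n. \<integral>x. indicator U x * indicator U (x + z n) \<partial>lborel) \<longlonglongrightarrow> (\<integral>x. indicator U x \<partial>lborel :: real)"
  proof (rule integral_dominated_convergence[where w = "indicator U"])
    show "AE x in lborel. (\<lambda>n. indicator U x * indicator U (x + z n)) \<longlonglongrightarrow> (indicator U x :: real)"
    proof (rule AE_I2)
      fix x :: 'a
      show "(\<lambda>n. indicator U x * indicator U (x + z n)) \<longlonglongrightarrow> (indicator U x :: real)"
      proof (cases "x \<in> U")
        case True
        have "(\<lambda>n. x + z n) \<longlonglongrightarrow> x + 0" by (intro tendsto_intros z)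
        then have "eventually (\<lambda>n. x + z n \<in> U) sequentially" using U(1) True by (auto dest: topological_tendstoD)
        then have "eventually (\<lambda>n. indicator U x = (indicator U x * indicator U (x + z n) :: real)) sequentially"
          by eventually_elim (simp add: True)
        then show ?thesis by (rule Lim_transform_eventually[OF tendsto_const])
      qed simp
    qed
    show "AE x in lborel. norm (indicator U x * indicator U (x + z n) :: real) \<le> indicator U x" for n
      by (auto simp: indicator_def)
    show "(\<lambda>x. indicator U x * indicator U (x + z n) :: real) \<in> borel_measurable lborel" for n by measurable
  qed (use iU in auto)
  have eq: "(\<integral>x. \<bar>indicator U (x + z n) - indicator U x\<bar> \<partial>lborel)
      = 2 * (\<integral>x. indicator U x \<partial>lborel) - 2 * (\<integral>x. indicator U x * indicator U (x + z n) \<partial>lborel :: real)" for n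
  proof -
    have i2: "integrable lborel (\<lambda>x. indicator U x * indicator U (x + z n) :: real)"
      by (rule Bochner_Integration.integrable_bound[OF iU]) (auto simp: indicator_def)
    have "(\<integral>x. \<bar>indicator U (x + z n) - indicator U x\<bar> \<partial>lborel)
      = (\<integral>x. (indicator U (x + z n) + indicator U x - 2 * (indicator U x * indicator U (x + z n)) :: real) \<partial>lborel)"
      by (intro Bochner_Integration.integral_cong) (auto simp: indicator_def)
    also have "\<dots> = (\<integral>x. indicator U (x + z n) \<partial>lborel) + (\<integral>x. indicator U x \<partial>lborel) - 2 * (\<integral>x. indicator U x * indicator U (x + z n) \<partial>lborel)"
      using iU iUz[of n] i2 by simp
    also have "(\<integral>x. indicator U (x + z n) \<partial>lborel) = (\<integral>x. indicator U x \<partial>lborel :: real)"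
      by (rule lborel_integral_translate) auto
    finally show ?thesis by simp
  qed
  have "(\<lambda>n. 2 * (\<integral>x. indicator U x \<partial>lborel) - 2 * (\<integral>x. indicator U x * indicator U (x + z n) \<partial>lborel :: real)) \<longlonglongrightarrow> 2 * (\<integral>x. indicator U x \<partial>lborel) - 2 * (\<integral>x. indicator U x \<partial>lborel)"
    by (intro tendsto_intros lim)
  then show ?thesis unfolding eq by simp
qed

lemma translation_approx:
  fixes f g :: "'a::euclidean_space \<Rightarrow> 'b::{banach,second_countable_topology}"
  assumes f: "integrable lborel f" and g: "integrable lborel g"
  shows "(\<integral>x. norm (f (x + z) - f x) \<partial>lborel) \<le> 2 * (\<integral>x. norm (f x - g x) \<partial>lborel) + (\<integral>x. norm (g (x + z) - g x) \<partial>lborel)"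
proof -
  have tr: "integrable lborel (\<lambda>x. h (x + z))" if "integrable lborel h" for h :: "'a \<Rightarrow> 'b"
    using lborel_integrable_affine[OF that, of 1 z] by (simp add: add.commute)
  have tfg: "integrable lborel (\<lambda>x. norm (f (x + z) - g (x + z)))"
    by (intro integrable_norm Bochner_Integration.integrable_diff tr f g)
  have fg: "integrable lborel (\<lambda>x. norm (f x - g x))" "integrable lborel (\<lambda>x. norm (g (x + z) - g x))"
    "integrable lborel (\<lambda>x. norm (f (x + z) - f x))"
    by (intro integrable_norm Bochner_Integration.integrable_diff tr f g)+
  have "(\<integral>x. norm (f (x + z) - f x) \<partial>lborel) \<le> (\<integral>x. norm (f (x + z) - g (x + z)) + norm (g (x + z) - g x) + norm (f x - g x) \<partial>lborel)"
  proof (rule integral_mono)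
    fix x
    have "f (x + z) - f x = (f (x + z) - g (x + z)) + (g (x + z) - g x) - (f x - g x)" by simp
    also have "norm \<dots> \<le> norm ((f (x + z) - g (x + z)) + (g (x + z) - g x)) + norm (f x - g x)" by (rule norm_triangle_ineq4)
    also have "norm ((f (x + z) - g (x + z)) + (g (x + z) - g x)) \<le> norm (f (x + z) - g (x + z)) + norm (g (x + z) - g x)"
      by (rule norm_triangle_ineq)
    finally show "norm (f (x + z) - f x) \<le> norm (f (x + z) - g (x + z)) + norm (g (x + z) - g x) + norm (f x - g x)" by simp
  qed (use tfg fg in auto)
  also have "\<dots> = (\<integral>x. norm (f (x + z) - g (x + z)) \<partial>lborel) + (\<integral>x. norm (g (x + z) - g x) \<partial>lborel) + (\<integral>x. norm (f x - g x) \<partial>lborel)"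
    using tfg fg by simp
  also have "(\<integral>x. norm (f (x + z) - g (x + z)) \<partial>lborel) = (\<integral>x. norm (f x - g x) \<partial>lborel)"
    using lborel_integral_translate[of "\<lambda>x. norm (f x - g x)" z] fg(1) by auto
  finally show ?thesis by simp
qed

text \<open>Approximation in \<open>L1\<close> costs twice the distance, uniformly in the
  translation, so the claim need only be known for arbitrarily close functions.\<close>

lemma translation_limit_approx:
  fixes f :: "'a::euclidean_space \<Rightarrow> 'b::{banach,second_countable_topology}"
  assumes f: "integrable lborel f"
    and g: "\<And>e. e > 0 \<Longrightarrow> \<exists>g. integrable lborel g \<and> (\<integral>x. norm (f x - g x) \<partial>lborel) \<le> e \<and>
       (\<lambda>n. \<integral>x. norm (g (x + z n) - g x) \<partial>lborel) \<longlonglongrightarrow> 0"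
  shows "(\<lambda>n. \<integral>x. norm (f (x + z n) - f x) \<partial>lborel) \<longlonglongrightarrow> 0"
proof (rule order_tendstoI)
  fix a :: real assume a: "0 < a"
  obtain g where g: "integrable lborel g" "(\<integral>x. norm (f x - g x) \<partial>lborel) \<le> a / 4"
    "(\<lambda>n. \<integral>x. norm (g (x + z n) - g x) \<partial>lborel) \<longlonglongrightarrow> 0" using g[of "a/4"] a by auto
  have "eventually (\<lambda>n. (\<integral>x. norm (g (x + z n) - g x) \<partial>lborel) < a / 4) sequentially"
    using g(3) a by (intro order_tendstoD) auto
  then show "eventually (\<lambda>n. (\<integral>x. norm (f (x + z n) - f x) \<partial>lborel) < a) sequentially"
  proof eventually_elim
    case (elim n)
    then show ?case using translation_approx[OF f g(1), of "z n"] g(2) a by linarith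
  qed
next
  fix a :: real assume "a < 0"
  then show "eventually (\<lambda>n. a < (\<integral>x. norm (f (x + z n) - f x) \<partial>lborel)) sequentially"
    by (intro always_eventually allI less_le_trans[OF _ Bochner_Integration.integral_nonneg]) auto
qed

text \<open>For the indicator of a set of finite measure, outer regularity reduces the claim to open sets.\<close>

lemma translation_continuous_L1:
  fixes f :: "'a::euclidean_space \<Rightarrow> 'b::{banach,second_countable_topology}"
  assumes "integrable lborel f" and z: "z \<longlonglongrightarrow> 0"
  shows "(\<lambda>n. \<integral>x. norm (f (x + z n) - f x) \<partial>lborel) \<longlonglongrightarrow> 0"
  using assms(1)
proof (induction rule: integrable_induct)
  case (base A c)
  then have [measurable]: "A \<in> sets borel" by simp
  show ?case
  proof (rule translation_limit_approx)
    show "integrable lborel (\<lambda>x. indicator A x *\<^sub>R c)" using base by (intro integrable_scaleR_left integrable_real_indicator) auto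
  next
    fix e :: real assume e: "e > 0"
    define e' where "e' = e / (norm c + 1)"
    have e': "e' > 0" "e' * norm c \<le> e" unfolding e'_def using e by (auto simp: field_simps add_pos_nonneg)
    obtain U where U: "open U" "A \<subseteq> U" "emeasure lborel (U - A) < ennreal e'"
      using outer_regular_lborel[of A e'] e' by auto
    have [measurable]: "U \<in> sets borel" using U by simp
    have "emeasure lborel U \<le> emeasure lborel A + emeasure lborel (U - A)"
      using emeasure_subadditive[of A lborel "U - A"] U(2) by (simp add: Un_absorb1)
    also have "\<dots> < \<infinity>" using base U(3) by (auto simp: less_top[symmetric] top_unique)
    finally have fU: "emeasure lborel U < \<infinity>" .
    show "\<exists>g. integrable lborel g \<and> (\<integral>x. norm (indicator A x *\<^sub>R c - g x) \<partial>lborel) \<le> e \<and>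
       (\<lambda>n. \<integral>x. norm (g (x + z n) - g x) \<partial>lborel) \<longlonglongrightarrow> 0"
    proof (intro exI conjI)
      show "integrable lborel (\<lambda>x. indicator U x *\<^sub>R c)" using fU by (intro integrable_scaleR_left integrable_real_indicator) auto
      have "(\<integral>x. norm (indicator A x *\<^sub>R c - indicator U x *\<^sub>R c) \<partial>lborel) = (\<integral>x. indicator (U - A) x * norm c \<partial>lborel)"
        using U(2) by (intro Bochner_Integration.integral_cong) (auto simp: indicator_def)
      also have "\<dots> = measure lborel (U - A) * norm c" by simp
      also have "\<dots> \<le> e' * norm c"
      proof (rule mult_right_mono)
        show "measure lborel (U - A) \<le> e'" unfolding measure_def
          using U(3) e' by (metis enn2real_leI less_imp_le)
      qed simp
      also have "\<dots> \<le> e" by (rule e')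
      finally show "(\<integral>x. norm (indicator A x *\<^sub>R c - indicator U x *\<^sub>R c) \<partial>lborel) \<le> e" .
      have "(\<lambda>n. norm c * (\<integral>x. \<bar>indicator U (x + z n) - indicator U x\<bar> \<partial>lborel)) \<longlonglongrightarrow> norm c * 0"
        by (intro tendsto_intros translation_indicator_open U fU z)
      moreover have "norm (indicator U (x + z n) *\<^sub>R c - indicator U x *\<^sub>R c) = norm c * \<bar>indicator U (x + z n) - indicator U x\<bar>" for n x
        by (simp flip: scaleR_diff_left)
      ultimately show "(\<lambda>n. \<integral>x. norm (indicator U (x + z n) *\<^sub>R c - indicator U x *\<^sub>R c) \<partial>lborel) \<longlonglongrightarrow> 0"
        by simp
    qed
  qed
next
  case (add f g)
  have tr: "integrable lborel (\<lambda>x. norm (h (x + z n) - h x))" if "integrable lborel h" for h :: "'a \<Rightarrow> 'b" and n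
    using lborel_integrable_affine[OF that, of 1 "z n"] that by (simp add: add.commute)
  have "(\<lambda>n. (\<integral>x. norm (f (x + z n) - f x) \<partial>lborel) + (\<integral>x. norm (g (x + z n) - g x) \<partial>lborel)) \<longlonglongrightarrow> 0 + 0"
    by (intro tendsto_add add.IH)
  then have s: "(\<lambda>n. (\<integral>x. norm (f (x + z n) - f x) \<partial>lborel) + (\<integral>x. norm (g (x + z n) - g x) \<partial>lborel)) \<longlonglongrightarrow> 0" by simp
  show ?case
  proof (rule tendsto_sandwich[OF _ _ tendsto_const s])
    show "eventually (\<lambda>n. 0 \<le> (\<integral>x. norm (f (x + z n) + g (x + z n) - (f x + g x)) \<partial>lborel)) sequentially"
      by (intro always_eventually allI Bochner_Integration.integral_nonneg) simp
    have "(\<integral>x. norm (f (x + z n) + g (x + z n) - (f x + g x)) \<partial>lborel)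
        \<le> (\<integral>x. norm (f (x + z n) - f x) \<partial>lborel) + (\<integral>x. norm (g (x + z n) - g x) \<partial>lborel)" for n
    proof -
      have "(\<integral>x. norm (f (x + z n) + g (x + z n) - (f x + g x)) \<partial>lborel) \<le> (\<integral>x. norm (f (x + z n) - f x) + norm (g (x + z n) - g x) \<partial>lborel)"
      proof (rule integral_mono)
        show "integrable lborel (\<lambda>x. norm (f (x + z n) + g (x + z n) - (f x + g x)))"
          using tr[of "\<lambda>x. f x + g x" n] add.hyps by simp
        show "norm (f (x + z n) + g (x + z n) - (f x + g x)) \<le> norm (f (x + z n) - f x) + norm (g (x + z n) - g x)" for x
          using norm_triangle_ineq[of "f (x + z n) - f x" "g (x + z n) - g x"] by (simp add: algebra_simps)
      qed (use tr add.hyps in auto)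
      then show ?thesis using tr[OF add.hyps(1)] tr[OF add.hyps(2)] by simp
    qed
    then show "eventually (\<lambda>n. (\<integral>x. norm (f (x + z n) + g (x + z n) - (f x + g x)) \<partial>lborel)
        \<le> (\<integral>x. norm (f (x + z n) - f x) \<partial>lborel) + (\<integral>x. norm (g (x + z n) - g x) \<partial>lborel)) sequentially"
      by (intro always_eventually allI)
  qed
next
  case (lim f s)
  show ?case
  proof (rule translation_limit_approx[OF lim.hyps(4)])
    fix e :: real assume e: "e > 0"
    have "(\<lambda>i. \<integral>x. norm (f x - s i x) \<partial>lborel) \<longlonglongrightarrow> (\<integral>x. 0 \<partial>(lborel :: 'a measure))"
    proof (rule integral_dominated_convergence[where w = "\<lambda>x. 3 * norm (f x)"])
      show "AE x in lborel. (\<lambda>i. norm (f x - s i x)) \<longlonglongrightarrow> 0"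
      proof (rule AE_I2)
        fix x
        have "(\<lambda>i. norm (f x - s i x)) \<longlonglongrightarrow> norm (f x - f x)" using lim.hyps(2)[of x] by (intro tendsto_intros) auto
        then show "(\<lambda>i. norm (f x - s i x)) \<longlonglongrightarrow> 0" by simp
      qed
      have "norm (f x - s i x) \<le> 3 * norm (f x)" for i x
        using lim.hyps(3)[of x i] norm_triangle_ineq4[of "f x" "s i x"] by simp
      then show "AE x in lborel. norm (norm (f x - s i x)) \<le> 3 * norm (f x)" for i by simp
      show "(\<lambda>x. norm (f x - s i x)) \<in> borel_measurable lborel" for i
        using borel_measurable_integrable[OF lim.hyps(1)[of i]] borel_measurable_integrable[OF lim.hyps(4)] by measurable
    qed (use lim.hyps(4) in auto)
    then have "eventually (\<lambda>i. (\<integral>x. norm (f x - s i x) \<partial>lborel) < e) sequentially" using e by (intro order_tendstoD) auto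
    then obtain i where "(\<integral>x. norm (f x - s i x) \<partial>lborel) < e" by (auto simp: eventually_sequentially)
    then show "\<exists>g. integrable lborel g \<and> (\<integral>x. norm (f x - g x) \<partial>lborel) \<le> e \<and>
       (\<lambda>n. \<integral>x. norm (g (x + z n) - g x) \<partial>lborel) \<longlonglongrightarrow> 0"
      using lim.hyps(1) lim.IH by (intro exI[of _ "s i"]) auto
  qed
qed

text \<open>Continuity of translations in \<open>L1\<close> is turned into weak convergence in
  \<open>L2\<close> by cutting \<open>f\<close> off at height \<open>k\<close>: the bounded part
  pairs with the \<open>L1\<close> difference, and the rest is small in \<open>L2\<close> uniformly
  in the translation.\<close>

lemma translation_continuous_L2_inner:
  fixes f :: "real^'n \<Rightarrow> complex"
  assumes i: "integrable lborel f" and f: "in_L2 f" and z: "z \<longlonglongrightarrow> 0"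
  shows "(\<lambda>n. L2_inner f (\<lambda>x. f (x + z n))) \<longlonglongrightarrow> L2_inner f f"
proof -
  note [measurable] = in_L2_measurable[OF f]
  define fk where "fk k x = (if norm (f x) \<le> real k then f x else 0)" for k x
  have fkm [measurable]: "fk k \<in> borel_measurable borel" for k unfolding fk_def by measurable
  have fkf: "norm (fk k x) \<le> norm (f x)" and fkk: "norm (fk k x) \<le> real k" for k x by (auto simp: fk_def)
  have fkL2: "in_L2 (fk k)" for k by (rule in_L2_dominated[OF f fkm fkf])
  have "L2_tendsto fk f sequentially"
  proof (rule L2_tendsto_dominated[OF fkm _ f fkf])
    show "AE x in lborel. (\<lambda>k. fk k x) \<longlonglongrightarrow> f x"
    proof (rule AE_I2)
      fix x :: "real^'n"
      have "eventually (\<lambda>k. f x = fk k x) sequentially"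
        by (rule eventually_sequentiallyI[of "nat \<lceil>norm (f x)\<rceil>"]) (auto simp: fk_def nat_le_iff ceiling_le_iff)
      then show "(\<lambda>k. fk k x) \<longlonglongrightarrow> f x" by (rule Lim_transform_eventually[OF tendsto_const])
    qed
  qed measurable
  then have fklim: "(\<lambda>k. L2_norm (\<lambda>x. fk k x - f x)) \<longlonglongrightarrow> 0"
    by (rule L2_tendsto_norm) (use fkL2 f in auto)
  define d where "d n x = f (x + z n) - f x" for n x
  have dL2: "in_L2 (d n)" for n unfolding d_def by (intro in_L2_diff in_L2_translate f)
  note [measurable] = in_L2_measurable[OF dL2]
  have dn: "L2_norm (d n) \<le> 2 * L2_norm f" for n
  proof -
    have "L2sq (d n) \<le> 2 * L2sq (\<lambda>x. f (x + z n)) + 2 * L2sq (\<lambda>x. - f x)"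
      using L2sq_add_le[of "\<lambda>x. f (x + z n)" "\<lambda>x. - f x"] by (simp add: d_def[abs_def])
    also have "L2sq (\<lambda>x. - f x) = L2sq f" by (simp add: L2sq_def)
    also have "L2sq (\<lambda>x. f (x + z n)) = L2sq f" by (rule L2sq_translate) measurable
    finally have "ennreal ((L2_norm (d n))\<^sup>2) \<le> 2 * ennreal ((L2_norm f)\<^sup>2) + 2 * ennreal ((L2_norm f)\<^sup>2)"
      by (simp only: L2sq_eq[OF f] L2sq_eq[OF dL2])
    also have "2 * ennreal ((L2_norm f)\<^sup>2) = ennreal (2 * (L2_norm f)\<^sup>2)" using ennreal_mult[of 2 "(L2_norm f)\<^sup>2"] by simp
    also have "ennreal (2 * (L2_norm f)\<^sup>2) + ennreal (2 * (L2_norm f)\<^sup>2) = ennreal ((2 * L2_norm f)\<^sup>2)"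
      by (simp add: ennreal_plus[symmetric] power_mult_distrib del: ennreal_plus)
    finally have "(L2_norm (d n))\<^sup>2 \<le> (2 * L2_norm f)\<^sup>2" by (simp add: ennreal_le_iff)
    then show ?thesis by (rule power2_le_imp_le) (simp add: L2_norm_nonneg)
  qed
  have id: "integrable lborel (\<lambda>x. norm (d n x))" for n
    unfolding d_def using lborel_integrable_affine[OF i, of 1 "z n"] i by (simp add: add.commute)
  have dlim: "(\<lambda>n. \<integral>x. norm (d n x) \<partial>lborel) \<longlonglongrightarrow> 0"
    unfolding d_def by (rule translation_continuous_L1[OF i z])
  \<comment> \<open>First \<open>k\<close> is fixed to make the second term small for all
    \<open>n\<close>, then \<open>n\<close> tends to infinity in the first.\<close>
  have key: "norm (L2_inner f (d n)) \<le> real k * (\<integral>x. norm (d n x) \<partial>lborel) + L2_norm (\<lambda>x. fk k x - f x) * (2 * L2_norm f)" for n k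
  proof -
    have "L2_inner f (d n) = L2_inner (fk k) (d n) - L2_inner (\<lambda>x. fk k x - f x) (d n)"
      by (simp add: L2_inner_diff_left fkL2 f dL2)
    then have "norm (L2_inner f (d n)) \<le> norm (L2_inner (fk k) (d n)) + norm (L2_inner (\<lambda>x. fk k x - f x) (d n))"
      using norm_triangle_ineq4 by metis
    moreover have "norm (L2_inner (fk k) (d n)) \<le> real k * (\<integral>x. norm (d n x) \<partial>lborel)"
    proof -
      have "norm (L2_inner (fk k) (d n)) \<le> (\<integral>x. norm (fk k x * cnj (d n x)) \<partial>lborel)"
        unfolding L2_inner_def by (rule integral_norm_bound)
      also have "\<dots> \<le> (\<integral>x. real k * norm (d n x) \<partial>lborel)"
        using fkk id by (intro integral_mono integrable_norm integrable_inner_L2 fkL2 dL2) (auto simp: norm_mult mult_right_mono)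
      finally show ?thesis by simp
    qed
    moreover have "norm (L2_inner (\<lambda>x. fk k x - f x) (d n)) \<le> L2_norm (\<lambda>x. fk k x - f x) * (2 * L2_norm f)"
    proof -
      have "norm (L2_inner (\<lambda>x. fk k x - f x) (d n)) \<le> L2_norm (\<lambda>x. fk k x - f x) * L2_norm (d n)"
        by (intro L2_inner_bound in_L2_diff fkL2 f dL2)
      also have "\<dots> \<le> L2_norm (\<lambda>x. fk k x - f x) * (2 * L2_norm f)"
        by (intro mult_left_mono dn L2_norm_nonneg)
      finally show ?thesis .
    qed
    ultimately show ?thesis by linarith
  qed
  have "(\<lambda>n. L2_inner f (d n)) \<longlonglongrightarrow> 0"
  proof (rule tendstoI)
    fix e :: real assume e: "e > 0"
    have "(\<lambda>k. L2_norm (\<lambda>x. fk k x - f x) * (2 * L2_norm f)) \<longlonglongrightarrow> 0 * (2 * L2_norm f)"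
      by (intro tendsto_intros fklim)
    then have "eventually (\<lambda>k. L2_norm (\<lambda>x. fk k x - f x) * (2 * L2_norm f) < e / 2) sequentially"
      using e by (intro order_tendstoD) auto
    then obtain k where k: "L2_norm (\<lambda>x. fk k x - f x) * (2 * L2_norm f) < e / 2" by (auto simp: eventually_sequentially)
    have "(\<lambda>n. real k * (\<integral>x. norm (d n x) \<partial>lborel)) \<longlonglongrightarrow> real k * 0" by (intro tendsto_intros dlim)
    then have "eventually (\<lambda>n. real k * (\<integral>x. norm (d n x) \<partial>lborel) < e / 2) sequentially"
      using e by (intro order_tendstoD) auto
    then show "eventually (\<lambda>n. dist (L2_inner f (d n)) 0 < e) sequentially"
    proof eventually_elim
      case (elim n)
      then show ?case using key[of n k] k by simp
    qed
  qed
  moreover have "L2_inner f (d n) = L2_inner f (\<lambda>x. f (x + z n)) - L2_inner f f" for n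
    unfolding d_def by (intro L2_inner_diff_right in_L2_translate f)
  ultimately have "(\<lambda>n. L2_inner f (\<lambda>x. f (x + z n)) - L2_inner f f) \<longlonglongrightarrow> 0" by simp
  then show ?thesis by (simp add: LIM_zero_iff)
qed

section \<open>Plancherel's identity for functions that are integrable and square integrable\<close>

lemma cnj_fourier_integral:
  fixes f :: "real^'n \<Rightarrow> complex"
  assumes [measurable]: "f \<in> borel_measurable borel"
  shows "cnj (fourier_integral f \<xi>) = fourier_integral (\<lambda>y. cnj (f (- y))) \<xi>"
    and "fourier_integral (\<lambda>y. cnj (f y)) \<xi> = cnj (fourier_integral f (- \<xi>))"
proof -
  have [measurable]: "cnj \<in> borel_measurable borel" by (intro borel_measurable_continuous_onI continuous_intros)
  have ce: "cnj (exp (- \<i> * of_real t)) = exp (\<i> * of_real t)" "cnj (exp (\<i> * of_real t)) = exp (- \<i> * of_real t)" for t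
    by (simp_all add: exp_cnj)
  have "cnj (\<integral>x. exp (- \<i> * of_real (x \<bullet> \<xi>)) * f x \<partial>lborel) = (\<integral>x. cnj (exp (- \<i> * of_real (x \<bullet> \<xi>)) * f x) \<partial>lborel)"
    by (rule Bochner_Integration.integral_cnj[symmetric])
  also have "\<dots> = (\<integral>x. exp (\<i> * of_real (x \<bullet> \<xi>)) * cnj (f x) \<partial>lborel)"
    unfolding complex_cnj_mult ce ..
  also have "\<dots> = (\<integral>x. exp (\<i> * of_real ((- x) \<bullet> \<xi>)) * cnj (f (- x)) \<partial>lborel)"
    by (rule lborel_integral_reflect[symmetric]) measurable
  finally show "cnj (fourier_integral f \<xi>) = fourier_integral (\<lambda>y. cnj (f (- y))) \<xi>"
    by (simp add: fourier_integral_def)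
  have "cnj (\<integral>x. exp (- \<i> * of_real (x \<bullet> (- \<xi>))) * f x \<partial>lborel) = (\<integral>x. cnj (exp (- \<i> * of_real (x \<bullet> (- \<xi>))) * f x) \<partial>lborel)"
    by (rule Bochner_Integration.integral_cnj[symmetric])
  also have "\<dots> = (\<integral>x. exp (- \<i> * of_real (x \<bullet> \<xi>)) * cnj (f x) \<partial>lborel)"
    unfolding complex_cnj_mult ce by simp
  finally show "fourier_integral (\<lambda>y. cnj (f y)) \<xi> = cnj (fourier_integral f (- \<xi>))"
    by (simp add: fourier_integral_def)
qed

text \<open>The Gaussian factor makes \<open>cnj (fourier_integral f)\<close> integrable, so the
  multiplication formula applies to the squared modulus. The result is a Gaussian average of inner
  products of \<open>f\<close> with its translates by \<open>e *\<^sub>R w\<close>.\<close>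

lemma gaussian_mollified_energy:
  fixes f :: "real^'n \<Rightarrow> complex"
  assumes i: "integrable lborel f" and f: "in_L2 f" and e: "e > 0"
  shows "(\<integral>\<xi>. (norm (fourier_integral f \<xi>))\<^sup>2 * exp (- (e * norm \<xi>)\<^sup>2 / 2) \<partial>lborel)
     = Re (of_real ((2 * pi) powr (- (real CARD('n) / 2))) *
        (\<integral>w. of_real (exp (- (norm w)\<^sup>2 / 2)) * L2_inner f (\<lambda>x. f (x + e *\<^sub>R w)) \<partial>lborel))"
    and "integrable lborel (\<lambda>\<xi>. (norm (fourier_integral f \<xi>))\<^sup>2 * exp (- (e * norm \<xi>)\<^sup>2 / 2))"
proof -
  note [measurable] = in_L2_measurable[OF f]
  have cnjm [measurable]: "cnj \<in> borel_measurable borel" by (intro borel_measurable_continuous_onI continuous_intros)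
  define c where "c = (2 * pi) powr (- (real CARD('n) / 2))"
  define p where "p = (2 * pi) powr (real CARD('n) / 2)"
  have cp: "c * p = 1" unfolding c_def p_def by (simp add: powr_add[symmetric])
  define G :: "real^'n \<Rightarrow> complex" where "G \<xi> = of_real (exp (- (e * norm \<xi>)\<^sup>2 / 2))" for \<xi>
  have iG: "integrable lborel G" unfolding G_def by (intro integrable_of_real integrable_gaussian e)
  note [measurable] = borel_measurable_integrable[OF iG]
  obtain B where B: "\<And>\<xi>. norm (fourier_integral f \<xi>) \<le> B" using fourier_integral_bound by blast
  have B0: "B \<ge> 0" using B[of 0] norm_ge_zero order_trans by blast
  define g where "g \<xi> = cnj (fourier_integral f \<xi>) * G \<xi>" for \<xi>
  have gm [measurable]: "g \<in> borel_measurable borel" unfolding g_def by measurable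
  have ig: "integrable lborel g"
    by (rule Bochner_Integration.integrable_bound[OF integrable_mult_right[OF iG, of "of_real B"]])
      (use B B0 in \<open>auto simp: g_def norm_mult intro!: mult_right_mono\<close>)
  show i2: "integrable lborel (\<lambda>\<xi>. (norm (fourier_integral f \<xi>))\<^sup>2 * exp (- (e * norm \<xi>)\<^sup>2 / 2))"
  proof (rule Bochner_Integration.integrable_bound[OF integrable_mult_right[OF integrable_gaussian[OF e], of "B\<^sup>2"]])
    have "(norm (fourier_integral f \<xi>))\<^sup>2 \<le> B\<^sup>2" for \<xi> using B by (intro power_mono) auto
    then show "AE \<xi> in lborel. norm ((norm (fourier_integral f \<xi>))\<^sup>2 * exp (- (e * norm \<xi>)\<^sup>2 / 2)) \<le> norm (B\<^sup>2 * exp (- (e * norm \<xi>)\<^sup>2 / 2))"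
      by (auto intro!: mult_right_mono simp: abs_mult)
  qed measurable
  \<comment> \<open>The transform of \<open>g\<close> is computed by a second use of the
    multiplication formula: the conjugate of the transform of \<open>f\<close> is the transform of
    \<open>h\<close>, and the modulated Gaussian \<open>k\<close> has an explicit transform.\<close>
  have FIg: "fourier_integral g x = of_real c * (\<integral>w. of_real (exp (- (norm w)\<^sup>2 / 2)) * cnj (f (x + e *\<^sub>R w)) \<partial>lborel)" for x
  proof -
    define h where "h y = cnj (f (- y))" for y
    have ih: "integrable lborel h"
      using lborel_integrable_affine[OF i, of "-1" 0] unfolding h_def by simp
    define k where "k \<xi> = exp (- \<i> * of_real (\<xi> \<bullet> x)) * G \<xi>" for \<xi>
    have ik: "integrable lborel k" unfolding k_def by (rule integrable_modulated[OF iG])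
    have FIk: "fourier_integral k y = of_real (exp (- (norm (x + y) / e)\<^sup>2 / 2) / e ^ CARD('n))" for y
    proof -
      have "(\<integral>\<xi>. exp (- \<i> * of_real (\<xi> \<bullet> y)) * k \<xi> \<partial>lborel) = (\<integral>\<xi>. exp (- \<i> * of_real (\<xi> \<bullet> (x + y))) * of_real (exp (- (e * norm \<xi>)\<^sup>2 / 2)) \<partial>lborel)"
        unfolding k_def G_def by (simp add: inner_add_right distrib_left exp_add[symmetric] mult.assoc[symmetric] add.commute)
      also have "\<dots> = of_real (p * exp (- (norm (x + y) / e)\<^sup>2 / 2) / e ^ CARD('n))"
        unfolding p_def by (rule integral_gaussian_exp_scaled[OF e])
      finally have "fourier_integral k y = of_real (c * (p * exp (- (norm (x + y) / e)\<^sup>2 / 2) / e ^ CARD('n)))"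
        unfolding fourier_integral_def c_def by simp
      also have "c * (p * exp (- (norm (x + y) / e)\<^sup>2 / 2) / e ^ CARD('n)) = (c * p) * (exp (- (norm (x + y) / e)\<^sup>2 / 2) / e ^ CARD('n))" by simp
      finally show ?thesis unfolding cp by simp
    qed
    have "fourier_integral g x = of_real c * (\<integral>\<xi>. fourier_integral h \<xi> * k \<xi> \<partial>lborel)"
      unfolding fourier_integral_def[of g] g_def k_def h_def c_def cnj_fourier_integral(1)[OF in_L2_measurable[OF f]]
      by (simp add: mult_ac)
    also have "(\<integral>\<xi>. fourier_integral h \<xi> * k \<xi> \<partial>lborel) = (\<integral>y. h y * fourier_integral k y \<partial>lborel)"
      by (rule fourier_integral_multiplication[OF ih ik])
    also have "\<dots> = (\<integral>y. cnj (f (- y)) * of_real (exp (- (norm (x - (- y)) / e)\<^sup>2 / 2) / e ^ CARD('n)) \<partial>lborel)"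
      unfolding FIk h_def by simp
    also have "\<dots> = (\<integral>y. cnj (f y) * of_real (exp (- (norm (x - y) / e)\<^sup>2 / 2) / e ^ CARD('n)) \<partial>lborel)"
      by (rule lborel_integral_reflect) measurable
    \<comment> \<open>The substitution \<open>y = x + e *\<^sub>R w\<close> moves the scale from the
      Gaussian to the translation, so that the weight no longer depends on \<open>e\<close> in the
      limit.\<close>
    also have "\<dots> = \<bar>e\<bar> ^ DIM(real^'n) *\<^sub>R (\<integral>w. cnj (f (x + e *\<^sub>R w)) * of_real (exp (- (norm (x - (x + e *\<^sub>R w)) / e)\<^sup>2 / 2) / e ^ CARD('n)) \<partial>lborel)"
      by (rule lborel_integral_affine) (use e in auto)
    also have "(\<lambda>w. cnj (f (x + e *\<^sub>R w)) * of_real (exp (- (norm (x - (x + e *\<^sub>R w)) / e)\<^sup>2 / 2) / e ^ CARD('n)))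
      = (\<lambda>w. of_real (1 / e ^ CARD('n)) * (of_real (exp (- (norm w)\<^sup>2 / 2)) * cnj (f (x + e *\<^sub>R w))))"
      using e by (simp add: fun_eq_iff)
    also have "\<bar>e\<bar> ^ DIM(real^'n) *\<^sub>R (\<integral>w. of_real (1 / e ^ CARD('n)) * (of_real (exp (- (norm w)\<^sup>2 / 2)) * cnj (f (x + e *\<^sub>R w))) \<partial>lborel)
       = (\<integral>w. of_real (exp (- (norm w)\<^sup>2 / 2)) * cnj (f (x + e *\<^sub>R w)) \<partial>lborel)"
      using e by (simp add: scaleR_conv_of_real)
    finally show ?thesis .
  qed
  define \<gamma> where "\<gamma> w = exp (- (norm w)\<^sup>2 / 2)" for w :: "real^'n"
  have i\<gamma>: "integrable lborel \<gamma>" unfolding \<gamma>_def using integrable_gaussian[of 1, where 'n = 'n] by simp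
  note [measurable] = borel_measurable_integrable[OF i\<gamma>]
  have \<gamma>0: "\<gamma> w \<ge> 0" for w by (simp add: \<gamma>_def)
  define K where "K w x = of_real (\<gamma> w) * (f x * cnj (f (x + e *\<^sub>R w)))" for w x
  have Km [measurable]: "(\<lambda>(w, x). K w x) \<in> borel_measurable (lborel \<Otimes>\<^sub>M lborel)"
    unfolding K_def case_prod_unfold by measurable
  have fz: "in_L2 (\<lambda>x. f (x + e *\<^sub>R w))" for w by (intro in_L2_translate f)
  have iK: "integrable lborel (K w)" for w
    unfolding K_def[abs_def] by (intro integrable_mult_right integrable_inner_L2 f fz)
  have "integrable (lborel \<Otimes>\<^sub>M lborel) (\<lambda>(w, x). K w x)"
  proof (rule lborel_pair.Fubini_integrable[OF Km])
    show "AE w in lborel. integrable lborel (\<lambda>x. case (w, x) of (w, x) \<Rightarrow> K w x)" using iK by simp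
    define A where "A = (\<integral>x. (norm (f x))\<^sup>2 \<partial>lborel)"
    have bd: "(\<integral>x. norm (K w x) \<partial>lborel) \<le> \<gamma> w * A" for w
    proof -
      have "(\<integral>x. norm (K w x) \<partial>lborel) \<le> (\<integral>x. \<gamma> w * ((norm (f x))\<^sup>2 / 2 + (norm (f (x + e *\<^sub>R w)))\<^sup>2 / 2) \<partial>lborel)"
      proof (rule integral_mono)
        show "integrable lborel (\<lambda>x. norm (K w x))" using iK by simp
        show "integrable lborel (\<lambda>x. \<gamma> w * ((norm (f x))\<^sup>2 / 2 + (norm (f (x + e *\<^sub>R w)))\<^sup>2 / 2))"
          using in_L2_integrable[OF f] in_L2_integrable[OF fz[of w]] by simp
        show "norm (K w x) \<le> \<gamma> w * ((norm (f x))\<^sup>2 / 2 + (norm (f (x + e *\<^sub>R w)))\<^sup>2 / 2)" for x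
          unfolding K_def norm_mult using sum_squares_bound[of "norm (f x)" "norm (f (x + e *\<^sub>R w))"] \<gamma>0[of w]
          by (auto intro!: mult_left_mono)
      qed
      also have "\<dots> = \<gamma> w * (A / 2 + (\<integral>x. (norm (f (x + e *\<^sub>R w)))\<^sup>2 \<partial>lborel) / 2)"
        using in_L2_integrable[OF f] in_L2_integrable[OF fz[of w]] by (simp add: A_def)
      also have "(\<integral>x. (norm (f (x + e *\<^sub>R w)))\<^sup>2 \<partial>lborel) = A" unfolding A_def
        by (rule lborel_integral_translate[of "\<lambda>x. (norm (f x))\<^sup>2"]) measurable
      finally show ?thesis by simp
    qed
    show "integrable lborel (\<lambda>w. \<integral>x. norm (case (w, x) of (w, x) \<Rightarrow> K w x) \<partial>lborel)"
    proof (rule Bochner_Integration.integrable_bound[OF integrable_mult_left[OF i\<gamma>, of A]])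
      show "(\<lambda>w. \<integral>x. norm (case (w, x) of (w, x) \<Rightarrow> K w x) \<partial>lborel) \<in> borel_measurable lborel"
        by (rule lborel.borel_measurable_lebesgue_integral) (use Km in \<open>simp add: case_prod_unfold\<close>)
      show "AE w in lborel. norm (\<integral>x. norm (case (w, x) of (w, x) \<Rightarrow> K w x) \<partial>lborel) \<le> norm (\<gamma> w * A)"
      proof (rule AE_I2)
        fix w
        have "0 \<le> (\<integral>x. norm (K w x) \<partial>lborel)" by (intro Bochner_Integration.integral_nonneg) simp
        then show "norm (\<integral>x. norm (case (w, x) of (w, x) \<Rightarrow> K w x) \<partial>lborel) \<le> norm (\<gamma> w * A)"
          using bd[of w] by simp
      qed
    qed
  qed
  from lborel_pair.Fubini_integral[OF this]
  have Fub: "(\<integral>x. (\<integral>w. K w x \<partial>lborel) \<partial>lborel) = (\<integral>w. (\<integral>x. K w x \<partial>lborel) \<partial>lborel)" .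
  have "complex_of_real (\<integral>\<xi>. (norm (fourier_integral f \<xi>))\<^sup>2 * exp (- (e * norm \<xi>)\<^sup>2 / 2) \<partial>lborel)
     = (\<integral>\<xi>. of_real ((norm (fourier_integral f \<xi>))\<^sup>2 * exp (- (e * norm \<xi>)\<^sup>2 / 2)) \<partial>lborel)"
    by (rule integral_complex_of_real[symmetric])
  also have "\<dots> = (\<integral>\<xi>. fourier_integral f \<xi> * g \<xi> \<partial>lborel)"
    unfolding g_def G_def of_real_mult complex_norm_square by (simp only: mult.assoc)
  also have "\<dots> = (\<integral>x. f x * fourier_integral g x \<partial>lborel)"
    by (rule fourier_integral_multiplication[OF i ig])
  also have "\<dots> = (\<integral>x. of_real c * (\<integral>w. K w x \<partial>lborel) \<partial>lborel)"
  proof (rule Bochner_Integration.integral_cong[OF refl])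
    fix x
    have "(\<integral>w. K w x \<partial>lborel) = (\<integral>w. f x * (of_real (\<gamma> w) * cnj (f (x + e *\<^sub>R w))) \<partial>lborel)"
      unfolding K_def by (simp add: mult_ac)
    also have "\<dots> = f x * (\<integral>w. of_real (\<gamma> w) * cnj (f (x + e *\<^sub>R w)) \<partial>lborel)" by (rule integral_mult_right_zero)
    finally show "f x * fourier_integral g x = of_real c * (\<integral>w. K w x \<partial>lborel)"
      unfolding FIg \<gamma>_def by (simp add: mult_ac)
  qed
  also have "\<dots> = of_real c * (\<integral>w. (\<integral>x. K w x \<partial>lborel) \<partial>lborel)" unfolding integral_mult_right_zero Fub ..
  also have "\<dots> = of_real c * (\<integral>w. of_real (\<gamma> w) * L2_inner f (\<lambda>x. f (x + e *\<^sub>R w)) \<partial>lborel)"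
    unfolding K_def L2_inner_def integral_mult_right_zero ..
  finally show "(\<integral>\<xi>. (norm (fourier_integral f \<xi>))\<^sup>2 * exp (- (e * norm \<xi>)\<^sup>2 / 2) \<partial>lborel)
     = Re (of_real ((2 * pi) powr (- (real CARD('n) / 2))) *
        (\<integral>w. of_real (exp (- (norm w)\<^sup>2 / 2)) * L2_inner f (\<lambda>x. f (x + e *\<^sub>R w)) \<partial>lborel))"
    unfolding c_def \<gamma>_def by (metis Re_complex_of_real)
qed

text \<open>Let the scale in the mollified identity tend to 0. On the side of \<open>f\<close>,
  continuity of translations and dominated convergence give the limit, and the total mass of the
  Gaussian cancels the normalisation.\<close>

theorem plancherel_L1_L2:
  fixes f :: "real^'n \<Rightarrow> complex"
  assumes i: "integrable lborel f" and f: "in_L2 f"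
  shows "L2sq (fourier_integral f) = L2sq f" and "in_L2 (fourier_integral f)"
proof -
  note [measurable] = in_L2_measurable[OF f]
  define c where "c = (2 * pi) powr (- (real CARD('n) / 2))"
  define p where "p = (2 * pi) powr (real CARD('n) / 2)"
  have cp: "c * p = 1" unfolding c_def p_def by (simp add: powr_add[symmetric])
  define e where "e k = 1 / real (Suc k)" for k
  have e: "e k > 0" for k by (simp add: e_def)
  have e0: "e \<longlonglongrightarrow> 0" unfolding e_def using LIMSEQ_inverse_real_of_nat by (simp add: divide_inverse)
  define J where "J k = (\<integral>w. of_real (exp (- (norm w)\<^sup>2 / 2)) * L2_inner f (\<lambda>x. f (x + e k *\<^sub>R w)) \<partial>lborel)" for k
  have i\<gamma>: "integrable lborel (\<lambda>w::real^'n. exp (- (norm w)\<^sup>2 / 2))" using integrable_gaussian[of 1, where 'n = 'n] by simp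
  have bd: "norm (L2_inner f (\<lambda>x. f (x + z))) \<le> (L2_norm f)\<^sup>2" for z
  proof -
    have "ennreal ((L2_norm (\<lambda>x. f (x + z)))\<^sup>2) = ennreal ((L2_norm f)\<^sup>2)"
      using L2sq_translate[of f z] L2sq_eq[OF f] L2sq_eq[OF in_L2_translate[OF f]] by simp
    then have "L2_norm (\<lambda>x. f (x + z)) = L2_norm f" by (simp add: ennreal_inj L2_norm_nonneg)
    then show ?thesis using L2_inner_bound[OF f in_L2_translate[OF f, of z]] by (simp add: power2_eq_square)
  qed
  have cnjm [measurable]: "cnj \<in> borel_measurable borel" by (intro borel_measurable_continuous_onI continuous_intros)
  have Lm [measurable]: "(\<lambda>w. L2_inner f (\<lambda>x. f (x + a *\<^sub>R w))) \<in> borel_measurable borel" for a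
  proof -
    have "(\<lambda>w. \<integral>x. f x * cnj (f (x + a *\<^sub>R w)) \<partial>lborel) \<in> borel_measurable lborel"
      by (rule lborel.borel_measurable_lebesgue_integral) (simp add: case_prod_unfold)
    then show ?thesis unfolding L2_inner_def by simp
  qed
  have "J \<longlonglongrightarrow> (\<integral>w. of_real (exp (- (norm w)\<^sup>2 / 2)) * L2_inner f f \<partial>(lborel :: (real^'n) measure))"
    unfolding J_def
  proof (rule integral_dominated_convergence[where w = "\<lambda>w. exp (- (norm w)\<^sup>2 / 2) * (L2_norm f)\<^sup>2"])
    show "AE w in lborel. (\<lambda>k. of_real (exp (- (norm w)\<^sup>2 / 2)) * L2_inner f (\<lambda>x. f (x + e k *\<^sub>R w))) \<longlonglongrightarrow> of_real (exp (- (norm w)\<^sup>2 / 2)) * L2_inner f f"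
    proof (rule AE_I2)
      fix w :: "real^'n"
      have "(\<lambda>k. e k *\<^sub>R w) \<longlonglongrightarrow> 0 *\<^sub>R w" by (intro tendsto_intros e0)
      then show "(\<lambda>k. of_real (exp (- (norm w)\<^sup>2 / 2)) * L2_inner f (\<lambda>x. f (x + e k *\<^sub>R w))) \<longlonglongrightarrow> of_real (exp (- (norm w)\<^sup>2 / 2)) * L2_inner f f"
        by (intro tendsto_intros translation_continuous_L2_inner i f) simp
    qed
    show "AE w in lborel. norm (of_real (exp (- (norm w)\<^sup>2 / 2)) * L2_inner f (\<lambda>x. f (x + e k *\<^sub>R w))) \<le> exp (- (norm w)\<^sup>2 / 2) * (L2_norm f)\<^sup>2" for k
      using bd by (intro AE_I2) (simp add: norm_mult)
    show "integrable lborel (\<lambda>w::real^'n. exp (- (norm w)\<^sup>2 / 2) * (L2_norm f)\<^sup>2)" using i\<gamma> by simp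
  qed measurable
  also have "(\<integral>w. of_real (exp (- (norm w)\<^sup>2 / 2)) * L2_inner f f \<partial>(lborel :: (real^'n) measure))
      = of_real (p * (L2_norm f)\<^sup>2)"
    using integral_gaussian_exp(1)[of "0 :: real^'n"] by (simp add: L2_inner_self[OF f] p_def)
  finally have J: "J \<longlonglongrightarrow> of_real (p * (L2_norm f)\<^sup>2)" .
  have "(\<lambda>k. Re (of_real c * J k)) \<longlonglongrightarrow> Re (of_real c * of_real (p * (L2_norm f)\<^sup>2))" by (intro tendsto_intros J)
  also have "Re (of_real c * of_real (p * (L2_norm f)\<^sup>2)) = (c * p) * (L2_norm f)\<^sup>2" by simp
  finally have lim1: "(\<lambda>k. ennreal (Re (of_real c * J k))) \<longlonglongrightarrow> ennreal ((L2_norm f)\<^sup>2)"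
    unfolding cp by (intro tendsto_ennrealI) simp
  \<comment> \<open>Monotone convergence works in \<open>ennreal\<close> before the transform is
    known to be square integrable; its finiteness is part of the conclusion.\<close>
  have "(\<lambda>k. \<integral>\<^sup>+\<xi>. ennreal ((norm (fourier_integral f \<xi>))\<^sup>2 * exp (- (e k * norm \<xi>)\<^sup>2 / 2)) \<partial>lborel) \<longlonglongrightarrow> L2sq (fourier_integral f)"
    unfolding L2sq_def
  proof (rule nn_integral_LIMSEQ)
    show "incseq (\<lambda>k \<xi>. ennreal ((norm (fourier_integral f \<xi>))\<^sup>2 * exp (- (e k * norm \<xi>)\<^sup>2 / 2)))"
    proof (intro incseq_SucI le_funI ennreal_leI mult_left_mono)
      fix k \<xi>
      have "e (Suc k) \<le> e k" unfolding e_def by (simp add: field_simps)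
      then have "(e (Suc k) * norm \<xi>)\<^sup>2 \<le> (e k * norm \<xi>)\<^sup>2" using e[of "Suc k"] by (intro power_mono mult_right_mono) auto
      then show "exp (- (e k * norm \<xi>)\<^sup>2 / 2) \<le> exp (- (e (Suc k) * norm \<xi>)\<^sup>2 / 2)" by simp
    qed simp
    show "(\<lambda>k. ennreal ((norm (fourier_integral f \<xi>))\<^sup>2 * exp (- (e k * norm \<xi>)\<^sup>2 / 2))) \<longlonglongrightarrow> ennreal ((norm (fourier_integral f \<xi>))\<^sup>2)" for \<xi>
    proof (rule tendsto_ennrealI)
      have "(\<lambda>k. (norm (fourier_integral f \<xi>))\<^sup>2 * exp (- (e k * norm \<xi>)\<^sup>2 / 2)) \<longlonglongrightarrow> (norm (fourier_integral f \<xi>))\<^sup>2 * exp (- (0 * norm \<xi>)\<^sup>2 / 2)"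
        by (intro tendsto_intros e0) auto
      then show "(\<lambda>k. (norm (fourier_integral f \<xi>))\<^sup>2 * exp (- (e k * norm \<xi>)\<^sup>2 / 2)) \<longlonglongrightarrow> (norm (fourier_integral f \<xi>))\<^sup>2" by simp
    qed
  qed measurable
  moreover have "(\<integral>\<^sup>+\<xi>. ennreal ((norm (fourier_integral f \<xi>))\<^sup>2 * exp (- (e k * norm \<xi>)\<^sup>2 / 2)) \<partial>lborel) = ennreal (Re (of_real c * J k))" for k
    unfolding c_def J_def gaussian_mollified_energy(1)[OF i f e, symmetric]
    by (rule nn_integral_eq_integral[OF gaussian_mollified_energy(2)[OF i f e]]) auto
  ultimately have "(\<lambda>k. ennreal (Re (of_real c * J k))) \<longlonglongrightarrow> L2sq (fourier_integral f)" by simp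
  then show *: "L2sq (fourier_integral f) = L2sq f"
    unfolding L2sq_eq[OF f] using lim1 by (rule LIMSEQ_unique)
  show "in_L2 (fourier_integral f)" using f unfolding in_L2_L2sq * by (simp add: fourier_integral_measurable)
qed

section \<open>Parseval's identity and the extension of the transform to \<open>L2\<close>\<close>

lemma L2_tendsto_diff:
  fixes F G :: "'i \<Rightarrow> real^'n \<Rightarrow> complex"
  assumes F: "L2_tendsto F f X" and G: "L2_tendsto G g X"
    and [measurable]: "\<And>i. F i \<in> borel_measurable borel" "\<And>i. G i \<in> borel_measurable borel"
      "f \<in> borel_measurable borel" "g \<in> borel_measurable borel"
  shows "L2_tendsto (\<lambda>i x. F i x - G i x) (\<lambda>x. f x - g x) X"
proof -
  have "((\<lambda>i. 2 * L2sq (\<lambda>x. F i x - f x) + 2 * L2sq (\<lambda>x. G i x - g x)) \<longlongrightarrow> 2 * 0 + 2 * 0) X"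
    using F G unfolding L2_tendsto_L2sq by (intro tendsto_add ennreal_tendsto_cmult) auto
  then have l: "((\<lambda>i. 2 * L2sq (\<lambda>x. F i x - f x) + 2 * L2sq (\<lambda>x. G i x - g x)) \<longlongrightarrow> 0) X" by simp
  have b: "L2sq (\<lambda>x. F i x - G i x - (f x - g x)) \<le> 2 * L2sq (\<lambda>x. F i x - f x) + 2 * L2sq (\<lambda>x. G i x - g x)" for i
  proof -
    have "L2sq (\<lambda>x. (F i x - f x) - (G i x - g x)) \<le> 2 * L2sq (\<lambda>x. F i x - f x - 0) + 2 * L2sq (\<lambda>x. 0 - (G i x - g x))"
      by (rule L2sq_diff_le) measurable
    moreover have "L2sq (\<lambda>x. 0 - (G i x - g x)) = L2sq (\<lambda>x. G i x - g x)" unfolding L2sq_def by (simp add: norm_minus_commute)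
    moreover have "(\<lambda>x. (F i x - f x) - (G i x - g x)) = (\<lambda>x. F i x - G i x - (f x - g x))" by (simp add: fun_eq_iff)
    ultimately show ?thesis by simp
  qed
  show ?thesis unfolding L2_tendsto_L2sq
    by (rule tendsto_sandwich[OF _ _ tendsto_const l]) (use b in auto)
qed

lemma fourier_integral_cmult: "fourier_integral (\<lambda>x. c * f x) \<xi> = c * fourier_integral f \<xi>"
  unfolding fourier_integral_def by (simp add: mult.left_commute)

lemma L2_norm_diff_sq:
  assumes f: "in_L2 f" and g: "in_L2 g"
  shows "(L2_norm (\<lambda>x. f x - g x))\<^sup>2 = (L2_norm f)\<^sup>2 + (L2_norm g)\<^sup>2 - 2 * Re (L2_inner f g)"
proof -
  have "L2_inner (\<lambda>x. f x - g x) (\<lambda>x. f x - g x) = L2_inner f f - L2_inner f g - (L2_inner g f - L2_inner g g)"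
    by (simp add: L2_inner_diff_left L2_inner_diff_right f g in_L2_diff)
  moreover have "L2_inner g f = cnj (L2_inner f g)"
    unfolding L2_inner_def by (simp flip: Bochner_Integration.integral_cnj add: mult.commute)
  ultimately have "Re (L2_inner (\<lambda>x. f x - g x) (\<lambda>x. f x - g x)) = Re (L2_inner f f) + Re (L2_inner g g) - 2 * Re (L2_inner f g)"
    by simp
  then show ?thesis by (simp only: L2_inner_self f g in_L2_diff Re_complex_of_real)
qed

lemma L2sq_eq_norm:
  assumes "L2sq f = L2sq g" "in_L2 f" "in_L2 g"
  shows "(L2_norm f)\<^sup>2 = (L2_norm g)\<^sup>2"
  using assms by (simp add: L2sq_eq ennreal_inj)

text \<open>Polarisation: Plancherel's identity for \<open>f - c * g\<close> determines the real
  part of \<open>cnj c\<close> times the inner product, and \<open>c = 1\<close> and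
  \<open>c = \<i>\<close> recover the inner product itself.\<close>

lemma fourier_integral_inner:
  fixes f g :: "real^'n \<Rightarrow> complex"
  assumes f: "integrable lborel f" "in_L2 f" and g: "integrable lborel g" "in_L2 g"
  shows "L2_inner (fourier_integral f) (fourier_integral g) = L2_inner f g"
proof -
  have key: "Re (cnj c * L2_inner (fourier_integral f) (fourier_integral g)) = Re (cnj c * L2_inner f g)" for c
  proof -
    have ic: "integrable lborel (\<lambda>x. c * g x)" "in_L2 (\<lambda>x. c * g x)" using g by (auto intro: in_L2_cmult)
    have eq: "(\<lambda>\<xi>. fourier_integral f \<xi> - c * fourier_integral g \<xi>) = fourier_integral (\<lambda>x. f x - c * g x)"
      by (rule ext) (simp add: fourier_integral_diff[OF f(1) ic(1)] fourier_integral_cmult)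
    have eq2: "(\<lambda>\<xi>. c * fourier_integral g \<xi>) = fourier_integral (\<lambda>x. c * g x)"
      by (rule ext) (simp add: fourier_integral_cmult)
    have P: "(L2_norm (fourier_integral h))\<^sup>2 = (L2_norm h)\<^sup>2" "in_L2 (fourier_integral h)" if "integrable lborel h" "in_L2 h" for h :: "real^'n \<Rightarrow> complex"
      using plancherel_L1_L2[OF that] that(2) by (auto intro: L2sq_eq_norm)
    have d: "integrable lborel (\<lambda>x. f x - c * g x)" "in_L2 (\<lambda>x. f x - c * g x)" using f ic by (auto intro: in_L2_diff)
    have cr: "L2_inner u (\<lambda>x. c * v x) = cnj c * L2_inner u v" for u v :: "real^'n \<Rightarrow> complex"
      unfolding L2_inner_def by (simp add: mult.left_commute)
    have "2 * Re (L2_inner f (\<lambda>x. c * g x)) = 2 * Re (L2_inner (fourier_integral f) (\<lambda>\<xi>. c * fourier_integral g \<xi>))"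
      using L2_norm_diff_sq[OF f(2) ic(2)] L2_norm_diff_sq[OF P(2)[OF f] P(2)[OF ic]] P(1)[OF f] P(1)[OF ic] P(1)[OF d]
      unfolding eq[symmetric] eq2[symmetric] by linarith
    then show ?thesis unfolding cr by simp
  qed
  show ?thesis using key[of 1] key[of \<i>] by (intro complex_eqI) auto
qed

text \<open>\<open>fourier\<close> is a choice, so its properties depend on a witness. The
  truncations converge in \<open>L2\<close>, and by Plancherel's identity their transforms form a
  Cauchy family.\<close>

lemma fourier_exists:
  fixes f :: "real^'n \<Rightarrow> complex"
  assumes f: "in_L2 f"
  shows "in_L2 (fourier f)" "L2_tendsto (\<lambda>R. fourier_integral (trunc R f)) (fourier f) at_top"
proof -
  note [measurable] = in_L2_measurable[OF f]
  have "\<exists>g. in_L2 g \<and> L2_tendsto (\<lambda>R. fourier_integral (trunc R f)) g at_top"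
  proof (rule L2_complete_at_top)
    show "in_L2 (fourier_integral (trunc R f))" for R
      by (intro plancherel_L1_L2 integrable_trunc in_L2_trunc f)
    fix e :: real assume "e > 0"
    from L2_tendsto_Cauchy[OF trunc_tendsto[OF f] in_L2_trunc[OF f] f this]
    obtain N where N: "\<And>R S. R \<ge> N \<Longrightarrow> S \<ge> N \<Longrightarrow> L2sq (\<lambda>x. trunc R f x - trunc S f x) \<le> ennreal e" by blast
    have "L2sq (\<lambda>\<xi>. fourier_integral (trunc R f) \<xi> - fourier_integral (trunc S f) \<xi>) = L2sq (\<lambda>x. trunc R f x - trunc S f x)" for R S
    proof -
      have "(\<lambda>\<xi>. fourier_integral (trunc R f) \<xi> - fourier_integral (trunc S f) \<xi>) = fourier_integral (\<lambda>x. trunc R f x - trunc S f x)"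
        by (rule ext) (simp add: fourier_integral_diff integrable_trunc f)
      then show ?thesis
        using plancherel_L1_L2(1)[of "\<lambda>x. trunc R f x - trunc S f x"] integrable_trunc[OF f] in_L2_trunc[OF f] by (simp add: in_L2_diff)
    qed
    then show "\<exists>N. \<forall>R\<ge>N. \<forall>S\<ge>N. L2sq (\<lambda>\<xi>. fourier_integral (trunc R f) \<xi> - fourier_integral (trunc S f) \<xi>) \<le> ennreal e"
      using N by (intro exI[of _ N]) auto
  qed
  then have "in_L2 (fourier f) \<and> L2_tendsto (\<lambda>R. fourier_integral (trunc R f)) (fourier f) at_top"
    unfolding fourier_def trunc_def[abs_def] by (rule someI_ex)
  then show "in_L2 (fourier f)" "L2_tendsto (\<lambda>R. fourier_integral (trunc R f)) (fourier f) at_top" by auto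
qed

lemma in_L2_fourier_trunc: "in_L2 f \<Longrightarrow> in_L2 (fourier_integral (trunc R f))"
  by (intro plancherel_L1_L2 integrable_trunc in_L2_trunc)

lemma fourier_inner:
  fixes f g :: "real^'n \<Rightarrow> complex"
  assumes f: "in_L2 f" and g: "in_L2 g"
  shows "L2_inner (fourier f) (fourier g) = L2_inner f g"
proof -
  have "((\<lambda>R. L2_inner (fourier_integral (trunc R f)) (fourier_integral (trunc R g))) \<longlongrightarrow> L2_inner (fourier f) (fourier g)) at_top"
    by (intro L2_tendsto_inner fourier_exists f g always_eventually allI in_L2_fourier_trunc)
  moreover have "L2_inner (fourier_integral (trunc R f)) (fourier_integral (trunc R g)) = L2_inner (trunc R f) (trunc R g)" for R
    by (intro fourier_integral_inner integrable_trunc in_L2_trunc f g)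
  moreover have "((\<lambda>R. L2_inner (trunc R f) (trunc R g)) \<longlongrightarrow> L2_inner f g) at_top"
    by (intro L2_tendsto_inner trunc_tendsto f g always_eventually allI in_L2_trunc)
  ultimately show ?thesis by (auto intro: tendsto_unique[OF trivial_limit_at_top_linorder])
qed

lemma fourier_norm:
  fixes f :: "real^'n \<Rightarrow> complex"
  assumes f: "in_L2 f"
  shows "L2_norm (fourier f) = L2_norm f" "L2sq (fourier f) = L2sq f"
proof -
  have "complex_of_real ((L2_norm (fourier f))\<^sup>2) = of_real ((L2_norm f)\<^sup>2)"
    using fourier_inner[OF f f] by (simp only: L2_inner_self f fourier_exists(1))
  then have "(L2_norm (fourier f))\<^sup>2 = (L2_norm f)\<^sup>2" by (simp only: of_real_eq_iff)
  then show "L2_norm (fourier f) = L2_norm f" "L2sq (fourier f) = L2sq f"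
    by (simp_all add: L2_norm_nonneg L2sq_eq f fourier_exists(1))
qed

lemma fourier_diff:
  fixes f g :: "real^'n \<Rightarrow> complex"
  assumes f: "in_L2 f" and g: "in_L2 g"
  shows "AE \<xi> in lborel. fourier (\<lambda>x. f x - g x) \<xi> = fourier f \<xi> - fourier g \<xi>"
proof (rule L2_tendsto_unique[OF fourier_exists(2)[OF in_L2_diff[OF f g]]])
  have "L2_tendsto (\<lambda>R \<xi>. fourier_integral (trunc R f) \<xi> - fourier_integral (trunc R g) \<xi>) (\<lambda>\<xi>. fourier f \<xi> - fourier g \<xi>) at_top"
    by (intro L2_tendsto_diff fourier_exists f g in_L2_measurable in_L2_fourier_trunc)
  moreover have "(\<lambda>R \<xi>. fourier_integral (trunc R f) \<xi> - fourier_integral (trunc R g) \<xi>) = (\<lambda>R. fourier_integral (trunc R (\<lambda>x. f x - g x)))"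
  proof (intro ext)
    fix R \<xi>
    have "trunc R (\<lambda>x. f x - g x) = (\<lambda>x. trunc R f x - trunc R g x)" by (auto simp: trunc_def fun_eq_iff scaleR_diff_right)
    then show "fourier_integral (trunc R f) \<xi> - fourier_integral (trunc R g) \<xi> = fourier_integral (trunc R (\<lambda>x. f x - g x)) \<xi>"
      by (simp add: fourier_integral_diff integrable_trunc f g)
  qed
  ultimately show "L2_tendsto (\<lambda>R. fourier_integral (trunc R (\<lambda>x. f x - g x))) (\<lambda>\<xi>. fourier f \<xi> - fourier g \<xi>) at_top" by simp
  show "\<forall>\<^sub>F R in at_top. fourier_integral (trunc R (\<lambda>x. f x - g x)) \<in> borel_measurable borel"
    by (intro always_eventually allI in_L2_measurable in_L2_fourier_trunc in_L2_diff f g)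
  show "fourier (\<lambda>x. f x - g x) \<in> borel_measurable borel" "(\<lambda>\<xi>. fourier f \<xi> - fourier g \<xi>) \<in> borel_measurable borel"
    by (intro in_L2_measurable fourier_exists in_L2_diff f g)+
qed auto

lemma fourier_tendsto:
  fixes F :: "'i \<Rightarrow> real^'n \<Rightarrow> complex"
  assumes F: "L2_tendsto F f X" "eventually (\<lambda>i. in_L2 (F i)) X" and f: "in_L2 f"
  shows "L2_tendsto (\<lambda>i. fourier (F i)) (fourier f) X"
proof -
  have "eventually (\<lambda>i. L2sq (\<lambda>x. F i x - f x) = L2sq (\<lambda>\<xi>. fourier (F i) \<xi> - fourier f \<xi>)) X"
    using F(2)
  proof eventually_elim
    case (elim i)
    have "L2sq (\<lambda>\<xi>. fourier (F i) \<xi> - fourier f \<xi>) = L2sq (fourier (\<lambda>x. F i x - f x))"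
      by (rule L2sq_cong_AE) (use fourier_diff[OF elim f] in \<open>eventually_elim, simp\<close>)
    also have "\<dots> = L2sq (\<lambda>x. F i x - f x)" by (intro fourier_norm in_L2_diff elim f)
    finally show ?case by simp
  qed
  then show ?thesis using F(1) unfolding L2_tendsto_L2sq by (auto intro: Lim_transform_eventually)
qed

text \<open>The equality holds everywhere: the Fourier integrals of the truncations agree at every
  frequency, so both transforms are the same choice.\<close>

lemma fourier_cong_AE:
  fixes f g :: "real^'n \<Rightarrow> complex"
  assumes f: "f \<in> borel_measurable borel" and g: "g \<in> borel_measurable borel" and ae: "AE x in lborel. f x = g x"
  shows "fourier f = fourier g"
proof -
  have "fourier_integral (\<lambda>x. indicator (cball 0 R) x *\<^sub>R f x) = fourier_integral (\<lambda>x. indicator (cball 0 R) x *\<^sub>R g x)" for R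
  proof -
    note [measurable] = trunc_measurable[OF f, of R] trunc_measurable[OF g, of R]
    have "(\<integral>x. exp (- \<i> * of_real (x \<bullet> \<xi>)) * trunc R f x \<partial>lborel) = (\<integral>x. exp (- \<i> * of_real (x \<bullet> \<xi>)) * trunc R g x \<partial>lborel)" for \<xi>
    proof (rule integral_cong_AE)
      show "AE x in lborel. exp (- \<i> * of_real (x \<bullet> \<xi>)) * trunc R f x = exp (- \<i> * of_real (x \<bullet> \<xi>)) * trunc R g x"
        using ae by eventually_elim (simp add: trunc_def)
    qed measurable
    then show ?thesis unfolding fourier_integral_def[abs_def] trunc_def by simp
  qed
  then show ?thesis unfolding fourier_def by simp
qed

lemma fourier_eq_integral:
  fixes f :: "real^'n \<Rightarrow> complex"
  assumes i: "integrable lborel f" and f: "in_L2 f"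
  shows "AE \<xi> in lborel. fourier f \<xi> = fourier_integral f \<xi>"
proof (rule L2_tendsto_unique[OF fourier_exists(2)[OF f]])
  have "L2sq (\<lambda>\<xi>. fourier_integral (trunc R f) \<xi> - fourier_integral f \<xi>) = L2sq (\<lambda>x. trunc R f x - f x)" for R
  proof -
    have "(\<lambda>\<xi>. fourier_integral (trunc R f) \<xi> - fourier_integral f \<xi>) = fourier_integral (\<lambda>x. trunc R f x - f x)"
      by (rule ext) (simp add: fourier_integral_diff integrable_trunc f i)
    then show ?thesis
      using plancherel_L1_L2(1)[of "\<lambda>x. trunc R f x - f x"] integrable_trunc[OF f] in_L2_trunc[OF f] i f by (simp add: in_L2_diff)
  qed
  then show "L2_tendsto (\<lambda>R. fourier_integral (trunc R f)) (fourier_integral f) at_top"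
    using trunc_tendsto[OF f] by (simp add: L2_tendsto_L2sq)
qed (use in_L2_measurable[OF f] in_L2_fourier_trunc[OF f] fourier_exists(1)[OF f] in \<open>auto intro: in_L2_measurable fourier_integral_measurable\<close>)

text \<open>The transform of \<open>x \<mapsto> fourier_integral \<phi> (- x)\<close> and \<open>\<phi>\<close> have the same norm, and their inner product is evaluated by the
  multiplication formula.\<close>

theorem fourier_inversion:
  fixes \<phi> :: "real^'n \<Rightarrow> complex"
  assumes i: "integrable lborel \<phi>" and \<phi>: "in_L2 \<phi>"
  defines "v \<equiv> \<lambda>x. fourier_integral \<phi> (- x)"
  shows "in_L2 v" "AE \<xi> in lborel. fourier v \<xi> = \<phi> \<xi>"
proof -
  show v: "in_L2 v" unfolding v_def by (intro in_L2_reflect plancherel_L1_L2 i \<phi>)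
  have nv: "(L2_norm v)\<^sup>2 = (L2_norm \<phi>)\<^sup>2"
  proof (rule L2sq_eq_norm[OF _ v \<phi>])
    show "L2sq v = L2sq \<phi>" unfolding v_def
      using L2sq_reflect[OF fourier_integral_measurable[OF in_L2_measurable[OF \<phi>]]] plancherel_L1_L2(1)[OF i \<phi>] by simp
  qed
  have Fv: "in_L2 (fourier v)" by (rule fourier_exists(1)[OF v])
  have "((\<lambda>R. L2_inner (fourier_integral (trunc R v)) \<phi>) \<longlongrightarrow> L2_inner (fourier v) \<phi>) at_top"
    by (intro L2_tendsto_inner fourier_exists v \<phi> always_eventually allI in_L2_fourier_trunc L2_tendsto_const)
  moreover have "L2_inner (fourier_integral (trunc R v)) \<phi> = L2_inner (trunc R v) v" for R
  proof -
    have "L2_inner (fourier_integral (trunc R v)) \<phi> = (\<integral>x. trunc R v x * fourier_integral (\<lambda>x. cnj (\<phi> x)) x \<partial>lborel)"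
      unfolding L2_inner_def by (rule fourier_integral_multiplication[OF integrable_trunc[OF v]]) (use i in simp)
    also have "\<dots> = L2_inner (trunc R v) v"
      unfolding L2_inner_def cnj_fourier_integral(2)[OF in_L2_measurable[OF \<phi>]] v_def ..
    finally show ?thesis .
  qed
  moreover have "((\<lambda>R. L2_inner (trunc R v) v) \<longlongrightarrow> L2_inner v v) at_top"
    by (intro L2_tendsto_inner trunc_tendsto v always_eventually allI in_L2_trunc L2_tendsto_const)
  ultimately have "L2_inner (fourier v) \<phi> = L2_inner v v"
    by (auto intro: tendsto_unique[OF trivial_limit_at_top_linorder])
  then have "Re (L2_inner (fourier v) \<phi>) = (L2_norm \<phi>)\<^sup>2" by (simp only: L2_inner_self[OF v] Re_complex_of_real nv)
  moreover have "(L2_norm (fourier v))\<^sup>2 = (L2_norm \<phi>)\<^sup>2" using fourier_norm(1)[OF v] nv by simp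
  ultimately have "(L2_norm (\<lambda>\<xi>. fourier v \<xi> - \<phi> \<xi>))\<^sup>2 = 0" unfolding L2_norm_diff_sq[OF Fv \<phi>] by simp
  then have "L2sq (\<lambda>\<xi>. fourier v \<xi> - \<phi> \<xi>) = 0" by (simp only: L2sq_eq in_L2_diff Fv \<phi> ennreal_0)
  moreover have "(\<lambda>\<xi>. ennreal ((norm (fourier v \<xi> - \<phi> \<xi>))\<^sup>2)) \<in> borel_measurable lborel"
    using in_L2_measurable[OF in_L2_diff[OF Fv \<phi>]] by simp
  ultimately have "AE \<xi> in lborel. ennreal ((norm (fourier v \<xi> - \<phi> \<xi>))\<^sup>2) = 0" unfolding L2sq_def
    by (subst (asm) nn_integral_0_iff_AE) auto
  then show "AE \<xi> in lborel. fourier v \<xi> = \<phi> \<xi>" by eventually_elim (simp add: ennreal_eq_0_iff)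
qed

section \<open>Test functions and weak gradients\<close>

text \<open>With \<open>y = 1 / (1 - s)\<close> this is \<open>y ^ k * exp (- y)\<close>, continued
  by 0. The powers are included because differentiation raises them: the derivative of the member
  \<open>k\<close> is \<open>k\<close> times the next member minus the one after that.\<close>

definition flat_exp :: "nat \<Rightarrow> real \<Rightarrow> real" where
  "flat_exp k s = (if s < 1 then (1 / (1 - s)) ^ k * exp (- (1 / (1 - s))) else 0)"

lemma power_exp_neg_le: "y ^ n * exp (- y) \<le> real n ^ n" if "y > 0" "n > 0" for y :: real
proof -
  have "(y / real n) ^ n \<le> exp (y / real n) ^ n"
  proof (rule power_mono)
    show "y / real n \<le> exp (y / real n)" using exp_ge_add_one_self[of "y / real n"] by linarith
  qed (use that in auto)
  also have "\<dots> = exp y" using that by (simp add: exp_of_nat_mult[symmetric])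
  finally have "y ^ n \<le> real n ^ n * exp y" using that by (simp add: power_divide field_simps)
  then show ?thesis by (simp add: exp_minus field_simps)
qed

text \<open>The factor \<open>1 / y\<^sup>2 = (1 - s)\<^sup>2\<close> is split off and
  \<open>y ^ (k + 2) * exp (- y)\<close> is bounded. Quadratic vanishing at \<open>s = 1\<close>
  yields the derivative 0 at the junction.\<close>

lemma flat_bound: "\<bar>flat_exp k s\<bar> \<le> real (k + 2) ^ (k + 2) * (s - 1)\<^sup>2"
proof (cases "s < 1")
  case True
  define y where "y = 1 / (1 - s)"
  have y: "y > 0" using True by (simp add: y_def)
  have "flat_exp k s = (y ^ (k + 2) * exp (- y)) / y\<^sup>2" using True y by (simp add: flat_exp_def y_def[symmetric] power_add power2_eq_square field_simps)
  also have "\<dots> \<le> real (k + 2) ^ (k + 2) / y\<^sup>2" using y by (intro divide_right_mono power_exp_neg_le) auto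
  also have "\<dots> = real (k + 2) ^ (k + 2) * (s - 1)\<^sup>2"
    unfolding y_def by (simp add: power_divide power2_commute)
  finally show ?thesis using True by (simp add: flat_exp_def)
qed (simp add: flat_exp_def)

lemma flat_deriv: "(flat_exp k has_real_derivative (real k * flat_exp (Suc k) s - flat_exp (k + 2) s)) (at s)"
proof -
  consider "s < 1" | "s = 1" | "s > 1" by linarith
  then show ?thesis
  proof cases
    case 1
    define Y where "Y s = 1 / (1 - s)" for s :: real
    have dY: "(Y has_real_derivative (Y s)\<^sup>2) (at s)"
      unfolding Y_def[abs_def] using 1 by (auto intro!: derivative_eq_intros simp: power2_eq_square)
    have "((\<lambda>s. Y s ^ k * exp (- Y s)) has_real_derivative
        real k * Y s ^ (k - 1) * (Y s)\<^sup>2 * exp (- Y s) - Y s ^ k * (Y s)\<^sup>2 * exp (- Y s)) (at s)"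
      by (auto intro!: derivative_eq_intros dY)
    moreover have "real k * Y s ^ (k - 1) * (Y s)\<^sup>2 * exp (- Y s) - Y s ^ k * (Y s)\<^sup>2 * exp (- Y s)
        = real k * flat_exp (Suc k) s - flat_exp (k + 2) s"
      using 1 by (cases k) (simp_all add: flat_exp_def Y_def[symmetric] power2_eq_square mult_ac)
    ultimately have "((\<lambda>s. Y s ^ k * exp (- Y s)) has_real_derivative (real k * flat_exp (Suc k) s - flat_exp (k + 2) s)) (at s)" by simp
    then show ?thesis
      by (rule has_field_derivative_transform_within_open[where S = "{..<1}"]) (use 1 in \<open>auto simp: Y_def flat_exp_def\<close>)
  next
    case 2
    define C where "C = real (k + 2) ^ (k + 2)"
    have "((\<lambda>y. (flat_exp k y - flat_exp k 1) / (y - 1)) \<longlongrightarrow> 0) (at 1)"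
    proof (rule Lim_null_comparison)
      show "eventually (\<lambda>y. norm ((flat_exp k y - flat_exp k 1) / (y - 1)) \<le> C * \<bar>y - 1\<bar>) (at 1)"
        unfolding eventually_at_filter
      proof (intro always_eventually allI impI)
        fix y :: real assume y: "y \<noteq> 1"
        have "\<bar>flat_exp k y\<bar> \<le> C * \<bar>y - 1\<bar> * \<bar>y - 1\<bar>"
          using flat_bound[of k y] by (simp add: C_def power2_eq_square mult.assoc)
        then show "norm ((flat_exp k y - flat_exp k 1) / (y - 1)) \<le> C * \<bar>y - 1\<bar>"
          using y by (simp add: flat_exp_def[of k 1] abs_divide pos_divide_le_eq)
      qed
      have "((\<lambda>y. C * \<bar>y - 1\<bar>) \<longlongrightarrow> C * \<bar>1 - 1\<bar>) (at 1)" by (intro tendsto_intros)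
      then show "((\<lambda>y. C * \<bar>y - 1\<bar>) \<longlongrightarrow> 0) (at 1)" by simp
    qed
    then show ?thesis unfolding 2 has_field_derivative_iff by (simp add: flat_exp_def)
  next
    case 3
    have "((\<lambda>_. 0) has_real_derivative 0) (at s)" by simp
    then have "(flat_exp k has_real_derivative 0) (at s)"
      by (rule has_field_derivative_transform_within_open[where S = "{1<..}"]) (use 3 in \<open>auto simp: flat_exp_def\<close>)
    then show ?thesis using 3 by (simp add: flat_exp_def)
  qed
qed

text \<open>A class of functions that is closed under directional derivatives, hence consists of smooth
  functions.\<close>

inductive_set smooth_class :: "(real^'n \<Rightarrow> real) set" where
  flat: "(\<lambda>x. flat_exp k (a * (x \<bullet> x))) \<in> smooth_class"
| inner: "(\<lambda>x. x \<bullet> v) \<in> smooth_class"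
| const: "(\<lambda>x. c) \<in> smooth_class"
| cos: "(\<lambda>x. cos (x \<bullet> v)) \<in> smooth_class"
| sin: "(\<lambda>x. sin (x \<bullet> v)) \<in> smooth_class"
| add: "f \<in> smooth_class \<Longrightarrow> g \<in> smooth_class \<Longrightarrow> (\<lambda>x. f x + g x) \<in> smooth_class"
| mult: "f \<in> smooth_class \<Longrightarrow> g \<in> smooth_class \<Longrightarrow> (\<lambda>x. f x * g x) \<in> smooth_class"

lemma flat_inner_deriv:
  "((\<lambda>x. flat_exp k (a * (x \<bullet> x))) has_derivative
     (\<lambda>v. (real k * flat_exp (Suc k) (a * (x \<bullet> x)) - flat_exp (k + 2) (a * (x \<bullet> x))) * (2 * a * (x \<bullet> v)))) (at x)"
proof -
  have "((\<lambda>x. a * (x \<bullet> x)) has_derivative (\<lambda>v. 2 * a * (x \<bullet> v))) (at x)"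
    by (auto intro!: derivative_eq_intros simp: inner_commute algebra_simps)
  from DERIV_compose_FDERIV[OF flat_deriv this] show ?thesis by (simp add: mult_ac)
qed

lemma smooth_class_deriv:
  assumes "f \<in> smooth_class"
  shows "\<exists>f'. (\<forall>x. (f has_derivative f' x) (at x)) \<and> (\<forall>v. (\<lambda>x. f' x v) \<in> smooth_class)"
  using assms
proof induction
  case (flat k a)
  show ?case
  proof (intro exI[of _ "\<lambda>x v. (real k * flat_exp (Suc k) (a * (x \<bullet> x)) - flat_exp (k + 2) (a * (x \<bullet> x))) * (2 * a * (x \<bullet> v))"] conjI allI flat_inner_deriv)
    fix v
    have "(\<lambda>x. (real k * flat_exp (Suc k) (a * (x \<bullet> x)) + (-1) * flat_exp (k + 2) (a * (x \<bullet> x))) * (2 * a * (x \<bullet> v))) \<in> smooth_class"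
      by (intro smooth_class.intros)
    then show "(\<lambda>x. (real k * flat_exp (Suc k) (a * (x \<bullet> x)) - flat_exp (k + 2) (a * (x \<bullet> x))) * (2 * a * (x \<bullet> v))) \<in> smooth_class" by simp
  qed
next
  case (inner v)
  show ?case
    by (intro exI[of _ "\<lambda>x w. w \<bullet> v"] conjI allI smooth_class.const) (auto intro!: derivative_eq_intros)
next
  case (const c)
  show ?case by (intro exI[of _ "\<lambda>x w. 0"] conjI allI smooth_class.const) auto
next
  case (cos v)
  show ?case
  proof (intro exI[of _ "\<lambda>x w. - sin (x \<bullet> v) * (w \<bullet> v)"] conjI allI)
    show "((\<lambda>x. cos (x \<bullet> v)) has_derivative (\<lambda>w. - sin (x \<bullet> v) * (w \<bullet> v))) (at x)" for x
      by (auto intro!: derivative_eq_intros)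
    have "(\<lambda>x. (-1) * sin (x \<bullet> v) * (w \<bullet> v)) \<in> smooth_class" for w by (intro smooth_class.intros)
    then show "(\<lambda>x. - sin (x \<bullet> v) * (w \<bullet> v)) \<in> smooth_class" for w by simp
  qed
next
  case (sin v)
  show ?case
  proof (intro exI[of _ "\<lambda>x w. cos (x \<bullet> v) * (w \<bullet> v)"] conjI allI)
    show "((\<lambda>x. sin (x \<bullet> v)) has_derivative (\<lambda>w. cos (x \<bullet> v) * (w \<bullet> v))) (at x)" for x
      by (auto intro!: derivative_eq_intros)
    show "(\<lambda>x. cos (x \<bullet> v) * (w \<bullet> v)) \<in> smooth_class" for w by (intro smooth_class.intros)
  qed
next
  case (add f g)
  then obtain f' g' where "\<forall>x. (f has_derivative f' x) (at x)" "\<forall>v. (\<lambda>x. f' x v) \<in> smooth_class"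
    "\<forall>x. (g has_derivative g' x) (at x)" "\<forall>v. (\<lambda>x. g' x v) \<in> smooth_class" by blast
  then show ?case
    by (intro exI[of _ "\<lambda>x v. f' x v + g' x v"] conjI allI has_derivative_add smooth_class.add) auto
next
  case (mult f g)
  then obtain f' g' where *: "\<forall>x. (f has_derivative f' x) (at x)" "\<forall>v. (\<lambda>x. f' x v) \<in> smooth_class"
    "\<forall>x. (g has_derivative g' x) (at x)" "\<forall>v. (\<lambda>x. g' x v) \<in> smooth_class" by blast
  show ?case
  proof (intro exI[of _ "\<lambda>x v. f x * g' x v + f' x v * g x"] conjI allI)
    show "((\<lambda>x. f x * g x) has_derivative (\<lambda>v. f x * g' x v + f' x v * g x)) (at x)" for x
      using * by (intro has_derivative_mult) auto
    show "(\<lambda>x. f x * g' x v + f' x v * g x) \<in> smooth_class" for v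
      using * mult.hyps by (intro smooth_class.add smooth_class.mult) auto
  qed
qed

lemma smooth_class_C_k: "f \<in> smooth_class \<Longrightarrow> C_k k f"
proof (induction k arbitrary: f)
  case 0
  obtain f' where "\<forall>x. (f has_derivative f' x) (at x)" using smooth_class_deriv[OF 0] by blast
  then show ?case by (auto intro: continuous_at_imp_continuous_on has_derivative_continuous)
next
  case (Suc k)
  obtain f' where f': "\<forall>x. (f has_derivative f' x) (at x)" "\<forall>v. (\<lambda>x. f' x v) \<in> smooth_class"
    using smooth_class_deriv[OF Suc.prems] by blast
  then have "frechet_derivative f (at x) = f' x" for x using frechet_derivative_at by metis
  then show ?case using f' Suc.IH by (auto simp: differentiable_def)
qed

lemma smooth_class_test_function:
  assumes "f \<in> smooth_class" "\<And>x. norm x > R \<Longrightarrow> f x = 0"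
  shows "test_function f"
proof -
  have "{x. f x \<noteq> 0} \<subseteq> cball 0 R" using assms(2) by (auto simp: not_less[symmetric])
  then have "closure {x. f x \<noteq> 0} \<subseteq> cball 0 R" by (rule closure_minimal) auto
  then have "bounded (closure {x. f x \<noteq> 0})" using bounded_cball bounded_subset by blast
  then have "compact (closure {x. f x \<noteq> 0})" by (simp add: compact_eq_bounded_closed)
  then show ?thesis unfolding test_function_def using smooth_class_C_k[OF assms(1)] by blast
qed

text \<open>The squared norm keeps the argument smooth at the origin, and \<open>exp 1\<close>
  normalises the value there to 1.\<close>

definition cutoff :: "nat \<Rightarrow> real^'n \<Rightarrow> real" where
  "cutoff n x = exp 1 * flat_exp 0 ((1 / real (Suc n))\<^sup>2 * (x \<bullet> x))"

text \<open>The partial derivative of \<open>cutoff n\<close> in direction \<open>j\<close>; for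
  \<open>k = 0\<close> the derivative of \<open>flat_exp\<close> consists of
  \<open>- flat_exp 2\<close> alone.\<close>

definition cutoff' :: "nat \<Rightarrow> 'n \<Rightarrow> real^'n \<Rightarrow> real" where
  "cutoff' n j x = exp 1 * (- flat_exp 2 ((1 / real (Suc n))\<^sup>2 * (x \<bullet> x)) * (2 * (1 / real (Suc n))\<^sup>2 * x $ j))"

lemma cutoff_smooth: "cutoff n \<in> smooth_class"
  unfolding cutoff_def[abs_def] by (intro smooth_class.intros)

lemma continuous_on_flat: "continuous_on UNIV (flat_exp k)"
  by (intro continuous_at_imp_continuous_on ballI DERIV_isCont[OF flat_deriv])

lemma flat_measurable [measurable]: "flat_exp k \<in> borel_measurable borel"
  by (rule borel_measurable_continuous_onI[OF continuous_on_flat])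

lemma cutoff_measurable [measurable]: "cutoff n \<in> borel_measurable borel" "cutoff' n j \<in> borel_measurable borel"
  unfolding cutoff_def[abs_def] cutoff'_def[abs_def] by measurable

lemma cutoff_deriv: "(cutoff n has_derivative (\<lambda>v. exp 1 * (- flat_exp 2 ((1 / real (Suc n))\<^sup>2 * (x \<bullet> x)) * (2 * (1 / real (Suc n))\<^sup>2 * (x \<bullet> v))))) (at x)"
  unfolding cutoff_def[abs_def] using has_derivative_mult_right[OF flat_inner_deriv[of 0 "(1 / real (Suc n))\<^sup>2" x], of "exp 1"]
  by (simp add: numeral_2_eq_2)

lemma cutoff_outside: "norm x > real (Suc n) \<Longrightarrow> cutoff n x = 0"
proof -
  assume x: "norm x > real (Suc n)"
  have "1 \<le> (norm x / real (Suc n))\<^sup>2" using x by (intro one_le_power) (simp add: field_simps)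
  moreover have "(norm x / real (Suc n))\<^sup>2 = (1 / real (Suc n))\<^sup>2 * (x \<bullet> x)" by (simp add: power_divide dot_square_norm)
  ultimately have "\<not> (1 / real (Suc n))\<^sup>2 * (x \<bullet> x) < 1" by simp
  then show ?thesis unfolding cutoff_def flat_exp_def by simp
qed

lemma flat_le: "0 \<le> s \<Longrightarrow> \<bar>flat_exp 0 s\<bar> \<le> exp (-1)"
proof (cases "s < 1")
  case True
  assume s: "0 \<le> s"
  have "1 \<le> 1 / (1 - s)" using True s by (simp add: field_simps)
  then show ?thesis using True by (simp add: flat_exp_def)
qed (simp add: flat_exp_def)

lemma cutoff_le: "\<bar>cutoff n x\<bar> \<le> 1"
proof -
  have "\<bar>cutoff n x\<bar> \<le> exp 1 * exp (-1)" unfolding cutoff_def abs_mult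
    by (intro mult_mono flat_le) auto
  then show ?thesis by (simp flip: exp_add)
qed

lemma cutoff_tendsto: "(\<lambda>n. cutoff n x) \<longlonglongrightarrow> 1"
proof -
  have "(\<lambda>n. (1 / real (Suc n))\<^sup>2 * (x \<bullet> x)) \<longlonglongrightarrow> 0\<^sup>2 * (x \<bullet> x)"
    using LIMSEQ_inverse_real_of_nat by (intro tendsto_intros) (simp add: divide_inverse)
  then have "(\<lambda>n. (1 / real (Suc n))\<^sup>2 * (x \<bullet> x)) \<longlonglongrightarrow> 0" by simp
  moreover have "isCont (flat_exp 0) 0" using flat_deriv DERIV_isCont by blast
  ultimately have "(\<lambda>n. flat_exp 0 ((1 / real (Suc n))\<^sup>2 * (x \<bullet> x))) \<longlonglongrightarrow> flat_exp 0 0"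
    by (rule isCont_tendsto_compose[rotated])
  then have "(\<lambda>n. exp 1 * flat_exp 0 ((1 / real (Suc n))\<^sup>2 * (x \<bullet> x))) \<longlonglongrightarrow> exp 1 * flat_exp 0 0" by (intro tendsto_intros)
  then show ?thesis by (simp add: cutoff_def flat_exp_def flip: exp_add)
qed

text \<open>The bound of \<open>flat_exp 2\<close> is \<open>4 ^ 4 = 256\<close>, and on the support
  the coordinate is at most the radius; the chain rule contributes 2 divided by the radius.\<close>

lemma cutoff'_le: "\<bar>cutoff' n j x\<bar> \<le> exp 1 * 512 / real (Suc n)"
proof -
  define a where "a = 1 / real (Suc n)"
  have a: "a > 0" by (simp add: a_def)
  have "\<bar>flat_exp 2 (a\<^sup>2 * (x \<bullet> x))\<bar> * (2 * a\<^sup>2 * \<bar>x $ j\<bar>) \<le> 512 * a"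
  proof (cases "a\<^sup>2 * (x \<bullet> x) < 1")
    case True
    have "(a * norm x)\<^sup>2 < 1\<^sup>2" using True by (simp add: power_mult_distrib dot_square_norm)
    then have ax: "a * norm x < 1" by (rule power_less_imp_less_base) simp
    have "a * \<bar>x $ j\<bar> \<le> a * norm x" using a component_le_norm_cart[of x j] by (intro mult_left_mono) auto
    then have axj: "a * \<bar>x $ j\<bar> \<le> 1" using ax by simp
    have "(a\<^sup>2 * (x \<bullet> x) - 1)\<^sup>2 \<le> 1"
      using True by (simp add: abs_square_le_1 abs_le_iff)
    then have "\<bar>flat_exp 2 (a\<^sup>2 * (x \<bullet> x))\<bar> \<le> 256 * 1"
      using flat_bound[of 2 "a\<^sup>2 * (x \<bullet> x)"] by (simp add: eval_nat_numeral)
    then have "\<bar>flat_exp 2 (a\<^sup>2 * (x \<bullet> x))\<bar> * (2 * a * (a * \<bar>x $ j\<bar>)) \<le> 256 * (2 * a * 1)"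
      using axj a by (intro mult_mono) auto
    then show ?thesis by (simp add: power2_eq_square mult_ac)
  next
    case False
    then show ?thesis using a by (simp add: flat_exp_def)
  qed
  then have "exp 1 * (\<bar>flat_exp 2 (a\<^sup>2 * (x \<bullet> x))\<bar> * (2 * a\<^sup>2 * \<bar>x $ j\<bar>)) \<le> exp 1 * (512 * a)" by (intro mult_left_mono) auto
  then show ?thesis using a unfolding cutoff'_def a_def[symmetric] by (simp add: abs_mult a_def)
qed

text \<open>Up to sign, the real and imaginary parts of a truncated exponential, because
  \<open>weak_gradient\<close> is tested against real functions.\<close>

lemma cutoff_test:
  "test_function (\<lambda>x. cutoff n x * cos (x \<bullet> \<xi>))" "test_function (\<lambda>x. cutoff n x * sin (x \<bullet> \<xi>))"
  by (rule smooth_class_test_function[of _ "real (Suc n)"];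
      (intro smooth_class.intros cutoff_smooth)?; simp add: cutoff_outside)+

lemma cutoff_test_deriv:
  "frechet_derivative (\<lambda>x. cutoff n x * cos (x \<bullet> \<xi>)) (at x) (axis j 1) = cutoff' n j x * cos (x \<bullet> \<xi>) - cutoff n x * sin (x \<bullet> \<xi>) * \<xi> $ j"
  "frechet_derivative (\<lambda>x. cutoff n x * sin (x \<bullet> \<xi>)) (at x) (axis j 1) = cutoff' n j x * sin (x \<bullet> \<xi>) + cutoff n x * cos (x \<bullet> \<xi>) * \<xi> $ j"
proof -
  have ax: "x \<bullet> axis j 1 = x $ j" "axis j 1 \<bullet> \<xi> = \<xi> $ j" by (simp_all add: inner_axis inner_axis')
  let ?d = "\<lambda>v. exp 1 * (- flat_exp 2 ((1 / real (Suc n))\<^sup>2 * (x \<bullet> x)) * (2 * (1 / real (Suc n))\<^sup>2 * (x \<bullet> v)))"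
  have c: "((\<lambda>x. cos (x \<bullet> \<xi>)) has_derivative (\<lambda>w. - sin (x \<bullet> \<xi>) * (w \<bullet> \<xi>))) (at x)"
    and s: "((\<lambda>x. sin (x \<bullet> \<xi>)) has_derivative (\<lambda>w. cos (x \<bullet> \<xi>) * (w \<bullet> \<xi>))) (at x)"
    by (auto intro!: derivative_eq_intros)
  show "frechet_derivative (\<lambda>x. cutoff n x * cos (x \<bullet> \<xi>)) (at x) (axis j 1) = cutoff' n j x * cos (x \<bullet> \<xi>) - cutoff n x * sin (x \<bullet> \<xi>) * \<xi> $ j"
    unfolding frechet_derivative_at[OF has_derivative_mult[OF cutoff_deriv c], symmetric] ax cutoff'_def by simp
  show "frechet_derivative (\<lambda>x. cutoff n x * sin (x \<bullet> \<xi>)) (at x) (axis j 1) = cutoff' n j x * sin (x \<bullet> \<xi>) + cutoff n x * cos (x \<bullet> \<xi>) * \<xi> $ j"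
    unfolding frechet_derivative_at[OF has_derivative_mult[OF cutoff_deriv s], symmetric] ax cutoff'_def by simp
qed

section \<open>Transforms of weak gradients\<close>

lemma fourier_integral_tendsto:
  fixes F :: "nat \<Rightarrow> real^'n \<Rightarrow> complex"
  assumes F: "L2_tendsto F f sequentially" and i: "\<And>n. integrable lborel (F n)" "\<And>n. in_L2 (F n)" and f: "in_L2 f"
  shows "L2_tendsto (\<lambda>n. fourier_integral (F n)) (fourier f) sequentially"
proof -
  have "L2sq (\<lambda>\<xi>. fourier (F n) \<xi> - fourier f \<xi>) = L2sq (\<lambda>\<xi>. fourier_integral (F n) \<xi> - fourier f \<xi>)" for n
    by (rule L2sq_cong_AE) (use fourier_eq_integral[OF i] in \<open>eventually_elim, simp\<close>)
  then show ?thesis using fourier_tendsto[OF F _ f] i(2) by (simp add: L2_tendsto_L2sq)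
qed

lemma L2_tendsto_mult_bounded:
  fixes F :: "'i \<Rightarrow> real^'n \<Rightarrow> complex"
  assumes F: "L2_tendsto F f X" and m: "\<And>x. norm (m x) \<le> 1"
  shows "L2_tendsto (\<lambda>i x. m x * F i x) (\<lambda>x. m x * f x) X"
proof -
  have "L2sq (\<lambda>x. m x * F i x - m x * f x) \<le> L2sq (\<lambda>x. F i x - f x)" for i
    by (rule L2sq_mono) (use m in \<open>simp add: norm_mult mult_left_le_one_le flip: right_diff_distrib\<close>)
  then show ?thesis unfolding L2_tendsto_L2sq
    by (intro tendsto_sandwich[OF _ _ tendsto_const F[unfolded L2_tendsto_L2sq]]) auto
qed

text \<open>The weak gradient is tested against the truncated exponentials
  \<open>e\<^bsup>-i x \<xi>\<^esup>\<close>; the derivative of the cutoff disappears in the limit.\<close>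

lemma fourier_weak_derivative:
  fixes f :: "real^'n \<Rightarrow> complex"
  assumes f: "in_L2 f" and g: "in_L2 g" and weak: "weak_gradient f g"
  shows "AE \<xi> in lborel. fourier (\<lambda>x. g x $ j) \<xi> = \<i> * of_real (\<xi> $ j) * fourier f \<xi>"
proof -
  note [measurable] = in_L2_measurable[OF f] in_L2_measurable[OF g]
  define gj where "gj x = g x $ j" for x
  have gjm [measurable]: "gj \<in> borel_measurable borel"
    unfolding gj_def[abs_def] by (rule measurable_compose[OF in_L2_measurable[OF g]]) (intro borel_measurable_continuous_onI continuous_intros)
  have gj: "in_L2 gj"
    by (rule in_L2_dominated[OF g gjm]) (simp add: gj_def component_le_norm_cart Finite_Cartesian_Product.norm_nth_le)
  define c where "c n x = (of_real (cutoff n x) :: complex)" for n and x :: "real^'n"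
  define c' where "c' n x = (of_real (cutoff' n j x) :: complex)" for n and x :: "real^'n"
  have cm [measurable]: "c n \<in> borel_measurable borel" "c' n \<in> borel_measurable borel" for n
    unfolding c_def[abs_def] c'_def[abs_def] by measurable
  have c'out: "c' n x = 0" if "norm x > real (Suc n)" for n x
  proof -
    have "1 \<le> (norm x / real (Suc n))\<^sup>2" using that by (intro one_le_power) (simp add: field_simps)
    moreover have "(norm x / real (Suc n))\<^sup>2 = (1 / real (Suc n))\<^sup>2 * (x \<bullet> x)" by (simp add: power_divide dot_square_norm)
    ultimately have "\<not> (1 / real (Suc n))\<^sup>2 * (x \<bullet> x) < 1" by simp
    then show ?thesis unfolding c'_def cutoff'_def flat_exp_def by simp
  qed
  have cL2: "in_L2 (c n)" for n
    by (rule in_L2_dominated[OF in_L2_indicator[of "real (Suc n)"]])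
      (use cutoff_le cutoff_outside in \<open>auto simp: c_def indicator_def not_le\<close>)
  have c'L2: "in_L2 (c' n)" for n
  proof (rule in_L2_dominated[OF in_L2_cmult[OF in_L2_indicator[of "real (Suc n)"], of "of_real (exp 1 * 512)"]])
    have "\<bar>cutoff' n j x\<bar> \<le> exp 1 * 512" for x :: "real^'n"
    proof -
      have "exp 1 * 512 / real (Suc n) \<le> exp 1 * (512::real) / 1" by (intro divide_left_mono) auto
      then show ?thesis using cutoff'_le[of n j x] by simp
    qed
    then show "cmod (c' n x) \<le> cmod (of_real (exp 1 * 512) * (indicator (cball 0 (real (Suc n))) x *\<^sub>R 1))" for x
      using c'out[of n x] by (cases "norm x \<le> real (Suc n)") (auto simp: c'_def indicator_def norm_mult)
  qed measurable
  have i: "integrable lborel (\<lambda>x. c n x * h x)" "integrable lborel (\<lambda>x. c' n x * h x)" if "in_L2 h" for n h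
    using integrable_mult_L2[OF cL2 that] integrable_mult_L2[OF c'L2 that] by auto
  have b: "in_L2 (\<lambda>x. c n x * h x)" "in_L2 (\<lambda>x. c' n x * h x)" if h: "in_L2 h" for n h
  proof -
    show "in_L2 (\<lambda>x. c n x * h x)" by (rule in_L2_mult_bounded[OF h, of _ 1]) (auto simp: c_def cutoff_le)
    show "in_L2 (\<lambda>x. c' n x * h x)"
      by (rule in_L2_mult_bounded[OF h, of _ "exp 1 * 512 / real (Suc n)"]) (use cutoff'_le in \<open>auto simp: c'_def\<close>)
  qed
  \<comment> \<open>The two real identities, tested with cosine and sine, are recombined into one
    for the exponential. The product rule produces the extra term with the gradient of the
    cutoff.\<close>
  have id: "fourier_integral (\<lambda>x. c n x * gj x) \<xi> = \<i> * of_real (\<xi> $ j) * fourier_integral (\<lambda>x. c n x * f x) \<xi>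
      - fourier_integral (\<lambda>x. c' n x * f x) \<xi>" for n \<xi>
  proof -
    define E where "E x = exp (- \<i> * of_real (x \<bullet> \<xi>))" for x
    have E: "E x = of_real (cos (x \<bullet> \<xi>)) - \<i> * of_real (sin (x \<bullet> \<xi>))" for x
      unfolding E_def using cis_conv_exp[of "- (x \<bullet> \<xi>)"] by (simp add: complex_eq_iff)
    have Em [measurable]: "E \<in> borel_measurable borel" unfolding E_def by measurable
    have icos: "integrable lborel (\<lambda>x. complex_of_real (u x) * (p x * h x))"
      if h: "integrable lborel (\<lambda>x. p x * h x)" and u: "\<And>x. \<bar>u x\<bar> \<le> 1" "u \<in> borel_measurable borel" for u and p h :: "real^'n \<Rightarrow> complex"
    proof (rule Bochner_Integration.integrable_bound[OF h])
      show "(\<lambda>x. complex_of_real (u x) * (p x * h x)) \<in> borel_measurable lborel"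
        using borel_measurable_integrable[OF h] u(2) by measurable
      show "AE x in lborel. norm (complex_of_real (u x) * (p x * h x)) \<le> norm (p x * h x)"
        using u(1) by (auto simp: norm_mult intro!: mult_left_le_one_le)
    qed
    have tr: "\<And>x. \<bar>cos (x \<bullet> \<xi>)\<bar> \<le> 1" "(\<lambda>x. cos (x \<bullet> \<xi>)) \<in> borel_measurable borel"
      "\<And>x. \<bar>sin (x \<bullet> \<xi>)\<bar> \<le> 1" "(\<lambda>x. sin (x \<bullet> \<xi>)) \<in> borel_measurable borel"
      by (auto intro!: borel_measurable_continuous_onI continuous_intros)
    note ic = icos[OF i(1)[OF f, of n] tr(1,2)] icos[OF i(1)[OF f, of n] tr(3,4)]
      icos[OF i(2)[OF f, of n] tr(1,2)] icos[OF i(2)[OF f, of n] tr(3,4)]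
      icos[OF i(1)[OF gj, of n] tr(1,2)] icos[OF i(1)[OF gj, of n] tr(3,4)]
    define Cf Sf Cf' Sf' Cg Sg where "Cf = (\<integral>x. of_real (cos (x \<bullet> \<xi>)) * (c n x * f x) \<partial>lborel)"
      and "Sf = (\<integral>x. of_real (sin (x \<bullet> \<xi>)) * (c n x * f x) \<partial>lborel)"
      and "Cf' = (\<integral>x. of_real (cos (x \<bullet> \<xi>)) * (c' n x * f x) \<partial>lborel)"
      and "Sf' = (\<integral>x. of_real (sin (x \<bullet> \<xi>)) * (c' n x * f x) \<partial>lborel)"
      and "Cg = (\<integral>x. of_real (cos (x \<bullet> \<xi>)) * (c n x * gj x) \<partial>lborel)"
      and "Sg = (\<integral>x. of_real (sin (x \<bullet> \<xi>)) * (c n x * gj x) \<partial>lborel)"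
    have "(\<integral>x. (cutoff' n j x * cos (x \<bullet> \<xi>) - cutoff n x * sin (x \<bullet> \<xi>) * \<xi> $ j) *\<^sub>R f x \<partial>lborel) = - (\<integral>x. (cutoff n x * cos (x \<bullet> \<xi>)) *\<^sub>R gj x \<partial>lborel)"
      using weak cutoff_test(1)[of n \<xi>] unfolding weak_gradient_def gj_def cutoff_test_deriv(1)[symmetric] by blast
    also have "(\<integral>x. (cutoff' n j x * cos (x \<bullet> \<xi>) - cutoff n x * sin (x \<bullet> \<xi>) * \<xi> $ j) *\<^sub>R f x \<partial>lborel)
       = (\<integral>x. of_real (cos (x \<bullet> \<xi>)) * (c' n x * f x) - of_real (\<xi> $ j) * (of_real (sin (x \<bullet> \<xi>)) * (c n x * f x)) \<partial>lborel)"
      by (intro Bochner_Integration.integral_cong) (auto simp: c_def c'_def scaleR_conv_of_real algebra_simps)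
    also have "\<dots> = Cf' - of_real (\<xi> $ j) * Sf" unfolding Cf'_def Sf_def using ic by simp
    also have "(\<integral>x. (cutoff n x * cos (x \<bullet> \<xi>)) *\<^sub>R gj x \<partial>lborel) = Cg" unfolding Cg_def
      by (intro Bochner_Integration.integral_cong) (auto simp: c_def scaleR_conv_of_real algebra_simps)
    finally have e1: "Cf' - of_real (\<xi> $ j) * Sf = - Cg" .
    have "(\<integral>x. (cutoff' n j x * sin (x \<bullet> \<xi>) + cutoff n x * cos (x \<bullet> \<xi>) * \<xi> $ j) *\<^sub>R f x \<partial>lborel) = - (\<integral>x. (cutoff n x * sin (x \<bullet> \<xi>)) *\<^sub>R gj x \<partial>lborel)"
      using weak cutoff_test(2)[of n \<xi>] unfolding weak_gradient_def gj_def cutoff_test_deriv(2)[symmetric] by blast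
    also have "(\<integral>x. (cutoff' n j x * sin (x \<bullet> \<xi>) + cutoff n x * cos (x \<bullet> \<xi>) * \<xi> $ j) *\<^sub>R f x \<partial>lborel)
       = (\<integral>x. of_real (sin (x \<bullet> \<xi>)) * (c' n x * f x) + of_real (\<xi> $ j) * (of_real (cos (x \<bullet> \<xi>)) * (c n x * f x)) \<partial>lborel)"
      by (intro Bochner_Integration.integral_cong) (auto simp: c_def c'_def scaleR_conv_of_real algebra_simps)
    also have "\<dots> = Sf' + of_real (\<xi> $ j) * Cf" unfolding Sf'_def Cf_def using ic by simp
    also have "(\<integral>x. (cutoff n x * sin (x \<bullet> \<xi>)) *\<^sub>R gj x \<partial>lborel) = Sg" unfolding Sg_def
      by (intro Bochner_Integration.integral_cong) (auto simp: c_def scaleR_conv_of_real algebra_simps)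
    finally have e2: "Sf' + of_real (\<xi> $ j) * Cf = - Sg" .
    have split: "(\<integral>x. E x * (p x * h x) \<partial>lborel) = (\<integral>x. of_real (cos (x \<bullet> \<xi>)) * (p x * h x) \<partial>lborel) - \<i> * (\<integral>x. of_real (sin (x \<bullet> \<xi>)) * (p x * h x) \<partial>lborel)"
      if "integrable lborel (\<lambda>x. of_real (cos (x \<bullet> \<xi>)) * (p x * h x))" "integrable lborel (\<lambda>x. of_real (sin (x \<bullet> \<xi>)) * (p x * h x))" for p h
      unfolding E left_diff_distrib mult.assoc using that by simp
    have "(\<integral>x. E x * (c n x * gj x) \<partial>lborel) = Cg - \<i> * Sg" unfolding Cg_def Sg_def by (rule split[OF ic(5,6)])
    also have "Cg = of_real (\<xi> $ j) * Sf - Cf'" using e1 by (simp add: algebra_simps)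
    also have "Sg = - Sf' - of_real (\<xi> $ j) * Cf" using e2 by (simp add: algebra_simps eq_neg_iff_add_eq_0)
    also have "of_real (\<xi> $ j) * Sf - Cf' - \<i> * (- Sf' - of_real (\<xi> $ j) * Cf) = \<i> * of_real (\<xi> $ j) * (Cf - \<i> * Sf) - (Cf' - \<i> * Sf')"
      by (simp add: algebra_simps)
    also have "Cf - \<i> * Sf = (\<integral>x. E x * (c n x * f x) \<partial>lborel)" unfolding Cf_def Sf_def by (rule split[OF ic(1,2), symmetric])
    also have "Cf' - \<i> * Sf' = (\<integral>x. E x * (c' n x * f x) \<partial>lborel)" unfolding Cf'_def Sf'_def by (rule split[OF ic(3,4), symmetric])
    finally have F: "(\<integral>x. E x * (c n x * gj x) \<partial>lborel) = \<i> * of_real (\<xi> $ j) * (\<integral>x. E x * (c n x * f x) \<partial>lborel)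
        - (\<integral>x. E x * (c' n x * f x) \<partial>lborel)" .
    show ?thesis unfolding fourier_integral_def E_def[symmetric] F by (simp add: algebra_simps)
  qed
  have lim: "L2_tendsto (\<lambda>n x. c n x * h x) h sequentially" if h: "in_L2 h" for h
  proof (rule L2_tendsto_dominated[where h = h])
    show "(\<lambda>x. c n x * h x) \<in> borel_measurable borel" for n by (intro in_L2_measurable b h)
    show "norm (c n x * h x) \<le> norm (h x)" for n x
      using cutoff_le[of n x] by (simp add: c_def norm_mult mult_left_le_one_le)
    show "AE x in lborel. (\<lambda>n. c n x * h x) \<longlonglongrightarrow> h x"
    proof (rule AE_I2)
      fix x :: "real^'n"
      have "(\<lambda>n. c n x * h x) \<longlonglongrightarrow> of_real 1 * h x" unfolding c_def by (intro tendsto_intros cutoff_tendsto)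
      then show "(\<lambda>n. c n x * h x) \<longlonglongrightarrow> h x" by simp
    qed
  qed (use h in_L2_measurable in auto)
  have lim': "L2_tendsto (\<lambda>n x. c' n x * f x) (\<lambda>x. 0) sequentially"
  proof (rule L2_tendsto_dominated[where h = "\<lambda>x. of_real (exp 1 * 512) * f x"])
    show "(\<lambda>x. c' n x * f x) \<in> borel_measurable borel" for n by (intro in_L2_measurable b f)
    have c'b: "norm (c' n x) \<le> exp 1 * 512 / real (Suc n)" for n x using cutoff'_le by (simp add: c'_def)
    have c'b2: "exp 1 * 512 / real (Suc n) \<le> exp 1 * (512::real) / 1" for n by (intro divide_left_mono) auto
    have "norm (c' n x) \<le> exp 1 * 512" for n x using order_trans[OF c'b[of n x] c'b2[of n]] by simp
    then show "norm (c' n x * f x) \<le> norm (of_real (exp 1 * 512) * f x)" for n x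
      unfolding norm_mult by (intro mult_right_mono) auto
    show "AE x in lborel. (\<lambda>n. c' n x * f x) \<longlonglongrightarrow> 0"
    proof (rule AE_I2)
      fix x :: "real^'n"
      have "(\<lambda>n. exp 1 * 512 * (1 / real (Suc n))) \<longlonglongrightarrow> exp 1 * 512 * 0"
        using LIMSEQ_inverse_real_of_nat by (intro tendsto_intros) (simp add: divide_inverse)
      then have "(\<lambda>n. exp 1 * 512 / real (Suc n)) \<longlonglongrightarrow> 0" by simp
      then have "(\<lambda>n. c' n x) \<longlonglongrightarrow> 0" by (rule Lim_null_comparison[rotated]) (use c'b in auto)
      then show "(\<lambda>n. c' n x * f x) \<longlonglongrightarrow> 0" by (rule tendsto_mult_left_zero)
    qed
  qed (use f in_L2_cmult in auto)
  \<comment> \<open>Multiplication by \<open>\<xi> $ j\<close> does not preserve \<open>L2\<close>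
    convergence. The weight \<open>1 / (1 + norm \<xi>)\<close> makes all multipliers bounded by 1,
    and since it never vanishes it is cancelled after the limits are identified.\<close>
  define m where "m \<xi> = complex_of_real (1 / (1 + norm \<xi>))" for \<xi> :: "real^'n"
  have mn: "norm (m \<xi>) = 1 / (1 + norm \<xi>)" for \<xi> unfolding m_def norm_of_real by simp
  have np: "1 + norm \<xi> > 0" for \<xi> :: "real^'n" by (simp add: add_pos_nonneg)
  have m1: "norm (m \<xi>) \<le> 1" for \<xi> unfolding mn using np[of \<xi>] by (simp add: divide_le_eq_1)
  have m2: "norm (m \<xi> * (\<i> * of_real (\<xi> $ j))) \<le> 1" for \<xi>
  proof -
    have "\<bar>\<xi> $ j\<bar> / (1 + norm \<xi>) \<le> 1" using component_le_norm_cart[of \<xi> j] np[of \<xi>] by (simp add: divide_le_eq_1)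
    then show ?thesis unfolding norm_mult mn by simp
  qed
  have mm [measurable]: "m \<in> borel_measurable borel" unfolding m_def[abs_def] by measurable
  have nthm [measurable]: "(\<lambda>\<xi>. complex_of_real (\<xi> $ j)) \<in> borel_measurable borel"
    by (intro borel_measurable_continuous_onI continuous_intros)
  note Fm [measurable] = in_L2_measurable[OF fourier_exists(1)[OF f]] in_L2_measurable[OF fourier_exists(1)[OF gj]]
  have [measurable]: "fourier_integral (\<lambda>x. c n x * f x) \<in> borel_measurable borel" "fourier_integral (\<lambda>x. c' n x * f x) \<in> borel_measurable borel"
    "fourier_integral (\<lambda>x. c n x * gj x) \<in> borel_measurable borel" for n
    by (intro fourier_integral_measurable in_L2_measurable b f gj)+
  have "L2_tendsto (\<lambda>n. fourier_integral (\<lambda>x. c' n x * f x)) (\<lambda>\<xi>. 0) sequentially"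
  proof -
    have "L2sq (fourier_integral (\<lambda>x. c' n x * f x)) = L2sq (\<lambda>x. c' n x * f x)" for n by (intro plancherel_L1_L2 i b f)
    then show ?thesis using lim' by (simp add: L2_tendsto_L2sq)
  qed
  then have l3: "L2_tendsto (\<lambda>n \<xi>. m \<xi> * fourier_integral (\<lambda>x. c' n x * f x) \<xi>) (\<lambda>\<xi>. m \<xi> * 0) sequentially"
    by (rule L2_tendsto_mult_bounded[OF _ m1])
  have l2: "L2_tendsto (\<lambda>n \<xi>. (m \<xi> * (\<i> * of_real (\<xi> $ j))) * fourier_integral (\<lambda>x. c n x * f x) \<xi>) (\<lambda>\<xi>. (m \<xi> * (\<i> * of_real (\<xi> $ j))) * fourier f \<xi>) sequentially"
    by (rule L2_tendsto_mult_bounded[OF fourier_integral_tendsto[OF lim[OF f] i(1)[OF f] b(1)[OF f] f] m2])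
  have l1: "L2_tendsto (\<lambda>n \<xi>. m \<xi> * fourier_integral (\<lambda>x. c n x * gj x) \<xi>) (\<lambda>\<xi>. m \<xi> * fourier gj \<xi>) sequentially"
    by (rule L2_tendsto_mult_bounded[OF fourier_integral_tendsto[OF lim[OF gj] i(1)[OF gj] b(1)[OF gj] gj] m1])
  have "L2_tendsto (\<lambda>n \<xi>. (m \<xi> * (\<i> * of_real (\<xi> $ j))) * fourier_integral (\<lambda>x. c n x * f x) \<xi> - m \<xi> * fourier_integral (\<lambda>x. c' n x * f x) \<xi>)
     (\<lambda>\<xi>. (m \<xi> * (\<i> * of_real (\<xi> $ j))) * fourier f \<xi> - m \<xi> * 0) sequentially"
    by (rule L2_tendsto_diff[OF l2 l3]) measurable
  moreover have "(\<lambda>n \<xi>. (m \<xi> * (\<i> * of_real (\<xi> $ j))) * fourier_integral (\<lambda>x. c n x * f x) \<xi> - m \<xi> * fourier_integral (\<lambda>x. c' n x * f x) \<xi>)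
      = (\<lambda>n \<xi>. m \<xi> * fourier_integral (\<lambda>x. c n x * gj x) \<xi>)"
    unfolding id by (simp add: fun_eq_iff algebra_simps)
  ultimately have l4: "L2_tendsto (\<lambda>n \<xi>. m \<xi> * fourier_integral (\<lambda>x. c n x * gj x) \<xi>)
     (\<lambda>\<xi>. (m \<xi> * (\<i> * of_real (\<xi> $ j))) * fourier f \<xi> - m \<xi> * 0) sequentially" by simp
  have "AE \<xi> in lborel. m \<xi> * fourier gj \<xi> = (m \<xi> * (\<i> * of_real (\<xi> $ j))) * fourier f \<xi> - m \<xi> * 0"
    by (rule L2_tendsto_unique[OF l1 l4]) (auto intro!: always_eventually)
  then show ?thesis
  proof eventually_elim
    case (elim \<xi>)
    have "norm (m \<xi>) > 0" unfolding mn using np[of \<xi>] by simp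
    then have "m \<xi> \<noteq> 0" by auto
    moreover have "m \<xi> * fourier gj \<xi> = m \<xi> * (\<i> * of_real (\<xi> $ j) * fourier f \<xi>)" using elim by (simp add: mult.assoc)
    ultimately have "fourier gj \<xi> = \<i> * of_real (\<xi> $ j) * fourier f \<xi>" by (rule mult_left_cancel[THEN iffD1])
    then show ?case by (simp add: gj_def[abs_def])
  qed
qed

lemma in_H1_grad: "in_H1 f \<Longrightarrow> in_L2 f \<and> in_L2 (grad f) \<and> weak_gradient f (grad f)"
  unfolding in_H1_def grad_def using someI_ex[of "\<lambda>g. in_L2 g \<and> weak_gradient f g"] by blast

lemma in_L2_component:
  fixes g :: "real^'n \<Rightarrow> complex^'n"
  assumes g: "in_L2 g"
  shows "in_L2 (\<lambda>x. g x $ j)"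
proof (rule in_L2_dominated[OF g])
  show "(\<lambda>x. g x $ j) \<in> borel_measurable borel"
    by (rule measurable_compose[OF in_L2_measurable[OF g]]) (intro borel_measurable_continuous_onI continuous_intros)
qed (simp add: Finite_Cartesian_Product.norm_nth_le)

lemma fourier_grad:
  assumes "in_H1 f"
  shows "AE \<xi> in lborel. fourier (\<lambda>x. grad f x $ j) \<xi> = \<i> * of_real (\<xi> $ j) * fourier f \<xi>"
  using in_H1_grad[OF assms] fourier_weak_derivative by blast

text \<open>Shifting \<open>\<psi>\<close> by \<open>h\<close> in direction \<open>j\<close>
  multiplies its Fourier integral by \<open>exp (\<i> * h * \<xi> $ j)\<close>. The identity is the
  limit of the resulting difference quotients, dominated because the derivative is bounded and the
  supports stay in one ball.\<close>

lemma test_function_exp_deriv: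
  fixes \<psi> :: "real^'n \<Rightarrow> real"
  assumes \<psi>: "test_function \<psi>"
  shows "(\<integral>x. exp (- \<i> * of_real (x \<bullet> \<xi>)) * of_real (frechet_derivative \<psi> (at x) (axis j 1)) \<partial>lborel)
      = \<i> * of_real (\<xi> $ j) * (\<integral>x. exp (- \<i> * of_real (x \<bullet> \<xi>)) * of_real (\<psi> x) \<partial>lborel)"
    and "integrable lborel \<psi>" and "integrable lborel (\<lambda>x. frechet_derivative \<psi> (at x) (axis j 1))"
    and "\<psi> \<in> borel_measurable borel"
proof -
  define d where "d x = frechet_derivative \<psi> (at x) (axis j 1)" for x
  have diff: "\<psi> differentiable (at x)" for x
    using \<psi> unfolding test_function_def by (metis C_k.simps(2))
  have contd: "continuous_on UNIV d"
    using \<psi> unfolding test_function_def d_def[abs_def] by (metis C_k.simps)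
  have cont: "continuous_on UNIV \<psi>" using \<psi> unfolding test_function_def by (metis C_k.simps(1))
  show m: "\<psi> \<in> borel_measurable borel" by (rule borel_measurable_continuous_onI[OF cont])
  have dm: "d \<in> borel_measurable borel" by (rule borel_measurable_continuous_onI[OF contd])
  note [measurable] = m dm
  have "bounded (closure {x. \<psi> x \<noteq> 0})" using \<psi> unfolding test_function_def by (simp add: compact_imp_bounded)
  then obtain R where R': "\<forall>x\<in>closure {x. \<psi> x \<noteq> 0}. norm x \<le> R" unfolding bounded_iff by (rule exE)
  have R: "norm x \<le> R" if "\<psi> x \<noteq> 0" for x using R' closure_subset[of "{x. \<psi> x \<noteq> 0}"] that by auto
  have line: "((\<lambda>s. \<psi> (x + s *\<^sub>R axis j 1)) has_real_derivative d (x + s *\<^sub>R axis j 1)) (at s)" for x s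
  proof -
    have "(\<psi> has_derivative frechet_derivative \<psi> (at (x + s *\<^sub>R axis j 1))) (at (x + s *\<^sub>R axis j 1))"
      using diff frechet_derivative_works by blast
    moreover have "((\<lambda>s. x + s *\<^sub>R axis j 1) has_derivative (\<lambda>h. h *\<^sub>R axis j 1)) (at s)" by (auto intro!: derivative_eq_intros)
    ultimately have "((\<lambda>s. \<psi> (x + s *\<^sub>R axis j 1)) has_derivative (\<lambda>h. frechet_derivative \<psi> (at (x + s *\<^sub>R axis j 1)) (h *\<^sub>R axis j 1))) (at s)"
      using diff_chain_at[of "\<lambda>s. x + s *\<^sub>R axis j 1" _ s \<psi>] by (simp add: o_def)
    moreover have "(\<lambda>h. frechet_derivative \<psi> (at (x + s *\<^sub>R axis j 1)) (h *\<^sub>R axis j 1)) = (*) (d (x + s *\<^sub>R axis j 1))"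
      using linear_frechet_derivative[OF diff] by (auto simp: d_def linear_cmul fun_eq_iff)
    ultimately show ?thesis by (simp add: has_field_derivative_def)
  qed
  \<comment> \<open>The margin 1 leaves a whole segment of the line through \<open>x\<close> on
    which \<open>\<psi>\<close> vanishes.\<close>
  have dout: "d x = 0" if "norm x > R + 1" for x
  proof -
    have "((\<lambda>s. \<psi> (x + s *\<^sub>R axis j 1)) has_real_derivative 0) (at 0)"
    proof (rule has_field_derivative_transform_within_open[where f = "\<lambda>_. 0" and S = "{-1<..<1}"])
      fix s :: real assume s: "s \<in> {-1<..<1}"
      have "norm x \<le> norm (x + s *\<^sub>R axis j 1) + norm (s *\<^sub>R axis j (1::real))"
        using norm_triangle_ineq4[of "x + s *\<^sub>R axis j 1" "s *\<^sub>R axis j 1"] by simp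
      moreover have "\<bar>s\<bar> < 1" using s by auto
      ultimately have "norm (x + s *\<^sub>R axis j 1) > R" using that by simp
      then show "0 = \<psi> (x + s *\<^sub>R axis j 1)" using R[of "x + s *\<^sub>R axis j 1"] by fastforce
    qed auto
    from DERIV_unique[OF line[of x 0] this] show ?thesis by simp
  qed
  have "compact (d ` cball 0 (R + 1))" by (rule compact_continuous_image[OF continuous_on_subset[OF contd]]) auto
  then have "bounded (d ` cball 0 (R + 1))" by (rule compact_imp_bounded)
  then obtain B where "\<forall>y\<in>d ` cball 0 (R + 1). norm y \<le> B" unfolding bounded_iff by (rule exE)
  then have B': "\<bar>d x\<bar> \<le> B" if "x \<in> cball 0 (R + 1)" for x using that by auto
  define B1 where "B1 = \<bar>B\<bar>"
  have B: "\<bar>d x\<bar> \<le> B1" for x using B'[of x] dout[of x] unfolding B1_def by (cases "norm x \<le> R + 1") auto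
  have icb: "integrable lborel (indicator (cball 0 S) :: real^'n \<Rightarrow> real)" for S
    using emeasure_lborel_cball_finite[of "0 :: real^'n" S] by (intro integrable_real_indicator) auto
  show id: "integrable lborel (\<lambda>x. frechet_derivative \<psi> (at x) (axis j 1))" unfolding d_def[symmetric]
  proof (rule Bochner_Integration.integrable_bound[OF integrable_mult_right[OF icb[of "R + 1"], of B1]])
    show "AE x in lborel. norm (d x) \<le> norm (B1 * indicator (cball 0 (R + 1)) x)"
      using B dout by (intro AE_I2) (auto simp: indicator_def B1_def)
  qed measurable
  have "compact (\<psi> ` cball 0 R)" by (rule compact_continuous_image[OF continuous_on_subset[OF cont]]) auto
  then have "bounded (\<psi> ` cball 0 R)" by (rule compact_imp_bounded)
  then obtain P where "\<forall>y\<in>\<psi> ` cball 0 R. norm y \<le> P" unfolding bounded_iff by (rule exE)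
  then have P: "\<bar>\<psi> x\<bar> \<le> P" if "x \<in> cball 0 R" for x using that by auto
  show i\<psi>: "integrable lborel \<psi>"
  proof (rule Bochner_Integration.integrable_bound[OF integrable_mult_right[OF icb[of R], of P]])
    show "AE x in lborel. norm (\<psi> x) \<le> norm (P * indicator (cball 0 R) x)"
      
    proof (rule AE_I2)
      fix x
      show "norm (\<psi> x) \<le> norm (P * indicator (cball 0 R) x)"
        using P[of x] R[of x] by (cases "x \<in> cball 0 R") auto
    qed
  qed measurable
  define E where "E x = exp (- \<i> * of_real (x \<bullet> \<xi>))" for x
  have Em [measurable]: "E \<in> borel_measurable borel" unfolding E_def by measurable
  have iE: "integrable lborel (\<lambda>x. E x * of_real (h x))" if "integrable lborel h" for h :: "real^'n \<Rightarrow> real"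
    unfolding E_def by (rule integrable_modulated) (use that in simp)
  define h where "h n = 1 / real (Suc n)" for n
  have h: "h n > 0" "h n \<le> 1" for n by (auto simp: h_def)
  have h0: "h \<longlonglongrightarrow> 0" unfolding h_def using LIMSEQ_inverse_real_of_nat by (simp add: divide_inverse)
  define q where "q n x = (\<psi> (x + h n *\<^sub>R axis j 1) - \<psi> x) / h n" for n x
  have qm [measurable]: "q n \<in> borel_measurable borel" for n unfolding q_def by measurable
  have "(\<lambda>n. \<integral>x. E x * of_real (q n x) \<partial>lborel) \<longlonglongrightarrow> (\<integral>x. E x * of_real (d x) \<partial>lborel)"
  proof (rule integral_dominated_convergence[where w = "\<lambda>x. B1 * indicator (cball 0 (R + 2)) x"])
    show "integrable lborel (\<lambda>x :: real^'n. B1 * indicator (cball 0 (R + 2)) x :: real)" by (rule integrable_mult_right[OF icb])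
    show "AE x in lborel. (\<lambda>n. E x * of_real (q n x)) \<longlonglongrightarrow> E x * of_real (d x)"
    proof (rule AE_I2)
      fix x
      have "((\<lambda>s. (\<psi> (x + s *\<^sub>R axis j 1) - \<psi> x) / s) \<longlongrightarrow> d x) (at 0)"
        using line[of x 0] by (simp add: has_field_derivative_iff)
      moreover have "filterlim h (at 0) sequentially" using h0 h(1) by (auto simp: filterlim_at less_imp_neq[symmetric])
      ultimately have "(\<lambda>n. q n x) \<longlonglongrightarrow> d x" unfolding q_def by (rule filterlim_compose)
      then show "(\<lambda>n. E x * of_real (q n x)) \<longlonglongrightarrow> E x * of_real (d x)" by (intro tendsto_intros)
    qed
    show "AE x in lborel. norm (E x * of_real (q n x)) \<le> B1 * indicator (cball 0 (R + 2)) x" for n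
    proof (rule AE_I2)
      fix x
      have nE: "norm (E x) = 1" by (simp add: E_def)
      have "\<exists>z>0. z < h n \<and> \<psi> (x + h n *\<^sub>R axis j 1) - \<psi> (x + 0 *\<^sub>R axis j 1) = (h n - 0) * d (x + z *\<^sub>R axis j 1)"
        by (rule MVT2[OF h(1)]) (rule line)
      then obtain z where "\<psi> (x + h n *\<^sub>R axis j 1) - \<psi> x = h n * d (x + z *\<^sub>R axis j 1)" by auto
      then have "\<bar>q n x\<bar> \<le> B1" using h(1)[of n] B by (simp add: q_def)
      \<comment> \<open>The steps are at most 1, so all difference quotients vanish outside one
        ball.\<close>
      moreover have "q n x = 0" if x: "norm x > R + 2"
      proof -
        have "norm x \<le> norm (x + h n *\<^sub>R axis j 1) + norm (h n *\<^sub>R axis j (1::real))"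
          using norm_triangle_ineq4[of "x + h n *\<^sub>R axis j 1" "h n *\<^sub>R axis j 1"] by simp
        then have "norm (x + h n *\<^sub>R axis j 1) > R" using x h[of n] by simp
        then have "\<psi> (x + h n *\<^sub>R axis j 1) = 0" "\<psi> x = 0" using R[of x] R[of "x + h n *\<^sub>R axis j 1"] x by fastforce+
        then show ?thesis by (simp add: q_def)
      qed
      ultimately show "norm (E x * of_real (q n x)) \<le> B1 * indicator (cball 0 (R + 2)) x"
        using nE by (cases "norm x \<le> R + 2") (auto simp: norm_mult indicator_def)
    qed
  qed measurable
  moreover have "(\<integral>x. E x * of_real (q n x) \<partial>lborel) = (exp (\<i> * of_real (h n * \<xi> $ j)) - 1) / of_real (h n) * (\<integral>x. E x * of_real (\<psi> x) \<partial>lborel)" for n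
  proof -
    have ax: "axis j 1 \<bullet> \<xi> = \<xi> $ j" by (simp add: inner_axis')
    have Etr: "E x = exp (\<i> * of_real (h n * \<xi> $ j)) * E (x + h n *\<^sub>R axis j 1)" for x
      by (simp add: E_def inner_add_left ax exp_add[symmetric] distrib_left)
    have itr: "integrable lborel (\<lambda>x. \<psi> (x + h n *\<^sub>R axis j 1))"
      using lborel_integrable_affine[OF i\<psi>, of 1 "h n *\<^sub>R axis j 1"] by (simp add: add.commute)
    have "(\<integral>x. E x * of_real (q n x) \<partial>lborel) = (\<integral>x. (E x * of_real (\<psi> (x + h n *\<^sub>R axis j 1)) - E x * of_real (\<psi> x)) / of_real (h n) \<partial>lborel)"
      by (intro Bochner_Integration.integral_cong) (auto simp: q_def right_diff_distrib)
    also have "\<dots> = ((\<integral>x. E x * of_real (\<psi> (x + h n *\<^sub>R axis j 1)) \<partial>lborel) - (\<integral>x. E x * of_real (\<psi> x) \<partial>lborel)) / of_real (h n)"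
      using iE[OF itr] iE[OF i\<psi>] by simp
    also have "(\<integral>x. E x * of_real (\<psi> (x + h n *\<^sub>R axis j 1)) \<partial>lborel)
        = exp (\<i> * of_real (h n * \<xi> $ j)) * (\<integral>x. E (x + h n *\<^sub>R axis j 1) * of_real (\<psi> (x + h n *\<^sub>R axis j 1)) \<partial>lborel)"
      by (subst Etr) (simp add: mult.assoc)
    also have "(\<integral>x. E (x + h n *\<^sub>R axis j 1) * of_real (\<psi> (x + h n *\<^sub>R axis j 1)) \<partial>lborel) = (\<integral>x. E x * of_real (\<psi> x) \<partial>lborel)"
      by (rule lborel_integral_translate[of "\<lambda>x. E x * of_real (\<psi> x)"]) measurable
    finally show ?thesis by (simp add: left_diff_distrib diff_divide_distrib)
  qed
  moreover have "(\<lambda>n. (exp (\<i> * of_real (h n * \<xi> $ j)) - 1) / of_real (h n) * (\<integral>x. E x * of_real (\<psi> x) \<partial>lborel))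
      \<longlonglongrightarrow> (\<i> * of_real (\<xi> $ j)) * (\<integral>x. E x * of_real (\<psi> x) \<partial>lborel)"
  proof -
    have "((\<lambda>z. exp (\<i> * of_real (\<xi> $ j) * z)) has_field_derivative \<i> * of_real (\<xi> $ j)) (at 0)"
      by (auto intro!: derivative_eq_intros)
    then have "((\<lambda>z. (exp (\<i> * of_real (\<xi> $ j) * z) - 1) / z) \<longlongrightarrow> \<i> * of_real (\<xi> $ j)) (at 0)"
      by (simp add: has_field_derivative_iff)
    moreover have "filterlim (\<lambda>n. complex_of_real (h n)) (at 0) sequentially"
      using tendsto_of_real[OF h0, where 'a = complex] h(1) by (auto simp: filterlim_at less_imp_neq[symmetric])
    ultimately have "(\<lambda>n. (exp (\<i> * of_real (\<xi> $ j) * of_real (h n)) - 1) / of_real (h n)) \<longlonglongrightarrow> \<i> * of_real (\<xi> $ j)"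
      by (rule filterlim_compose)
    then show ?thesis by (intro tendsto_mult tendsto_const) (simp add: mult_ac)
  qed
  ultimately have "(\<integral>x. E x * of_real (d x) \<partial>lborel) = (\<i> * of_real (\<xi> $ j)) * (\<integral>x. E x * of_real (\<psi> x) \<partial>lborel)"
    by (auto intro: LIMSEQ_unique)
  then show "(\<integral>x. exp (- \<i> * of_real (x \<bullet> \<xi>)) * of_real (frechet_derivative \<psi> (at x) (axis j 1)) \<partial>lborel)
      = \<i> * of_real (\<xi> $ j) * (\<integral>x. exp (- \<i> * of_real (x \<bullet> \<xi>)) * of_real (\<psi> x) \<partial>lborel)"
    by (simp add: E_def d_def)
qed

section \<open>Fundamental solutions\<close>

text \<open>The solution \<open>g\<close> of \<open>g'' + b * g' = - f\<close> with zero data at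
  time 0, obtained by integrating
  \<open>(exp (\<integral>b) * g')' = - exp (\<integral>b) * f\<close> twice.\<close>

definition duhamel :: "(real \<Rightarrow> real) \<Rightarrow> (real \<Rightarrow> real) \<Rightarrow> real \<Rightarrow> real" where
  "duhamel b f t = - integral {0..t} (\<lambda>s. exp (- integral {0..s} b) * integral {0..s} (\<lambda>\<tau>. exp (integral {0..\<tau>} b) * f \<tau>))"

lemma duhamel_cont:
  assumes b: "continuous_on {0..} b" and f: "continuous_on {0..} f"
  shows "continuous_on {0..} (\<lambda>\<tau>. exp (integral {0..\<tau>} b) * f \<tau>)"
    and "continuous_on {0..} (\<lambda>s. exp (- integral {0..s} b) * integral {0..s} (\<lambda>\<tau>. exp (integral {0..\<tau>} b) * f \<tau>))"
    and "continuous_on {0..} (duhamel b f)"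
proof -
  note B = continuous_on_integral_halfline[OF b]
  show 1: "continuous_on {0..} (\<lambda>\<tau>. exp (integral {0..\<tau>} b) * f \<tau>)" by (intro continuous_intros B f)
  show 2: "continuous_on {0..} (\<lambda>s. exp (- integral {0..s} b) * integral {0..s} (\<lambda>\<tau>. exp (integral {0..\<tau>} b) * f \<tau>))"
    by (intro continuous_intros B continuous_on_integral_halfline[OF 1])
  show "continuous_on {0..} (duhamel b f)" unfolding duhamel_def[abs_def]
    by (intro continuous_intros continuous_on_integral_halfline[OF 2])
qed

lemma duhamel_deriv:
  assumes b: "continuous_on {0..} b" and f: "continuous_on {0..} f" and t: "t \<ge> 0"
  shows "(duhamel b f has_real_derivative - (exp (- integral {0..t} b) * integral {0..t} (\<lambda>\<tau>. exp (integral {0..\<tau>} b) * f \<tau>))) (at t within {0..})"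
  unfolding duhamel_def[abs_def] by (intro DERIV_minus integral_deriv_halfline duhamel_cont b f t)

lemma duhamel_linear:
  assumes b: "continuous_on {0..} b" and f: "continuous_on {0..} f" and g: "continuous_on {0..} g" and t: "t \<ge> 0"
  shows "duhamel b (\<lambda>x. f x + q * g x) t = duhamel b f t + q * duhamel b g t"
proof -
  define e where "e s = exp (integral {0..s} b)" for s
  define e' where "e' s = exp (- integral {0..s} b)" for s
  note ci = integrable_continuous_real[OF continuous_on_subset[OF duhamel_cont(1)[OF b]], folded e_def]
  have inner: "integral {0..s} (\<lambda>\<tau>. e \<tau> * (f \<tau> + q * g \<tau>)) = integral {0..s} (\<lambda>\<tau>. e \<tau> * f \<tau>) + q * integral {0..s} (\<lambda>\<tau>. e \<tau> * g \<tau>)" for s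
  proof -
    have i: "(\<lambda>\<tau>. e \<tau> * f \<tau>) integrable_on {0..s}" "(\<lambda>\<tau>. e \<tau> * g \<tau>) integrable_on {0..s}"
      by (rule ci[OF f], simp) (rule ci[OF g], simp)
    have "(\<lambda>\<tau>. q * (e \<tau> * g \<tau>)) integrable_on {0..s}" using integrable_cmul[OF i(2), of q] by simp
    from integral_add[OF i(1) this]
    have "integral {0..s} (\<lambda>\<tau>. e \<tau> * f \<tau> + q * (e \<tau> * g \<tau>)) = integral {0..s} (\<lambda>\<tau>. e \<tau> * f \<tau>) + integral {0..s} (\<lambda>\<tau>. q * (e \<tau> * g \<tau>))" .
    then show ?thesis by (simp add: distrib_left mult.left_commute)
  qed
  note co = integrable_continuous_real[OF continuous_on_subset[OF duhamel_cont(2)[OF b]], folded e_def e'_def]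
  have "integral {0..t} (\<lambda>s. e' s * integral {0..s} (\<lambda>\<tau>. e \<tau> * (f \<tau> + q * g \<tau>)))
     = integral {0..t} (\<lambda>s. e' s * integral {0..s} (\<lambda>\<tau>. e \<tau> * f \<tau>) + q * (e' s * integral {0..s} (\<lambda>\<tau>. e \<tau> * g \<tau>)))"
    unfolding inner by (simp add: distrib_left mult.left_commute)
  also have "\<dots> = integral {0..t} (\<lambda>s. e' s * integral {0..s} (\<lambda>\<tau>. e \<tau> * f \<tau>)) + integral {0..t} (\<lambda>s. q * (e' s * integral {0..s} (\<lambda>\<tau>. e \<tau> * g \<tau>)))"
  proof (rule integral_add)
    show "(\<lambda>s. e' s * integral {0..s} (\<lambda>\<tau>. e \<tau> * f \<tau>)) integrable_on {0..t}" by (rule co[OF f]) simp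
    have "(\<lambda>s. e' s * integral {0..s} (\<lambda>\<tau>. e \<tau> * g \<tau>)) integrable_on {0..t}" by (rule co[OF g]) simp
    from integrable_cmul[OF this, of q]
    show "(\<lambda>s. q * (e' s * integral {0..s} (\<lambda>\<tau>. e \<tau> * g \<tau>))) integrable_on {0..t}" by simp
  qed
  finally show ?thesis unfolding duhamel_def e_def[symmetric] e'_def[symmetric] by simp
qed

text \<open>The two exponentials contribute at most \<open>exp (2 * \<beta>)\<close>, and the inner
  integral of a nondecreasing majorant up to \<open>x\<close> is at most \<open>T * g x\<close>. The
  outer integration is left to an explicit antiderivative \<open>h\<close>, which in the iteration
  is a monomial.\<close>

lemma duhamel_bound:
  assumes b: "continuous_on {0..} b" and f: "continuous_on {0..} f"
    and \<beta>: "\<And>s. s \<in> {0..T} \<Longrightarrow> \<bar>integral {0..s} b\<bar> \<le> \<beta>" and s: "0 \<le> s" "s \<le> T"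
    and g: "\<And>x y. 0 \<le> x \<Longrightarrow> x \<le> y \<Longrightarrow> y \<le> T \<Longrightarrow> g x \<le> g y" "\<And>x. 0 \<le> x \<Longrightarrow> x \<le> T \<Longrightarrow> \<bar>f x\<bar> \<le> g x"
    and h: "continuous_on {0..s} h" "\<And>x. 0 < x \<Longrightarrow> x < s \<Longrightarrow> (h has_real_derivative T * exp (2 * \<beta>) * g x) (at x)"
  shows "\<bar>duhamel b f s\<bar> \<le> h s - h 0"
proof -
  have "\<bar>duhamel b f s - duhamel b f 0\<bar> \<le> h s - h 0"
  proof (rule abs_diff_le_by_deriv[where f' = "\<lambda>x. - (exp (- integral {0..x} b) * integral {0..x} (\<lambda>\<tau>. exp (integral {0..\<tau>} b) * f \<tau>))"
      and g' = "\<lambda>x. T * exp (2 * \<beta>) * g x", OF s(1) _ h(1)])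
    show "continuous_on {0..s} (duhamel b f)" by (rule continuous_on_subset[OF duhamel_cont(3)[OF b f]]) auto
  next
    fix x assume x: "0 < x" "x < s"
    have "at x within {0..} = at x" by (rule at_within_interior) (use x in auto)
    then show "(duhamel b f has_real_derivative - (exp (- integral {0..x} b) * integral {0..x} (\<lambda>\<tau>. exp (integral {0..\<tau>} b) * f \<tau>))) (at x)"
      using duhamel_deriv[OF b f, of x] x by simp
    show "(h has_real_derivative T * exp (2 * \<beta>) * g x) (at x)" by (rule h(2)[OF x])
    have "norm (integral {0..x} (\<lambda>\<tau>. exp (integral {0..\<tau>} b) * f \<tau>)) \<le> (exp \<beta> * g x) * (x - 0)"
    proof (rule integral_bound)
      show "continuous_on {0..x} (\<lambda>\<tau>. exp (integral {0..\<tau>} b) * f \<tau>)"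
        by (rule continuous_on_subset[OF duhamel_cont(1)[OF b f]]) auto
      fix y assume y: "y \<in> {0..x}"
      have "integral {0..y} b \<le> \<beta>" using \<beta>[of y] y x s by auto
      moreover have "\<bar>f y\<bar> \<le> g x" using g(2)[of y] g(1)[of y x] y x s by auto
      ultimately show "norm (exp (integral {0..y} b) * f y) \<le> exp \<beta> * g x"
        by (simp add: abs_mult mult_mono)
    qed (use x in auto)
    then have I: "\<bar>integral {0..x} (\<lambda>\<tau>. exp (integral {0..\<tau>} b) * f \<tau>)\<bar> \<le> exp \<beta> * g x * x" by simp
    have gx: "0 \<le> g x" using g(2)[of x] x s by auto
    have "exp (- integral {0..x} b) \<le> exp \<beta>" using \<beta>[of x] x s by auto
    then have "\<bar>- (exp (- integral {0..x} b) * integral {0..x} (\<lambda>\<tau>. exp (integral {0..\<tau>} b) * f \<tau>))\<bar> \<le> exp \<beta> * (exp \<beta> * g x * x)"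
      unfolding abs_minus_cancel abs_mult abs_exp_cancel using I by (intro mult_mono) auto
    also have "\<dots> = x * (exp \<beta> * exp \<beta>) * g x" by simp
    also have "exp \<beta> * exp \<beta> = exp (2 * \<beta>)" by (simp flip: exp_add)
    also have "x * exp (2 * \<beta>) * g x \<le> T * exp (2 * \<beta>) * g x" using x s gx by (intro mult_right_mono) auto
    finally show "\<bar>- (exp (- integral {0..x} b) * integral {0..x} (\<lambda>\<tau>. exp (integral {0..\<tau>} b) * f \<tau>))\<bar> \<le> T * exp (2 * \<beta>) * g x" .
  qed
  then show ?thesis by (simp add: duhamel_def)
qed

definition duhamel_iter :: "(real \<Rightarrow> real) \<Rightarrow> (real \<Rightarrow> real) \<Rightarrow> nat \<Rightarrow> real \<Rightarrow> real" where
  "duhamel_iter b f k = (duhamel b ^^ k) f"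

lemma duhamel_iter_simps: "duhamel_iter b f 0 = f" "duhamel_iter b f (Suc k) = duhamel b (duhamel_iter b f k)"
  by (simp_all add: duhamel_iter_def)

lemma duhamel_iter_cont:
  "continuous_on {0..} b \<Longrightarrow> continuous_on {0..} f \<Longrightarrow> continuous_on {0..} (duhamel_iter b f k)"
  by (induction k) (auto simp: duhamel_iter_simps duhamel_cont(3))

text \<open>With \<open>D = T * exp (2 * \<beta>)\<close> each application integrates the previous
  monomial bound once, which builds up the factorial.\<close>

lemma duhamel_iter_bound:
  assumes b: "continuous_on {0..} b" and f: "continuous_on {0..} f" and T: "T \<ge> 0"
  obtains A D where "A \<ge> 0" "D \<ge> 0" "\<And>k s. 0 \<le> s \<Longrightarrow> s \<le> T \<Longrightarrow> \<bar>duhamel_iter b f k s\<bar> \<le> A * (D * s)^k / fact k"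
proof -
  have bdd: "\<exists>A\<ge>0. \<forall>s\<in>{0..T}. \<bar>h s\<bar> \<le> A" if "continuous_on {0..} h" for h :: "real \<Rightarrow> real"
  proof -
    have "bounded (h ` {0..T})"
      by (intro compact_imp_bounded compact_continuous_image continuous_on_subset[OF that]) auto
    then obtain A where "\<forall>y\<in>h ` {0..T}. norm y \<le> A" unfolding bounded_iff by (rule exE)
    then show ?thesis using T by (intro exI[of _ "\<bar>A\<bar>"]) (auto intro: order_trans[OF _ abs_ge_self])
  qed
  obtain A where A: "A \<ge> 0" "\<forall>s\<in>{0..T}. \<bar>f s\<bar> \<le> A" using bdd[OF f] by blast
  obtain \<beta> where \<beta>: "\<forall>s\<in>{0..T}. \<bar>integral {0..s} b\<bar> \<le> \<beta>" using bdd[OF continuous_on_integral_halfline[OF b]] by blast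
  define D where "D = T * exp (2 * \<beta>)"
  have D: "D \<ge> 0" using T by (simp add: D_def)
  have "\<bar>duhamel_iter b f k s\<bar> \<le> A * (D * s)^k / fact k" if "0 \<le> s" "s \<le> T" for k s
    using that
  proof (induction k arbitrary: s)
    case 0
    then show ?case using A by (simp add: duhamel_iter_simps)
  next
    case (Suc k)
    define g where "g x = A * (D * x)^k / fact k" for x
    define h where "h x = A * (D * x)^Suc k / fact (Suc k)" for x
    have "\<bar>duhamel b (duhamel_iter b f k) s\<bar> \<le> h s - h 0"
    proof (rule duhamel_bound[OF b duhamel_iter_cont[OF b f] \<beta>[rule_format] Suc.prems, where g = g])
      show "g x \<le> g y" if "0 \<le> x" "x \<le> y" for x y
        unfolding g_def using that A D by (intro divide_right_mono mult_left_mono power_mono) auto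
      show "\<bar>duhamel_iter b f k x\<bar> \<le> g x" if "0 \<le> x" "x \<le> T" for x unfolding g_def by (rule Suc.IH[OF that])
      show "continuous_on {0..s} h" unfolding h_def by (intro continuous_intros) auto
      show "(h has_real_derivative T * exp (2 * \<beta>) * g x) (at x)" for x
      proof -
        have "(h has_real_derivative A * (real (Suc k) * (D * x)^k * D) / fact (Suc k)) (at x)"
          unfolding h_def[abs_def] by (auto intro!: derivative_eq_intros simp del: fact_Suc power_Suc)
        moreover have "A * (real (Suc k) * (D * x)^k * D) / fact (Suc k) = T * exp (2 * \<beta>) * g x"
          unfolding g_def D_def[symmetric] by (simp del: of_nat_Suc)
        ultimately show ?thesis by simp
      qed
    qed
    then show ?case by (simp add: duhamel_iter_simps h_def)
  qed
  then show ?thesis using that[OF A(1) D] by blast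
qed

text \<open>The Neumann series for \<open>v = f + q * duhamel b v\<close>. As a power series in
  \<open>q\<close>, with \<open>q = r\<^sup>2\<close> later, it shows measurability in the frequency
  directly.\<close>

definition duhamel_sol :: "(real \<Rightarrow> real) \<Rightarrow> (real \<Rightarrow> real) \<Rightarrow> real \<Rightarrow> real \<Rightarrow> real" where
  "duhamel_sol b f q t = (\<Sum>k. q^k * duhamel_iter b f k t)"

lemma duhamel_sol_uniform:
  assumes b: "continuous_on {0..} b" and f: "continuous_on {0..} f" and T: "T \<ge> 0"
  shows "uniform_limit {0..T} (\<lambda>n t. \<Sum>k<n. q^k * duhamel_iter b f k t) (duhamel_sol b f q) sequentially"
proof -
  obtain A D where A: "A \<ge> 0" and D: "D \<ge> 0"
    and bd: "\<And>k s. 0 \<le> s \<Longrightarrow> s \<le> T \<Longrightarrow> \<bar>duhamel_iter b f k s\<bar> \<le> A * (D * s)^k / fact k"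
    by (rule duhamel_iter_bound[OF b f T]) (rule that)
  have "summable (\<lambda>k. A * ((\<bar>q\<bar> * (D * T))^k / fact k))"
    using summable_exp[of "\<bar>q\<bar> * (D * T)"] by (intro summable_mult) (simp add: divide_inverse mult.commute)
  moreover have "norm (q^k * duhamel_iter b f k s) \<le> A * ((\<bar>q\<bar> * (D * T))^k / fact k)" if s: "s \<in> {0..T}" for k s
  proof -
    have "\<bar>duhamel_iter b f k s\<bar> \<le> A * (D * s)^k / fact k" using bd s by auto
    also have "\<dots> \<le> A * (D * T)^k / fact k" using s A D
      by (intro divide_right_mono mult_left_mono power_mono) auto
    finally have "\<bar>q\<bar>^k * \<bar>duhamel_iter b f k s\<bar> \<le> \<bar>q\<bar>^k * (A * (D * T)^k / fact k)" by (intro mult_left_mono) auto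
    then show ?thesis by (simp add: abs_mult power_abs power_mult_distrib mult_ac)
  qed
  ultimately show ?thesis unfolding duhamel_sol_def[abs_def]
    by (intro Weierstrass_m_test) auto
qed

lemma duhamel_sol_cont:
  assumes b: "continuous_on {0..} b" and f: "continuous_on {0..} f"
  shows "continuous_on {0..} (duhamel_sol b f q)"
proof -
  have "continuous (at t within {0..}) (duhamel_sol b f q)" if t: "t \<ge> 0" for t
  proof -
    have "continuous_on {0..t+1} (duhamel_sol b f q)"
      by (rule uniform_limit_theorem[OF _ duhamel_sol_uniform[OF b f]])
        (use t in \<open>auto intro!: always_eventually continuous_intros continuous_on_subset[OF duhamel_iter_cont[OF b f]]\<close>)
    then have "continuous (at t within {0..t+1}) (duhamel_sol b f q)"
      using t unfolding continuous_on_eq_continuous_within by auto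
    moreover have "at t within {0..t+1} = at t within {0..}" by (rule at_within_nhd[of _ "{..<t+1}"]) auto
    ultimately show ?thesis by simp
  qed
  then show ?thesis unfolding continuous_on_eq_continuous_within by auto
qed

text \<open>Each partial sum arises from the preceding one by the fixed point map. Uniform
  convergence on \<open>{0..t}\<close> allows the limit to be taken inside
  \<open>duhamel\<close>.\<close>

lemma duhamel_sol_eq:
  assumes b: "continuous_on {0..} b" and f: "continuous_on {0..} f" and t: "t \<ge> 0"
  shows "duhamel_sol b f q t = f t + q * duhamel b (duhamel_sol b f q) t"
proof -
  define S where "S n x = (\<Sum>k<n. q^k * duhamel_iter b f k x)" for n x
  have contS: "continuous_on {0..} (S n)" for n unfolding S_def by (intro continuous_intros duhamel_iter_cont b f)
  have S: "q * duhamel b (S n) t = S (Suc n) t - f t" for n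
  proof (induction n)
    case 0
    then show ?case by (simp add: S_def duhamel_def duhamel_iter_simps)
  next
    case (Suc n)
    have "S (Suc n) = (\<lambda>x. S n x + q^n * duhamel_iter b f n x)" by (simp add: S_def fun_eq_iff)
    then have "duhamel b (S (Suc n)) t = duhamel b (\<lambda>x. S n x + q^n * duhamel_iter b f n x) t" by (simp only:)
    also have "\<dots> = duhamel b (S n) t + q^n * duhamel_iter b f (Suc n) t"
      unfolding duhamel_iter_simps by (rule duhamel_linear[OF b contS duhamel_iter_cont[OF b f] t])
    finally have "q * duhamel b (S (Suc n)) t = (S (Suc n) t - f t) + q^Suc n * duhamel_iter b f (Suc n) t"
      using Suc.IH by (simp add: distrib_left)
    moreover have "S (Suc (Suc n)) t = S (Suc n) t + q^Suc n * duhamel_iter b f (Suc n) t" by (simp add: S_def)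
    ultimately show ?case by simp
  qed
  note unif = duhamel_sol_uniform[OF b f t, of q, folded S_def]
  have "bounded ((\<lambda>s. integral {0..s} b) ` {0..t})"
    by (intro compact_imp_bounded compact_continuous_image continuous_on_subset[OF continuous_on_integral_halfline[OF b]]) auto
  then obtain \<beta> where \<beta>: "\<forall>y\<in>(\<lambda>s. integral {0..s} b) ` {0..t}. norm y \<le> \<beta>" unfolding bounded_iff by (rule exE)
  have contv: "continuous_on {0..} (duhamel_sol b f q)" by (rule duhamel_sol_cont[OF b f])
  have "(\<lambda>n. duhamel b (S n) t) \<longlonglongrightarrow> duhamel b (duhamel_sol b f q) t"
  proof (rule tendstoI)
    fix e :: real assume e: "e > 0"
    define D where "D = t * exp (2 * \<beta>) * t"
    have D: "D \<ge> 0" using t by (simp add: D_def)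
    define e' where "e' = e / (D + 1)"
    have e': "e' > 0" "D * e' < e" using e D by (auto simp: e'_def field_simps)
    have "eventually (\<lambda>n. \<forall>x\<in>{0..t}. dist (S n x) (duhamel_sol b f q x) < e') sequentially"
      using unif e' by (simp add: uniform_limit_iff)
    then show "eventually (\<lambda>n. dist (duhamel b (S n) t) (duhamel b (duhamel_sol b f q) t) < e) sequentially"
    proof eventually_elim
      case (elim n)
      have "\<bar>duhamel b (\<lambda>x. S n x + (-1) * duhamel_sol b f q x) t\<bar> \<le> t * exp (2 * \<beta>) * e' * t - t * exp (2 * \<beta>) * e' * 0"
      proof (rule duhamel_bound[OF b _ _ t order_refl, where g = "\<lambda>_. e'" and h = "\<lambda>x. t * exp (2 * \<beta>) * e' * x"])
        show "continuous_on {0..} (\<lambda>x. S n x + - 1 * duhamel_sol b f q x)" by (intro continuous_intros contS contv)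
        show "\<bar>S n x + - 1 * duhamel_sol b f q x\<bar> \<le> e'" if "0 \<le> x" "x \<le> t" for x
          using elim that by (auto simp: dist_real_def less_imp_le)
      qed (use \<beta> in \<open>auto intro!: continuous_intros derivative_eq_intros\<close>)
      also have "t * exp (2 * \<beta>) * e' * t - t * exp (2 * \<beta>) * e' * 0 = D * e'" by (simp add: D_def)
      also have "duhamel b (\<lambda>x. S n x + (-1) * duhamel_sol b f q x) t = duhamel b (S n) t + (-1) * duhamel b (duhamel_sol b f q) t"
        by (rule duhamel_linear[OF b contS contv t])
      finally show ?case using e' by (simp add: dist_real_def)
    qed
  qed
  then have "(\<lambda>n. q * duhamel b (S n) t) \<longlonglongrightarrow> q * duhamel b (duhamel_sol b f q) t" by (intro tendsto_intros)
  moreover have "(\<lambda>n. q * duhamel b (S n) t) \<longlonglongrightarrow> duhamel_sol b f q t - f t" unfolding S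
  proof (intro tendsto_intros)
    have "(\<lambda>n. S n t) \<longlonglongrightarrow> duhamel_sol b f q t" by (rule tendsto_uniform_limitI[OF unif]) (use t in auto)
    then show "(\<lambda>n. S (Suc n) t) \<longlonglongrightarrow> duhamel_sol b f q t" by (rule LIMSEQ_Suc)
  qed
  ultimately have "q * duhamel b (duhamel_sol b f q) t = duhamel_sol b f q t - f t" by (rule LIMSEQ_unique)
  then show ?thesis by simp
qed

text \<open>The free term solves the equation for \<open>r = 0\<close> with value
  \<open>\<alpha>\<close> and slope \<open>\<beta>\<close> at time 0, so the series is the mode with
  these data.\<close>

definition fund :: "(real \<Rightarrow> real) \<Rightarrow> real \<Rightarrow> real \<Rightarrow> real \<Rightarrow> real \<Rightarrow> real" where
  "fund b \<alpha> \<beta> r = duhamel_sol b (\<lambda>t. \<alpha> + \<beta> * integral {0..t} (\<lambda>s. exp (- integral {0..s} b))) (r\<^sup>2)"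

text \<open>The derivative of \<open>fund\<close> as read off from the integral equation; times
  \<open>exp (\<integral>b)\<close> it has derivative
  \<open>- r\<^sup>2 * exp (\<integral>b) * fund\<close>.\<close>

definition fund' :: "(real \<Rightarrow> real) \<Rightarrow> real \<Rightarrow> real \<Rightarrow> real \<Rightarrow> real \<Rightarrow> real" where
  "fund' b \<alpha> \<beta> r t = exp (- integral {0..t} b) * (\<beta> - r\<^sup>2 * integral {0..t} (\<lambda>\<tau>. exp (integral {0..\<tau>} b) * fund b \<alpha> \<beta> r \<tau>))"

lemma fund_mode:
  assumes b: "continuous_on {0..} b"
  shows "mode b r (fund b \<alpha> \<beta> r) (fund' b \<alpha> \<beta> r)" "fund b \<alpha> \<beta> r 0 = \<alpha>" "fund' b \<alpha> \<beta> r 0 = \<beta>"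
proof -
  define f where "f t = \<alpha> + \<beta> * integral {0..t} (\<lambda>s. exp (- integral {0..s} b))" for t
  note B = continuous_on_integral_halfline[OF b]
  have e: "continuous_on {0..} (\<lambda>s. exp (- integral {0..s} b))" by (intro continuous_intros B)
  have f: "continuous_on {0..} f" unfolding f_def by (intro continuous_intros continuous_on_integral_halfline[OF e])
  have fund: "fund b \<alpha> \<beta> r = duhamel_sol b f (r\<^sup>2)" by (simp add: fund_def f_def[abs_def])
  have contv: "continuous_on {0..} (fund b \<alpha> \<beta> r)" unfolding fund by (rule duhamel_sol_cont[OF b f])
  have eq: "fund b \<alpha> \<beta> r t = f t + r\<^sup>2 * duhamel b (fund b \<alpha> \<beta> r) t" if "t \<ge> 0" for t
    unfolding fund by (rule duhamel_sol_eq[OF b f that])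
  show "fund b \<alpha> \<beta> r 0 = \<alpha>" using eq[of 0] by (simp add: f_def duhamel_def)
  show "fund' b \<alpha> \<beta> r 0 = \<beta>" by (simp add: fund'_def)
  show "mode b r (fund b \<alpha> \<beta> r) (fund' b \<alpha> \<beta> r)" unfolding mode_def
  proof (intro allI impI conjI)
    fix t :: real assume t: "t \<ge> 0"
    have "((\<lambda>t. f t + r\<^sup>2 * duhamel b (fund b \<alpha> \<beta> r) t) has_real_derivative
        \<beta> * exp (- integral {0..t} b) + r\<^sup>2 * (- (exp (- integral {0..t} b) * integral {0..t} (\<lambda>\<tau>. exp (integral {0..\<tau>} b) * fund b \<alpha> \<beta> r \<tau>)))) (at t within {0..})"
      unfolding f_def by (auto intro!: derivative_eq_intros integral_deriv_halfline[OF e t] duhamel_deriv[OF b contv t])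
    then have "((\<lambda>t. f t + r\<^sup>2 * duhamel b (fund b \<alpha> \<beta> r) t) has_real_derivative fund' b \<alpha> \<beta> r t) (at t within {0..})"
      by (simp add: fund'_def algebra_simps)
    then show "(fund b \<alpha> \<beta> r has_real_derivative fund' b \<alpha> \<beta> r t) (at t within {0..})"
      by (rule has_field_derivative_transform_within[where d = 1]) (use t eq in auto)
    have "exp (- integral {0..t} b) * exp (integral {0..t} b) = 1" by (simp flip: exp_add)
    then show "(fund' b \<alpha> \<beta> r has_real_derivative - r\<^sup>2 * fund b \<alpha> \<beta> r t - b t * fund' b \<alpha> \<beta> r t) (at t within {0..})"
    proof -
      define J where "J t = integral {0..t} (\<lambda>\<tau>. exp (integral {0..\<tau>} b) * fund b \<alpha> \<beta> r \<tau>)" for t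
      have dJ: "(J has_real_derivative exp (integral {0..t} b) * fund b \<alpha> \<beta> r t) (at t within {0..})"
        unfolding J_def[abs_def] by (rule integral_deriv_halfline[OF duhamel_cont(1)[OF b contv] t])
      have "((\<lambda>t. exp (- integral {0..t} b) * (\<beta> - r\<^sup>2 * J t)) has_real_derivative
          - r\<^sup>2 * (exp (- integral {0..t} b) * exp (integral {0..t} b)) * fund b \<alpha> \<beta> r t
          - b t * (exp (- integral {0..t} b) * (\<beta> - r\<^sup>2 * J t))) (at t within {0..})"
        by (auto intro!: derivative_eq_intros integral_deriv_halfline[OF b t] dJ simp: algebra_simps)
      then show ?thesis using \<open>exp (- integral {0..t} b) * exp (integral {0..t} b) = 1\<close>
        unfolding fund'_def[abs_def] J_def[symmetric] by simp
    qed
  qed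
qed

text \<open>The terms of the series are powers of \<open>r\<^sup>2\<close> times numbers independent
  of \<open>r\<close>. The time derivative inherits measurability as a limit of forward difference
  quotients, which also exist at time 0.\<close>

lemma fund_measurable:
  assumes b: "continuous_on {0..} b" and t: "t \<ge> 0"
  shows "(\<lambda>r. fund b \<alpha> \<beta> r t) \<in> borel_measurable borel" "(\<lambda>r. fund' b \<alpha> \<beta> r t) \<in> borel_measurable borel"
proof -
  show 1: "(\<lambda>r. fund b \<alpha> \<beta> r t) \<in> borel_measurable borel" for t
    unfolding fund_def duhamel_sol_def by measurable
  define h where "h n = 1 / real (Suc n)" for n
  have h: "h n > 0" for n by (simp add: h_def)
  have h0: "h \<longlonglongrightarrow> 0" unfolding h_def using LIMSEQ_inverse_real_of_nat by (simp add: divide_inverse)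
  show "(\<lambda>r. fund' b \<alpha> \<beta> r t) \<in> borel_measurable borel"
  proof (rule borel_measurable_LIMSEQ_real[where u = "\<lambda>n r. (fund b \<alpha> \<beta> r (t + h n) - fund b \<alpha> \<beta> r t) / h n"])
    fix r :: real
    have "(fund b \<alpha> \<beta> r has_real_derivative fund' b \<alpha> \<beta> r t) (at t within {0..})"
      using fund_mode(1)[OF b, of r \<alpha> \<beta>] t unfolding mode_def by blast
    then have l: "((\<lambda>y. (fund b \<alpha> \<beta> r y - fund b \<alpha> \<beta> r t) / (y - t)) \<longlongrightarrow> fund' b \<alpha> \<beta> r t) (at t within {0..})"
      by (simp add: has_field_derivative_iff)
    have "(\<lambda>n. t + h n) \<longlonglongrightarrow> t + 0" by (intro tendsto_intros h0)
    then have "filterlim (\<lambda>n. t + h n) (at t within {0..}) sequentially"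
      unfolding filterlim_at using h t by (auto intro!: always_eventually simp: less_imp_neq[symmetric] add_nonneg_nonneg less_imp_le)
    from filterlim_compose[OF l this]
    show "(\<lambda>n. (fund b \<alpha> \<beta> r (t + h n) - fund b \<alpha> \<beta> r t) / h n) \<longlonglongrightarrow> fund' b \<alpha> \<beta> r t" by simp
  qed (use 1 in measurable)
qed

section \<open>Energy solutions in Fourier space\<close>

lemma in_L2_vec:
  fixes g :: "real^'n \<Rightarrow> complex^'n"
  assumes g: "\<And>j. in_L2 (\<lambda>x. g x $ j)"
  shows "in_L2 g" "L2sq g = (\<Sum>j\<in>UNIV. L2sq (\<lambda>x. g x $ j))"
proof -
  have [measurable]: "(\<lambda>x. g x $ j) \<in> borel_measurable borel" for j by (rule in_L2_measurable[OF g])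
  have m: "g \<in> borel_measurable borel"
  proof (subst borel_measurable_euclidean_space, rule ballI)
    fix i :: "complex^'n" assume "i \<in> Basis"
    then obtain j and b :: complex where i: "i = axis j b" by (auto simp: Basis_vec_def)
    show "(\<lambda>x. g x \<bullet> i) \<in> borel_measurable borel" unfolding i inner_axis by measurable
  qed
  have e: "ennreal ((norm (g x))\<^sup>2) = (\<Sum>j\<in>UNIV. ennreal ((norm (g x $ j))\<^sup>2))" for x
    by (simp add: norm_vec_def L2_set_def sum_nonneg)
  show eq: "L2sq g = (\<Sum>j\<in>UNIV. L2sq (\<lambda>x. g x $ j))"
    unfolding L2sq_def e by (rule nn_integral_sum) measurable
  have "L2sq g < \<infinity>" unfolding eq using g unfolding in_L2_L2sq by (simp add: less_top)
  then show "in_L2 g" using m unfolding in_L2_L2sq by simp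
qed

text \<open>The test functions on the Fourier side. Bounded support puts their inverse transforms
  into \<open>H1\<close>, and the class is stable under locally bounded multipliers; since no
  smoothness is asked for, the phase of a Borel function on a ball belongs to it.\<close>

definition nice :: "(real^'n \<Rightarrow> complex) \<Rightarrow> bool" where
  "nice \<phi> \<longleftrightarrow> \<phi> \<in> borel_measurable borel \<and> (\<exists>R M. \<forall>\<xi>. norm (\<phi> \<xi>) \<le> M * indicator (cball 0 R) \<xi>)"

lemma nice_measurable: "nice \<phi> \<Longrightarrow> \<phi> \<in> borel_measurable borel"
  by (simp add: nice_def)

lemma nice_in_L2:
  assumes "nice \<phi>"
  shows "in_L2 \<phi>" "integrable lborel \<phi>"
proof -
  obtain R M where b: "\<And>\<xi>. norm (\<phi> \<xi>) \<le> M * indicator (cball 0 R) \<xi>" and m: "\<phi> \<in> borel_measurable borel"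
    using assms unfolding nice_def by blast
  have b': "norm (\<phi> \<xi>) \<le> norm (of_real M * (indicator (cball 0 R) \<xi> *\<^sub>R (1::complex)))" for \<xi>
    using b[of \<xi>] by (cases "\<xi> \<in> cball 0 R") (auto simp: norm_mult)
  show "in_L2 \<phi>" by (rule in_L2_dominated[OF in_L2_cmult[OF in_L2_indicator] m b'])
  have "integrable lborel (\<lambda>\<xi> :: real^'n. M * indicator (cball 0 R) \<xi> :: real)"
    using emeasure_lborel_cball_finite[of "0 :: real^'n" R] by (intro integrable_mult_right integrable_real_indicator) auto
  then show "integrable lborel \<phi>"
    by (rule Bochner_Integration.integrable_bound) (use m b in \<open>auto intro: order_trans[OF _ abs_ge_self]\<close>)
qed

lemma nice_mult:
  assumes \<phi>: "nice \<phi>" and m: "m \<in> borel_measurable borel"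
    and b: "\<And>R. \<exists>K. \<forall>\<xi>\<in>cball 0 R. norm (m \<xi>) \<le> K"
  shows "nice (\<lambda>\<xi>. m \<xi> * \<phi> \<xi>)"
proof -
  obtain R M where bd: "\<And>\<xi>. norm (\<phi> \<xi>) \<le> M * indicator (cball 0 R) \<xi>" and pm: "\<phi> \<in> borel_measurable borel"
    using \<phi> unfolding nice_def by blast
  obtain K where K: "\<forall>\<xi>\<in>cball 0 R. norm (m \<xi>) \<le> K" using b by blast
  have "norm (m \<xi> * \<phi> \<xi>) \<le> (\<bar>K\<bar> * M) * indicator (cball 0 R) \<xi>" for \<xi>
  proof (cases "\<xi> \<in> cball 0 R")
    case True
    then have "norm (m \<xi>) \<le> \<bar>K\<bar>" using K by fastforce
    moreover have "norm (\<phi> \<xi>) \<le> M" using bd[of \<xi>] True by simp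
    ultimately have "norm (m \<xi>) * norm (\<phi> \<xi>) \<le> \<bar>K\<bar> * M" by (intro mult_mono) auto
    then show ?thesis using True by (simp add: norm_mult)
  next
    case False
    then show ?thesis using bd[of \<xi>] by simp
  qed
  then show ?thesis unfolding nice_def using pm m by auto
qed

lemma nth_measurable [measurable]: "(\<lambda>\<xi>::real^'n. complex_of_real (\<xi> $ j)) \<in> borel_measurable borel"
  by (intro borel_measurable_continuous_onI continuous_intros)

lemma nice_component:
  assumes "nice \<phi>"
  shows "nice (\<lambda>\<xi>. \<i> * of_real (\<xi> $ j) * \<phi> \<xi>)"
proof (rule nice_mult[OF assms])
  show "(\<lambda>\<xi>. \<i> * complex_of_real (\<xi> $ j)) \<in> borel_measurable borel" by measurable
  show "\<exists>K. \<forall>\<xi>\<in>cball 0 R. cmod (\<i> * complex_of_real (\<xi> $ j)) \<le> K" for R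
    by (intro exI[of _ R]) (auto simp: norm_mult intro: order_trans[OF component_le_norm_cart])
qed

text \<open>The gradient is the inverse transform of \<open>\<i> * \<xi> * \<phi>\<close>. The
  multiplication formula moves the weak identity to the transform of the reflected test function,
  where differentiation is multiplication by \<open>- \<i> * \<xi> $ j\<close>; a second use moves
  it back.\<close>

lemma nice_inverse_H1:
  fixes \<phi> :: "real^'n \<Rightarrow> complex"
  assumes \<phi>: "nice \<phi>"
  shows "in_H1 (\<lambda>x. fourier_integral \<phi> (- x))"
proof -
  define G where "G x = (\<chi> j. fourier_integral (\<lambda>\<xi>. \<i> * of_real (\<xi> $ j) * \<phi> \<xi>) (- x))" for x
  have G: "in_L2 G" by (rule in_L2_vec(1)) (simp add: G_def fourier_inversion(1) nice_in_L2 nice_component \<phi>)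
  have "weak_gradient (\<lambda>x. fourier_integral \<phi> (- x)) G" unfolding weak_gradient_def
  proof (intro allI impI)
    fix \<psi> :: "real^'n \<Rightarrow> real" and j assume \<psi>: "test_function \<psi>"
    note T1 = test_function_exp_deriv(1)[OF \<psi>, where j = j] and T2 = test_function_exp_deriv(2)[OF \<psi>]
      and T3 = test_function_exp_deriv(3)[OF \<psi>, where j = j] and T4 = test_function_exp_deriv(4)[OF \<psi>]
    define d where "d x = frechet_derivative \<psi> (at x) (axis j 1)" for x
    define h k where "h x = complex_of_real (d (- x))" and "k x = complex_of_real (\<psi> (- x))" for x
    define p where "p \<xi> = \<i> * of_real (\<xi> $ j) * \<phi> \<xi>" for \<xi>
    have ih: "integrable lborel h"
      using lborel_integrable_affine[OF T3[folded d_def], of "-1" 0] unfolding h_def by simp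
    have ik: "integrable lborel k"
      using lborel_integrable_affine[OF T2, of "-1" 0] unfolding k_def by simp
    have [measurable]: "d \<in> borel_measurable borel" "\<psi> \<in> borel_measurable borel"
      using borel_measurable_integrable[OF T3] T4 unfolding d_def by auto
    note [measurable] = nice_measurable[OF \<phi>] borel_measurable_integrable[OF ih] borel_measurable_integrable[OF ik]
    have FIh: "fourier_integral h \<xi> = - (\<i> * of_real (\<xi> $ j)) * fourier_integral k \<xi>" for \<xi>
    proof -
      have "(\<integral>x. exp (- \<i> * of_real (x \<bullet> \<xi>)) * h x \<partial>lborel) = (\<integral>x. exp (- \<i> * of_real (x \<bullet> (- \<xi>))) * of_real (d x) \<partial>lborel)"
        unfolding h_def using lborel_integral_reflect[of "\<lambda>x. exp (- \<i> * of_real (x \<bullet> (- \<xi>))) * of_real (d x)"] by simp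
      also have "\<dots> = \<i> * of_real ((- \<xi>) $ j) * (\<integral>x. exp (- \<i> * of_real (x \<bullet> (- \<xi>))) * of_real (\<psi> x) \<partial>lborel)"
        unfolding d_def by (rule T1)
      also have "(\<integral>x. exp (- \<i> * of_real (x \<bullet> (- \<xi>))) * of_real (\<psi> x) \<partial>lborel) = (\<integral>x. exp (- \<i> * of_real (x \<bullet> \<xi>)) * k x \<partial>lborel)"
        unfolding k_def using lborel_integral_reflect[of "\<lambda>x. exp (- \<i> * of_real (x \<bullet> (- \<xi>))) * of_real (\<psi> x)"] by simp
      finally show ?thesis unfolding fourier_integral_def by simp
    qed
    have "(\<integral>x. d x *\<^sub>R fourier_integral \<phi> (- x) \<partial>lborel) = (\<integral>x. fourier_integral \<phi> x * h x \<partial>lborel)"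
      unfolding h_def using lborel_integral_reflect[of "\<lambda>x. fourier_integral \<phi> x * of_real (d (- x))"]
      by (simp add: scaleR_conv_of_real mult.commute)
    also have "\<dots> = (\<integral>\<xi>. \<phi> \<xi> * fourier_integral h \<xi> \<partial>lborel)"
      by (rule fourier_integral_multiplication[OF nice_in_L2(2)[OF \<phi>] ih])
    also have "\<dots> = (\<integral>\<xi>. - (p \<xi> * fourier_integral k \<xi>) \<partial>lborel)" unfolding FIh p_def by (simp add: mult_ac)
    also have "\<dots> = - (\<integral>\<xi>. p \<xi> * fourier_integral k \<xi> \<partial>lborel)" by simp
    also have "(\<integral>\<xi>. p \<xi> * fourier_integral k \<xi> \<partial>lborel) = (\<integral>x. fourier_integral p x * k x \<partial>lborel)"
      by (rule fourier_integral_multiplication[symmetric, OF _ ik]) (simp add: p_def[abs_def] nice_in_L2 nice_component \<phi>)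
    also have "\<dots> = (\<integral>x. \<psi> x *\<^sub>R (G x $ j) \<partial>lborel)"
    proof -
      have [measurable]: "p \<in> borel_measurable borel" unfolding p_def by measurable
      have "(\<integral>x. fourier_integral p x * k x \<partial>lborel) = (\<integral>x. fourier_integral p (- x) * k (- x) \<partial>lborel)"
        by (rule lborel_integral_reflect[symmetric]) measurable
      then show ?thesis by (simp add: k_def G_def p_def[abs_def] scaleR_conv_of_real mult.commute)
    qed
    finally show "(\<integral>x. frechet_derivative \<psi> (at x) (axis j 1) *\<^sub>R fourier_integral \<phi> (- x) \<partial>lborel) = - (\<integral>x. \<psi> x *\<^sub>R (G x $ j) \<partial>lborel)"
      unfolding d_def .
  qed
  moreover have "in_L2 (\<lambda>x. fourier_integral \<phi> (- x))" by (intro fourier_inversion nice_in_L2 \<phi>)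
  ultimately show ?thesis unfolding in_H1_def using G by blast
qed

lemma L2_inner_cong_AE:
  assumes "in_L2 f" "in_L2 f'" "in_L2 g" "in_L2 g'" "AE x in lborel. f x = f' x" "AE x in lborel. g x = g' x"
  shows "L2_inner f g = L2_inner f' g'"
  unfolding L2_inner_def
proof (rule integral_cong_AE)
  show "(\<lambda>x. f x * cnj (g x)) \<in> borel_measurable lborel" "(\<lambda>x. f' x * cnj (g' x)) \<in> borel_measurable lborel"
    using borel_measurable_integrable[OF integrable_inner_L2] assms by blast+
  show "AE x in lborel. f x * cnj (g x) = f' x * cnj (g' x)" using assms(5,6) by eventually_elim simp
qed

text \<open>By Parseval and inversion, pairing with \<open>\<phi>\<close> on the Fourier side is pairing with an element of
  \<open>H\<^sup>1\<close>.\<close>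

lemma pairing_transfer:
  fixes \<phi> :: "real^'n \<Rightarrow> complex"
  assumes \<phi>: "nice \<phi>"
  defines "v \<equiv> \<lambda>x. fourier_integral \<phi> (- x)"
  shows "in_L2 f \<Longrightarrow> L2_inner f v = L2_inner (fourier f) \<phi>"
    and "in_H1 f \<Longrightarrow> (\<Sum>j\<in>UNIV. L2_inner (\<lambda>x. grad f x $ j) (\<lambda>x. grad v x $ j))
      = L2_inner (fourier f) (\<lambda>\<xi>. of_real ((norm \<xi>)\<^sup>2) * \<phi> \<xi>)"
proof -
  have H1: "in_H1 v" unfolding v_def by (rule nice_inverse_H1[OF \<phi>])
  have v: "in_L2 v" "AE \<xi> in lborel. fourier v \<xi> = \<phi> \<xi>"
    unfolding v_def by (intro fourier_inversion nice_in_L2 \<phi>)+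
  note p = nice_in_L2(1)[OF \<phi>] and pj = nice_in_L2(1)[OF nice_component[OF \<phi>]]
  show "L2_inner f v = L2_inner (fourier f) \<phi>" if "in_L2 f"
    using fourier_inner[OF that v(1)] L2_inner_cong_AE[OF fourier_exists(1)[OF that] fourier_exists(1)[OF that] fourier_exists(1)[OF v(1)] p _ v(2)]
    by simp
  assume f: "in_H1 f"
  note g = in_H1_grad[OF f] and gv = in_H1_grad[OF H1]
  have Ff: "in_L2 (fourier f)" using g fourier_exists(1) by blast
  have "L2_inner (\<lambda>x. grad f x $ j) (\<lambda>x. grad v x $ j) = (\<integral>\<xi>. of_real ((\<xi> $ j)\<^sup>2) * (fourier f \<xi> * cnj (\<phi> \<xi>)) \<partial>lborel)
     \<and> integrable lborel (\<lambda>\<xi>. of_real ((\<xi> $ j)\<^sup>2) * (fourier f \<xi> * cnj (\<phi> \<xi>)))" for j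
  proof -
    have c: "in_L2 (\<lambda>x. grad f x $ j)" "in_L2 (\<lambda>x. grad v x $ j)" using g gv in_L2_component by blast+
    have aev: "AE \<xi> in lborel. fourier (\<lambda>x. grad v x $ j) \<xi> = \<i> * of_real (\<xi> $ j) * \<phi> \<xi>"
      using fourier_grad[OF H1, of j] v(2) by eventually_elim simp
    have "L2_inner (\<lambda>x. grad f x $ j) (\<lambda>x. grad v x $ j) = L2_inner (fourier (\<lambda>x. grad f x $ j)) (\<lambda>\<xi>. \<i> * of_real (\<xi> $ j) * \<phi> \<xi>)"
      using fourier_inner[OF c] L2_inner_cong_AE[OF fourier_exists(1)[OF c(1)] fourier_exists(1)[OF c(1)] fourier_exists(1)[OF c(2)] pj _ aev]
      by simp
    also have "\<dots> = (\<integral>\<xi>. of_real ((\<xi> $ j)\<^sup>2) * (fourier f \<xi> * cnj (\<phi> \<xi>)) \<partial>lborel)" unfolding L2_inner_def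
    proof (rule integral_cong_AE)
      show "(\<lambda>\<xi>. fourier (\<lambda>x. grad f x $ j) \<xi> * cnj (\<i> * of_real (\<xi> $ j) * \<phi> \<xi>)) \<in> borel_measurable lborel"
        by (rule borel_measurable_integrable[OF integrable_inner_L2[OF fourier_exists(1)[OF c(1)] pj]])
      show "(\<lambda>\<xi>. of_real ((\<xi> $ j)\<^sup>2) * (fourier f \<xi> * cnj (\<phi> \<xi>))) \<in> borel_measurable lborel"
        using borel_measurable_integrable[OF integrable_inner_L2[OF Ff p]] by (simp add: power2_eq_square) measurable
      show "AE \<xi> in lborel. fourier (\<lambda>x. grad f x $ j) \<xi> * cnj (\<i> * of_real (\<xi> $ j) * \<phi> \<xi>) = of_real ((\<xi> $ j)\<^sup>2) * (fourier f \<xi> * cnj (\<phi> \<xi>))"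
        using fourier_grad[OF f, of j]
      proof eventually_elim
        case (elim \<xi>)
        have ii: "\<i> * a * F * (- \<i> * a * q) = a * a * (F * q)" for a F q :: complex
        proof -
          have "\<i> * a * F * (- \<i> * a * q) = - (\<i> * \<i>) * (a * a * (F * q))" by (simp only: mult_ac mult_minus_left mult_minus_right)
          then show ?thesis by simp
        qed
        show ?case unfolding elim using ii[of "of_real (\<xi> $ j)" "fourier f \<xi>" "cnj (\<phi> \<xi>)"] by (simp add: power2_eq_square)
      qed
    qed
    finally have 1: "L2_inner (\<lambda>x. grad f x $ j) (\<lambda>x. grad v x $ j) = (\<integral>\<xi>. of_real ((\<xi> $ j)\<^sup>2) * (fourier f \<xi> * cnj (\<phi> \<xi>)) \<partial>lborel)" .
    \<comment> \<open>Applying the component multiplier twice to \<open>\<phi>\<close> gives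
      \<open>- (\<xi> $ j)\<^sup>2 * \<phi>\<close>, again of bounded support, so integrability
      follows by pairing with the square integrable transform of \<open>f\<close>.\<close>
    have "integrable lborel (\<lambda>\<xi>. fourier f \<xi> * cnj (\<i> * of_real (\<xi> $ j) * (\<i> * of_real (\<xi> $ j) * \<phi> \<xi>)))"
      by (intro integrable_inner_L2 Ff nice_in_L2 nice_component \<phi>)
    then have "integrable lborel (\<lambda>\<xi>. - (of_real ((\<xi> $ j)\<^sup>2) * (fourier f \<xi> * cnj (\<phi> \<xi>))))"
      by (simp add: power2_eq_square mult_ac)
    from Bochner_Integration.integrable_minus[OF this]
    have "integrable lborel (\<lambda>\<xi>. of_real ((\<xi> $ j)\<^sup>2) * (fourier f \<xi> * cnj (\<phi> \<xi>)))" by simp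
    with 1 show ?thesis by blast
  qed
  then have "(\<Sum>j\<in>UNIV. L2_inner (\<lambda>x. grad f x $ j) (\<lambda>x. grad v x $ j))
      = (\<integral>\<xi>. (\<Sum>j\<in>UNIV. of_real ((\<xi> $ j)\<^sup>2) * (fourier f \<xi> * cnj (\<phi> \<xi>))) \<partial>lborel)"
    by (simp add: Bochner_Integration.integral_sum)
  also have "\<dots> = L2_inner (fourier f) (\<lambda>\<xi>. of_real ((norm \<xi>)\<^sup>2) * \<phi> \<xi>)" unfolding L2_inner_def
  proof (rule Bochner_Integration.integral_cong[OF refl])
    fix \<xi> :: "real^'n"
    have eq: "(norm \<xi>)\<^sup>2 = (\<Sum>j\<in>UNIV. (\<xi> $ j)\<^sup>2)" by (simp add: norm_vec_def L2_set_def sum_nonneg)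
    have "(\<Sum>j\<in>UNIV. of_real ((\<xi> $ j)\<^sup>2) * (fourier f \<xi> * cnj (\<phi> \<xi>))) = of_real ((norm \<xi>)\<^sup>2) * (fourier f \<xi> * cnj (\<phi> \<xi>))"
      unfolding eq of_real_sum sum_distrib_right ..
    also have "\<dots> = fourier f \<xi> * cnj (of_real ((norm \<xi>)\<^sup>2) * \<phi> \<xi>)"
      by (simp only: complex_cnj_mult complex_cnj_complex_of_real mult.left_commute)
    finally show "(\<Sum>j\<in>UNIV. of_real ((\<xi> $ j)\<^sup>2) * (fourier f \<xi> * cnj (\<phi> \<xi>))) = fourier f \<xi> * cnj (of_real ((norm \<xi>)\<^sup>2) * \<phi> \<xi>)" .
  qed
  finally show "(\<Sum>j\<in>UNIV. L2_inner (\<lambda>x. grad f x $ j) (\<lambda>x. grad v x $ j))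
      = L2_inner (fourier f) (\<lambda>\<xi>. of_real ((norm \<xi>)\<^sup>2) * \<phi> \<xi>)" .
qed

lemma vector_derivative_quotientI:
  fixes f :: "real \<Rightarrow> complex"
  assumes "((\<lambda>s. (1 / (s - t)) *\<^sub>R (f s - f t)) \<longlongrightarrow> D) (at t)"
  shows "(f has_vector_derivative D) (at t)"
proof -
  have "((\<lambda>s. norm ((1 / (s - t)) *\<^sub>R (f s - f t) - D)) \<longlongrightarrow> 0) (at t)"
    using assms by (intro tendsto_norm_zero) (simp add: LIM_zero_iff)
  moreover have "eventually (\<lambda>s. norm ((1 / (s - t)) *\<^sub>R (f s - f t) - D) = norm (f s - f t - (s - t) *\<^sub>R D) / norm (s - t)) (at t)"
    unfolding eventually_at_filter
  proof (intro always_eventually allI impI)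
    fix s assume "s \<noteq> t"
    then have "(1 / (s - t)) *\<^sub>R (f s - f t) - D = (1 / (s - t)) *\<^sub>R (f s - f t - (s - t) *\<^sub>R D)"
      by (simp add: scaleR_diff_right)
    then show "norm ((1 / (s - t)) *\<^sub>R (f s - f t) - D) = norm (f s - f t - (s - t) *\<^sub>R D) / norm (s - t)"
      by (simp add: divide_inverse mult.commute)
  qed
  ultimately have "((\<lambda>s. norm (f s - f t - (s - t) *\<^sub>R D) / norm (s - t)) \<longlongrightarrow> 0) (at t)"
    by (rule Lim_transform_eventually)
  then show ?thesis unfolding has_vector_derivative_def has_derivative_iff_norm
    by (simp add: bounded_linear_scaleR_left)
qed

lemma L2_tendsto_at_dominated:
  fixes g :: "real \<Rightarrow> real^'n \<Rightarrow> complex"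
  assumes m: "\<And>s. s \<in> J \<Longrightarrow> g s \<in> borel_measurable borel" and m0: "g0 \<in> borel_measurable borel"
    and h: "in_L2 h" and b: "\<And>s \<xi>. s \<in> J \<Longrightarrow> s \<noteq> t \<Longrightarrow> norm (g s \<xi>) \<le> norm (h \<xi>)"
    and l: "\<And>\<xi>. ((\<lambda>s. g s \<xi>) \<longlongrightarrow> g0 \<xi>) (at t within J)"
  shows "L2_tendsto g g0 (at t within J)"
  unfolding L2_tendsto_L2sq tendsto_at_iff_sequentially
proof (intro allI impI)
  fix X :: "nat \<Rightarrow> real" assume X: "\<forall>i. X i \<in> J - {t}" "X \<longlonglongrightarrow> t"
  have "L2_tendsto (\<lambda>n. g (X n)) g0 sequentially"
  proof (rule L2_tendsto_dominated[OF _ m0 h])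
    show "AE \<xi> in lborel. (\<lambda>n. g (X n) \<xi>) \<longlonglongrightarrow> g0 \<xi>"
      using l X unfolding tendsto_at_iff_sequentially by (intro AE_I2) (auto simp: o_def)
  qed (use X b m in auto)
  then show "((\<lambda>i. L2sq (\<lambda>x. g i x - g0 x)) \<circ> X) \<longlonglongrightarrow> 0" by (simp add: L2_tendsto_L2sq o_def)
qed

lemma mode_add:
  assumes "mode b r v w" "mode b r v' w'"
  shows "mode b r (\<lambda>t. x * v t + y * v' t) (\<lambda>t. x * w t + y * w' t)"
  unfolding mode_def
proof (intro allI impI conjI)
  fix t :: real assume t: "t \<ge> 0"
  have d: "(v has_real_derivative w t) (at t within {0..})" "(w has_real_derivative (- r\<^sup>2 * v t - b t * w t)) (at t within {0..})"
    "(v' has_real_derivative w' t) (at t within {0..})" "(w' has_real_derivative (- r\<^sup>2 * v' t - b t * w' t)) (at t within {0..})"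
    using assms t unfolding mode_def by blast+
  show "((\<lambda>t. x * v t + y * v' t) has_real_derivative x * w t + y * w' t) (at t within {0..})"
    by (auto intro!: derivative_eq_intros d)
  show "((\<lambda>t. x * w t + y * w' t) has_real_derivative - r\<^sup>2 * (x * v t + y * v' t) - b t * (x * w t + y * w' t)) (at t within {0..})"
    by (auto intro!: derivative_eq_intros d simp: algebra_simps)
qed

text \<open>The crude energy bound controls \<open>fund'\<close> uniformly for frequencies up to
  \<open>R\<close>, but \<open>fund\<close> only with the factor \<open>r\<close>, which may vanish.
  So \<open>fund\<close> is recovered by integrating \<open>fund'\<close>.\<close>

lemma mode_bounded:
  assumes b: "continuous_on {0..} b" and T: "T \<ge> 0"
  shows "\<exists>K. \<forall>r. \<bar>r\<bar> \<le> R \<longrightarrow> (\<forall>s\<in>{0..T}. \<bar>fund b \<alpha> \<beta> r s\<bar> \<le> K \<and> \<bar>fund' b \<alpha> \<beta> r s\<bar> \<le> K)"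
proof -
  define I where "I = integral {0..T} (\<lambda>x. 2 * \<bar>b x\<bar>)"
  define Q where "Q = (R\<^sup>2 * \<alpha>\<^sup>2 + \<beta>\<^sup>2) * exp I"
  have Q0: "Q \<ge> 0" by (simp add: Q_def)
  have "\<bar>fund b \<alpha> \<beta> r s\<bar> \<le> \<bar>\<alpha>\<bar> + sqrt Q * T + sqrt Q \<and> \<bar>fund' b \<alpha> \<beta> r s\<bar> \<le> \<bar>\<alpha>\<bar> + sqrt Q * T + sqrt Q"
    if r: "\<bar>r\<bar> \<le> R" and s: "s \<in> {0..T}" for r s
  proof -
    note md = fund_mode[OF b, where r = r and \<alpha> = \<alpha> and \<beta> = \<beta>]
    have f': "\<bar>fund' b \<alpha> \<beta> r s\<bar> \<le> sqrt Q" if s: "s \<in> {0..T}" for s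
    proof -
      have "(fund' b \<alpha> \<beta> r s)\<^sup>2 \<le> mode_energy r (fund b \<alpha> \<beta> r) (fund' b \<alpha> \<beta> r) s" by (simp add: mode_energy_def)
      also have "\<dots> \<le> mode_energy r (fund b \<alpha> \<beta> r) (fund' b \<alpha> \<beta> r) 0 * exp (integral {0..s} (\<lambda>x. 2 * \<bar>b x\<bar>))"
        by (rule mode_energy_crude[OF md(1) b]) (use s in auto)
      also have "\<dots> \<le> (R\<^sup>2 * \<alpha>\<^sup>2 + \<beta>\<^sup>2) * exp I"
      proof (rule mult_mono)
        have "r\<^sup>2 \<le> R\<^sup>2" using power_mono[OF r, of 2] by simp
        then show "mode_energy r (fund b \<alpha> \<beta> r) (fund' b \<alpha> \<beta> r) 0 \<le> R\<^sup>2 * \<alpha>\<^sup>2 + \<beta>\<^sup>2"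
          unfolding mode_energy_def md by (intro add_mono mult_right_mono) auto
        have "integral {0..s} (\<lambda>x. 2 * \<bar>b x\<bar>) \<le> I" unfolding I_def
          by (intro integral_subset_le integrable_continuous_real continuous_intros continuous_on_subset[OF b]) (use s in auto)
        then show "exp (integral {0..s} (\<lambda>x. 2 * \<bar>b x\<bar>)) \<le> exp I" by simp
      qed auto
      finally show ?thesis unfolding Q_def[symmetric] by (metis real_sqrt_abs real_sqrt_le_mono)
    qed
    have "\<bar>fund b \<alpha> \<beta> r s - fund b \<alpha> \<beta> r 0\<bar> \<le> sqrt Q * s - sqrt Q * 0"
    proof (rule abs_diff_le_by_deriv[where f' = "fund' b \<alpha> \<beta> r" and g' = "\<lambda>_. sqrt Q"])
      show "continuous_on {0..s} (fund b \<alpha> \<beta> r)" by (rule continuous_on_subset[OF mode_cont(1)[OF md(1)]]) auto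
      show "(fund b \<alpha> \<beta> r has_real_derivative fund' b \<alpha> \<beta> r x) (at x)" if "0 < x" for x by (rule mode_deriv[OF md(1) that])
      show "\<bar>fund' b \<alpha> \<beta> r x\<bar> \<le> sqrt Q" if "0 < x" "x < s" for x using f'[of x] that s by simp
    qed (use s in \<open>auto intro!: continuous_intros derivative_eq_intros\<close>)
    moreover have "sqrt Q * s \<le> sqrt Q * T" using s Q0 by (intro mult_left_mono) auto
    ultimately have "\<bar>fund b \<alpha> \<beta> r s\<bar> \<le> \<bar>\<alpha>\<bar> + sqrt Q * T" unfolding md(2) by linarith
    moreover have "0 \<le> sqrt Q * T" using Q0 T by simp
    ultimately show ?thesis using f'[OF s] real_sqrt_ge_zero[OF Q0] abs_ge_zero[of \<alpha>] by linarith
  qed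
  then show ?thesis by blast
qed

text \<open>The bounds on bounded sets of times and frequencies dominate the multiplier and, by the
  mean value theorem, its difference quotients; against a nice function this gives convergence in
  \<open>L2\<close>.\<close>

definition multiplier :: "(real \<Rightarrow> real^'n \<Rightarrow> real) \<Rightarrow> (real \<Rightarrow> real^'n \<Rightarrow> real) \<Rightarrow> bool" where
  "multiplier a a' \<longleftrightarrow> (\<forall>s\<ge>0. a s \<in> borel_measurable borel \<and> a' s \<in> borel_measurable borel) \<and>
     (\<forall>\<xi>. \<forall>s\<ge>0. ((\<lambda>s. a s \<xi>) has_real_derivative a' s \<xi>) (at s within {0..})) \<and>
     (\<forall>R T. \<exists>K. \<forall>s\<in>{0..T}. \<forall>\<xi>\<in>cball 0 R. \<bar>a s \<xi>\<bar> \<le> K \<and> \<bar>a' s \<xi>\<bar> \<le> K)"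

lemma multiplier_nice:
  assumes "multiplier a a'" "nice \<phi>" "s \<ge> 0"
  shows "nice (\<lambda>\<xi>. of_real (a s \<xi>) * \<phi> \<xi>)" "nice (\<lambda>\<xi>. of_real (a' s \<xi>) * \<phi> \<xi>)"
proof -
  have m: "a s \<in> borel_measurable borel" "a' s \<in> borel_measurable borel" using assms unfolding multiplier_def by auto
  have b: "\<exists>K. \<forall>\<xi>\<in>cball 0 R. norm (complex_of_real (a s \<xi>)) \<le> K" "\<exists>K. \<forall>\<xi>\<in>cball 0 R. norm (complex_of_real (a' s \<xi>)) \<le> K" for R
  proof -
    obtain K where "\<forall>s'\<in>{0..s}. \<forall>\<xi>\<in>cball 0 R. \<bar>a s' \<xi>\<bar> \<le> K \<and> \<bar>a' s' \<xi>\<bar> \<le> K"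
      using assms unfolding multiplier_def by blast
    then show "\<exists>K. \<forall>\<xi>\<in>cball 0 R. norm (complex_of_real (a s \<xi>)) \<le> K" "\<exists>K. \<forall>\<xi>\<in>cball 0 R. norm (complex_of_real (a' s \<xi>)) \<le> K"
      using assms(3) by (auto intro!: exI[of _ K])
  qed
  show "nice (\<lambda>\<xi>. of_real (a s \<xi>) * \<phi> \<xi>)" "nice (\<lambda>\<xi>. of_real (a' s \<xi>) * \<phi> \<xi>)"
    by (rule nice_mult[OF assms(2) _ b(1)], use m in measurable) (rule nice_mult[OF assms(2) _ b(2)], use m in measurable)
qed

text \<open>The multiplier is bounded only on bounded time intervals, so the limits are taken within
  \<open>{0..t+1}\<close>, a neighbourhood of \<open>t\<close> in the half-line.\<close>

lemma multiplier_tendsto: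
  assumes a: "multiplier a a'" and \<phi>: "nice \<phi>" and t: "t \<ge> 0"
  shows "L2_tendsto (\<lambda>s \<xi>. of_real (a s \<xi>) * \<phi> \<xi>) (\<lambda>\<xi>. of_real (a t \<xi>) * \<phi> \<xi>) (at t within {0..t+1})"
    and "L2_tendsto (\<lambda>s \<xi>. of_real ((a s \<xi> - a t \<xi>) / (s - t)) * \<phi> \<xi>) (\<lambda>\<xi>. of_real (a' t \<xi>) * \<phi> \<xi>) (at t within {0..t+1})"
proof -
  obtain R M where b: "\<And>\<xi>. norm (\<phi> \<xi>) \<le> M * indicator (cball 0 R) \<xi>" using \<phi> unfolding nice_def by blast
  have out: "\<phi> \<xi> = 0" if "\<xi> \<notin> cball 0 R" for \<xi> using b[of \<xi>] that by simp
  have "\<forall>R T. \<exists>K. \<forall>s\<in>{0..T}. \<forall>\<xi>\<in>cball 0 R. \<bar>a s \<xi>\<bar> \<le> K \<and> \<bar>a' s \<xi>\<bar> \<le> K" using a unfolding multiplier_def by blast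
  then obtain K where K: "\<forall>s\<in>{0..t+1}. \<forall>\<xi>\<in>cball 0 R. \<bar>a s \<xi>\<bar> \<le> K \<and> \<bar>a' s \<xi>\<bar> \<le> K" by blast
  have m: "a s \<in> borel_measurable borel" "a' s \<in> borel_measurable borel" if "s \<ge> 0" for s using a that unfolding multiplier_def by auto
  note pm [measurable] = nice_measurable[OF \<phi>]
  have der: "((\<lambda>s. a s \<xi>) has_real_derivative a' s \<xi>) (at s within {0..})" if "s \<ge> 0" for s \<xi>
    using a that unfolding multiplier_def by blast
  have KL2: "in_L2 (\<lambda>\<xi>. of_real K * \<phi> \<xi>)" by (rule in_L2_cmult[OF nice_in_L2(1)[OF \<phi>]])
  have bound: "norm (of_real x * \<phi> \<xi>) \<le> norm (of_real K * \<phi> \<xi>)" if "\<xi> \<in> cball 0 R \<Longrightarrow> \<bar>x\<bar> \<le> K" for x \<xi>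
    using that out[of \<xi>] by (cases "\<xi> \<in> cball 0 R") (auto simp: norm_mult intro: mult_right_mono)
  show "L2_tendsto (\<lambda>s \<xi>. of_real (a s \<xi>) * \<phi> \<xi>) (\<lambda>\<xi>. of_real (a t \<xi>) * \<phi> \<xi>) (at t within {0..t+1})"
  proof (rule L2_tendsto_at_dominated[OF _ _ KL2])
    show "(\<lambda>\<xi>. of_real (a s \<xi>) * \<phi> \<xi>) \<in> borel_measurable borel" if "s \<in> {0..t+1}" for s
    proof -
      have [measurable]: "a s \<in> borel_measurable borel" using m(1) that by auto
      show ?thesis by measurable
    qed
    show "(\<lambda>\<xi>. of_real (a t \<xi>) * \<phi> \<xi>) \<in> borel_measurable borel" using m(1)[OF t] by measurable
    show "norm (of_real (a s \<xi>) * \<phi> \<xi>) \<le> norm (of_real K * \<phi> \<xi>)" if "s \<in> {0..t+1}" for s \<xi>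
      by (rule bound) (use K that in blast)
    show "((\<lambda>s. of_real (a s \<xi>) * \<phi> \<xi>) \<longlongrightarrow> of_real (a t \<xi>) * \<phi> \<xi>) (at t within {0..t+1})" for \<xi>
    proof -
      have "((\<lambda>s. a s \<xi>) \<longlongrightarrow> a t \<xi>) (at t within {0..})" using DERIV_continuous[OF der[OF t]] by (simp add: continuous_within)
      then have "((\<lambda>s. a s \<xi>) \<longlongrightarrow> a t \<xi>) (at t within {0..t+1})" by (rule tendsto_within_subset) auto
      then show ?thesis by (intro tendsto_intros)
    qed
  qed
  show "L2_tendsto (\<lambda>s \<xi>. of_real ((a s \<xi> - a t \<xi>) / (s - t)) * \<phi> \<xi>) (\<lambda>\<xi>. of_real (a' t \<xi>) * \<phi> \<xi>) (at t within {0..t+1})"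
  proof (rule L2_tendsto_at_dominated[OF _ _ KL2])
    show "(\<lambda>\<xi>. of_real ((a s \<xi> - a t \<xi>) / (s - t)) * \<phi> \<xi>) \<in> borel_measurable borel" if "s \<in> {0..t+1}" for s
    proof -
      have [measurable]: "a s \<in> borel_measurable borel" "a t \<in> borel_measurable borel" using m(1) that t by auto
      show ?thesis by measurable
    qed
    show "(\<lambda>\<xi>. of_real (a' t \<xi>) * \<phi> \<xi>) \<in> borel_measurable borel" using m(2)[OF t] by measurable
    show "norm (of_real ((a s \<xi> - a t \<xi>) / (s - t)) * \<phi> \<xi>) \<le> norm (of_real K * \<phi> \<xi>)" if s: "s \<in> {0..t+1}" "s \<noteq> t" for s \<xi>
    proof (rule bound)
      assume \<xi>: "\<xi> \<in> cball 0 R"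
      \<comment> \<open>The mean value estimate needs ordered endpoints, while \<open>s\<close> may
        lie on either side of \<open>t\<close>.\<close>
      define x y where "x = min s t" and "y = max s t"
      have xy: "0 \<le> x" "x < y" "y \<le> t + 1" using s t by (auto simp: x_def y_def min_def max_def)
      have "\<bar>a y \<xi> - a x \<xi>\<bar> \<le> K * y - K * x"
      proof (rule abs_diff_le_by_deriv[where f' = "\<lambda>s. a' s \<xi>" and g' = "\<lambda>_. K"])
        show "continuous_on {x..y} (\<lambda>s. a s \<xi>)"
          unfolding continuous_on_eq_continuous_within
        proof
          fix z assume z: "z \<in> {x..y}"
          have "((\<lambda>s. a s \<xi>) has_real_derivative a' z \<xi>) (at z within {x..y})"
            by (rule DERIV_subset[OF der]) (use z xy in auto)
          then show "continuous (at z within {x..y}) (\<lambda>s. a s \<xi>)" by (rule DERIV_continuous)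
        qed
        fix z assume z: "x < z" "z < y"
        have "at z within {0..} = at z" by (rule at_within_interior) (use z xy in auto)
        then show "((\<lambda>s. a s \<xi>) has_real_derivative a' z \<xi>) (at z)" using der[of z \<xi>] z xy by simp
        show "\<bar>a' z \<xi>\<bar> \<le> K" using K \<xi> z xy by auto
        show "((*) K has_real_derivative K) (at z)" by (auto intro!: derivative_eq_intros)
      qed (use xy in \<open>auto intro!: continuous_intros\<close>)
      then have "\<bar>a y \<xi> - a x \<xi>\<bar> \<le> K * (y - x)" by (simp add: right_diff_distrib)
      then have "\<bar>a y \<xi> - a x \<xi>\<bar> / (y - x) \<le> K" using xy by (simp add: pos_divide_le_eq)
      moreover have "\<bar>(a s \<xi> - a t \<xi>) / (s - t)\<bar> = \<bar>a y \<xi> - a x \<xi>\<bar> / (y - x)"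
        using s by (auto simp: x_def y_def min_def max_def abs_divide abs_minus_commute)
      ultimately show "\<bar>(a s \<xi> - a t \<xi>) / (s - t)\<bar> \<le> K" by simp
    qed
    show "((\<lambda>s. of_real ((a s \<xi> - a t \<xi>) / (s - t)) * \<phi> \<xi>) \<longlongrightarrow> of_real (a' t \<xi>) * \<phi> \<xi>) (at t within {0..t+1})" for \<xi>
    proof -
      have "((\<lambda>s. (a s \<xi> - a t \<xi>) / (s - t)) \<longlongrightarrow> a' t \<xi>) (at t within {0..})"
        using der[OF t, of \<xi>] by (simp add: has_field_derivative_iff)
      then have "((\<lambda>s. (a s \<xi> - a t \<xi>) / (s - t)) \<longlongrightarrow> a' t \<xi>) (at t within {0..t+1})" by (rule tendsto_within_subset) auto
      then show ?thesis by (intro tendsto_intros)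
    qed
  qed
qed

lemma L2_tendsto_filter_mono: "L2_tendsto F f X \<Longrightarrow> Y \<le> X \<Longrightarrow> L2_tendsto F f Y"
  unfolding L2_tendsto_def by (rule tendsto_mono)

lemma L2_inner_scale_right: "L2_inner f (\<lambda>x. of_real c * g x) = of_real c * L2_inner f g"
  unfolding L2_inner_def complex_cnj_mult complex_cnj_complex_of_real mult.left_commute[of _ "of_real c"] by simp

lemma multiplier_pairing_continuous:
  assumes a: "multiplier a a'" and \<phi>: "nice \<phi>" and t: "t \<ge> 0"
    and X: "\<And>s. s \<ge> 0 \<Longrightarrow> in_L2 (X s)" "L2_tendsto X (X t) (at t within {0..})"
  shows "((\<lambda>s. L2_inner (X s) (\<lambda>\<xi>. of_real (a s \<xi>) * \<phi> \<xi>)) \<longlongrightarrow> L2_inner (X t) (\<lambda>\<xi>. of_real (a t \<xi>) * \<phi> \<xi>)) (at t within {0..t+1})"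
proof (rule L2_tendsto_inner[OF _ _ X(1)[OF t] multiplier_tendsto(1)[OF a \<phi> t]])
  show "L2_tendsto X (X t) (at t within {0..t+1})" by (rule L2_tendsto_filter_mono[OF X(2) at_le]) auto
  show "eventually (\<lambda>s. in_L2 (X s)) (at t within {0..t+1})" unfolding eventually_at_filter using X(1) by (intro always_eventually) auto
  show "eventually (\<lambda>s. in_L2 (\<lambda>\<xi>. of_real (a s \<xi>) * \<phi> \<xi>)) (at t within {0..t+1})"
    unfolding eventually_at_filter using multiplier_nice(1)[OF a \<phi>] nice_in_L2(1) by (intro always_eventually) auto
  show "in_L2 (\<lambda>\<xi>. of_real (a t \<xi>) * \<phi> \<xi>)" by (intro nice_in_L2 multiplier_nice[OF a \<phi> t])
qed

text \<open>A product rule for an \<open>X\<close> that is continuous in \<open>L2\<close> but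
  differentiable only in pairings. \<open>D\<close> is the derivative with the multiplier frozen at
  time \<open>t\<close>; the other difference quotient falls on the multiplier, where it converges
  in \<open>L2\<close>.\<close>

lemma multiplier_pairing_deriv:
  assumes a: "multiplier a a'" and \<phi>: "nice \<phi>" and t: "t > 0"
    and X: "\<And>s. s \<ge> 0 \<Longrightarrow> in_L2 (X s)" "L2_tendsto X (X t) (at t within {0..})"
    and D: "((\<lambda>s. L2_inner (X s) (\<lambda>\<xi>. of_real (a t \<xi>) * \<phi> \<xi>)) has_vector_derivative D) (at t)"
  shows "((\<lambda>s. L2_inner (X s) (\<lambda>\<xi>. of_real (a s \<xi>) * \<phi> \<xi>)) has_vector_derivative
     D + L2_inner (X t) (\<lambda>\<xi>. of_real (a' t \<xi>) * \<phi> \<xi>)) (at t)"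
proof -
  have t0: "t \<ge> 0" using t by simp
  have at: "at t within {0..t+1} = at t" by (rule at_within_interior) (use t in auto)
  define q where "q s \<xi> = of_real ((a s \<xi> - a t \<xi>) / (s - t)) * \<phi> \<xi>" for s \<xi>
  note aL2 = nice_in_L2(1)[OF multiplier_nice(1)[OF a \<phi>]]
  have ev: "eventually (\<lambda>s. s > 0 \<and> s \<noteq> t) (at t)"
  proof -
    have "eventually (\<lambda>s. s \<in> {0<..}) (nhds t)" by (rule eventually_nhds_in_open) (use t in auto)
    then show ?thesis unfolding eventually_at_filter by eventually_elim auto
  qed
  have qe: "q s = (\<lambda>\<xi>. of_real (1 / (s - t)) * (of_real (a s \<xi>) * \<phi> \<xi> - of_real (a t \<xi>) * \<phi> \<xi>))" for s
    by (auto simp: q_def fun_eq_iff diff_divide_distrib left_diff_distrib)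
  have qL2: "in_L2 (q s)" if "s > 0" for s unfolding qe by (intro in_L2_cmult in_L2_diff aL2) (use that t in auto)
  have "((\<lambda>s. L2_inner (X s) (q s)) \<longlongrightarrow> L2_inner (X t) (\<lambda>\<xi>. of_real (a' t \<xi>) * \<phi> \<xi>)) (at t)"
  proof (rule L2_tendsto_inner)
    show "L2_tendsto X (X t) (at t)" unfolding at[symmetric] by (rule L2_tendsto_filter_mono[OF X(2) at_le]) auto
    show "eventually (\<lambda>s. in_L2 (X s)) (at t)" using ev by eventually_elim (simp add: X(1))
    show "eventually (\<lambda>s. in_L2 (q s)) (at t)" using ev by eventually_elim (simp add: qL2)
    show "L2_tendsto q (\<lambda>\<xi>. of_real (a' t \<xi>) * \<phi> \<xi>) (at t)"
      unfolding q_def using multiplier_tendsto(2)[OF a \<phi> t0] unfolding at .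
    show "in_L2 (\<lambda>\<xi>. of_real (a' t \<xi>) * \<phi> \<xi>)" by (intro nice_in_L2 multiplier_nice[OF a \<phi> t0])
  qed (use X t0 in auto)
  \<comment> \<open>The subtracted pairing is zero; it is written out so that a difference quotient
    in \<open>s\<close> appears.\<close>
  moreover have "eventually (\<lambda>s. L2_inner (X s) (q s) = (1 / (s - t)) *\<^sub>R (L2_inner (X s) (\<lambda>\<xi>. of_real (a s \<xi>) * \<phi> \<xi> - of_real (a t \<xi>) * \<phi> \<xi>)
      - L2_inner (X t) (\<lambda>\<xi>. of_real (a t \<xi>) * \<phi> \<xi> - of_real (a t \<xi>) * \<phi> \<xi>))) (at t)"
    using ev
  proof eventually_elim
    case (elim s)
    have "L2_inner (X s) (q s) = of_real (1 / (s - t)) * L2_inner (X s) (\<lambda>\<xi>. of_real (a s \<xi>) * \<phi> \<xi> - of_real (a t \<xi>) * \<phi> \<xi>)"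
      unfolding qe by (rule L2_inner_scale_right)
    then show ?case by (simp add: scaleR_conv_of_real L2_inner_def)
  qed
  ultimately have "((\<lambda>s. (1 / (s - t)) *\<^sub>R (L2_inner (X s) (\<lambda>\<xi>. of_real (a s \<xi>) * \<phi> \<xi> - of_real (a t \<xi>) * \<phi> \<xi>)
      - L2_inner (X t) (\<lambda>\<xi>. of_real (a t \<xi>) * \<phi> \<xi> - of_real (a t \<xi>) * \<phi> \<xi>))) \<longlongrightarrow> L2_inner (X t) (\<lambda>\<xi>. of_real (a' t \<xi>) * \<phi> \<xi>)) (at t)"
    by (rule Lim_transform_eventually)
  then have "((\<lambda>s. L2_inner (X s) (\<lambda>\<xi>. of_real (a s \<xi>) * \<phi> \<xi> - of_real (a t \<xi>) * \<phi> \<xi>)) has_vector_derivative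
      L2_inner (X t) (\<lambda>\<xi>. of_real (a' t \<xi>) * \<phi> \<xi>)) (at t)"
    by (rule vector_derivative_quotientI)
  from has_vector_derivative_add[OF D this]
  have sum: "((\<lambda>s. L2_inner (X s) (\<lambda>\<xi>. of_real (a t \<xi>) * \<phi> \<xi>) + L2_inner (X s) (\<lambda>\<xi>. of_real (a s \<xi>) * \<phi> \<xi> - of_real (a t \<xi>) * \<phi> \<xi>))
    has_vector_derivative D + L2_inner (X t) (\<lambda>\<xi>. of_real (a' t \<xi>) * \<phi> \<xi>)) (at t)" .
  have eq: "L2_inner (X s) (\<lambda>\<xi>. of_real (a t \<xi>) * \<phi> \<xi>) + L2_inner (X s) (\<lambda>\<xi>. of_real (a s \<xi>) * \<phi> \<xi> - of_real (a t \<xi>) * \<phi> \<xi>)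
      = L2_inner (X s) (\<lambda>\<xi>. of_real (a s \<xi>) * \<phi> \<xi>)" if "s \<in> {0<..}" for s
    using that t by (simp add: L2_inner_diff_right X(1) aL2)
  show ?thesis
    by (rule has_vector_derivative_transform_within_open[OF sum open_greaterThan _ eq]) (use t in auto)
qed

text \<open>The factor \<open>exp (\<integral>b)\<close> cancels the damping in the derivative of
  \<open>fund'\<close> and adds a term with \<open>b\<close> to that of \<open>fund\<close>. The
  pair thus solves the adjoint system.\<close>

lemma fund_multiplier:
  assumes b: "continuous_on {0..} b"
  defines "e \<equiv> \<lambda>s. exp (integral {0..s} b)"
  shows "multiplier (\<lambda>s \<xi>::real^'n. e s * fund' b \<alpha> \<beta> (norm \<xi>) s) (\<lambda>s \<xi>. - (norm \<xi>)\<^sup>2 * (e s * fund b \<alpha> \<beta> (norm \<xi>) s))" (is ?A)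
    and "multiplier (\<lambda>s \<xi>::real^'n. e s * fund b \<alpha> \<beta> (norm \<xi>) s)
      (\<lambda>s \<xi>. b s * (e s * fund b \<alpha> \<beta> (norm \<xi>) s) + e s * fund' b \<alpha> \<beta> (norm \<xi>) s)" (is ?B)
proof -
  have de: "(e has_real_derivative b s * e s) (at s within {0..})" if "s \<ge> 0" for s
    unfolding e_def by (auto intro!: derivative_eq_intros integral_deriv_halfline[OF b that])
  have conte: "continuous_on {0..} e" unfolding e_def by (intro continuous_intros continuous_on_integral_halfline b)
  have bdd: "\<exists>K\<ge>0. \<forall>s\<in>{0..T}. \<bar>h s\<bar> \<le> K" if h: "continuous_on {0..} h" for h :: "real \<Rightarrow> real" and T
  proof -
    obtain K where K: "\<And>s. s \<in> {0..T} \<Longrightarrow> \<bar>h s\<bar> \<le> K"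
      by (rule continuous_on_Icc_bounded[OF continuous_on_subset[OF h, of "{0..T}"]]) auto
    then show ?thesis by (intro exI[of _ "\<bar>K\<bar>"]) (auto intro: order_trans[OF _ abs_ge_self])
  qed
  have m: "(\<lambda>\<xi>::real^'n. fund b \<alpha> \<beta> (norm \<xi>) s) \<in> borel_measurable borel" "(\<lambda>\<xi>::real^'n. fund' b \<alpha> \<beta> (norm \<xi>) s) \<in> borel_measurable borel" if "s \<ge> 0" for s
    by (rule measurable_compose[OF _ fund_measurable(1)[OF b that]], measurable)
      (rule measurable_compose[OF _ fund_measurable(2)[OF b that]], measurable)
  have d: "(fund b \<alpha> \<beta> r has_real_derivative fund' b \<alpha> \<beta> r s) (at s within {0..})"
    "(fund' b \<alpha> \<beta> r has_real_derivative (- r\<^sup>2 * fund b \<alpha> \<beta> r s - b s * fund' b \<alpha> \<beta> r s)) (at s within {0..})" if "s \<ge> 0" for r s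
    using fund_mode(1)[OF b] that unfolding mode_def by blast+
  have K: "\<exists>K0 Ke Kb. K0 \<ge> 0 \<and> Ke \<ge> 0 \<and> Kb \<ge> 0 \<and> (\<forall>s\<in>{0..T}. \<forall>\<xi>::real^'n \<in> cball 0 R. \<bar>e s * fund b \<alpha> \<beta> (norm \<xi>) s\<bar> \<le> Ke * K0
      \<and> \<bar>e s * fund' b \<alpha> \<beta> (norm \<xi>) s\<bar> \<le> Ke * K0 \<and> \<bar>b s\<bar> \<le> Kb)" for R T
  proof -
    obtain Ke Kb where K: "Ke \<ge> 0" "\<forall>s\<in>{0..T}. \<bar>e s\<bar> \<le> Ke" "Kb \<ge> 0" "\<forall>s\<in>{0..T}. \<bar>b s\<bar> \<le> Kb" using bdd[OF conte] bdd[OF b] by metis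
    obtain K0 where K0: "\<forall>r. \<bar>r\<bar> \<le> R \<longrightarrow> (\<forall>s\<in>{0..max T 0}. \<bar>fund b \<alpha> \<beta> r s\<bar> \<le> K0 \<and> \<bar>fund' b \<alpha> \<beta> r s\<bar> \<le> K0)"
      using mode_bounded[OF b, of "max T 0" R \<alpha> \<beta>] by auto
    have "\<bar>fund b \<alpha> \<beta> (norm \<xi>) s\<bar> \<le> \<bar>K0\<bar> \<and> \<bar>fund' b \<alpha> \<beta> (norm \<xi>) s\<bar> \<le> \<bar>K0\<bar>" if "s \<in> {0..T}" "\<xi> \<in> cball 0 R" for s and \<xi> :: "real^'n"
    proof -
      have "\<bar>norm \<xi>\<bar> \<le> R" "s \<in> {0..max T 0}" using that by auto
      with K0 show ?thesis using abs_ge_self[of K0] by (meson order_trans)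
    qed
    then show ?thesis using K by (intro exI[of _ "\<bar>K0\<bar>"] exI[of _ Ke] exI[of _ Kb]) (auto simp: abs_mult intro!: mult_mono)
  qed
  show ?A unfolding multiplier_def
  proof (intro conjI allI impI)
    fix R T
    obtain K0 Ke Kb where k: "K0 \<ge> 0" "Ke \<ge> 0" and K1: "\<forall>s\<in>{0..T}. \<forall>\<xi>::real^'n \<in> cball 0 R. \<bar>e s * fund b \<alpha> \<beta> (norm \<xi>) s\<bar> \<le> Ke * K0
      \<and> \<bar>e s * fund' b \<alpha> \<beta> (norm \<xi>) s\<bar> \<le> Ke * K0 \<and> \<bar>b s\<bar> \<le> Kb" using K by blast
    show "\<exists>K. \<forall>s\<in>{0..T}. \<forall>\<xi>::real^'n\<in>cball 0 R. \<bar>e s * fund' b \<alpha> \<beta> (norm \<xi>) s\<bar> \<le> K \<and> \<bar>- (norm \<xi>)\<^sup>2 * (e s * fund b \<alpha> \<beta> (norm \<xi>) s)\<bar> \<le> K"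
    proof (intro exI[of _ "Ke * K0 + R\<^sup>2 * (Ke * K0)"] ballI conjI)
      fix s and \<xi> :: "real^'n" assume s: "s \<in> {0..T}" "\<xi> \<in> cball 0 R"
      have KK: "0 \<le> Ke * K0" using k by simp
      then show "\<bar>e s * fund' b \<alpha> \<beta> (norm \<xi>) s\<bar> \<le> Ke * K0 + R\<^sup>2 * (Ke * K0)"
        using K1 s by (meson add_increasing2 mult_nonneg_nonneg zero_le_power2)
      have "(norm \<xi>)\<^sup>2 \<le> R\<^sup>2" using s(2) by (intro power_mono) auto
      then have "(norm \<xi>)\<^sup>2 * \<bar>e s * fund b \<alpha> \<beta> (norm \<xi>) s\<bar> \<le> R\<^sup>2 * (Ke * K0)" using K1 s by (intro mult_mono) auto
      moreover have "\<bar>- (norm \<xi>)\<^sup>2 * (e s * fund b \<alpha> \<beta> (norm \<xi>) s)\<bar> = (norm \<xi>)\<^sup>2 * \<bar>e s * fund b \<alpha> \<beta> (norm \<xi>) s\<bar>" by (simp add: abs_mult)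
      ultimately show "\<bar>- (norm \<xi>)\<^sup>2 * (e s * fund b \<alpha> \<beta> (norm \<xi>) s)\<bar> \<le> Ke * K0 + R\<^sup>2 * (Ke * K0)" using KK by linarith
    qed
  next
    fix \<xi> :: "real^'n" and s :: real assume s: "0 \<le> s"
    show "((\<lambda>s. e s * fund' b \<alpha> \<beta> (norm \<xi>) s) has_real_derivative - (norm \<xi>)\<^sup>2 * (e s * fund b \<alpha> \<beta> (norm \<xi>) s)) (at s within {0..})"
      by (auto intro!: derivative_eq_intros de[OF s] d[OF s] simp: algebra_simps)
  next
    fix s :: real assume s: "0 \<le> s"
    note [measurable] = m[OF s]
    show "(\<lambda>\<xi>::real^'n. e s * fund' b \<alpha> \<beta> (norm \<xi>) s) \<in> borel_measurable borel"
      "(\<lambda>\<xi>::real^'n. - (norm \<xi>)\<^sup>2 * (e s * fund b \<alpha> \<beta> (norm \<xi>) s)) \<in> borel_measurable borel" by measurable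
  qed
  show ?B unfolding multiplier_def
  proof (intro conjI allI impI)
    fix R T
    obtain K0 Ke Kb where k: "K0 \<ge> 0" "Ke \<ge> 0" "Kb \<ge> 0" and K1: "\<forall>s\<in>{0..T}. \<forall>\<xi>::real^'n \<in> cball 0 R. \<bar>e s * fund b \<alpha> \<beta> (norm \<xi>) s\<bar> \<le> Ke * K0
      \<and> \<bar>e s * fund' b \<alpha> \<beta> (norm \<xi>) s\<bar> \<le> Ke * K0 \<and> \<bar>b s\<bar> \<le> Kb" using K by blast
    show "\<exists>K. \<forall>s\<in>{0..T}. \<forall>\<xi>::real^'n\<in>cball 0 R. \<bar>e s * fund b \<alpha> \<beta> (norm \<xi>) s\<bar> \<le> K \<and> \<bar>b s * (e s * fund b \<alpha> \<beta> (norm \<xi>) s) + e s * fund' b \<alpha> \<beta> (norm \<xi>) s\<bar> \<le> K"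
    proof (intro exI[of _ "Kb * (Ke * K0) + Ke * K0"] ballI conjI)
      fix s and \<xi> :: "real^'n" assume s: "s \<in> {0..T}" "\<xi> \<in> cball 0 R"
      have KK: "0 \<le> Kb * (Ke * K0)" using k by simp
      have f: "\<bar>e s * fund b \<alpha> \<beta> (norm \<xi>) s\<bar> \<le> Ke * K0" "\<bar>e s * fund' b \<alpha> \<beta> (norm \<xi>) s\<bar> \<le> Ke * K0" "\<bar>b s\<bar> \<le> Kb"
        using K1 s by blast+
      show "\<bar>e s * fund b \<alpha> \<beta> (norm \<xi>) s\<bar> \<le> Kb * (Ke * K0) + Ke * K0" using f(1) KK by linarith
      have "\<bar>b s\<bar> * \<bar>e s * fund b \<alpha> \<beta> (norm \<xi>) s\<bar> \<le> Kb * (Ke * K0)" using f k by (intro mult_mono) auto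
      then show "\<bar>b s * (e s * fund b \<alpha> \<beta> (norm \<xi>) s) + e s * fund' b \<alpha> \<beta> (norm \<xi>) s\<bar> \<le> Kb * (Ke * K0) + Ke * K0"
        using f(2) abs_triangle_ineq[of "b s * (e s * fund b \<alpha> \<beta> (norm \<xi>) s)" "e s * fund' b \<alpha> \<beta> (norm \<xi>) s"] unfolding abs_mult[of "b s"] by linarith
    qed
  next
    fix \<xi> :: "real^'n" and s :: real assume s: "0 \<le> s"
    show "((\<lambda>s. e s * fund b \<alpha> \<beta> (norm \<xi>) s) has_real_derivative b s * (e s * fund b \<alpha> \<beta> (norm \<xi>) s) + e s * fund' b \<alpha> \<beta> (norm \<xi>) s) (at s within {0..})"
      by (auto intro!: derivative_eq_intros de[OF s] d[OF s] simp: algebra_simps)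
  next
    fix s :: real assume s: "0 \<le> s"
    note [measurable] = m[OF s]
    show "(\<lambda>\<xi>::real^'n. e s * fund b \<alpha> \<beta> (norm \<xi>) s) \<in> borel_measurable borel"
      "(\<lambda>\<xi>::real^'n. b s * (e s * fund b \<alpha> \<beta> (norm \<xi>) s) + e s * fund' b \<alpha> \<beta> (norm \<xi>) s) \<in> borel_measurable borel" by measurable
  qed
qed

text \<open>Pairing with the phase of \<open>h\<close>, restricted to a ball, gives the integral of
  the modulus of \<open>h\<close> over that ball; countably many balls cover the space.\<close>

lemma AE_zero_by_nice:
  fixes h :: "real^'n \<Rightarrow> complex"
  assumes [measurable]: "h \<in> borel_measurable borel"
    and i: "\<And>\<phi>. nice \<phi> \<Longrightarrow> integrable lborel (\<lambda>\<xi>. h \<xi> * cnj (\<phi> \<xi>))"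
    and z: "\<And>\<phi>. nice \<phi> \<Longrightarrow> (\<integral>\<xi>. h \<xi> * cnj (\<phi> \<xi>) \<partial>lborel) = 0"
  shows "AE \<xi> in lborel. h \<xi> = 0"
proof -
  have "AE \<xi> in lborel. \<xi> \<in> cball 0 (real k) \<longrightarrow> h \<xi> = 0" for k
  proof -
    \<comment> \<open>Where \<open>h\<close> vanishes, division by zero yields 0, so
      \<open>\<phi>\<close> is total, measurable and bounded by 1.\<close>
    define \<phi> where "\<phi> \<xi> = of_real (indicator (cball 0 (real k)) \<xi> / norm (h \<xi>)) * h \<xi>" for \<xi>
    have [measurable]: "cball 0 (real k) \<in> sets (borel :: (real^'n) measure)" by (simp add: borel_closed)
    have "\<phi> \<in> borel_measurable borel" unfolding \<phi>_def[abs_def] by measurable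
    moreover have "norm (\<phi> \<xi>) \<le> 1 * indicator (cball 0 (real k)) \<xi>" for \<xi>
      by (cases "h \<xi> = 0") (auto simp: \<phi>_def norm_mult norm_divide indicator_def)
    ultimately have n: "nice \<phi>" unfolding nice_def by blast
    have e: "h \<xi> * cnj (\<phi> \<xi>) = of_real (indicator (cball 0 (real k)) \<xi> * norm (h \<xi>))" for \<xi>
    proof (cases "h \<xi> = 0")
      case False
      have "h \<xi> * cnj (\<phi> \<xi>) = of_real (indicator (cball 0 (real k)) \<xi> / norm (h \<xi>)) * (h \<xi> * cnj (h \<xi>))"
        by (simp only: \<phi>_def complex_cnj_mult complex_cnj_complex_of_real mult.left_commute)
      also have "\<dots> = of_real (indicator (cball 0 (real k)) \<xi> / norm (h \<xi>) * (norm (h \<xi>))\<^sup>2)"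
        by (simp only: complex_norm_square[symmetric] of_real_mult)
      also have "indicator (cball 0 (real k)) \<xi> / norm (h \<xi>) * (norm (h \<xi>))\<^sup>2 = indicator (cball 0 (real k)) \<xi> * norm (h \<xi>)"
        using False by (simp add: power2_eq_square)
      finally show ?thesis .
    qed (simp add: \<phi>_def)
    define g where "g \<xi> = indicator (cball 0 (real k)) \<xi> * norm (h \<xi>)" for \<xi>
    have g0: "g \<xi> \<ge> 0" for \<xi> by (simp add: g_def)
    have ig: "integrable lborel g"
      using integrable_norm[OF i[OF n]] g0 unfolding e g_def[symmetric] by simp
    have "complex_of_real (\<integral>\<xi>. g \<xi> \<partial>lborel) = 0"
      using z[OF n] unfolding e g_def[symmetric] integral_complex_of_real .
    then have "AE \<xi> in lborel. g \<xi> = 0" using integral_nonneg_eq_0_iff_AE[OF ig] g0 by simp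
    then show ?thesis by eventually_elim (auto simp: g_def)
  qed
  then have "AE \<xi> in lborel. \<forall>k. \<xi> \<in> cball 0 (real k) \<longrightarrow> h \<xi> = 0" by (subst AE_all_countable) blast
  then show ?thesis
  proof eventually_elim
    case (elim \<xi>)
    obtain k :: nat where "norm \<xi> \<le> real k" using real_arch_simple by blast
    then show ?case using elim by auto
  qed
qed

section \<open>Reduction of energy solutions to modes\<close>

lemma energy_solution_L2:
  fixes u :: "real \<Rightarrow> real^'n \<Rightarrow> complex"
  assumes sol: "energy_solution b u0 u1 u" and t: "t \<ge> 0"
  shows "in_H1 (u t)" "in_L2 (u t)" "in_L2 (time_deriv u t)" "has_L2_time_derivative u (time_deriv u t) t"
    "L2_tendsto u (u t) (at t within {0..})" "L2_tendsto (time_deriv u) (time_deriv u t) (at t within {0..})"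
proof -
  show "in_H1 (u t)" "L2_tendsto u (u t) (at t within {0..})" "L2_tendsto (time_deriv u) (time_deriv u t) (at t within {0..})"
    and d: "has_L2_time_derivative u (time_deriv u t) t"
    using sol t someI_ex[of "\<lambda>v. has_L2_time_derivative u v t"] unfolding energy_solution_def time_deriv_def by blast+
  then show "in_L2 (u t)" "in_L2 (time_deriv u t)" using in_H1_grad unfolding has_L2_time_derivative_def by blast+
qed

lemma energy_solution_fourier_tendsto:
  fixes u :: "real \<Rightarrow> real^'n \<Rightarrow> complex"
  assumes sol: "energy_solution b u0 u1 u" and t: "t \<ge> 0"
  shows "L2_tendsto (\<lambda>s. fourier (u s)) (fourier (u t)) (at t within {0..})"
    "L2_tendsto (\<lambda>s. fourier (time_deriv u s)) (fourier (time_deriv u t)) (at t within {0..})"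
proof -
  note E = energy_solution_L2[OF sol]
  have ev: "eventually (\<lambda>s. s \<ge> 0) (at t within {0..})" unfolding eventually_at_filter by (intro always_eventually) auto
  have "eventually (\<lambda>s. in_L2 (u s)) (at t within {0..})" "eventually (\<lambda>s. in_L2 (time_deriv u s)) (at t within {0..})"
    by (rule eventually_mono[OF ev], erule E)+
  then show "L2_tendsto (\<lambda>s. fourier (u s)) (fourier (u t)) (at t within {0..})"
    "L2_tendsto (\<lambda>s. fourier (time_deriv u s)) (fourier (time_deriv u t)) (at t within {0..})"
    by (auto intro!: fourier_tendsto E t)
qed

text \<open>The variational equation is tested with the inverse transform of \<open>\<phi>\<close>,
  an element of \<open>H1\<close>; \<open>pairing_transfer\<close> rewrites each term on the Fourier
  side.\<close>

lemma energy_solution_fourier_deriv: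
  fixes u :: "real \<Rightarrow> real^'n \<Rightarrow> complex"
  assumes sol: "energy_solution b u0 u1 u" and t: "t > 0" and \<phi>: "nice \<phi>"
  shows "((\<lambda>s. L2_inner (fourier (u s)) \<phi>) has_vector_derivative L2_inner (fourier (time_deriv u t)) \<phi>) (at t)"
    and "((\<lambda>s. L2_inner (fourier (time_deriv u s)) \<phi>) has_vector_derivative
      - L2_inner (fourier (u t)) (\<lambda>\<xi>. of_real ((norm \<xi>)\<^sup>2) * \<phi> \<xi>) - of_real (b t) * L2_inner (fourier (time_deriv u t)) \<phi>) (at t)"
proof -
  note E = energy_solution_L2[OF sol]
  have t0: "t \<ge> 0" using t by simp
  define v where "v x = fourier_integral \<phi> (- x)" for x
  note tr = pairing_transfer[OF \<phi>, folded v_def]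
  have H1: "in_H1 v" using nice_inverse_H1[OF \<phi>] unfolding v_def .
  have v: "in_L2 v" using in_H1_grad[OF H1] by blast
  have at: "at t within {0..} = at t" by (rule at_within_interior) (use t in auto)
  have ev: "eventually (\<lambda>s. s > 0) (at t)"
    by (rule order_tendstoD(1)[OF tendsto_ident_at t])
  have qL2: "in_L2 (\<lambda>x. (1 / (s - t)) *\<^sub>R (u s x - u t x))" if "s > 0" for s
    unfolding scaleR_conv_of_real by (intro in_L2_cmult in_L2_diff E) (use that t in auto)
  have "((\<lambda>s. L2_inner (\<lambda>x. (1 / (s - t)) *\<^sub>R (u s x - u t x)) v) \<longlongrightarrow> L2_inner (time_deriv u t) v) (at t)"
  proof (rule L2_tendsto_inner[OF _ _ E(3)[OF t0] L2_tendsto_const _ v])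
    show "L2_tendsto (\<lambda>s x. (1 / (s - t)) *\<^sub>R (u s x - u t x)) (time_deriv u t) (at t)"
      using E(4)[OF t0] unfolding has_L2_time_derivative_def at by blast
    show "eventually (\<lambda>s. in_L2 (\<lambda>x. (1 / (s - t)) *\<^sub>R (u s x - u t x))) (at t)"
      using ev by eventually_elim (rule qL2)
  qed (simp add: v)
  moreover have "eventually (\<lambda>s. L2_inner (\<lambda>x. (1 / (s - t)) *\<^sub>R (u s x - u t x)) v
      = (1 / (s - t)) *\<^sub>R (L2_inner (u s) v - L2_inner (u t) v)) (at t)"
    using ev
  proof eventually_elim
    case (elim s)
    have "L2_inner (\<lambda>x. (1 / (s - t)) *\<^sub>R (u s x - u t x)) v = (1 / (s - t)) *\<^sub>R L2_inner (\<lambda>x. u s x - u t x) v"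
      unfolding L2_inner_def by simp
    then show ?case using elim t by (simp add: L2_inner_diff_left E v)
  qed
  ultimately have "((\<lambda>s. (1 / (s - t)) *\<^sub>R (L2_inner (u s) v - L2_inner (u t) v)) \<longlongrightarrow> L2_inner (time_deriv u t) v) (at t)"
    by (rule Lim_transform_eventually)
  then have 1: "((\<lambda>s. L2_inner (u s) v) has_vector_derivative L2_inner (fourier (time_deriv u t)) \<phi>) (at t)"
    unfolding tr(1)[OF E(3)[OF t0]] by (rule vector_derivative_quotientI)
  have e1: "L2_inner (u s) v = L2_inner (fourier (u s)) \<phi>" if "s \<in> {0<..}" for s
    using that by (intro tr(1) E) auto
  show "((\<lambda>s. L2_inner (fourier (u s)) \<phi>) has_vector_derivative L2_inner (fourier (time_deriv u t)) \<phi>) (at t)"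
    by (rule has_vector_derivative_transform_within_open[OF 1 open_greaterThan _ e1]) (use t in auto)
  have 2: "((\<lambda>s. L2_inner (time_deriv u s) v) has_vector_derivative
      - L2_inner (fourier (u t)) (\<lambda>\<xi>. of_real ((norm \<xi>)\<^sup>2) * \<phi> \<xi>) - of_real (b t) * L2_inner (fourier (time_deriv u t)) \<phi>) (at t)"
    using sol H1 t unfolding energy_solution_def tr(1)[OF E(3)[OF t0], symmetric] tr(2)[OF E(1)[OF t0], symmetric] by blast
  have e2: "L2_inner (time_deriv u s) v = L2_inner (fourier (time_deriv u s)) \<phi>" if "s \<in> {0<..}" for s
    using that by (intro tr(1) E) auto
  show "((\<lambda>s. L2_inner (fourier (time_deriv u s)) \<phi>) has_vector_derivative
      - L2_inner (fourier (u t)) (\<lambda>\<xi>. of_real ((norm \<xi>)\<^sup>2) * \<phi> \<xi>) - of_real (b t) * L2_inner (fourier (time_deriv u t)) \<phi>) (at t)"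
    by (rule has_vector_derivative_transform_within_open[OF 2 open_greaterThan _ e2]) (use t in auto)
qed

text \<open>With \<open>v\<close> a fundamental solution of the mode equation, \<open>e\<^bsup>\<integral>b\<^esup> v\<close> solves the adjoint
  equation, so the pairing of the transform of \<open>(u, u\<^sub>t)\<close> with it is conserved.\<close>

lemma energy_solution_conserved:
  fixes u :: "real \<Rightarrow> real^'n \<Rightarrow> complex"
  assumes sol: "energy_solution b u0 u1 u" and b: "continuous_on {0..} b" and t: "t \<ge> 0"
  defines "e \<equiv> \<lambda>s. exp (integral {0..s} b)"
  shows "AE \<xi> in lborel. of_real (e t * fund' b \<alpha> \<beta> (norm \<xi>) t) * fourier (u t) \<xi> - of_real (e t * fund b \<alpha> \<beta> (norm \<xi>) t) * fourier (time_deriv u t) \<xi>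
     = of_real \<beta> * fourier (u 0) \<xi> - of_real \<alpha> * fourier (time_deriv u 0) \<xi>"
proof -
  define U W where "U s = fourier (u s)" and "W s = fourier (time_deriv u s)" for s
  note E = energy_solution_L2[OF sol]
  have UL2: "in_L2 (U s)" and WL2: "in_L2 (W s)" if "s \<ge> 0" for s
    unfolding U_def W_def by (rule fourier_exists(1)[OF E(2)[OF that]]) (rule fourier_exists(1)[OF E(3)[OF that]])
  have Ut: "L2_tendsto U (U s) (at s within {0..})" and Wt: "L2_tendsto W (W s) (at s within {0..})" if "s \<ge> 0" for s
    using energy_solution_fourier_tendsto[OF sol that] unfolding U_def[abs_def] W_def[abs_def] by blast+
  note D = energy_solution_fourier_deriv[OF sol, folded U_def W_def]
  define a where "a s \<xi> = e s * fund' b \<alpha> \<beta> (norm \<xi>) s" for s and \<xi> :: "real^'n"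
  define c where "c s \<xi> = e s * fund b \<alpha> \<beta> (norm \<xi>) s" for s and \<xi> :: "real^'n"
  define a' where "a' s \<xi> = - (norm \<xi>)\<^sup>2 * c s \<xi>" for s and \<xi> :: "real^'n"
  define c' where "c' s \<xi> = b s * c s \<xi> + a s \<xi>" for s and \<xi> :: "real^'n"
  have ma: "multiplier a a'" and mc: "multiplier c c'"
    using fund_multiplier[OF b, of \<alpha> \<beta>] unfolding a_def[abs_def] c_def[abs_def] a'_def[abs_def] c'_def[abs_def] e_def by blast+
  define H where "H \<phi> s = L2_inner (U s) (\<lambda>\<xi>. of_real (a s \<xi>) * \<phi> \<xi>) - L2_inner (W s) (\<lambda>\<xi>. of_real (c s \<xi>) * \<phi> \<xi>)" for \<phi> s
  \<comment> \<open>In the derivative, \<open>a' = - (norm \<xi>)\<^sup>2 * c\<close> cancels the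
    terms pairing with \<open>U\<close>, and \<open>c' = b * c + a\<close> cancels those pairing
    with \<open>W\<close>.\<close>
  have H0: "(H \<phi> has_vector_derivative 0) (at s)" if s: "s > 0" and \<phi>: "nice \<phi>" for \<phi> s
  proof -
    have s0: "s \<ge> 0" using s by simp
    note na = multiplier_nice[OF ma \<phi> s0] and nc = multiplier_nice[OF mc \<phi> s0]
    have "(H \<phi> has_vector_derivative (L2_inner (W s) (\<lambda>\<xi>. of_real (a s \<xi>) * \<phi> \<xi>) + L2_inner (U s) (\<lambda>\<xi>. of_real (a' s \<xi>) * \<phi> \<xi>))
      - ((- L2_inner (U s) (\<lambda>\<xi>. of_real ((norm \<xi>)\<^sup>2) * (of_real (c s \<xi>) * \<phi> \<xi>)) - of_real (b s) * L2_inner (W s) (\<lambda>\<xi>. of_real (c s \<xi>) * \<phi> \<xi>))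
         + L2_inner (W s) (\<lambda>\<xi>. of_real (c' s \<xi>) * \<phi> \<xi>))) (at s)"
      unfolding H_def
      by (intro has_vector_derivative_diff multiplier_pairing_deriv[OF ma \<phi> s UL2 Ut[OF s0] D(1)[OF s na(1)]]
          multiplier_pairing_deriv[OF mc \<phi> s WL2 Wt[OF s0] D(2)[OF s nc(1)]])
    moreover have "L2_inner (U s) (\<lambda>\<xi>. of_real (a' s \<xi>) * \<phi> \<xi>) = - L2_inner (U s) (\<lambda>\<xi>. of_real ((norm \<xi>)\<^sup>2) * (of_real (c s \<xi>) * \<phi> \<xi>))"
      unfolding L2_inner_def a'_def by (simp add: mult.assoc)
    moreover have "L2_inner (W s) (\<lambda>\<xi>. of_real (a s \<xi>) * \<phi> \<xi>)
      = L2_inner (W s) (\<lambda>\<xi>. of_real (c' s \<xi>) * \<phi> \<xi>) - of_real (b s) * L2_inner (W s) (\<lambda>\<xi>. of_real (c s \<xi>) * \<phi> \<xi>)"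
    proof -
      have "(\<lambda>\<xi>. of_real (a s \<xi>) * \<phi> \<xi>) = (\<lambda>\<xi>. of_real (c' s \<xi>) * \<phi> \<xi> - of_real (b s) * (of_real (c s \<xi>) * \<phi> \<xi>))"
        by (simp add: fun_eq_iff c'_def algebra_simps)
      then show ?thesis
        by (simp only: L2_inner_scale_right[symmetric]) (intro L2_inner_diff_right nice_in_L2(1) nc in_L2_cmult WL2 s0)
    qed
    ultimately show ?thesis by simp
  qed
  \<comment> \<open>The equation holds for positive times only; continuity up to 0 carries the
    conservation to the initial time.\<close>
  have Hcont: "continuous_on {0..t} (H \<phi>)" if \<phi>: "nice \<phi>" for \<phi>
    unfolding continuous_on_def
  proof
    fix s assume s: "s \<in> {0..t}"
    then have s0: "s \<ge> 0" by simp
    have "(H \<phi> \<longlongrightarrow> H \<phi> s) (at s within {0..s+1})" unfolding H_def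
      by (intro tendsto_diff multiplier_pairing_continuous[OF ma \<phi> s0] multiplier_pairing_continuous[OF mc \<phi> s0] UL2 WL2 Ut Wt s0)
    then have "(H \<phi> \<longlongrightarrow> H \<phi> s) (at s within {0..t} \<inter> {..<s+1})" by (rule tendsto_within_subset) auto
    moreover have "at s within {0..t} = at s within ({0..t} \<inter> {..<s+1})"
      by (rule at_within_nhd[of s "{..<s+1}"]) auto
    ultimately show "(H \<phi> \<longlongrightarrow> H \<phi> s) (at s within {0..t})" by simp
  qed
  have Hconst: "H \<phi> t = H \<phi> 0" if \<phi>: "nice \<phi>" for \<phi>
  proof (rule has_derivative_zero_unique_strong_interval[where k = "{0}" and f = "H \<phi>" and a = 0 and b = t and y = "H \<phi> 0" and x = t])
    fix s assume "s \<in> {0..t} - {0}"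
    then have "(H \<phi> has_vector_derivative 0) (at s within {0..t})" by (intro has_vector_derivative_at_within[OF H0] \<phi>) auto
    then show "(H \<phi> has_derivative (\<lambda>h. 0)) (at s within {0..t})" by (simp add: has_vector_derivative_def)
  qed (use t Hcont[OF \<phi>] in auto)
  \<comment> \<open>The conserved expression at time \<open>t\<close> minus its value at time 0. Its
    pairing with every nice function is a difference of two values of \<open>H\<close>, hence
    0.\<close>
  define h where "h \<xi> = (U t \<xi> * of_real (a t \<xi>) - W t \<xi> * of_real (c t \<xi>)) - (U 0 \<xi> * of_real (a 0 \<xi>) - W 0 \<xi> * of_real (c 0 \<xi>))" for \<xi>
  have mm: "a s \<in> borel_measurable borel" "c s \<in> borel_measurable borel" "U s \<in> borel_measurable borel" "W s \<in> borel_measurable borel" if "s \<ge> 0" for s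
    using ma mc that in_L2_measurable[OF UL2] in_L2_measurable[OF WL2] unfolding multiplier_def by blast+
  note [measurable] = mm[OF t] mm[OF order_refl]
  have ii: "integrable lborel (\<lambda>\<xi>. U s \<xi> * cnj (of_real (a s \<xi>) * \<phi> \<xi>))" "integrable lborel (\<lambda>\<xi>. W s \<xi> * cnj (of_real (c s \<xi>) * \<phi> \<xi>))"
    if "s \<ge> 0" "nice \<phi>" for s \<phi>
    by (intro integrable_inner_L2 UL2 WL2 nice_in_L2 multiplier_nice[OF ma] multiplier_nice[OF mc] that)+
  have he: "(\<lambda>\<xi>. h \<xi> * cnj (\<phi> \<xi>)) = (\<lambda>\<xi>. (U t \<xi> * cnj (of_real (a t \<xi>) * \<phi> \<xi>) - W t \<xi> * cnj (of_real (c t \<xi>) * \<phi> \<xi>))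
      - (U 0 \<xi> * cnj (of_real (a 0 \<xi>) * \<phi> \<xi>) - W 0 \<xi> * cnj (of_real (c 0 \<xi>) * \<phi> \<xi>)))" for \<phi>
    by (simp add: fun_eq_iff h_def algebra_simps)
  have "AE \<xi> in lborel. h \<xi> = 0"
  proof (rule AE_zero_by_nice)
    show "h \<in> borel_measurable borel" unfolding h_def[abs_def] by measurable
    fix \<phi> :: "real^'n \<Rightarrow> complex" assume \<phi>: "nice \<phi>"
    note i = ii[OF t \<phi>] ii[OF order_refl \<phi>]
    show "integrable lborel (\<lambda>\<xi>. h \<xi> * cnj (\<phi> \<xi>))" unfolding he by (intro Bochner_Integration.integrable_diff i)
    have "(\<integral>\<xi>. h \<xi> * cnj (\<phi> \<xi>) \<partial>lborel) = H \<phi> t - H \<phi> 0"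
      unfolding he H_def L2_inner_def
      by (subst Bochner_Integration.integral_diff | intro Bochner_Integration.integrable_diff i refl)+
    then show "(\<integral>\<xi>. h \<xi> * cnj (\<phi> \<xi>) \<partial>lborel) = 0" using Hconst[OF \<phi>] by simp
  qed
  then show ?thesis
  proof eventually_elim
    case (elim \<xi>)
    have "a 0 \<xi> = \<beta>" "c 0 \<xi> = \<alpha>" by (simp_all add: a_def c_def e_def fund_mode(2,3)[OF b])
    with elim show ?case by (simp add: h_def U_def W_def a_def c_def mult.commute del: of_real_mult)
  qed
qed

text \<open>Liouville's formula: the Wronskian decays exactly like
  \<open>exp (- \<integral>b)\<close>.\<close>

lemma mode_wronskian:
  assumes v: "mode b r v w" and v': "mode b r v' w'" and b: "continuous_on {0..} b" and t: "t \<ge> 0"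
  shows "exp (integral {0..t} b) * (v t * w' t - w t * v' t) = v 0 * w' 0 - w 0 * v' 0"
proof -
  have "\<exists>c. \<forall>t\<in>{0..}. exp (integral {0..t} b) * (v t * w' t - w t * v' t) = c"
  proof (rule has_field_derivative_zero_constant)
    fix t :: real assume "t \<in> {0..}"
    then have t: "t \<ge> 0" by simp
    have d: "(v has_real_derivative w t) (at t within {0..})" "(w has_real_derivative (- r\<^sup>2 * v t - b t * w t)) (at t within {0..})"
      "(v' has_real_derivative w' t) (at t within {0..})" "(w' has_real_derivative (- r\<^sup>2 * v' t - b t * w' t)) (at t within {0..})"
      using v v' t unfolding mode_def by blast+
    show "((\<lambda>t. exp (integral {0..t} b) * (v t * w' t - w t * v' t)) has_real_derivative 0) (at t within {0..})"
      by (auto intro!: derivative_eq_intros d integral_deriv_halfline[OF b t] simp: algebra_simps)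
  qed simp
  then obtain c where c: "\<And>t. t \<ge> 0 \<Longrightarrow> exp (integral {0..t} b) * (v t * w' t - w t * v' t) = c" by auto
  from c[OF t] c[OF order_refl] show ?thesis by simp
qed

text \<open>The conserved quantities for the data (1, 0) and (0, 1) form a linear system for the two
  transforms at time \<open>t\<close>. Its coefficients are those of the Wronskian identity, so
  Cramer's rule solves it.\<close>

lemma energy_solution_representation:
  fixes u :: "real \<Rightarrow> real^'n \<Rightarrow> complex"
  assumes sol: "energy_solution b u0 u1 u" and b: "continuous_on {0..} b" and t: "t \<ge> 0"
  shows "AE \<xi> in lborel. fourier (u t) \<xi> = of_real (fund b 1 0 (norm \<xi>) t) * fourier (u 0) \<xi> + of_real (fund b 0 1 (norm \<xi>) t) * fourier (time_deriv u 0) \<xi>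
    \<and> fourier (time_deriv u t) \<xi> = of_real (fund' b 1 0 (norm \<xi>) t) * fourier (u 0) \<xi> + of_real (fund' b 0 1 (norm \<xi>) t) * fourier (time_deriv u 0) \<xi>"
  using energy_solution_conserved[OF sol b t, of 1 0] energy_solution_conserved[OF sol b t, of 0 1]
proof eventually_elim
  case (elim \<xi>)
  have "exp (integral {0..t} b) * (fund b 1 0 (norm \<xi>) t * fund' b 0 1 (norm \<xi>) t - fund' b 1 0 (norm \<xi>) t * fund b 0 1 (norm \<xi>) t) = 1"
    using mode_wronskian[OF fund_mode(1)[OF b] fund_mode(1)[OF b] b t] by (simp add: fund_mode(2,3)[OF b])
  then have w: "complex_of_real (exp (integral {0..t} b)) * (of_real (fund b 1 0 (norm \<xi>) t) * of_real (fund' b 0 1 (norm \<xi>) t)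
      - of_real (fund' b 1 0 (norm \<xi>) t) * of_real (fund b 0 1 (norm \<xi>) t)) = 1"
    by (metis of_real_1 of_real_diff of_real_mult)
  have "U = p1 * U0 + p2 * W0 \<and> W = q1 * U0 + q2 * W0"
    if "e * (p1 * q2 - q1 * p2) = 1" "(e * q1) * U - (e * p1) * W = - W0" "(e * q2) * U - (e * p2) * W = U0"
    for e p1 p2 q1 q2 U W U0 W0 :: complex
  proof
    have W0: "W0 = (e * p1) * W - (e * q1) * U" using that(2) by (metis minus_diff_eq minus_minus)
    have "p1 * U0 + p2 * W0 = (e * (p1 * q2 - q1 * p2)) * U"
      unfolding W0 that(3)[symmetric] by (simp add: algebra_simps)
    then show "U = p1 * U0 + p2 * W0" by (simp add: that(1))
    have "q1 * U0 + q2 * W0 = (e * (p1 * q2 - q1 * p2)) * W"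
      unfolding W0 that(3)[symmetric] by (simp add: algebra_simps)
    then show "W = q1 * U0 + q2 * W0" by (simp add: that(1))
  qed
  from this[OF w] elim show ?case by simp
qed

text \<open>The fundamental solutions are real, so the bound for real modes applies to the real and
  imaginary parts of the initial transforms separately. The frequency 0, where no mode bound is
  assumed, is a null set.\<close>

lemma energy_solution_pointwise:
  fixes u :: "real \<Rightarrow> real^'n \<Rightarrow> complex"
  assumes sol: "energy_solution b u0 u1 u" and b: "continuous_on {0..} b" and t: "t \<ge> 0"
    and bound: "\<And>r v w. r > 0 \<Longrightarrow> mode b r v w \<Longrightarrow> mode_energy r v w t \<le> K r * ((1 + r\<^sup>2) * (v 0)\<^sup>2 + (w 0)\<^sup>2)"
  shows "AE \<xi> in lborel. (norm \<xi>)\<^sup>2 * (norm (fourier (u t) \<xi>))\<^sup>2 + (norm (fourier (time_deriv u t) \<xi>))\<^sup>2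
    \<le> K (norm \<xi>) * ((1 + (norm \<xi>)\<^sup>2) * (norm (fourier (u 0) \<xi>))\<^sup>2 + (norm (fourier (time_deriv u 0) \<xi>))\<^sup>2)"
  using energy_solution_representation[OF sol b t] AE_lborel_singleton[of "0 :: real^'n"]
proof eventually_elim
  case (elim \<xi>)
  define r where "r = norm \<xi>"
  have r: "r > 0" using elim(2) by (simp add: r_def)
  have *: "r\<^sup>2 * (x * fund b 1 0 r t + y * fund b 0 1 r t)\<^sup>2 + (x * fund' b 1 0 r t + y * fund' b 0 1 r t)\<^sup>2
     \<le> K r * ((1 + r\<^sup>2) * x\<^sup>2 + y\<^sup>2)" for x y
    using bound[OF r mode_add[OF fund_mode(1)[OF b, of r 1 0] fund_mode(1)[OF b, of r 0 1], of x y]]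
    by (simp add: mode_energy_def fund_mode(2,3)[OF b])
  define U0 W0 where "U0 = fourier (u 0) \<xi>" and "W0 = fourier (time_deriv u 0) \<xi>"
  have U: "fourier (u t) \<xi> = of_real (fund b 1 0 r t) * U0 + of_real (fund b 0 1 r t) * W0"
    and W: "fourier (time_deriv u t) \<xi> = of_real (fund' b 1 0 r t) * U0 + of_real (fund' b 0 1 r t) * W0"
    using elim(1) unfolding r_def U0_def W0_def by blast+
  show ?case unfolding U W r_def[symmetric] U0_def[symmetric] W0_def[symmetric] cmod_power2
    using *[of "Re U0" "Re W0"] *[of "Im U0" "Im W0"]
    by (simp add: distrib_left distrib_right mult.commute)
qed

text \<open>Plancherel's identity turns the energy into an integral over frequencies, to which the
  pointwise bound applies. The computation is done in \<open>ennreal\<close>; finiteness of the data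
  norm allows the return to real numbers, and the factor 1/2 of the energy is given away.\<close>

lemma energy_le_data:
  fixes u :: "real \<Rightarrow> real^'n \<Rightarrow> complex"
  assumes sol: "energy_solution b u0 u1 u" and b: "continuous_on {0..} b" and t: "t \<ge> 0"
    and \<rho>: "continuous_on {0..} \<rho>" and data: "(u0, u1) \<in> data_space \<rho> \<kappa>" and C: "C \<ge> 0"
    and bound: "\<And>r v w. r > 0 \<Longrightarrow> mode b r v w \<Longrightarrow>
      mode_energy r v w t \<le> C * exp (2 * \<kappa> * \<rho> r) * ((1 + r\<^sup>2) * (v 0)\<^sup>2 + (w 0)\<^sup>2)"
  shows "energy u t \<le> C * (data_norm \<rho> \<kappa> (u0, u1))\<^sup>2"
proof -
  note E = energy_solution_L2[OF sol] and g = in_H1_grad[OF energy_solution_L2(1)[OF sol t]]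
  define U W where "U = fourier (u t)" and "W = fourier (time_deriv u t)"
  have d: "in_L2 u0" "in_L2 u1" "data_norm_sq \<rho> \<kappa> (u0, u1) < \<infinity>"
    using data in_H1_grad unfolding data_space_def by blast+
  have UW: "in_L2 U" "in_L2 W"
    unfolding U_def W_def by (intro fourier_exists E t)+
  note [measurable] = in_L2_measurable[OF UW(1)] in_L2_measurable[OF UW(2)]
  have init: "fourier (u 0) = fourier u0" "fourier (time_deriv u 0) = fourier u1"
    using sol unfolding energy_solution_def by (auto intro!: fourier_cong_AE in_L2_measurable E d)
  have "L2sq (grad (u t)) = (\<Sum>j\<in>UNIV. L2sq (\<lambda>x. grad (u t) x $ j))"
    using g in_L2_component in_L2_vec(2) by blast
  also have "\<dots> = (\<Sum>j\<in>UNIV. \<integral>\<^sup>+\<xi>. ennreal ((\<xi> $ j)\<^sup>2 * (norm (U \<xi>))\<^sup>2) \<partial>lborel)"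
  proof (rule sum.cong[OF refl])
    fix j
    have gj: "in_L2 (\<lambda>x. grad (u t) x $ j)" using g in_L2_component by blast
    have "L2sq (\<lambda>x. grad (u t) x $ j) = L2sq (fourier (\<lambda>x. grad (u t) x $ j))" by (rule fourier_norm(2)[OF gj, symmetric])
    also have "\<dots> = L2sq (\<lambda>\<xi>. \<i> * of_real (\<xi> $ j) * U \<xi>)"
      unfolding U_def by (rule L2sq_cong_AE[OF fourier_grad[OF E(1)[OF t]]])
    finally show "L2sq (\<lambda>x. grad (u t) x $ j) = (\<integral>\<^sup>+\<xi>. ennreal ((\<xi> $ j)\<^sup>2 * (norm (U \<xi>))\<^sup>2) \<partial>lborel)"
      by (simp add: L2sq_def norm_mult power_mult_distrib)
  qed
  also have "\<dots> = (\<integral>\<^sup>+\<xi>. (\<Sum>j\<in>UNIV. ennreal ((\<xi> $ j)\<^sup>2 * (norm (U \<xi>))\<^sup>2)) \<partial>lborel)"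
    by (rule nn_integral_sum[symmetric]) measurable
  also have "\<dots> = (\<integral>\<^sup>+\<xi>. ennreal ((norm \<xi>)\<^sup>2 * (norm (U \<xi>))\<^sup>2) \<partial>lborel)"
    by (simp add: norm_vec_def L2_set_def sum_nonneg sum_distrib_right)
  finally have grad: "L2sq (grad (u t)) = (\<integral>\<^sup>+\<xi>. ennreal ((norm \<xi>)\<^sup>2 * (norm (U \<xi>))\<^sup>2) \<partial>lborel)" .
  have td: "L2sq (time_deriv u t) = (\<integral>\<^sup>+\<xi>. ennreal ((norm (W \<xi>))\<^sup>2) \<partial>lborel)"
    using fourier_norm(2)[OF E(3)[OF t]] by (simp add: W_def L2sq_def)
  define Q where "Q \<xi> = exp (2 * \<kappa> * \<rho> (norm \<xi>)) * ((1 + (norm \<xi>)\<^sup>2) * (norm (fourier u0 \<xi>))\<^sup>2 + (norm (fourier u1 \<xi>))\<^sup>2)" for \<xi>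
  have "ennreal ((L2_norm (grad (u t)))\<^sup>2 + (L2_norm (time_deriv u t))\<^sup>2) = L2sq (grad (u t)) + L2sq (time_deriv u t)"
    using g E(3)[OF t] by (simp add: L2sq_eq)
  also have "\<dots> = (\<integral>\<^sup>+\<xi>. ennreal ((norm \<xi>)\<^sup>2 * (norm (U \<xi>))\<^sup>2 + (norm (W \<xi>))\<^sup>2) \<partial>lborel)"
    unfolding grad td by (subst nn_integral_add[symmetric]) auto
  also have "\<dots> \<le> (\<integral>\<^sup>+\<xi>. ennreal (C * Q \<xi>) \<partial>lborel)"
  proof (rule nn_integral_mono_AE)
    have "AE \<xi> in lborel. (norm \<xi>)\<^sup>2 * (norm (U \<xi>))\<^sup>2 + (norm (W \<xi>))\<^sup>2 \<le> C * exp (2 * \<kappa> * \<rho> (norm \<xi>))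
       * ((1 + (norm \<xi>)\<^sup>2) * (norm (fourier u0 \<xi>))\<^sup>2 + (norm (fourier u1 \<xi>))\<^sup>2)"
      unfolding U_def W_def init[symmetric] by (rule energy_solution_pointwise[OF sol b t bound])
    then show "AE \<xi> in lborel. ennreal ((norm \<xi>)\<^sup>2 * (norm (U \<xi>))\<^sup>2 + (norm (W \<xi>))\<^sup>2) \<le> ennreal (C * Q \<xi>)"
      by eventually_elim (simp only: Q_def mult.assoc ennreal_leI)
  qed
  also have "\<dots> = (\<integral>\<^sup>+\<xi>. ennreal C * ennreal (Q \<xi>) \<partial>lborel)"
    using C by (simp add: ennreal_mult' Q_def)
  also have "\<dots> = ennreal C * data_norm_sq \<rho> \<kappa> (u0, u1)"
  proof -
    have [measurable]: "(\<lambda>\<xi>::real^'n. \<rho> (norm \<xi>)) \<in> borel_measurable borel"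
      by (intro borel_measurable_continuous_onI continuous_on_compose2[OF \<rho>] continuous_intros) auto
    note [measurable] = in_L2_measurable[OF fourier_exists(1)[OF d(1)]] in_L2_measurable[OF fourier_exists(1)[OF d(2)]]
    have "Q \<in> borel_measurable borel" unfolding Q_def[abs_def] by measurable
    then have "(\<integral>\<^sup>+\<xi>. ennreal C * ennreal (Q \<xi>) \<partial>lborel) = ennreal C * (\<integral>\<^sup>+\<xi>. ennreal (Q \<xi>) \<partial>lborel)"
      by (intro nn_integral_cmult) simp
    then show ?thesis by (simp add: data_norm_sq_def Q_def)
  qed
  also have "\<dots> = ennreal (C * (data_norm \<rho> \<kappa> (u0, u1))\<^sup>2)"
    using d(3) C by (simp add: data_norm_def ennreal_mult')
  finally have "(L2_norm (grad (u t)))\<^sup>2 + (L2_norm (time_deriv u t))\<^sup>2 \<le> C * (data_norm \<rho> \<kappa> (u0, u1))\<^sup>2"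
    by (subst (asm) ennreal_le_iff) (use C in auto)
  moreover have "energy u t \<le> (L2_norm (grad (u t)))\<^sup>2 + (L2_norm (time_deriv u t))\<^sup>2"
    unfolding energy_def by simp
  ultimately show ?thesis by linarith
qed

theorem theorem2p3:
  fixes m :: nat and \<rho> \<zeta> b \<mu> \<sigma> \<Theta> \<Xi> \<zeta>inv :: "real \<Rightarrow> real"
  assumes m: "m > 0"
    and weight: "weight_function \<rho>"
    and zeta: "\<zeta> = (\<lambda>r. r / \<rho> r)"
    and zeta_inv: "\<zeta>inv = the_inv_into {0..} \<zeta>"
    and sigma: "\<sigma> = (\<lambda>t. b t - \<mu> t)"
    and A1: "condition_A1 b \<mu>"
    and A2: "condition_A2 \<sigma>"
    and A3: "condition_A3 m b"
    and Theta: "\<forall>t\<ge>0. \<Theta> t > 0" "strict_mono_on {0..} \<Theta>" "continuous_on {0..} \<Theta>"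
      "\<Theta> ` {0..} \<subseteq> \<zeta> ` {0..}"
    and Xi: "\<forall>t\<ge>0. \<Xi> t > 0" "monotone_on {0..} (\<le>) (\<le>) \<Xi> \<or> monotone_on {0..} (\<le>) (\<ge>) \<Xi>"
      "continuous_on {0..} \<Xi>"
    and tail: "\<forall>t\<ge>0. integral {t..} (\<lambda>s. \<bar>improper_tail \<sigma> s\<bar>) \<le> 1 / \<Theta> t"
    and deriv_bound: "\<forall>t\<ge>0. \<forall>k\<le>m. \<bar>halfline_deriv k b t\<bar> \<le> \<Xi> t ^ (k + 1)"
    and sup1: "bdd_above ((\<lambda>t. \<Xi> t / \<zeta>inv (\<Theta> t)) ` {0..})"
    and sup2: "bdd_above ((\<lambda>t. \<Theta> t / \<zeta>inv (\<Theta> t) ^ (m + 1) *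
                  integral {0..t} (\<lambda>s. \<Xi> s ^ (m + 1))) ` {0..})"
  shows "\<exists>\<kappa>0>0. \<exists>C>0. \<forall>(u0 :: real^'n \<Rightarrow> complex) u1 u.
           (u0, u1) \<in> data_space_inf \<rho> \<longrightarrow> energy_solution b u0 u1 u \<longrightarrow>
           (\<forall>t\<ge>0. energy u t \<le>
              C * (data_norm \<rho> \<kappa>0 (u0, u1))\<^sup>2 * exp (- integral {0..t} \<mu>))"
proof -
  obtain \<kappa>0 C where \<kappa>0: "\<kappa>0 > 0" and C: "C > 0" and bound: "\<And>r v w t. r > 0 \<Longrightarrow> mode b r v w \<Longrightarrow> t \<ge> 0 \<Longrightarrow> mode_energy r v w t \<le>
     C * exp (2 * \<kappa>0 * \<rho> r) * exp (- integral {0..t} \<mu>) * ((1 + r\<^sup>2) * (v 0)\<^sup>2 + (w 0)\<^sup>2)"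
    using mode_bound[OF m weight zeta zeta_inv sigma A1 A2 A3 Theta Xi(1,3) tail deriv_bound sup1 sup2] by metis
  have contb: "continuous_on {0..} b"
    using A3 unfolding condition_A3_def by (metis halfline_deriv.simps(1) zero_le)
  show ?thesis
  proof (rule exI[of _ \<kappa>0], rule conjI[OF \<kappa>0], rule exI[of _ C], rule conjI[OF C], intro allI impI)
    fix u0 u1 :: "real^'n \<Rightarrow> complex" and u and t :: real
    assume data: "(u0, u1) \<in> data_space_inf \<rho>" and sol: "energy_solution b u0 u1 u" and t: "0 \<le> t"
    have "energy u t \<le> (C * exp (- integral {0..t} \<mu>)) * (data_norm \<rho> \<kappa>0 (u0, u1))\<^sup>2"
    proof (rule energy_le_data[OF sol contb t])
      show "continuous_on {0..} \<rho>" using weight unfolding weight_function_def by blast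
      show "(u0, u1) \<in> data_space \<rho> \<kappa>0" using data \<kappa>0 unfolding data_space_inf_def by blast
      show "mode_energy r v w t \<le> C * exp (- integral {0..t} \<mu>) * exp (2 * \<kappa>0 * \<rho> r) * ((1 + r\<^sup>2) * (v 0)\<^sup>2 + (w 0)\<^sup>2)"
        if "r > 0" "mode b r v w" for r v w
        using bound[OF that t] by (simp only: mult_ac)
    qed (use C in simp)
    then show "energy u t \<le> C * (data_norm \<rho> \<kappa>0 (u0, u1))\<^sup>2 * exp (- integral {0..t} \<mu>)"
      by (simp only: mult_ac)
  qed
qed

end
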